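(* Suppose the setting and the standing assumptions (S1)–(S5) stated in the context hold. Then there exists a $\lambda$-independent (but possibly data-dependent) constant $c_n$ such that the $n$-fold cross-validation criterion satisfies, as $n\to\infty$, $$\sup_{\lambda\in\Lambda}\left|CV_n(\lambda)-c_n-SURE(\lambda,\hat\theta_n,\Sigma)\right|\rightarrow^{\mu_n}0 .$$
   Context: Setting. Parameters lie in $\mathbb R^k$, with $k$ fixed. $l(\beta,z)$ is a loss function, $\beta\in\mathbb R^k$. For each $n$, $Z_n^1,\dots,Z_n^n$ are i.i.d. with distribution $\mu_n$. $\|\cdot\|$ is the Euclidean norm (operator norm for matrices and tensors). $O_{\mu_n}(1)$ and $\rightarrow^{\mu_n}$ denote boundedness in probability and convergence in probability under $\mu_n$ as $n\to\infty$. $\mathbb R^+=[0,\infty)$. Loss. $l_n(\theta,z)=l(\theta/\sqrt n,z)$; $L_n(\theta)=\sum_{i=1}^n l_n(\theta,Z_n^i)$; $\bar L_n(\theta,\theta_0)=E[L_n(\theta)-L_n(\theta_0)]$; $\bar L(\theta,\theta_0)=\lim_{n\to\infty}\bar L_n(\theta,\theta_0)$, the sequence $\mu_n$ being such that this limit is well defined. Estimators. $\hat\theta_n=\arg\min_\theta L_n(\theta)$; $L_n^{-i}(\theta)=\sum_{j\ne i}l_n(\theta,Z_n^j)$; $\hat\theta_n^{\lambda,-i}=\arg\min_\theta[L_n^{-i}(\theta)+\lambda\pi(\theta)]$. $g^\lambda(\theta)=\arg\min_g[\tfrac12\|g\|^2+\lambda\pi(\theta+g)]$. $\nabla g^\lambda(\theta)$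 is the derivative of $g^\lambda$ in $\theta$ where it exists, and $\nabla g^\lambda(\theta)=0$ by convention where $g^\lambda$ is not differentiable. For $\lambda=\infty$ (Ridge case) there is full shrinkage: $\hat\theta_n^{\infty,-i}=0$, $g^\infty(\theta)=-\theta$. Risk estimates. $CV_n(\lambda)=\sum_{i=1}^n l_n(\hat\theta_n^{\lambda,-i},Z_n^i)$ and $SURE(\lambda,\theta,\Sigma)=\tfrac12[\operatorname{trace}(\Sigma)+\|g^\lambda(\theta)\|^2+2\operatorname{trace}(\nabla g^\lambda(\theta)\cdot\Sigma)]$. Standing assumptions. (S1) The distributions $\mu_n$ are such that $\theta_0=\arg\min_\theta E[l(\theta/\sqrt n,Z_n^i)]$ and $\Sigma=\operatorname{Var}(\nabla_\beta l(\theta_0/\sqrt n,Z_n^i))$ do not depend on $n$; $\Sigma$ is positive definite. (S2) $\nabla_\theta^2\bar L(\theta,\theta_0)|_{\theta=\theta_0}=I$. (S3) Either (Ridge) $\pi(\theta)=\tfrac12\theta\cdot A^{-1}\cdot\theta$ with $A$ positive definite and $\Lambda=\mathbb R^+\cup\{\infty\}$; or (Lasso) $\pi(\theta)=\|A^{-1}\theta\|_1$ with $A$ an invertible matrix and $\Lambda\subset\mathbb R^+$ finite. (S4) (i) $|l(\beta_1,z)-l(\beta_2,z)|\le m(z)\|\beta_1-\beta_2\|$ for all $\beta_1,\beta_2$ in a neighborhood of $0$, with $\sup_n\operatorname{Var}(m(Z_n^i))<\infty$; and $l(\beta,Z_n^i)$ is differentiable in $\beta$ for all $\beta$ in a neighborhood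 of $0$ with probability 1. (ii) The sequence $\hat\theta_n$ is bounded in probability. (S5) With $\Theta=\mathbb R^k$ the parameter space: (i) there are $\mu>0$, $\nu<\infty$ independent of $n$ such that, with probability approaching 1 under $\mu_n$, $L_n(\theta)$ is $\mu$-strongly convex ($\nabla^2L_n(\theta)-\mu I$ positive semidefinite for all $\theta$) and has $\nu$-smooth Hessians (a function is called $L$-smooth if its gradients are Lipschitz with constant $L$). (ii) There is $B_n(Z_n^i)$ with $\|\sqrt n\nabla_\theta l_n(\theta,Z_n^i)-\sqrt n\nabla_\theta l_n(\theta',Z_n^i)\|\le B_n(Z_n^i)\|\theta-\theta'\|$ for all $\theta,\theta'\in\Theta$ almost everywhere, and $E_{\mu_n}[\|B_n(Z_n^i)\|^2]<\infty$; and there is $M<\infty$ independent of $n$ with $E_{\mu_n}[\|\sqrt n\nabla_\theta l_n(\theta_0,Z_n^i)\|^4]\le M$. (iii) $\frac1n\sum_{i=1}^n\|n\nabla_\theta^2l_n(\theta_0,Z_n^i)\|^2=O_{\mu_n}(1)$, and there is $C_n(Z_n^i)$ with $\|n\nabla_\theta^2l_n(\theta,Z_n^i)-n\nabla_\theta^2l_n(\theta',Z_n^i)\|\le C_n(Z_n^i)\|\theta-\theta'\|$ for all $\theta,\theta'\in\Theta$ and $\sup_nE_{\mu_n}[C_n(Z_n^i)^2]<\infty$. (iv) The fourth derivative tensor satisfies $\sup_nE_{\mu_n}[\sup_{\theta\in\Theta}\|n^2D_\theta^4l_n(\theta,Z_n^i)\|^4]\le M$ for some $M<\infty$.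
   Formalization: In (S5)(ii) the bound on B_n is taken uniformly, sup_n E_{μ_n}[‖B_n(Z_n^i)‖²] < ∞, instead of finiteness for each n; with only the latter the claim fails (rare, huge Hessians enter the limiting risk but not the sample). *)

theory Defs
  imports "HOL-Probability.Probability"
begin

section \<open>Derivatives and matrices\<close>

text \<open>
  Iterating \<open>frechet\<close> gives the derivative tensors, e.g. \<open>frechet (frechet f) x\<close> is the second
  derivative as a bilinear form. The norm of the (nested) bounded-linear-function type is the
  operator norm of the tensor; in contrast, the library norm on \<open>real^'k^'k\<close> is the Frobenius norm,
  so norms of Hessians are taken in the former type. These terms are meaningful only where the
  derivatives exist, hence the explicit differentiability requirements below.
\<close>

definition frechet :: "('a::real_normed_vector \<Rightarrow> 'b::real_normed_vector) \<Rightarrow> 'a \<Rightarrow> 'a \<Rightarrow>\<^sub>L 'b" where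
  "frechet f x = Blinfun (frechet_derivative f (at x))"

definition grad :: "(real^'k \<Rightarrow> real) \<Rightarrow> real^'k \<Rightarrow> real^'k" where
  "grad f x = (\<chi> i. blinfun_apply (frechet f x) (axis i 1))"

definition hess :: "(real^'k \<Rightarrow> real) \<Rightarrow> real^'k \<Rightarrow> real^'k^'k" where
  "hess f x = (\<chi> i j. blinfun_apply (blinfun_apply (frechet (frechet f) x) (axis i 1)) (axis j 1))"

definition twice_differentiable_at :: "(real^'k \<Rightarrow> real) \<Rightarrow> real^'k \<Rightarrow> bool" where
  "twice_differentiable_at f x \<longleftrightarrow>
     (\<forall>\<^sub>F y in nhds x. f differentiable (at y)) \<and> frechet f differentiable (at x)"

definition four_times_differentiable :: "(real^'k \<Rightarrow> real) \<Rightarrow> bool" where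
  "four_times_differentiable f \<longleftrightarrow>
     (\<forall>x. f differentiable (at x) \<and>
          frechet f differentiable (at x) \<and>
          frechet (frechet f) differentiable (at x) \<and>
          frechet (frechet (frechet f)) differentiable (at x))"

definition pos_semidef :: "real^'k^'k \<Rightarrow> bool" where
  "pos_semidef A \<longleftrightarrow> transpose A = A \<and> (\<forall>x. x \<bullet> (A *v x) \<ge> 0)"

definition pos_def :: "real^'k^'k \<Rightarrow> bool" where
  "pos_def A \<longleftrightarrow> transpose A = A \<and> (\<forall>x. x \<noteq> 0 \<longrightarrow> x \<bullet> (A *v x) > 0)"

definition strongly_convex :: "real \<Rightarrow> (real^'k \<Rightarrow> real) \<Rightarrow> bool" where
  "strongly_convex c f \<longleftrightarrow>
     (\<forall>x. twice_differentiable_at f x \<and> pos_semidef (hess f x - c *\<^sub>R mat 1))"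

definition smooth :: "real \<Rightarrow> ('a::real_normed_vector \<Rightarrow> 'b::real_normed_vector) \<Rightarrow> bool" where
  "smooth c F \<longleftrightarrow>
     (\<forall>x. F differentiable (at x)) \<and>
     (\<forall>x y. norm (frechet F x - frechet F y) \<le> c * norm (x - y))"


section \<open>Stochastic convergence along a sequence of probability spaces\<close>

text \<open>
  Argmins need not be measurable where they are not unique (or do not exist), so these notions are
  stated with inner probabilities. For measurable random variables they are the usual ones.
\<close>

definition with_prob_to_1 :: "(nat \<Rightarrow> 'w measure) \<Rightarrow> (nat \<Rightarrow> 'w \<Rightarrow> bool) \<Rightarrow> bool" where
  "with_prob_to_1 P Q \<longleftrightarrow>
     (\<exists>E. (\<forall>n. E n \<in> sets (P n)) \<and> (\<forall>n. \<forall>\<omega>\<in>E n. Q n \<omega>) \<and>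
          (\<lambda>n. measure (P n) (E n)) \<longlonglongrightarrow> 1)"

definition bounded_in_prob ::
    "(nat \<Rightarrow> 'w measure) \<Rightarrow> (nat \<Rightarrow> 'w \<Rightarrow> 'b::real_normed_vector) \<Rightarrow> bool" where
  "bounded_in_prob P X \<longleftrightarrow>
     (\<forall>\<epsilon>>0. \<exists>K. \<forall>\<^sub>F n in sequentially. \<exists>E\<in>sets (P n).
        measure (P n) E \<ge> 1 - \<epsilon> \<and> (\<forall>\<omega>\<in>E. norm (X n \<omega>) \<le> K))"

text \<open>Values in \<^typ>\<open>ennreal\<close>, so that an infinite supremum counts as large.\<close>

definition tendsto_0_in_prob :: "(nat \<Rightarrow> 'w measure) \<Rightarrow> (nat \<Rightarrow> 'w \<Rightarrow> ennreal) \<Rightarrow> bool" where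
  "tendsto_0_in_prob P X \<longleftrightarrow>
     (\<forall>\<epsilon>::real. \<epsilon> > 0 \<longrightarrow> with_prob_to_1 P (\<lambda>n \<omega>. X n \<omega> \<le> ennreal \<epsilon>))"

definition cov_matrix :: "'z measure \<Rightarrow> ('z \<Rightarrow> real^'k) \<Rightarrow> real^'k^'k" where
  "cov_matrix M X = (\<chi> i j.
     \<integral>z. (X z $ i - (\<integral>y. X y $ i \<partial>M)) * (X z $ j - (\<integral>y. X y $ j \<partial>M)) \<partial>M)"


section \<open>Losses and estimators\<close>

text \<open>
  A sample of size \<open>n\<close> is a function \<open>zs\<close> of which only the values on \<open>{1..n}\<close> are used.
  Penalty parameters range over \<^typ>\<open>ennreal\<close>, that is, \<open>[0,\<infinity>]\<close>.
  \<^const>\<open>arg_min\<close> picks some minimizer; it is arbitrary if there is none.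
\<close>

definition local_loss :: "(real^'k \<Rightarrow> 'z \<Rightarrow> real) \<Rightarrow> nat \<Rightarrow> real^'k \<Rightarrow> 'z \<Rightarrow> real" where
  "local_loss l n \<theta> z = l (\<theta> /\<^sub>R sqrt (real n)) z"

definition total_loss :: "(real^'k \<Rightarrow> 'z \<Rightarrow> real) \<Rightarrow> nat \<Rightarrow> (nat \<Rightarrow> 'z) \<Rightarrow> real^'k \<Rightarrow> real" where
  "total_loss l n zs \<theta> = (\<Sum>i=1..n. local_loss l n \<theta> (zs i))"

definition loo_loss :: "(real^'k \<Rightarrow> 'z \<Rightarrow> real) \<Rightarrow> nat \<Rightarrow> (nat \<Rightarrow> 'z) \<Rightarrow> nat \<Rightarrow> real^'k \<Rightarrow> real" where
  "loo_loss l n zs i \<theta> = (\<Sum>j\<in>{1..n} - {i}. local_loss l n \<theta> (zs j))"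

definition theta_hat :: "(real^'k \<Rightarrow> 'z \<Rightarrow> real) \<Rightarrow> nat \<Rightarrow> (nat \<Rightarrow> 'z) \<Rightarrow> real^'k" where
  "theta_hat l n zs = arg_min (total_loss l n zs) (\<lambda>_. True)"

definition theta_loo ::
    "(real^'k \<Rightarrow> 'z \<Rightarrow> real) \<Rightarrow> (real^'k \<Rightarrow> real) \<Rightarrow> nat \<Rightarrow> (nat \<Rightarrow> 'z) \<Rightarrow> ennreal \<Rightarrow> nat \<Rightarrow> real^'k" where
  "theta_loo l pen n zs lam i =
     (if lam = \<infinity> then 0
      else arg_min (\<lambda>\<theta>. loo_loss l n zs i \<theta> + enn2real lam * pen \<theta>) (\<lambda>_. True))"

definition shrinkage :: "(real^'k \<Rightarrow> real) \<Rightarrow> ennreal \<Rightarrow> real^'k \<Rightarrow> real^'k" where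
  "shrinkage pen lam \<theta> =
     (if lam = \<infinity> then - \<theta>
      else arg_min (\<lambda>g. (1/2) * (norm g)\<^sup>2 + enn2real lam * pen (\<theta> + g)) (\<lambda>_. True))"

definition shrinkage_deriv :: "(real^'k \<Rightarrow> real) \<Rightarrow> ennreal \<Rightarrow> real^'k \<Rightarrow> real^'k^'k" where
  "shrinkage_deriv pen lam \<theta> =
     (if shrinkage pen lam differentiable (at \<theta>) then jacobian (shrinkage pen lam) (at \<theta>) else 0)"

definition CV :: "(real^'k \<Rightarrow> 'z \<Rightarrow> real) \<Rightarrow> (real^'k \<Rightarrow> real) \<Rightarrow> nat \<Rightarrow> (nat \<Rightarrow> 'z) \<Rightarrow> ennreal \<Rightarrow> real" where
  "CV l pen n zs lam = (\<Sum>i=1..n. local_loss l n (theta_loo l pen n zs lam i) (zs i))"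

definition SURE :: "(real^'k \<Rightarrow> real) \<Rightarrow> ennreal \<Rightarrow> real^'k \<Rightarrow> real^'k^'k \<Rightarrow> real" where
  "SURE pen lam \<theta> S =
     (1/2) * (trace S + (norm (shrinkage pen lam \<theta>))\<^sup>2 + 2 * trace (shrinkage_deriv pen lam \<theta> ** S))"


section \<open>Setting\<close>

definition iid_array ::
    "(nat \<Rightarrow> 'w measure) \<Rightarrow> (nat \<Rightarrow> 'z measure) \<Rightarrow> (nat \<Rightarrow> nat \<Rightarrow> 'w \<Rightarrow> 'z) \<Rightarrow> bool" where
  "iid_array P \<mu> Z \<longleftrightarrow>
     (\<forall>n\<ge>1. prob_space (P n) \<and>
        prob_space.indep_vars (P n) (\<lambda>_. \<mu> n) (Z n) {1..n} \<and>
        (\<forall>i\<in>{1..n}. distr (P n) (\<mu> n) (Z n i) = \<mu> n))"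

definition sample :: "(nat \<Rightarrow> nat \<Rightarrow> 'w \<Rightarrow> 'z) \<Rightarrow> nat \<Rightarrow> 'w \<Rightarrow> nat \<Rightarrow> 'z" where
  "sample Z n \<omega> = (\<lambda>i\<in>{1..n}. Z n i \<omega>)"

definition excess_risk ::
    "(nat \<Rightarrow> 'w measure) \<Rightarrow> (nat \<Rightarrow> nat \<Rightarrow> 'w \<Rightarrow> 'z) \<Rightarrow> (real^'k \<Rightarrow> 'z \<Rightarrow> real) \<Rightarrow>
     real^'k \<Rightarrow> nat \<Rightarrow> real^'k \<Rightarrow> real" where
  "excess_risk P Z l \<theta>0 n \<theta> =
     (\<integral>\<omega>. total_loss l n (sample Z n \<omega>) \<theta> - total_loss l n (sample Z n \<omega>) \<theta>0 \<partial>P n)"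

definition limit_risk ::
    "(nat \<Rightarrow> 'w measure) \<Rightarrow> (nat \<Rightarrow> nat \<Rightarrow> 'w \<Rightarrow> 'z) \<Rightarrow> (real^'k \<Rightarrow> 'z \<Rightarrow> real) \<Rightarrow>
     real^'k \<Rightarrow> real^'k \<Rightarrow> real" where
  "limit_risk P Z l \<theta>0 \<theta> = lim (\<lambda>n. excess_risk P Z l \<theta>0 n \<theta>)"

definition stable_parameters ::
    "(nat \<Rightarrow> 'z measure) \<Rightarrow> (real^'k \<Rightarrow> 'z \<Rightarrow> real) \<Rightarrow> real^'k \<Rightarrow> real^'k^'k \<Rightarrow> bool" where
  "stable_parameters \<mu> l \<theta>0 S \<longleftrightarrow>
     pos_def S \<and>
     (\<forall>n\<ge>1.
        (\<forall>\<theta>. integrable (\<mu> n) (local_loss l n \<theta>)) \<and>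
        is_arg_min (\<lambda>\<theta>. \<integral>z. local_loss l n \<theta> z \<partial>\<mu> n) (\<lambda>_. True) \<theta>0 \<and>
        (let G = (\<lambda>z. grad (\<lambda>\<beta>. l \<beta> z) (\<theta>0 /\<^sub>R sqrt (real n))) in
           G \<in> borel_measurable (\<mu> n) \<and>
           integrable (\<mu> n) (\<lambda>z. (norm (G z))\<^sup>2) \<and>
           cov_matrix (\<mu> n) G = S))"

definition normalized_limit_risk ::
    "(nat \<Rightarrow> 'w measure) \<Rightarrow> (nat \<Rightarrow> nat \<Rightarrow> 'w \<Rightarrow> 'z) \<Rightarrow> (real^'k \<Rightarrow> 'z \<Rightarrow> real) \<Rightarrow>
     real^'k \<Rightarrow> bool" where
  "normalized_limit_risk P Z l \<theta>0 \<longleftrightarrow>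
     (\<forall>\<theta>. convergent (\<lambda>n. excess_risk P Z l \<theta>0 n \<theta>)) \<and>
     twice_differentiable_at (limit_risk P Z l \<theta>0) \<theta>0 \<and>
     hess (limit_risk P Z l \<theta>0) \<theta>0 = mat 1"

definition ridge_penalty :: "(real^'k \<Rightarrow> real) \<Rightarrow> ennreal set \<Rightarrow> bool" where
  "ridge_penalty pen \<Lambda> \<longleftrightarrow>
     (\<exists>A. pos_def A \<and> pen = (\<lambda>\<theta>. (1/2) * (\<theta> \<bullet> (matrix_inv A *v \<theta>)))) \<and> \<Lambda> = UNIV"

definition lasso_penalty :: "(real^'k \<Rightarrow> real) \<Rightarrow> ennreal set \<Rightarrow> bool" where
  "lasso_penalty pen \<Lambda> \<longleftrightarrow>
     (\<exists>A::real^'k^'k. invertible A \<and> pen = (\<lambda>\<theta>. \<Sum>j\<in>UNIV. \<bar>(matrix_inv A *v \<theta>) $ j\<bar>)) \<and>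
     finite \<Lambda> \<and> \<infinity> \<notin> \<Lambda>"

definition locally_regular_loss ::
    "(nat \<Rightarrow> 'z measure) \<Rightarrow> (real^'k \<Rightarrow> 'z \<Rightarrow> real) \<Rightarrow> bool" where
  "locally_regular_loss \<mu> l \<longleftrightarrow>
     (\<exists>U m K. open U \<and> 0 \<in> U \<and>
        (\<forall>n\<ge>1.
           (\<forall>z\<in>space (\<mu> n). \<forall>\<beta>1\<in>U. \<forall>\<beta>2\<in>U. \<bar>l \<beta>1 z - l \<beta>2 z\<bar> \<le> m z * norm (\<beta>1 - \<beta>2)) \<and>
           m \<in> borel_measurable (\<mu> n) \<and>
           integrable (\<mu> n) (\<lambda>z. (m z)\<^sup>2) \<and>
           (\<integral>z. (m z - (\<integral>y. m y \<partial>\<mu> n))\<^sup>2 \<partial>\<mu> n) \<le> K \<and>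
           (AE z in \<mu> n. \<forall>\<beta>\<in>U. (\<lambda>b. l b z) differentiable (at \<beta>))))"

definition curvature ::
    "(nat \<Rightarrow> 'w measure) \<Rightarrow> (nat \<Rightarrow> nat \<Rightarrow> 'w \<Rightarrow> 'z) \<Rightarrow> (real^'k \<Rightarrow> 'z \<Rightarrow> real) \<Rightarrow> bool" where
  "curvature P Z l \<longleftrightarrow>
     (\<exists>c>0. \<exists>\<nu>. with_prob_to_1 P (\<lambda>n \<omega>.
        let f = total_loss l n (sample Z n \<omega>)
        in strongly_convex c f \<and> smooth \<nu> (frechet (frechet f))))"

text \<open>
  The second-moment bound on \<open>B\<close> is uniform in \<open>n\<close>, like the other moment bounds. Finiteness for
  each \<open>n\<close> separately would not control Hessians that are huge with vanishing probability: these
  enter the limiting risk but not the sample.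
\<close>

definition gradient_moments ::
    "(nat \<Rightarrow> 'z measure) \<Rightarrow> (real^'k \<Rightarrow> 'z \<Rightarrow> real) \<Rightarrow> real^'k \<Rightarrow> bool" where
  "gradient_moments \<mu> l \<theta>0 \<longleftrightarrow>
     (\<exists>B. (\<forall>n\<ge>1. B n \<in> borel_measurable (\<mu> n) \<and>
             (AE z in \<mu> n. \<forall>\<theta> \<theta>'.
                norm (sqrt (real n) *\<^sub>R grad (\<lambda>t. local_loss l n t z) \<theta>
                      - sqrt (real n) *\<^sub>R grad (\<lambda>t. local_loss l n t z) \<theta>')
                \<le> B n z * norm (\<theta> - \<theta>'))) \<and>
          (SUP n\<in>{1..}. \<integral>\<^sup>+z. ennreal ((B n z)\<^sup>2) \<partial>\<mu> n) < \<infinity>) \<and>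
     (\<exists>M::real. \<forall>n\<ge>1.
        (\<integral>\<^sup>+z. ennreal (norm (sqrt (real n) *\<^sub>R grad (\<lambda>t. local_loss l n t z) \<theta>0) ^ 4) \<partial>\<mu> n)
        \<le> ennreal M)"

definition hessian_moments ::
    "(nat \<Rightarrow> 'w measure) \<Rightarrow> (nat \<Rightarrow> 'z measure) \<Rightarrow> (nat \<Rightarrow> nat \<Rightarrow> 'w \<Rightarrow> 'z) \<Rightarrow>
     (real^'k \<Rightarrow> 'z \<Rightarrow> real) \<Rightarrow> real^'k \<Rightarrow> bool" where
  "hessian_moments P \<mu> Z l \<theta>0 \<longleftrightarrow>
     bounded_in_prob P (\<lambda>n \<omega>. (1 / real n) *
        (\<Sum>i=1..n. (norm (real n *\<^sub>R frechet (frechet (\<lambda>t. local_loss l n t (Z n i \<omega>))) \<theta>0))\<^sup>2)) \<and>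
     (\<exists>C. (\<forall>n\<ge>1. C n \<in> borel_measurable (\<mu> n) \<and>
             (AE z in \<mu> n. \<forall>\<theta> \<theta>'.
                norm (real n *\<^sub>R frechet (frechet (\<lambda>t. local_loss l n t z)) \<theta>
                      - real n *\<^sub>R frechet (frechet (\<lambda>t. local_loss l n t z)) \<theta>')
                \<le> C n z * norm (\<theta> - \<theta>'))) \<and>
          (SUP n\<in>{1..}. \<integral>\<^sup>+z. ennreal ((C n z)\<^sup>2) \<partial>\<mu> n) < \<infinity>)"

definition fourth_derivative_moments ::
    "(nat \<Rightarrow> 'z measure) \<Rightarrow> (real^'k \<Rightarrow> 'z \<Rightarrow> real) \<Rightarrow> bool" where
  "fourth_derivative_moments \<mu> l \<longleftrightarrow>
     (\<forall>n\<ge>1. AE z in \<mu> n. four_times_differentiable (\<lambda>t. local_loss l n t z)) \<and>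
     (\<exists>M::real. \<forall>n\<ge>1.
        (let D = (\<lambda>z. SUP \<theta>. ennreal (norm ((real n)\<^sup>2 *\<^sub>R
                    frechet (frechet (frechet (frechet (\<lambda>t. local_loss l n t z)))) \<theta>)))
         in D \<in> borel_measurable (\<mu> n) \<and> (\<integral>\<^sup>+z. D z ^ 4 \<partial>\<mu> n) \<le> ennreal M))"

end

theory Submission
  imports Defs
begin

text \<open>
  Near its minimizer \<open>\<theta>h\<close> the total loss is \<open>|\<theta> - \<theta>h|^2 / 2\<close> up to a function with small
  second derivative. Writing \<open>S\<close> for the proximal map \<open>\<theta> + g(\<theta>)\<close> of \<open>\<lambda>\<pi>\<close>, stationarity turns the
  full-sample and the leave-one-out penalized minimizers into values of \<open>S\<close> near \<open>\<theta>h\<close>: at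
  \<open>\<theta>h\<close> up to a small error, and at the same point shifted by the gradient of the \<open>i\<close>-th loss.
  Where \<open>S\<close> is affine with linear part \<open>M\<close>, their difference is therefore \<open>M\<close> times that gradient.
  A Taylor expansion of the criterion at the full-sample minimizer then gives
  \<open>L(\<theta>h) + |g(\<theta>h)|^2 / 2 + trace (M \<Sigma>)\<close>, and \<open>M = I + \<nabla>g(\<theta>h)\<close>.

  The Ridge map is linear. The Lasso map is affine off finitely many hyperplanes, which
  \<open>\<theta>h\<close> avoids with high probability by the central limit theorem.

  The derivative conditions allow third derivatives of the total loss of order one. However, a
  second derivative along a line that is nonnegative everywhere and has itself a second derivative
  of order \<open>1/n\<close> must vary slowly, so strong convexity and the bound on the fourth derivative make
  the Hessian of the total loss locally constant. That the Hessian tends to the identity follows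
  from a law of large numbers with truncation.
\<close>

subsection \<open>Proximal points\<close>

text \<open>The total loss enters through its gradient \<open>(x - th) + e x\<close>, where
  \<open>e th = 0\<close> and \<open>e\<close> has a small Lipschitz constant on a ball. A penalized
  minimizer \<open>t\<close> thus equals \<open>S (th - e t)\<close>, a leave-one-out minimizer
  \<open>S (th + gf i t - e t)\<close>: no Hessian is inverted and the penalty need not be smooth.
  The error bounds see the penalty only through convexity, \<open>pen 0 = 0\<close>, nonnegativity
  and the nonexpansive map \<open>S\<close>, so they do not depend on \<lambda>, and the supremum
  over the infinite Ridge range is harmless. The constant is
  \<open>L(th) + trace \<Sigma> / 2\<close>, because SURE contains \<open>trace \<Sigma> / 2 + trace
  ((M - I) \<Sigma>) = trace (M \<Sigma>) - trace \<Sigma> / 2\<close>. Truncation is forced by the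
  moments: a Lipschitz gradient bounds the rescaled Hessian of one observation only by a multiple of
  \<open>sqrt n * B\<close>, so its second moment may grow like \<open>n\<close>, and Chebyshev
  alone gives nothing. A further obstacle: curvature is assumed for the full sample only, whereas
  all leave-one-out minimizers must exist and stay bounded, for all \<open>i\<close> at
  once.\<close>

definition is_prox :: "('a::euclidean_space \<Rightarrow> real) \<Rightarrow> 'a \<Rightarrow> 'a \<Rightarrow> bool" where
  "is_prox h x t \<longleftrightarrow> (\<forall>u. h t + (x - t) \<bullet> (u - t) \<le> h u)"

text \<open>The definition says that \<open>x - t\<close> is a subgradient of \<open>h\<close> at
  \<open>t\<close>. Adding two such inequalities cancels \<open>h\<close> and leaves the
  monotonicity of the subdifferential.\<close>

lemma is_prox_nonexpansive:
  assumes "is_prox h x t" "is_prox h y u"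
  shows "norm (t - u) \<le> norm (x - y)"
proof -
  have "h t + (x - t) \<bullet> (u - t) \<le> h u" "h u + (y - u) \<bullet> (t - u) \<le> h t"
    using assms unfolding is_prox_def by blast+
  then have "(x - t) \<bullet> (u - t) + (y - u) \<bullet> (t - u) \<le> 0" by simp
  moreover have "(x - t) \<bullet> (u - t) + (y - u) \<bullet> (t - u) = (norm (t - u))\<^sup>2 - (x - y) \<bullet> (t - u)"
    by (simp add: power2_norm_eq_inner inner_diff_left inner_diff_right inner_commute)
  ultimately have "(norm (t - u))\<^sup>2 \<le> (x - y) \<bullet> (t - u)" by simp
  also have "\<dots> \<le> norm (x - y) * norm (t - u)" by (rule norm_cauchy_schwarz)
  finally have "norm (t - u) * norm (t - u) \<le> norm (x - y) * norm (t - u)"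
    by (simp add: power2_eq_square)
  then show ?thesis
    by (cases "norm (t - u) = 0") (use mult_right_le_imp_le in auto)
qed

lemma is_prox_unique: "is_prox h x t \<Longrightarrow> is_prox h x u \<Longrightarrow> t = u"
  using is_prox_nonexpansive[of h x t x u] by simp

text \<open>One-sided optimality for a differentiable plus a convex function: \<open>F\<close>
  contributes its derivative, and the convex part, bounded by its chord, contributes
  \<open>c\<close>.\<close>

lemma directional_limit_nonneg:
  fixes F :: "'a::real_normed_vector \<Rightarrow> real"
  assumes der: "(F has_derivative D) (at t)"
    and le: "\<And>s. 0 < s \<Longrightarrow> s \<le> 1 \<Longrightarrow> 0 \<le> (F (t + s *\<^sub>R v) - F t) + s * c"
  shows "0 \<le> D v + c"
proof -
  have lin: "linear D" using der by (rule has_derivative_linear)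
  have "((\<lambda>s::real. F (t + s *\<^sub>R v)) has_real_derivative D v) (at 0)"
  proof -
    have "((\<lambda>s::real. t + s *\<^sub>R v) has_derivative (\<lambda>s. s *\<^sub>R v)) (at 0)"
      by (auto intro!: derivative_eq_intros)
    from has_derivative_compose[OF this, of F D] der
    have "((\<lambda>s::real. F (t + s *\<^sub>R v)) has_derivative (\<lambda>s. D (s *\<^sub>R v))) (at 0)" by simp
    moreover have "(\<lambda>s. D (s *\<^sub>R v)) = (*) (D v)"
      using lin by (auto simp: linear_cmul fun_eq_iff)
    ultimately show ?thesis unfolding has_field_derivative_def by simp
  qed
  then have "((\<lambda>s. (F (t + s *\<^sub>R v) - F t) / s) \<longlongrightarrow> D v) (at 0)"
    unfolding has_field_derivative_iff by simp
  then have "((\<lambda>s. (F (t + s *\<^sub>R v) - F t) / s) \<longlongrightarrow> D v) (at_right 0)"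
    by (rule tendsto_mono[rotated]) (simp add: at_within_le_at)
  then have lim: "((\<lambda>s. (F (t + s *\<^sub>R v) - F t) / s + c) \<longlongrightarrow> D v + c) (at_right 0)"
    by (intro tendsto_intros)
  have "\<forall>\<^sub>F s in at_right (0::real). 0 \<le> (F (t + s *\<^sub>R v) - F t) / s + c"
  proof -
    have "\<forall>\<^sub>F s in at_right (0::real). 0 < s \<and> s < 1"
      using eventually_at_right_real[of 0 1] by (auto elim: eventually_mono)
    then show ?thesis
    proof eventually_elim
      case (elim s)
      then have "0 \<le> ((F (t + s *\<^sub>R v) - F t) + s * c) / s" using le[of s] by simp
      then show ?case using elim by (simp add: add_divide_distrib)
    qed
  qed
  then show ?thesis using tendsto_lowerbound[OF lim] by simp
qed

text \<open>The comparison runs along the segment towards \<open>u\<close>, where convexity bounds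
  \<open>h\<close> by its chord, while \<open>F\<close> is differentiated at \<open>t\<close> alone.
  The point \<open>t - G\<close> is a gradient step from \<open>t\<close>.\<close>

lemma is_prox_if_minimizer:
  fixes F h :: "'a::euclidean_space \<Rightarrow> real"
  assumes convex: "convex_on UNIV h"
    and der: "(F has_derivative (\<lambda>v. G \<bullet> v)) (at t)"
    and min: "\<And>u. F t + h t \<le> F u + h u"
  shows "is_prox h (t - G) t"
  unfolding is_prox_def
proof
  fix u
  have "0 \<le> G \<bullet> (u - t) + (h u - h t)"
  proof (rule directional_limit_nonneg[OF der])
    fix s :: real assume s: "0 < s" "s \<le> 1"
    have eq: "t + s *\<^sub>R (u - t) = (1 - s) *\<^sub>R t + s *\<^sub>R u"
      by (simp add: algebra_simps)
    have "h (t + s *\<^sub>R (u - t)) \<le> (1 - s) * h t + s * h u"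
      unfolding eq using convex s by (auto simp: convex_on_def)
    with min[of "t + s *\<^sub>R (u - t)"]
    show "0 \<le> F (t + s *\<^sub>R (u - t)) - F t + s * (h u - h t)" by (simp add: algebra_simps)
  qed
  then show "h t + (t - G - t) \<bullet> (u - t) \<le> h u" by simp
qed

section \<open>Existence of minimizers under quadratic growth\<close>

lemma coercive_attains_minimum:
  fixes F :: "'a::euclidean_space \<Rightarrow> real"
  assumes cont: "continuous_on UNIV F" and c: "c > 0"
    and low: "\<And>x. F x \<ge> a + G \<bullet> x + c / 2 * (norm x)\<^sup>2"
  shows "\<exists>t. \<forall>u. F t \<le> F u"
proof -
  \<comment> \<open>Solves \<open>R * c / 2 = norm G + \<bar>F 0 - a\<bar> + c / 2\<close>, so that
    outside the ball the quadratic term absorbs the linear one and the gap at zero; the summand 1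
    gives \<open>R \<ge> 1\<close>.\<close>
  define R where "R = norm G * 2 / c + \<bar>F 0 - a\<bar> * 2 / c + 1"
  have R: "R \<ge> 1" using c unfolding R_def by simp
  have "compact (cball (0::'a) R)" "cball (0::'a) R \<noteq> {}" using R by auto
  from continuous_attains_inf[OF this continuous_on_subset[OF cont]]
  obtain t where t: "t \<in> cball 0 R" "\<And>u. u \<in> cball 0 R \<Longrightarrow> F t \<le> F u" by auto
  have "F t \<le> F u" for u
  proof (cases "norm u \<le> R")
    case True then show ?thesis using t by simp
  next
    case False
    then have u: "norm u > R" by simp
    have "\<bar>F 0 - a\<bar> \<le> \<bar>F 0 - a\<bar> * norm u" using u R mult_left_mono[of 1 "norm u" "\<bar>F 0 - a\<bar>"] by simp
    moreover have "G \<bullet> u \<ge> - (norm G * norm u)"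
      using Cauchy_Schwarz_ineq2[of G u] by (simp add: abs_le_iff)
    moreover have "R * c / 2 * norm u \<le> c / 2 * (norm u)\<^sup>2"
    proof -
      have "R * norm u \<le> norm u * norm u" using u by (intro mult_right_mono) auto
      then have "c / 2 * (R * norm u) \<le> c / 2 * (norm u * norm u)" using c by (intro mult_left_mono) auto
      then show ?thesis by (simp add: power2_eq_square mult_ac)
    qed
    moreover have "R * c / 2 = norm G + \<bar>F 0 - a\<bar> + c / 2"
      unfolding R_def using c by (simp add: field_simps)
    then have "R * c / 2 * norm u = norm G * norm u + \<bar>F 0 - a\<bar> * norm u + c / 2 * norm u"
      by (simp add: distrib_right)
    moreover have "0 \<le> c / 2 * norm u" using c by simp
    ultimately have "F 0 \<le> F u" using low[of u] by linarith
    moreover have "F t \<le> F 0" using t R by simp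
    ultimately show ?thesis by simp
  qed
  then show ?thesis by blast
qed

lemma arg_min_le:
  fixes F :: "'a \<Rightarrow> real"
  assumes "\<exists>t. \<forall>u. F t \<le> F u"
  shows "F (arg_min F (\<lambda>_. True)) \<le> F u"
proof -
  obtain t where "\<forall>u. F t \<le> F u" using assms by blast
  then have "is_arg_min F (\<lambda>_. True) t" by (simp add: is_arg_min_linorder)
  then have "is_arg_min F (\<lambda>_. True) (arg_min F (\<lambda>_. True))"
    unfolding arg_min_def by (rule someI)
  then show ?thesis by (simp add: is_arg_min_linorder)
qed

text \<open>At \<open>lam = \<infinity>\<close> the convention for \<open>shrinkage\<close> makes
  this the zero map. It is still nonexpansive and affine, but the variational characterization is
  stated for finite \<open>lam\<close> only, hence the case distinctions below.\<close>

definition prox :: "(real^'k \<Rightarrow> real) \<Rightarrow> ennreal \<Rightarrow> real^'k \<Rightarrow> real^'k" where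
  "prox pen lam x = x + shrinkage pen lam x"

lemma prox_top [simp]: "prox pen top x = 0"
  by (simp add: prox_def shrinkage_def)

text \<open>The only properties of the penalties used outside of the local description of their
  proximal maps.\<close>

definition penalty :: "(real^'k \<Rightarrow> real) \<Rightarrow> bool" where
  "penalty pen \<longleftrightarrow> convex_on UNIV pen \<and> continuous_on UNIV pen \<and> (\<forall>x. pen x \<ge> 0) \<and> pen 0 = 0"

text \<open>The substitution \<open>t = x + g\<close> turns the quadratic into
  \<open>1/2 * (norm (t - x))^2\<close>, whose gradient at the minimizer is \<open>shrinkage\<close>
  itself; the gradient step from the minimizer then leads back to \<open>x\<close>.\<close>

lemma is_prox_prox:
  assumes "penalty pen" "lam \<noteq> \<infinity>"
  shows "is_prox (\<lambda>t. enn2real lam * pen t) x (prox pen lam x)"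
proof -
  define c where "c = enn2real lam"
  have c: "c \<ge> 0" by (simp add: c_def)
  define F where "F = (\<lambda>g. 1/2 * (norm g)\<^sup>2 + c * pen (x + g))"
  have pen: "convex_on UNIV pen" "continuous_on UNIV pen" "\<And>x. pen x \<ge> 0"
    using assms by (auto simp: penalty_def)
  have "continuous_on UNIV F" unfolding F_def
    by (intro continuous_intros continuous_on_compose2[OF pen(2)]) auto
  moreover have "F g \<ge> 0 + 0 \<bullet> g + 1 / 2 * (norm g)\<^sup>2" for g
    using pen(3)[of "x + g"] c by (simp add: F_def)
  ultimately have "\<exists>t. \<forall>u. F t \<le> F u"
    by (intro coercive_attains_minimum[of F 1 0 0]) auto
  from arg_min_le[OF this] have min: "F (shrinkage pen lam x) \<le> F u" for u
    using assms(2) by (simp add: shrinkage_def F_def c_def)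
  have "is_prox (\<lambda>t. c * pen t) (prox pen lam x - shrinkage pen lam x) (prox pen lam x)"
  proof (rule is_prox_if_minimizer[where F = "\<lambda>t. 1/2 * (norm (t - x))\<^sup>2"])
    show "convex_on UNIV (\<lambda>t. c * pen t)"
      using pen(1) c by (rule convex_on_cmul[rotated])
    show "((\<lambda>t. 1 / 2 * (norm (t - x))\<^sup>2) has_derivative (\<bullet>) (shrinkage pen lam x)) (at (prox pen lam x))"
      unfolding power2_norm_eq_inner
      by (auto intro!: derivative_eq_intros simp: prox_def inner_commute)
    show "1 / 2 * (norm (prox pen lam x - x))\<^sup>2 + c * pen (prox pen lam x)
      \<le> 1 / 2 * (norm (u - x))\<^sup>2 + c * pen u" for u
      using min[of "u - x"] by (simp add: F_def prox_def)
  qed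
  then show ?thesis by (simp add: prox_def c_def)
qed

lemma prox_eqI:
  assumes "penalty pen" "lam \<noteq> \<infinity>" "is_prox (\<lambda>t. enn2real lam * pen t) x t"
  shows "prox pen lam x = t"
  using is_prox_unique[OF is_prox_prox[OF assms(1,2)] assms(3)] .

lemma prox_nonexpansive:
  assumes "penalty pen"
  shows "norm (prox pen lam x - prox pen lam y) \<le> norm (x - y)"
proof (cases "lam = \<infinity>")
  case False
  show ?thesis by (rule is_prox_nonexpansive[OF is_prox_prox is_prox_prox]) (use False assms in auto)
qed auto

lemma prox_zero:
  assumes "penalty pen"
  shows "prox pen lam 0 = 0"
proof (cases "lam = \<infinity>")
  case False
  then show ?thesis
    using assms by (intro prox_eqI) (auto simp: penalty_def is_prox_def)
qed auto

text \<open>An exact affine relation on a ball of known radius, not mere differentiability at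
  \<open>x\<close>: it is applied at all leave-one-out points, and no remainder has to be summed
  over them.\<close>

definition prox_affine_near ::
    "(real^'k \<Rightarrow> real) \<Rightarrow> ennreal \<Rightarrow> real \<Rightarrow> real^'k \<Rightarrow> real^'k^'k \<Rightarrow> bool" where
  "prox_affine_near pen lam \<rho> x M \<longleftrightarrow>
     (\<forall>y. norm (y - x) < \<rho> \<longrightarrow> prox pen lam y = prox pen lam x + M *v (y - x))"

text \<open>The linear part inherits nonexpansiveness, since a small multiple of \<open>v\<close>
  stays within the radius.\<close>

lemma prox_affine_near_norm:
  assumes "penalty pen" "prox_affine_near pen lam \<rho> x M" "\<rho> > 0"
  shows "norm (M *v v) \<le> norm v"
proof (cases "v = 0")
  case False
  define s where "s = \<rho> / (2 * norm v)"
  have s: "s > 0" "norm (s *\<^sub>R v) < \<rho>" using assms(3) False by (auto simp: s_def)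
  have "prox pen lam (x + s *\<^sub>R v) = prox pen lam x + M *v (s *\<^sub>R v)"
    using assms(2) s unfolding prox_affine_near_def
    by (metis add_diff_cancel_left')
  with prox_nonexpansive[OF assms(1), of lam "x + s *\<^sub>R v" x]
  have "norm (s *\<^sub>R (M *v v)) \<le> norm (s *\<^sub>R v)" by (simp add: matrix_vector_mult_scaleR)
  then show ?thesis using s by simp
qed simp

text \<open>At such points the map is differentiable, so the default value zero of
  \<open>shrinkage_deriv\<close> never enters.\<close>

lemma prox_affine_near_deriv:
  assumes "prox_affine_near pen lam \<rho> x M" "\<rho> > 0"
  shows "shrinkage_deriv pen lam x = M - mat 1"
proof -
  have "((\<lambda>y. prox pen lam x + M *v (y - x) - y) has_derivative (\<lambda>v. M *v v - v)) (at x)"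
    by (auto intro!: derivative_eq_intros
        bounded_linear.has_derivative[OF matrix_vector_mul_bounded_linear])
  then have "(shrinkage pen lam has_derivative (\<lambda>v. M *v v - v)) (at x)"
  proof (rule has_derivative_transform_within[OF _ assms(2)])
    fix y assume "dist y x < \<rho>"
    then have "prox pen lam y = prox pen lam x + M *v (y - x)"
      using assms(1) by (simp add: prox_affine_near_def dist_norm)
    then show "prox pen lam x + M *v (y - x) - y = shrinkage pen lam y"
      by (simp add: prox_def algebra_simps)
  qed auto
  moreover have "(\<lambda>v. M *v v - v) = (\<lambda>v. (M - mat 1) *v v)"
    by (simp add: matrix_vector_mult_diff_rdistrib)
  ultimately have d: "(shrinkage pen lam has_derivative (\<lambda>v. (M - mat 1) *v v)) (at x)" by simp
  then have "frechet_derivative (shrinkage pen lam) (at x) = (\<lambda>v. (M - mat 1) *v v)"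
    by (metis frechet_derivative_at)
  moreover have "shrinkage pen lam differentiable (at x)" using d by (auto simp: differentiable_def)
  ultimately show ?thesis by (simp add: shrinkage_deriv_def jacobian_def)
qed

lemma prox_affine_near_infty: "prox_affine_near pen \<infinity> \<rho> x 0"
  by (simp add: prox_affine_near_def)

text \<open>Penalty parameter zero is split off because the Lasso description below divides by the
  parameter.\<close>

lemma prox_affine_near_zero:
  assumes "penalty pen"
  shows "prox_affine_near pen 0 \<rho> x (mat 1)"
proof -
  have "prox pen 0 y = y" for y
    by (intro prox_eqI assms) (auto simp: is_prox_def)
  then show ?thesis by (simp add: prox_affine_near_def)
qed

subsection \<open>Ridge\<close>

lemma matrix_inv_mult:
  fixes A :: "real^'k^'k"
  assumes "invertible A"
  shows "A ** matrix_inv A = mat 1" "matrix_inv A ** A = mat 1"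
  using someI_ex[OF assms[unfolded invertible_def]] unfolding matrix_inv_def by auto

lemma quadratic_expand:
  fixes W :: "real^'k^'k"
  assumes "transpose W = W"
  shows "(x + s *\<^sub>R y) \<bullet> (W *v (x + s *\<^sub>R y)) = x \<bullet> (W *v x) + 2 * s * (y \<bullet> (W *v x)) + s\<^sup>2 * (y \<bullet> (W *v y))"
proof -
  have "x \<bullet> (W *v y) = y \<bullet> (W *v x)"
    using assms by (metis dot_lmul_matrix inner_commute transpose_matrix_vector)
  then show ?thesis
    by (simp add: matrix_vector_right_distrib matrix_vector_mult_scaleR inner_add_left
        inner_add_right power2_eq_square algebra_simps)
qed

lemma pos_def_matrix_inv:
  fixes A :: "real^'k^'k"
  assumes "pos_def A"
  shows "transpose (matrix_inv A) = matrix_inv A" "x \<bullet> (matrix_inv A *v x) \<ge> 0"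
proof -
  have inj: "x = 0" if "A *v x = 0" for x
    using assms that unfolding pos_def_def by (metis inner_zero_right less_irrefl)
  then have inv: "invertible A"
    by (metis invertible_left_inverse matrix_left_invertible_ker)
  then have AW: "A ** matrix_inv A = mat 1" and WA: "matrix_inv A ** A = mat 1"
    by (simp_all add: matrix_inv_mult)
  have "transpose (matrix_inv A) ** A = mat 1"
    using arg_cong[OF AW, of transpose] assms by (simp add: matrix_transpose_mul transpose_mat pos_def_def)
  then have "transpose (matrix_inv A) ** A ** matrix_inv A = matrix_inv A" by simp
  then show sym: "transpose (matrix_inv A) = matrix_inv A"
    by (simp add: AW flip: matrix_mul_assoc)
  have "x = A *v (matrix_inv A *v x)" by (simp add: matrix_vector_mul_assoc AW)
  then have "x \<bullet> (matrix_inv A *v x) = (A *v (matrix_inv A *v x)) \<bullet> (matrix_inv A *v x)" by simp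
  also have "\<dots> \<ge> 0" using assms unfolding pos_def_def
    by (metis inner_commute inner_zero_right less_eq_real_def)
  finally show "x \<bullet> (matrix_inv A *v x) \<ge> 0" .
qed

lemma ridge_is_penalty:
  fixes W :: "real^'k^'k"
  assumes sym: "transpose W = W" and psd: "\<And>x. x \<bullet> (W *v x) \<ge> 0"
  shows "penalty (\<lambda>\<theta>. (1/2) * (\<theta> \<bullet> (W *v \<theta>)))"
proof -
  let ?f = "\<lambda>\<theta>. (1/2) * (\<theta> \<bullet> (W *v \<theta>))"
  have "convex_on UNIV ?f"
  proof (intro convex_onI)
    fix t :: real and x y :: "real^'k" assume t: "0 < t" "t < 1"
    have eq: "(1 - t) *\<^sub>R x + t *\<^sub>R y = x + t *\<^sub>R (y - x)" by (simp add: algebra_simps)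
    have q: "y \<bullet> (W *v y) = x \<bullet> (W *v x) + 2 * ((y - x) \<bullet> (W *v x)) + (y - x) \<bullet> (W *v (y - x))"
      using quadratic_expand[OF sym, of x 1 "y - x"] by simp
    have "t\<^sup>2 * ((y - x) \<bullet> (W *v (y - x))) \<le> t * ((y - x) \<bullet> (W *v (y - x)))"
      using t psd by (intro mult_right_mono) (auto simp: power2_eq_square mult_left_le)
    then show "?f ((1 - t) *\<^sub>R x + t *\<^sub>R y) \<le> (1 - t) * ?f x + t * ?f y"
      unfolding eq quadratic_expand[OF sym] q
      by (simp add: left_diff_distrib distrib_left add_divide_distrib diff_divide_distrib)
  qed simp
  moreover have "continuous_on UNIV ?f"
    by (intro continuous_intros linear_continuous_on matrix_vector_mul_bounded_linear)
  ultimately show ?thesis using psd by (simp add: penalty_def)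
qed

lemma ridge_prox_iff:
  fixes W :: "real^'k^'k"
  assumes sym: "transpose W = W" and psd: "\<And>x. x \<bullet> (W *v x) \<ge> 0" and c: "c \<ge> 0"
  shows "is_prox (\<lambda>\<theta>. c * ((1/2) * (\<theta> \<bullet> (W *v \<theta>)))) x t \<longleftrightarrow> x = t + c *\<^sub>R (W *v t)"
proof
  assume *: "x = t + c *\<^sub>R (W *v t)"
  show "is_prox (\<lambda>\<theta>. c * ((1/2) * (\<theta> \<bullet> (W *v \<theta>)))) x t"
    unfolding is_prox_def
  proof
    fix u
    have "u \<bullet> (W *v u) = t \<bullet> (W *v t) + 2 * ((u - t) \<bullet> (W *v t)) + (u - t) \<bullet> (W *v (u - t))"
      using quadratic_expand[OF sym, of t 1 "u - t"] by simp
    moreover have "(x - t) \<bullet> (u - t) = c * ((u - t) \<bullet> (W *v t))"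
      using * by (simp add: inner_commute)
    moreover have "0 \<le> c * ((u - t) \<bullet> (W *v (u - t)))" using psd c by simp
    ultimately show "c * ((1/2) * (t \<bullet> (W *v t))) + (x - t) \<bullet> (u - t) \<le> c * ((1/2) * (u \<bullet> (W *v u)))"
      by (simp add: algebra_simps)
  qed
next
  assume *: "is_prox (\<lambda>\<theta>. c * ((1/2) * (\<theta> \<bullet> (W *v \<theta>)))) x t"
  \<comment> \<open>A step of length \<open>s\<close> in direction \<open>d\<close> makes the
    quadratic remainder \<open>s * (c * q) / 2\<close> smaller than \<open>e\<close>. The resulting
    inequality, valid for all \<open>d\<close>, is afterwards tested with the residual of the
    equation.\<close>
  have le: "d \<bullet> (x - t) \<le> c * (d \<bullet> (W *v t))" for d
  proof (rule field_le_epsilon)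
    fix e :: real assume e: "e > 0"
    define q where "q = d \<bullet> (W *v d)"
    have q: "q \<ge> 0" by (simp add: q_def psd)
    define s where "s = e / (c * q + 1)"
    have cq: "c * q \<ge> 0" using c q by simp
    then have s: "s > 0" "s * (c * q) \<le> e"
      using e by (auto simp: s_def field_simps)
    have "c * ((1/2) * (t \<bullet> (W *v t))) + (x - t) \<bullet> (t + s *\<^sub>R d - t)
       \<le> c * ((1/2) * ((t + s *\<^sub>R d) \<bullet> (W *v (t + s *\<^sub>R d))))"
      using * unfolding is_prox_def by blast
    then have "s * (d \<bullet> (x - t)) \<le> s * (c * (d \<bullet> (W *v t)) + s * (c * q) / 2)"
      unfolding quadratic_expand[OF sym]
      by (simp add: q_def inner_commute algebra_simps power2_eq_square)
    then have "d \<bullet> (x - t) \<le> c * (d \<bullet> (W *v t)) + s * (c * q) / 2" using s by simp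
    then show "d \<bullet> (x - t) \<le> c * (d \<bullet> (W *v t)) + e" using s e by simp
  qed
  have "(x - t - c *\<^sub>R (W *v t)) \<bullet> (x - t - c *\<^sub>R (W *v t)) \<le> 0"
    using le[of "x - t - c *\<^sub>R (W *v t)"] by (simp add: inner_diff_right)
  then have "x - t - c *\<^sub>R (W *v t) = 0"
    by (meson inner_eq_zero_iff inner_ge_zero order_antisym)
  then show "x = t + c *\<^sub>R (W *v t)" by (simp add: algebra_simps)
qed

text \<open>The graph of the proximal map is the linear relation
  \<open>x = t + c *\<^sub>R (W *v t)\<close>, so the map is linear without \<open>I + c W\<close>
  being inverted; one matrix serves all \<open>x\<close>.\<close>

lemma ridge_prox_affine:
  assumes "ridge_penalty pen \<Lambda>"
  shows "penalty pen" "\<exists>M. \<forall>x. prox_affine_near pen lam \<rho> x M"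
proof -
  obtain A where A: "pos_def A" and pen: "pen = (\<lambda>\<theta>. (1/2) * (\<theta> \<bullet> (matrix_inv A *v \<theta>)))"
    using assms unfolding ridge_penalty_def by blast
  define W where "W = matrix_inv A"
  have sym: "transpose W = W" and psd: "\<And>x. x \<bullet> (W *v x) \<ge> 0"
    using pos_def_matrix_inv[OF A] by (auto simp: W_def)
  have pen: "pen = (\<lambda>\<theta>. (1/2) * (\<theta> \<bullet> (W *v \<theta>)))" using pen by (simp add: W_def)
  show p: "penalty pen" unfolding pen by (rule ridge_is_penalty[OF sym psd])
  show "\<exists>M. \<forall>x. prox_affine_near pen lam \<rho> x M"
  proof (cases "lam = \<infinity>")
    case True then show ?thesis using prox_affine_near_infty by blast
  next
    case False
    define S where "S = prox pen lam"
    define c where "c = enn2real lam"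
    have c: "c \<ge> 0" by (simp add: c_def)
    have iff: "S x = t \<longleftrightarrow> x = t + c *\<^sub>R (W *v t)" for x t
    proof -
      have "S x = t \<longleftrightarrow> is_prox (\<lambda>\<theta>. c * pen \<theta>) x t"
        using is_prox_prox[OF p False, of x] prox_eqI[OF p False, of x t] by (auto simp: S_def c_def)
      then show ?thesis using ridge_prox_iff[OF sym psd c] by (simp add: pen)
    qed
    have "linear S"
    proof (rule linearI)
      fix x y
      have "x = S x + c *\<^sub>R (W *v S x)" "y = S y + c *\<^sub>R (W *v S y)" using iff by blast+
      then have "x + y = (S x + c *\<^sub>R (W *v S x)) + (S y + c *\<^sub>R (W *v S y))" by simp
      then show "S (x + y) = S x + S y"
        by (simp add: iff matrix_vector_right_distrib algebra_simps)
    next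
      fix r x
      have "x = S x + c *\<^sub>R (W *v S x)" using iff by blast
      then have "r *\<^sub>R x = r *\<^sub>R (S x + c *\<^sub>R (W *v S x))" by simp
      then show "S (r *\<^sub>R x) = r *\<^sub>R S x"
        by (simp add: iff matrix_vector_mult_scaleR algebra_simps)
    qed
    then have "S y = S x + matrix S *v (y - x)" for x y
      using fun_cong[OF matrix_vector_mul(2), of S "y - x"] by (simp add: linear_diff)
    then show ?thesis unfolding prox_affine_near_def S_def by blast
  qed
qed

subsection \<open>Lasso\<close>

locale lasso_map =
  fixes A W :: "real^'k^'k" and c :: real
  assumes WA: "W ** A = mat 1" and AW: "A ** W = mat 1" and c: "c > 0"
begin

section \<open>Stationarity conditions of the Lasso, sorted by sign pattern\<close>

definition h :: "real^'k \<Rightarrow> real" where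
  "h t = c * (\<Sum>j\<in>UNIV. \<bar>(W *v t) $ j\<bar>)"

text \<open>The part of the subgradient that the sign pattern forces; coordinates with
  \<open>sg j = 0\<close> contribute nothing.\<close>

definition base :: "('k \<Rightarrow> real) \<Rightarrow> real^'k" where
  "base sg = (\<Sum>j\<in>UNIV. (c * sg j) *\<^sub>R row j W)"

text \<open>On the region where the proximal point \<open>t\<close> of \<open>x\<close> has sign pattern \<open>sg\<close> (that is,
  \<open>sgn (W t) = sg\<close>), \<open>x - base sg\<close> is a linear image of the vector \<open>y\<close> that lists the nonzero
  coordinates of \<open>W t\<close> and the free subgradient coordinates.\<close>

definition combine :: "('k \<Rightarrow> real) \<Rightarrow> real^'k \<Rightarrow> real^'k" where
  "combine sg y = (\<Sum>j\<in>UNIV. (y $ j) *\<^sub>R (if sg j \<noteq> 0 then column j A else c *\<^sub>R row j W))"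

text \<open>Recovers the proximal point: the coordinates of \<open>W t\<close> are kept, the free
  subgradient coordinates dropped.\<close>

definition active :: "('k \<Rightarrow> real) \<Rightarrow> real^'k \<Rightarrow> real^'k" where
  "active sg y = (\<Sum>j\<in>UNIV. (if sg j \<noteq> 0 then y $ j else 0) *\<^sub>R column j A)"

text \<open>The rows of \<open>W\<close> and the columns of \<open>A\<close> are dual bases; this
  decouples the penalty into coordinates.\<close>

lemma row_column: "row i W \<bullet> column j A = (if i = j then 1 else 0)"
proof -
  have "row i W \<bullet> column j A = (W ** A) $ i $ j"
    by (simp add: matrix_matrix_mult_def row_def column_def inner_vec_def)
  then show ?thesis by (simp add: WA mat_def)
qed

lemma mult_A: "A *v u = (\<Sum>j\<in>UNIV. (u $ j) *\<^sub>R column j A)"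
  by (simp add: matrix_mult_sum scalar_mult_eq_scaleR)

lemma mult_W_nth: "(W *v t) $ j = row j W \<bullet> t"
  by (simp add: matrix_vector_mul_component row_def vec_nth_inverse)

lemma W_active: "(W *v active sg y) $ j = (if sg j \<noteq> 0 then y $ j else 0)"
proof -
  have "active sg y = A *v (\<chi> j. if sg j \<noteq> 0 then y $ j else 0)"
    by (simp add: mult_A active_def)
  then have "W *v active sg y = (\<chi> j. if sg j \<noteq> 0 then y $ j else 0)"
    by (simp add: matrix_vector_mul_assoc WA)
  then show ?thesis by simp
qed

lemma combine_split:
  "combine sg y = active sg y + (\<Sum>j\<in>UNIV. (if sg j \<noteq> 0 then 0 else c * y $ j) *\<^sub>R row j W)"
  unfolding combine_def active_def sum.distrib[symmetric] by (rule sum.cong) auto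

lemma linear_combine: "linear (combine sg)"
  unfolding combine_def by (rule linearI) (auto simp: algebra_simps sum.distrib scaleR_sum_right)

lemma linear_active: "linear (active sg)"
  unfolding active_def
  by (rule linearI) (auto simp: algebra_simps sum.distrib scaleR_sum_right intro!: sum.cong
      simp flip: sum.distrib)

text \<open>By duality every inactive row of \<open>W\<close> is orthogonal to every active column
  of \<open>A\<close>. If the two parts of \<open>combine\<close> cancel, each of them is therefore
  zero, and duality again reads off the coordinates of \<open>y\<close>.\<close>

lemma inj_combine: "inj (combine sg)"
proof -
  have "y = 0" if "combine sg y = 0" for y
  proof -
    define t where "t = active sg y"
    define r where "r = (\<Sum>j\<in>UNIV. (if sg j \<noteq> 0 then 0 else c * y $ j) *\<^sub>R row j W)"
    have tr: "t + r = 0" using that by (simp add: combine_split t_def r_def)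
    have "r \<bullet> t = 0"
      unfolding r_def inner_sum_left
      by (rule sum.neutral) (auto simp: t_def W_active simp flip: mult_W_nth)
    then have t: "t = 0" using tr by (metis add_eq_0_iff inner_eq_zero_iff inner_minus_left neg_equal_0_iff_equal)
    then have r: "r = 0" using tr by simp
    have "y $ j = 0" for j
    proof (cases "sg j = 0")
      case False
      then show ?thesis using W_active[of sg y j] t by (simp add: t_def)
    next
      case True
      have "0 = r \<bullet> column j A" by (simp add: r)
      also have "\<dots> = (\<Sum>i\<in>UNIV. (if sg i \<noteq> 0 then 0 else c * y $ i) * (if i = j then 1 else 0))"
        unfolding r_def inner_sum_left by (simp add: row_column)
      also have "\<dots> = (\<Sum>i\<in>UNIV. if i = j then c * y $ j else 0)"
        using True by (intro sum.cong) auto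
      also have "\<dots> = c * y $ j" by simp
      finally show ?thesis using c by simp
    qed
    then show ?thesis by (simp add: vec_eq_iff)
  qed
  then show ?thesis by (simp add: linear_injective_0[OF linear_combine])
qed

text \<open>Sufficiency: the vector \<open>s\<close> has entries of size at most one and agrees with
  the signs of \<open>W t\<close> where these are nonzero, so it is a subgradient of the l1 norm at
  \<open>W t\<close>.\<close>

lemma is_prox_pattern:
  assumes y: "combine sg y = x - base sg"
    and sg: "\<And>j. sg j \<in> {-1, 0, 1}"
    and pos: "\<And>j. sg j \<noteq> 0 \<Longrightarrow> sg j * y $ j > 0"
    and le: "\<And>j. sg j = 0 \<Longrightarrow> \<bar>y $ j\<bar> \<le> 1"
  shows "is_prox h x (active sg y)"
  unfolding is_prox_def
proof
  fix u
  define t where "t = active sg y"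
  define s where "s = (\<lambda>j. if sg j \<noteq> 0 then sg j else y $ j)"
  have "x - t = (\<Sum>j\<in>UNIV. (if sg j \<noteq> 0 then 0 else c * y $ j) *\<^sub>R row j W) + base sg"
    using y by (simp add: combine_split t_def algebra_simps)
  also have "\<dots> = (\<Sum>j\<in>UNIV. (c * s j) *\<^sub>R row j W)"
    unfolding base_def sum.distrib[symmetric] by (rule sum.cong) (auto simp: s_def)
  finally have "(x - t) \<bullet> (u - t) = (\<Sum>j\<in>UNIV. c * s j * ((W *v u) $ j - (W *v t) $ j))"
    by (simp add: inner_sum_left inner_diff_right mult_W_nth sum_subtractf right_diff_distrib)
  also have "\<dots> \<le> (\<Sum>j\<in>UNIV. c * (\<bar>(W *v u) $ j\<bar> - \<bar>(W *v t) $ j\<bar>))"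
  proof (rule sum_mono)
    fix j
    have "\<bar>s j\<bar> \<le> 1" using sg[of j] le[of j] by (auto simp: s_def)
    then have "\<bar>s j * (W *v u) $ j\<bar> \<le> \<bar>(W *v u) $ j\<bar>"
      by (simp add: abs_mult mult_left_le_one_le)
    then have "s j * (W *v u) $ j \<le> \<bar>(W *v u) $ j\<bar>" by linarith
    moreover have "s j * (W *v t) $ j = \<bar>(W *v t) $ j\<bar>"
      using sg[of j] pos[of j] by (auto simp: t_def W_active s_def)
    ultimately have "s j * ((W *v u) $ j - (W *v t) $ j) \<le> \<bar>(W *v u) $ j\<bar> - \<bar>(W *v t) $ j\<bar>"
      by (simp add: algebra_simps)
    then show "c * s j * ((W *v u) $ j - (W *v t) $ j) \<le> c * (\<bar>(W *v u) $ j\<bar> - \<bar>(W *v t) $ j\<bar>)"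
      using c by (simp add: mult.assoc)
  qed
  also have "\<dots> = h u - h t" by (simp add: h_def sum_distrib_left sum_subtractf right_diff_distrib)
  finally show "h (active sg y) + (x - active sg y) \<bullet> (u - active sg y) \<le> h u" by (simp add: t_def)
qed

text \<open>Necessity: moving \<open>t\<close> along column \<open>j\<close> of \<open>A\<close>
  changes only coordinate \<open>j\<close> of \<open>W t\<close>, so the defining inequality splits
  into one-dimensional subgradient inequalities.\<close>

lemma prox_pattern_exists:
  assumes "is_prox h x t"
  obtains sg y where "combine sg y = x - base sg" "\<And>j. sg j \<in> {-1, 0, 1}"
    "\<And>j. sg j \<noteq> 0 \<Longrightarrow> sg j * y $ j > 0" "\<And>j. sg j = 0 \<Longrightarrow> \<bar>y $ j\<bar> \<le> 1"
proof -
  define u where "u = W *v t"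
  define s where "s = (\<lambda>j. ((x - t) \<bullet> column j A) / c)"
  have sub: "s j * d \<le> \<bar>u $ j + d\<bar> - \<bar>u $ j\<bar>" for j d
  proof -
    have W: "(W *v (t + d *\<^sub>R column j A)) $ i = u $ i + (if i = j then d else 0)" for i
      by (simp add: u_def matrix_vector_right_distrib mult_W_nth row_column)
    have "h t + (x - t) \<bullet> (t + d *\<^sub>R column j A - t) \<le> h (t + d *\<^sub>R column j A)"
      using assms unfolding is_prox_def by blast
    then have "c * (s j * d) \<le> h (t + d *\<^sub>R column j A) - h t"
      using c by (simp add: s_def mult.commute)
    also have "\<dots> = c * (\<Sum>i\<in>UNIV. \<bar>u $ i + (if i = j then d else 0)\<bar> - \<bar>u $ i\<bar>)"
      by (simp add: h_def W sum_subtractf right_diff_distrib) (simp add: u_def)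
    also have "(\<Sum>i\<in>UNIV. \<bar>u $ i + (if i = j then d else 0)\<bar> - \<bar>u $ i\<bar>) =
        (\<Sum>i\<in>UNIV. if i = j then \<bar>u $ j + d\<bar> - \<bar>u $ j\<bar> else 0)"
      by (rule sum.cong) auto
    finally show ?thesis using c by simp
  qed
  \<comment> \<open>The choices \<open>d = 1\<close> and \<open>d = -1\<close> bound the
    subgradient; \<open>d = u $ j\<close> and \<open>d = - u $ j\<close> identify it where the
    coordinate is nonzero.\<close>
  have s1: "\<bar>s j\<bar> \<le> 1" for j
    using sub[of j 1] sub[of j "-1"] by (auto simp: abs_le_iff)
  have ssgn: "s j = sgn (u $ j)" if "u $ j \<noteq> 0" for j
  proof -
    have "s j * u $ j \<le> \<bar>u $ j\<bar>" using sub[of j "u $ j"] by simp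
    moreover have "\<bar>u $ j\<bar> \<le> s j * u $ j" using sub[of j "- u $ j"] by simp
    ultimately have "s j * u $ j = \<bar>u $ j\<bar>" by simp
    then have "s j = \<bar>u $ j\<bar> / u $ j" using that by (simp add: field_simps)
    then show ?thesis using that by (auto simp: sgn_real_def)
  qed
  define sg where "sg = (\<lambda>j. sgn (u $ j))"
  define y where "y = (\<chi> j. if sg j \<noteq> 0 then u $ j else s j)"
  have act: "active sg y = t"
  proof -
    have "active sg y = A *v u"
      unfolding active_def mult_A by (rule sum.cong) (auto simp: y_def sg_def sgn_real_def)
    then show ?thesis by (simp add: u_def matrix_vector_mul_assoc AW)
  qed
  \<comment> \<open>Expands \<open>x - t\<close> in the rows of \<open>W\<close>, with inner
    products against the dual columns of \<open>A\<close> as coefficients.\<close>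
  have xt: "x - t = (\<Sum>j\<in>UNIV. (c * s j) *\<^sub>R row j W)"
  proof -
    have "x - t = transpose W *v (transpose A *v (x - t))"
      by (simp add: matrix_vector_mul_assoc AW transpose_mat del: transpose_matrix_vector
          flip: matrix_transpose_mul)
    also have "\<dots> = (\<Sum>j\<in>UNIV. ((transpose A *v (x - t)) $ j) *\<^sub>R row j W)"
      by (simp add: matrix_mult_sum scalar_mult_eq_scaleR column_transpose)
    also have "\<dots> = (\<Sum>j\<in>UNIV. (c * s j) *\<^sub>R row j W)"
    proof (rule sum.cong[OF refl])
      fix j
      have "(transpose A *v (x - t)) $ j = (x - t) \<bullet> column j A"
        by (simp add: matrix_vector_mul_component inner_commute transpose_def column_def)
      then show "((transpose A *v (x - t)) $ j) *\<^sub>R row j W = (c * s j) *\<^sub>R row j W"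
        using c by (simp add: s_def)
    qed
    finally show ?thesis .
  qed
  have "combine sg y + base sg = t + ((\<Sum>j\<in>UNIV. (if sg j \<noteq> 0 then 0 else c * y $ j) *\<^sub>R row j W) + base sg)"
    by (simp add: combine_split act)
  also have "(\<Sum>j\<in>UNIV. (if sg j \<noteq> 0 then 0 else c * y $ j) *\<^sub>R row j W) + base sg
      = (\<Sum>j\<in>UNIV. (c * s j) *\<^sub>R row j W)"
    unfolding base_def sum.distrib[symmetric]
  proof (rule sum.cong[OF refl])
    fix j
    show "(if sg j \<noteq> 0 then 0 else c * y $ j) *\<^sub>R row j W + (c * sg j) *\<^sub>R row j W = (c * s j) *\<^sub>R row j W"
      using ssgn[of j] by (cases "u $ j = 0") (auto simp: sg_def y_def)
  qed
  finally have "combine sg y + base sg = x" by (simp flip: xt)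
  then have "combine sg y = x - base sg" by (simp add: eq_diff_eq)
  moreover have "sg j \<in> {-1, 0, 1}" for j by (auto simp: sg_def sgn_real_def)
  moreover have "sg j * y $ j > 0" if "sg j \<noteq> 0" for j
    using that by (auto simp: sg_def y_def sgn_real_def split: if_splits)
  moreover have "\<bar>y $ j\<bar> \<le> 1" if "sg j = 0" for j using that s1 by (simp add: y_def)
  ultimately show ?thesis using that by blast
qed

text \<open>For each of the finitely many sign patterns the coordinates \<open>y\<close> are affine
  in \<open>x\<close>. At distance \<rho> from all bounding hyperplanes the sign and range
  conditions survive a small move, so sufficiency certifies the same pattern, and with it the same
  affine formula, at \<open>z\<close>.\<close>

lemma prox_affine_off_hyperplanes:
  obtains H :: "((real^'k) \<times> real) set" and K :: real where
    "finite H" "\<And>v b. (v, b) \<in> H \<Longrightarrow> v \<noteq> 0" "K > 0"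
    "\<And>\<rho> x S. \<rho> > 0 \<Longrightarrow> (\<And>v b. (v, b) \<in> H \<Longrightarrow> \<rho> \<le> \<bar>v \<bullet> x - b\<bar>) \<Longrightarrow> (\<And>x. is_prox h x (S x)) \<Longrightarrow>
       \<exists>M. \<forall>z. norm (z - x) < \<rho> / K \<longrightarrow> S z = S x + M *v (z - x)"
proof -
  have "\<exists>N. linear N \<and> (\<forall>x. N (combine sg x) = x) \<and> (\<forall>x. combine sg (N x) = x)" for sg
    using linear_injective_isomorphism[OF linear_combine inj_combine] by blast
  then obtain N where N: "\<And>sg. linear (N sg)" "\<And>sg x. N sg (combine sg x) = x"
      "\<And>sg x. combine sg (N sg x) = x"
    by metis
  define v where "v = (\<lambda>sg j. matrix (N sg) $ j)"
  have Nv: "N sg z $ j = v sg j \<bullet> z" for sg j z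
    using fun_cong[OF matrix_vector_mul(2)[OF N(1)[of sg]], of z] matrix_vector_mul_component[of "matrix (N sg)" z j]
    by (simp add: v_def)
  have v0: "v sg j \<noteq> 0" for sg j
  proof
    assume "v sg j = 0"
    then have "N sg (combine sg (axis j 1)) $ j = 0" by (simp add: Nv)
    then show False by (simp add: N)
  qed
  define Pat :: "('k \<Rightarrow> real) set" where "Pat = UNIV \<rightarrow>\<^sub>E {-1, 0, 1}"
  have "finite Pat" unfolding Pat_def by (rule finite_PiE) auto
  \<comment> \<open>The value \<open>r = 0\<close> guards the sign of an active coordinate,
    \<open>r = 1\<close> and \<open>r = -1\<close> the range of a free one. All patterns are
    included because that of \<open>x\<close> is not known in advance.\<close>
  define H where "H = (\<lambda>((sg, j), r). (v sg j, v sg j \<bullet> base sg + r)) ` ((Pat \<times> UNIV) \<times> {-1, 0, 1})"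
  have fin: "finite H" unfolding H_def using \<open>finite Pat\<close> by auto
  have H0: "w \<noteq> 0" if "(w, b) \<in> H" for w b using that v0 by (auto simp: H_def)
  \<comment> \<open>Bounds all normal vectors: a move by less than \<open>\<rho> / K\<close> changes
    each coordinate of \<open>y\<close> by less than \<rho>.\<close>
  define K where "K = 1 + (\<Sum>p\<in>H. norm (fst p))"
  have K0: "K > 0" unfolding K_def by (smt (verit) sum_nonneg norm_ge_zero)
  have HI: "(v sg j, v sg j \<bullet> base sg + r) \<in> H" if "\<And>j. sg j \<in> {-1, 0, 1}" "r \<in> {-1, 0, 1}" for sg j r
    unfolding H_def using that
    by (intro image_eqI[of _ _ "((sg, j), r)"]) (auto simp: Pat_def PiE_def extensional_def)
  have vK: "norm (v sg j) \<le> K" if "\<And>j. sg j \<in> {-1, 0, 1}" for sg j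
  proof -
    have "norm (fst (v sg j, v sg j \<bullet> base sg + 0)) \<le> (\<Sum>p\<in>H. norm (fst p))"
      using HI[OF that, of 0 _ j] fin by (intro member_le_sum) auto
    then show ?thesis by (simp add: K_def)
  qed
  show ?thesis
  proof (rule that[OF fin H0 K0])
    fix \<rho> :: real and x :: "real^'k" and S
    assume \<rho>: "\<rho> > 0" and far: "\<And>v b. (v, b) \<in> H \<Longrightarrow> \<rho> \<le> \<bar>v \<bullet> x - b\<bar>"
      and S: "\<And>x. is_prox h x (S x)"
    obtain sg y where y: "combine sg y = x - base sg" and sg: "\<And>j. sg j \<in> {-1, 0, 1}"
      and pos: "\<And>j. sg j \<noteq> 0 \<Longrightarrow> sg j * y $ j > 0" and le: "\<And>j. sg j = 0 \<Longrightarrow> \<bar>y $ j\<bar> \<le> 1"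
      using prox_pattern_exists[OF S] by metis
    have yN: "y = N sg (x - base sg)" by (simp add: N flip: y)
    have near: "S z = active sg (N sg (z - base sg))" if z: "norm (z - x) < \<rho> / K" for z
    proof -
      define y' where "y' = N sg (z - base sg)"
      have diff: "\<bar>y' $ j - y $ j\<bar> < \<rho>" for j
      proof -
        have "y' $ j - y $ j = v sg j \<bullet> (z - x)"
          by (simp add: y'_def yN Nv inner_diff_right)
        then have "\<bar>y' $ j - y $ j\<bar> \<le> norm (v sg j) * norm (z - x)"
          using Cauchy_Schwarz_ineq2 by simp
        also have "\<dots> \<le> K * norm (z - x)" using vK[OF sg] by (intro mult_right_mono) auto
        also have "\<dots> < \<rho>" using z K0 by (simp add: field_simps)
        finally show ?thesis .
      qed
      have far': "\<rho> \<le> \<bar>y $ j - r\<bar>" if "r \<in> {-1, 0, 1}" for j r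
        using far[OF HI[OF sg that]] by (simp add: yN Nv inner_diff_right algebra_simps)
      have "is_prox h z (active sg y')"
      proof (rule is_prox_pattern[OF _ sg])
        show "combine sg y' = z - base sg" by (simp add: y'_def N)
      next
        fix j assume "sg j \<noteq> 0"
        then have "sg j = 1 \<and> y $ j > 0 \<or> sg j = -1 \<and> y $ j < 0" using sg[of j] pos[of j] by auto
        then show "sg j * y' $ j > 0" using far'[of 0 j] diff[of j] by auto
      next
        fix j assume "sg j = 0"
        then show "\<bar>y' $ j\<bar> \<le> 1" using far'[of 1 j] far'[of "-1" j] diff[of j] le[of j] by auto
      qed
      from is_prox_unique[OF S this] show ?thesis by (simp add: y'_def)
    qed
    have lin: "linear (active sg \<circ> N sg)" by (intro linear_compose N linear_active)
    show "\<exists>M. \<forall>z. norm (z - x) < \<rho> / K \<longrightarrow> S z = S x + M *v (z - x)"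
    proof (intro exI allI impI)
      fix z assume z: "norm (z - x) < \<rho> / K"
      have "S x = active sg (N sg (x - base sg))" using \<rho> K0 by (intro near) auto
      then show "S z = S x + matrix (active sg \<circ> N sg) *v (z - x)"
        using near[OF z] fun_cong[OF matrix_vector_mul(2)[OF lin], of "z - x"]
        by (simp add: linear_diff[OF N(1)] linear_diff[OF linear_active])
    qed
  qed
qed

end

lemma lasso_is_penalty:
  fixes W :: "real^'k^'k"
  shows "penalty (\<lambda>\<theta>. \<Sum>j\<in>UNIV. \<bar>(W *v \<theta>) $ j\<bar>)"
proof -
  have lin: "linear (\<lambda>\<theta>. (W *v \<theta>) $ j)" for j
    by (rule linearI) (auto simp: matrix_vector_right_distrib matrix_vector_mult_scaleR)
  have "convex_on UNIV (\<lambda>\<theta>. \<bar>(W *v \<theta>) $ j\<bar>)" for j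
  proof (rule convex_onI)
    fix t :: real and x y :: "real^'k" assume "0 < t" "t < 1"
    then have "\<bar>(1 - t) * (W *v x) $ j + t * (W *v y) $ j\<bar> \<le> (1 - t) * \<bar>(W *v x) $ j\<bar> + t * \<bar>(W *v y) $ j\<bar>"
      by (intro order_trans[OF abs_triangle_ineq]) (auto simp: abs_mult)
    then show "\<bar>(W *v ((1 - t) *\<^sub>R x + t *\<^sub>R y)) $ j\<bar> \<le> (1 - t) * \<bar>(W *v x) $ j\<bar> + t * \<bar>(W *v y) $ j\<bar>"
      by (simp add: matrix_vector_right_distrib matrix_vector_mult_scaleR)
  qed simp
  note abs_convex = this
  have "convex_on UNIV (\<lambda>\<theta>. \<Sum>j\<in>J. \<bar>(W *v \<theta>) $ j\<bar>)" if "finite J" for J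
    using that by (induction J) (auto intro!: convex_on_add abs_convex simp: convex_on_def[of _ "\<lambda>_. 0"])
  moreover have "continuous_on UNIV (\<lambda>\<theta>. \<Sum>j\<in>UNIV. \<bar>(W *v \<theta>) $ j\<bar>)"
    using lin by (intro continuous_intros linear_continuous_on) (simp add: linear_linear)
  ultimately show ?thesis using finite by (auto simp: penalty_def sum_nonneg)
qed

text \<open>A finite \<Lambda> allows one finite family of hyperplanes, the union, and one constant,
  which exceeds the sum of the individual ones and so shrinks every radius enough.\<close>

lemma lasso_prox_affine_off_hyperplanes:
  fixes pen :: "real^'k \<Rightarrow> real"
  assumes "lasso_penalty pen \<Lambda>"
  obtains H :: "((real^'k) \<times> real) set" and K :: real where
    "finite H" "\<And>v b. (v, b) \<in> H \<Longrightarrow> v \<noteq> 0" "K > 0"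
    "\<And>\<rho> x lam. \<rho> > 0 \<Longrightarrow> (\<And>v b. (v, b) \<in> H \<Longrightarrow> \<rho> \<le> \<bar>v \<bullet> x - b\<bar>) \<Longrightarrow> lam \<in> \<Lambda> \<Longrightarrow>
       \<exists>M. prox_affine_near pen lam (\<rho> / K) x M"
proof -
  obtain A :: "real^'k^'k" where A: "invertible A"
    and pen: "pen = (\<lambda>\<theta>. \<Sum>j\<in>UNIV. \<bar>(matrix_inv A *v \<theta>) $ j\<bar>)" and fin: "finite \<Lambda>" "\<infinity> \<notin> \<Lambda>"
    using assms unfolding lasso_penalty_def by blast
  have p: "penalty pen" unfolding pen by (rule lasso_is_penalty)
  have "\<exists>H K. finite H \<and> (\<forall>v b. (v, b) \<in> H \<longrightarrow> v \<noteq> 0) \<and> K > 0 \<and>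
      (\<forall>\<rho> x. \<rho> > 0 \<longrightarrow> (\<forall>v b. (v, b) \<in> H \<longrightarrow> \<rho> \<le> \<bar>v \<bullet> x - b\<bar>) \<longrightarrow>
       (\<exists>M. prox_affine_near pen lam (\<rho> / K) x M))" (is "\<exists>H K. ?Q lam H K") if "lam \<in> \<Lambda>" for lam
  proof (cases "lam = 0")
    case True
    then show ?thesis using prox_affine_near_zero[OF p] by (intro exI[of _ "{}"] exI[of _ 1]) auto
  next
    case False
    have fl: "lam \<noteq> \<infinity>" using that fin by auto
    interpret lasso_map A "matrix_inv A" "enn2real lam"
      using A False fl by unfold_locales (auto simp: matrix_inv_mult enn2real_positive_iff top.not_eq_extremum zero_less_iff_neq_zero)
    have "is_prox h x (prox pen lam x)" for x
      using is_prox_prox[OF p fl] by (simp add: h_def[abs_def] pen)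
    with prox_affine_off_hyperplanes show ?thesis
      unfolding prox_affine_near_def by metis
  qed
  then obtain H K where HK: "\<And>lam. lam \<in> \<Lambda> \<Longrightarrow> ?Q lam (H lam) (K lam)" by metis
  define K' where "K' = 1 + (\<Sum>lam\<in>\<Lambda>. K lam)"
  have Kp: "\<And>lam. lam \<in> \<Lambda> \<Longrightarrow> K lam > 0" using HK by blast
  have K': "K' > 0" unfolding K'_def using Kp by (smt (verit) sum_nonneg)
  show ?thesis
  proof (rule that[of "\<Union>lam\<in>\<Lambda>. H lam" K'])
    show "finite (\<Union>lam\<in>\<Lambda>. H lam)" using HK fin by auto
    show "v \<noteq> 0" if "(v, b) \<in> (\<Union>lam\<in>\<Lambda>. H lam)" for v b using that HK by blast
    fix \<rho> :: real and x lam
    assume \<rho>: "\<rho> > 0" and far: "\<And>v b. (v, b) \<in> (\<Union>lam\<in>\<Lambda>. H lam) \<Longrightarrow> \<rho> \<le> \<bar>v \<bullet> x - b\<bar>"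
      and lam: "lam \<in> \<Lambda>"
    then obtain M where M: "prox_affine_near pen lam (\<rho> / K lam) x M" using HK[OF lam] by blast
    have "K lam \<le> (\<Sum>lam\<in>\<Lambda>. K lam)" using lam fin Kp by (intro member_le_sum) (auto simp: less_imp_le)
    then have "\<rho> / K' \<le> \<rho> / K lam" using \<rho> Kp[OF lam] by (intro divide_left_mono) (auto simp: K'_def)
    then show "\<exists>M. prox_affine_near pen lam (\<rho> / K') x M"
      using M unfolding prox_affine_near_def by (meson less_le_trans)
  qed (rule K')
qed

subsection \<open>Expansion of the cross-validation criterion\<close>

lemma sum_abs_mult_le:
  fixes a b :: "'i \<Rightarrow> real"
  assumes "(\<Sum>i\<in>I. (a i)\<^sup>2) \<le> A" "(\<Sum>i\<in>I. (b i)\<^sup>2) \<le> B"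
  shows "(\<Sum>i\<in>I. \<bar>a i\<bar> * \<bar>b i\<bar>) \<le> sqrt A * sqrt B"
proof -
  have "(\<Sum>i\<in>I. \<bar>a i\<bar> * \<bar>b i\<bar>) \<le> L2_set a I * L2_set b I" by (rule L2_set_mult_ineq)
  also have "\<dots> \<le> sqrt A * sqrt B"
    unfolding L2_set_def using assms by (intro mult_mono) (auto simp: sum_nonneg real_sqrt_ge_zero
      order_trans[OF sum_nonneg assms(1)])
  finally show ?thesis .
qed

lemma gradient_mvt:
  fixes f :: "'a::real_inner \<Rightarrow> real"
  assumes "\<And>x. (f has_derivative (\<lambda>v. g x \<bullet> v)) (at x)"
  obtains s where "0 < s" "s < 1" "f y - f x = g (x + s *\<^sub>R (y - x)) \<bullet> (y - x)"
proof -
  have d: "((\<lambda>s. f (x + s *\<^sub>R (y - x))) has_real_derivative g (x + s *\<^sub>R (y - x)) \<bullet> (y - x)) (at s)" for s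
  proof -
    have "((\<lambda>s::real. x + s *\<^sub>R (y - x)) has_derivative (\<lambda>s. s *\<^sub>R (y - x))) (at s)"
      by (auto intro!: derivative_eq_intros)
    from has_derivative_compose[OF this assms]
    show ?thesis unfolding has_field_derivative_def
      by (rule has_derivative_eq_rhs) (auto simp: fun_eq_iff)
  qed
  obtain s :: real where "0 < s" "s < 1" "f (x + 1 *\<^sub>R (y - x)) - f (x + 0 *\<^sub>R (y - x)) =
      (1 - 0) * (g (x + s *\<^sub>R (y - x)) \<bullet> (y - x))"
    using MVT2[OF zero_less_one, of "\<lambda>s. f (x + s *\<^sub>R (y - x))"
        "\<lambda>s. g (x + s *\<^sub>R (y - x)) \<bullet> (y - x)"] d by blast
  then show ?thesis by (intro that[of s]) auto
qed

lemma norm_segment_le: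
  fixes x y :: "'a::real_normed_vector"
  assumes "norm x \<le> R" "norm y \<le> R" "0 < s" "s < (1::real)"
  shows "norm (x + s *\<^sub>R (y - x)) \<le> R"
proof -
  have "x + s *\<^sub>R (y - x) = (1 - s) *\<^sub>R x + s *\<^sub>R y" by (simp add: algebra_simps)
  also have "norm \<dots> \<le> (1 - s) * R + s * R"
    using assms by (intro order_trans[OF norm_triangle_ineq] add_mono) (auto intro!: mult_left_mono)
  finally show ?thesis by (simp add: algebra_simps)
qed

text \<open>The mean value theorem costs a factor 2 against the sharp remainder but needs the
  Lipschitz bound only between \<open>x\<close> and points of the ball.\<close>

lemma taylor_first_order:
  fixes f :: "'a::real_inner \<Rightarrow> real"
  assumes d: "\<And>x. (f has_derivative (\<lambda>v. g x \<bullet> v)) (at x)"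
    and lip: "\<And>z. norm z \<le> R \<Longrightarrow> norm (g z - g x) \<le> w * norm (z - x)"
    and R: "norm x \<le> R" "norm y \<le> R"
  shows "\<bar>f y - f x - g x \<bullet> (y - x)\<bar> \<le> w * (norm (y - x))\<^sup>2"
proof -
  obtain s where s: "0 < s" "s < 1" "f y - f x = g (x + s *\<^sub>R (y - x)) \<bullet> (y - x)"
    using gradient_mvt[OF d] by blast
  let ?z = "x + s *\<^sub>R (y - x)"
  have lz: "norm (g ?z - g x) \<le> w * norm (?z - x)" using norm_segment_le[OF R s(1,2)] lip by blast
  show ?thesis
  proof (cases "y = x")
    case False
    have "0 \<le> w * norm (?z - x)" using norm_ge_zero lz by (rule order_trans)
    moreover have "norm (?z - x) > 0" using False s by simp
    ultimately have w: "w \<ge> 0" by (metis mult.commute zero_le_mult_iff not_le)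
    have "\<bar>f y - f x - g x \<bullet> (y - x)\<bar> = \<bar>(g ?z - g x) \<bullet> (y - x)\<bar>" by (simp add: s(3) inner_diff_left)
    also have "\<dots> \<le> norm (g ?z - g x) * norm (y - x)" by (rule Cauchy_Schwarz_ineq2)
    also have "\<dots> \<le> (w * norm (?z - x)) * norm (y - x)" using lz by (intro mult_right_mono) auto
    also have "\<dots> = (w * s) * (norm (y - x) * norm (y - x))" using s by simp
    also have "\<dots> \<le> w * (norm (y - x) * norm (y - x))"
      using s w by (intro mult_right_mono) (auto simp: mult_left_le)
    finally show ?thesis by (simp add: power2_eq_square)
  qed simp
qed

lemma trace_mult: "trace (M ** S) = (\<Sum>a\<in>UNIV. \<Sum>b\<in>UNIV. M $ a $ b * S $ b $ a)"
  for M S :: "real^'k^'k"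
  by (simp add: trace_def matrix_matrix_mult_def)

text \<open>Entries of a contraction have size at most one, so each entry of the second moment
  matrix contributes at most \<tau>.\<close>

lemma sum_quadratic_form_trace:
  fixes M S :: "real^'k^'k" and g :: "'i \<Rightarrow> real^'k"
  assumes M: "\<And>v. norm (M *v v) \<le> norm v"
    and S: "\<And>a b. \<bar>(\<Sum>i\<in>I. g i $ a * g i $ b) - S $ a $ b\<bar> \<le> \<tau>"
  shows "\<bar>(\<Sum>i\<in>I. g i \<bullet> (M *v g i)) - trace (M ** S)\<bar> \<le> (real CARD('k))\<^sup>2 * \<tau>"
proof -
  have Mab: "\<bar>M $ a $ b\<bar> \<le> 1" for a b
  proof -
    have "\<bar>(M *v axis b 1) $ a\<bar> \<le> norm (M *v axis b 1)" by (rule component_le_norm_cart)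
    also have "\<dots> \<le> 1" using M[of "axis b 1"] by simp
    finally show ?thesis by (simp add: matrix_vector_mult_basis column_def)
  qed
  have "g i \<bullet> (M *v g i) = (\<Sum>a\<in>UNIV. \<Sum>b\<in>UNIV. M $ a $ b * (g i $ b * g i $ a))" for i
    by (simp add: inner_vec_def matrix_vector_mult_def sum_distrib_left mult_ac)
  then have "(\<Sum>i\<in>I. g i \<bullet> (M *v g i)) = (\<Sum>i\<in>I. \<Sum>a\<in>UNIV. \<Sum>b\<in>UNIV. M $ a $ b * (g i $ b * g i $ a))"
    by simp
  also have "\<dots> = (\<Sum>a\<in>UNIV. \<Sum>i\<in>I. \<Sum>b\<in>UNIV. M $ a $ b * (g i $ b * g i $ a))"
    by (rule sum.swap)
  also have "\<dots> = (\<Sum>a\<in>UNIV. \<Sum>b\<in>UNIV. \<Sum>i\<in>I. M $ a $ b * (g i $ b * g i $ a))"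
    by (intro sum.cong refl sum.swap)
  finally have "(\<Sum>i\<in>I. g i \<bullet> (M *v g i)) - trace (M ** S) =
      (\<Sum>a\<in>UNIV. \<Sum>b\<in>UNIV. M $ a $ b * ((\<Sum>i\<in>I. g i $ b * g i $ a) - S $ b $ a))"
    by (simp add: trace_mult sum_distrib_left sum_subtractf right_diff_distrib)
  also have "\<bar>\<dots>\<bar> \<le> (\<Sum>a\<in>(UNIV::'k set). \<Sum>b\<in>(UNIV::'k set). \<tau>)"
  proof (intro order_trans[OF sum_abs] sum_mono)
    fix a b
    show "\<bar>M $ a $ b * ((\<Sum>i\<in>I. g i $ b * g i $ a) - S $ b $ a)\<bar> \<le> \<tau>"
      using mult_mono[OF Mab[of a b] S[of b a]] by (simp add: abs_mult)
  qed
  also have "\<dots> = (real CARD('k))\<^sup>2 * \<tau>" by (simp add: power2_eq_square)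
  finally show ?thesis .
qed

text \<open>Sum of the coefficients of \<tau> in the estimates \<open>cv1\<close> to
  \<open>cv6\<close> below; \<open>D\<close> bounds the sum of the squared displacements of the
  leave-one-out minimizers.\<close>

definition cv_const :: "nat \<Rightarrow> real \<Rightarrow> real \<Rightarrow> real" where
  "cv_const k R K = (let D = 8 * (K + 4 * R\<^sup>2) in
     D + 8 * R\<^sup>2 + 2 * R * sqrt D + 2 * R * sqrt K + sqrt K * sqrt D + (real k)\<^sup>2)"

text \<open>The deterministic core. Here \<open>th\<close> stands for the full-sample minimizer,
  \<open>p\<close> for its proximal point, \<open>tf\<close> and \<open>ti i\<close> for the
  penalized minimizers on the full and the reduced samples, and \<open>t0\<close> for a fixed point
  where the gradients have known second moments. The single number \<tau> measures every deviation
  from the quadratic model, and the error is linear in it.\<close>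

lemma cv_expansion:
  fixes f :: "'i \<Rightarrow> real^'k \<Rightarrow> real" and gf :: "'i \<Rightarrow> real^'k \<Rightarrow> real^'k"
    and M S :: "real^'k^'k"
  assumes fin: "finite I"
    and d: "\<And>i x. i \<in> I \<Longrightarrow> (f i has_derivative (\<lambda>v. gf i x \<bullet> v)) (at x)"
    and w: "\<And>i x y. i \<in> I \<Longrightarrow> norm x \<le> R \<Longrightarrow> norm y \<le> R \<Longrightarrow> norm (gf i x - gf i y) \<le> w i * norm (x - y)"
    and w2: "\<And>i. i \<in> I \<Longrightarrow> w i \<ge> 0" "(\<Sum>i\<in>I. (w i)\<^sup>2) \<le> \<tau>\<^sup>2"
    and K: "(\<Sum>i\<in>I. (norm (gf i t0))\<^sup>2) \<le> K"
    and S: "\<And>a b. \<bar>(\<Sum>i\<in>I. gf i t0 $ a * gf i t0 $ b) - S $ a $ b\<bar> \<le> \<tau>"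
    and e: "\<And>x. e x = (\<Sum>i\<in>I. gf i x) - (x - th)"
    and elip: "\<And>x y. norm x \<le> R \<Longrightarrow> norm y \<le> R \<Longrightarrow> norm (e x - e y) \<le> \<tau> * norm (x - y)"
    and eth: "e th = 0"
    and R: "norm t0 \<le> R" "norm th \<le> R" "norm p \<le> R" "norm tf \<le> R" "\<And>i. i \<in> I \<Longrightarrow> norm (ti i) \<le> R"
    and M: "\<And>v. norm (M *v v) \<le> norm v"
    and tf: "tf - p = M *v (- e tf)"
    and ti: "\<And>i. i \<in> I \<Longrightarrow> ti i - p = M *v (gf i (ti i) - e (ti i))"
    and \<tau>: "0 \<le> \<tau>" "\<tau> \<le> 1/2"
  shows "\<bar>(\<Sum>i\<in>I. f i (ti i)) - ((\<Sum>i\<in>I. f i th) + trace S / 2)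
      - (1/2) * (trace S + (norm (p - th))\<^sup>2 + 2 * trace ((M - mat 1) ** S))\<bar>
      \<le> cv_const CARD('k) R K * \<tau>"
proof -
  define D where "D = 8 * (K + 4 * R\<^sup>2)"
  define g where "g i = gf i t0" for i
  define \<Delta> where "\<Delta> i = ti i - tf" for i
  have R0: "R \<ge> 0" using R(1) norm_ge_zero order_trans by blast
  have K0: "K \<ge> 0" using K by (meson order_trans sum_nonneg zero_le_power2)
  have dist: "norm (x - y) \<le> 2 * R" if "norm x \<le> R" "norm y \<le> R" for x y :: "real^'k"
    using that norm_triangle_ineq4[of x y] by linarith
  have \<tau>2: "\<tau>\<^sup>2 \<le> 1" using \<tau> by (simp add: abs_square_le_1)
  have wi: "w i \<le> \<tau>" if "i \<in> I" for i
  proof -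
    have "(w i)\<^sup>2 \<le> (\<Sum>i\<in>I. (w i)\<^sup>2)" using that fin by (intro member_le_sum) auto
    then have "(w i)\<^sup>2 \<le> \<tau>\<^sup>2" using w2 by linarith
    then show ?thesis using \<tau> by (simp add: power2_le_iff_abs_le)
  qed
  have gfg: "norm (gf i x - g i) \<le> 2 * R * w i" if "i \<in> I" "norm x \<le> R" for i x
  proof -
    have "norm (gf i x - g i) \<le> w i * norm (x - t0)" using w that R by (simp add: g_def)
    also have "\<dots> \<le> w i * (2 * R)" using w2(1) dist that R by (intro mult_left_mono) auto
    finally show ?thesis by (simp add: mult_ac)
  qed
  \<comment> \<open>The difference of the two equations is \<open>M\<close> applied to the gradient
    of the removed loss, up to the change of \<open>e\<close> between the two minimizers.\<close>
  have \<Delta>M: "\<Delta> i = M *v (gf i (ti i) - (e (ti i) - e tf))" if "i \<in> I" for i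
  proof -
    have "\<Delta> i = (ti i - p) - (tf - p)" by (simp add: \<Delta>_def)
    also have "\<dots> = M *v (gf i (ti i) - e (ti i) + e tf)"
      unfolding tf ti[OF that] by (simp add: matrix_vector_mult_diff_distrib[symmetric])
    finally show ?thesis by (simp add: algebra_simps)
  qed
  have elip': "norm (e (ti i) - e tf) \<le> \<tau> * norm (\<Delta> i)" if "i \<in> I" for i
    using elip R that by (simp add: \<Delta>_def)
  \<comment> \<open>The displacement reappears on the right through \<open>e\<close>; since
    \<open>\<tau> \<le> 1/2\<close> it can be absorbed, which yields the factor 2.\<close>
  have \<Delta>le: "norm (\<Delta> i) \<le> 2 * (norm (g i) + 2 * R * w i)" if i: "i \<in> I" for i
  proof -
    have "norm (\<Delta> i) \<le> norm (gf i (ti i) - (e (ti i) - e tf))" by (simp add: \<Delta>M[OF i] M)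
    also have "\<dots> \<le> norm (gf i (ti i)) + \<tau> * norm (\<Delta> i)"
      using norm_triangle_ineq4 elip'[OF i] by (metis add_left_mono order_trans)
    also have "norm (gf i (ti i)) \<le> norm (g i) + 2 * R * w i"
      using gfg[OF i R(5)[OF i]] norm_triangle_sub[of "gf i (ti i)" "g i"] by linarith
    also have "\<tau> * norm (\<Delta> i) \<le> 1/2 * norm (\<Delta> i)" using \<tau> by (intro mult_right_mono) auto
    finally show ?thesis by simp
  qed
  \<comment> \<open>The 8 is the square of that factor times the 2 from
    \<open>(a + b)^2 \<le> 2 * (a^2 + b^2)\<close>.\<close>
  have \<Delta>2: "(\<Sum>i\<in>I. (norm (\<Delta> i))\<^sup>2) \<le> D"
  proof -
    have "(norm (\<Delta> i))\<^sup>2 \<le> 8 * ((norm (g i))\<^sup>2 + 4 * R\<^sup>2 * (w i)\<^sup>2)" if "i \<in> I" for i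
    proof -
      have "(norm (\<Delta> i))\<^sup>2 \<le> (2 * (norm (g i) + 2 * R * w i))\<^sup>2"
        using \<Delta>le[OF that] by (intro power_mono) auto
      also have "\<dots> \<le> 8 * ((norm (g i))\<^sup>2 + (2 * R * w i)\<^sup>2)"
        using sum_squares_bound[of "norm (g i)" "2 * R * w i"] by (simp add: power2_eq_square algebra_simps)
      finally show ?thesis by (simp add: power_mult_distrib)
    qed
    then have "(\<Sum>i\<in>I. (norm (\<Delta> i))\<^sup>2) \<le> (\<Sum>i\<in>I. 8 * ((norm (g i))\<^sup>2 + 4 * R\<^sup>2 * (w i)\<^sup>2))"
      by (rule sum_mono)
    also have "\<dots> = 8 * ((\<Sum>i\<in>I. (norm (g i))\<^sup>2) + 4 * R\<^sup>2 * (\<Sum>i\<in>I. (w i)\<^sup>2))"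
      by (simp add: sum.distrib sum_distrib_left distrib_left)
    also have "\<dots> \<le> 8 * (K + 4 * R\<^sup>2 * 1)"
      using K w2(2) \<tau>2 by (intro mult_left_mono add_mono) (auto simp: g_def)
    finally show ?thesis by (simp add: D_def)
  qed
  have n2: "(\<Sum>i\<in>I. (norm (g i))\<^sup>2) \<le> K" using K by (simp add: g_def)
  have sq: "sqrt (\<tau>\<^sup>2) = \<tau>" using \<tau> by simp
  have wD: "(\<Sum>i\<in>I. w i * norm (\<Delta> i)) \<le> \<tau> * sqrt D"
    using sum_abs_mult_le[OF w2(2) \<Delta>2] w2(1) \<tau> by (simp add: sq)
  have gD: "(\<Sum>i\<in>I. norm (g i) * norm (\<Delta> i)) \<le> sqrt K * sqrt D"
    using sum_abs_mult_le[OF n2 \<Delta>2] by simp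
  have gw: "(\<Sum>i\<in>I. norm (g i) * w i) \<le> sqrt K * \<tau>"
    using sum_abs_mult_le[OF n2 w2(2)] w2(1) \<tau> by (simp add: sq)

  \<comment> \<open>All losses are expanded at the common point \<open>tf\<close>; each remainder is
    at most \<open>w i \<le> \<tau>\<close> times a squared displacement, and those are
    summable.\<close>
  have cv1: "\<bar>(\<Sum>i\<in>I. f i (ti i)) - (\<Sum>i\<in>I. f i tf) - (\<Sum>i\<in>I. gf i tf \<bullet> \<Delta> i)\<bar> \<le> D * \<tau>"
  proof -
    have "\<bar>f i (ti i) - f i tf - gf i tf \<bullet> \<Delta> i\<bar> \<le> \<tau> * (norm (\<Delta> i))\<^sup>2" if i: "i \<in> I" for i
    proof -
      have "\<bar>f i (ti i) - f i tf - gf i tf \<bullet> \<Delta> i\<bar> \<le> w i * (norm (\<Delta> i))\<^sup>2"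
        unfolding \<Delta>_def using R i by (intro taylor_first_order[where R = R] d w) auto
      also have "\<dots> \<le> \<tau> * (norm (\<Delta> i))\<^sup>2" using wi[OF i] by (intro mult_right_mono) auto
      finally show ?thesis .
    qed
    then have "\<bar>\<Sum>i\<in>I. f i (ti i) - f i tf - gf i tf \<bullet> \<Delta> i\<bar> \<le> (\<Sum>i\<in>I. \<tau> * (norm (\<Delta> i))\<^sup>2)"
      by (intro order_trans[OF sum_abs] sum_mono)
    also have "\<dots> \<le> \<tau> * D" using \<Delta>2 \<tau> by (simp add: mult_left_mono flip: sum_distrib_left)
    finally show ?thesis by (simp add: sum_subtractf mult.commute)
  qed

  \<comment> \<open>The total loss minus the ideal quadratic has gradient \<open>e\<close>, which
    vanishes at \<open>th\<close>; hence the increase from \<open>th\<close> to \<open>tf\<close> is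
    half the squared distance up to order \<tau>.\<close>
  have dL: "((\<lambda>x. (\<Sum>i\<in>I. f i x) - 1/2 * (norm (x - th))\<^sup>2) has_derivative (\<lambda>v. e x \<bullet> v)) (at x)" for x
  proof -
    have "((\<lambda>x. (\<Sum>i\<in>I. f i x) - 1/2 * ((x - th) \<bullet> (x - th))) has_derivative
        (\<lambda>v. (\<Sum>i\<in>I. gf i x \<bullet> v) - 1/2 * ((x - th) \<bullet> v + v \<bullet> (x - th)))) (at x)"
      using d by (auto intro!: derivative_eq_intros)
    then show ?thesis
      unfolding power2_norm_eq_inner
      by (rule has_derivative_eq_rhs)
        (simp add: fun_eq_iff e inner_diff_left inner_diff_right inner_sum_left inner_sum_right
          inner_commute diff_divide_distrib)
  qed
  have cv2: "\<bar>(\<Sum>i\<in>I. f i tf) - (\<Sum>i\<in>I. f i th) - 1/2 * (norm (tf - th))\<^sup>2\<bar> \<le> 4 * R\<^sup>2 * \<tau>"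
  proof -
    have "\<bar>((\<Sum>i\<in>I. f i tf) - 1/2 * (norm (tf - th))\<^sup>2) - ((\<Sum>i\<in>I. f i th) - 1/2 * (norm (th - th))\<^sup>2) - e th \<bullet> (tf - th)\<bar>
        \<le> \<tau> * (norm (tf - th))\<^sup>2"
      using R by (intro taylor_first_order[where R = R] dL elip) auto
    also have "\<dots> \<le> \<tau> * (2 * R)\<^sup>2" using \<tau> dist R by (intro mult_left_mono power_mono) auto
    finally show ?thesis by (simp add: eth algebra_simps)
  qed

  have etl: "norm (e tf) \<le> 2 * R * \<tau>"
  proof -
    have "norm (e tf - e th) \<le> \<tau> * norm (tf - th)" using elip R by simp
    also have "\<dots> \<le> \<tau> * (2 * R)" using \<tau> dist R by (intro mult_left_mono) auto
    finally show ?thesis by (simp add: eth mult_ac)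
  qed
  have cv3: "\<bar>1/2 * (norm (tf - th))\<^sup>2 - 1/2 * (norm (p - th))\<^sup>2\<bar> \<le> 4 * R\<^sup>2 * \<tau>"
  proof -
    have "norm (tf - p) \<le> 2 * R * \<tau>" unfolding tf using M[of "- e tf"] etl by simp
    then have a: "\<bar>norm (tf - th) - norm (p - th)\<bar> \<le> 2 * R * \<tau>"
      using norm_triangle_ineq3[of "tf - th" "p - th"] by simp
    have b: "\<bar>norm (tf - th) + norm (p - th)\<bar> \<le> 4 * R"
      using dist[of tf th] dist[of p th] R by simp
    have "\<bar>1/2 * (norm (tf - th))\<^sup>2 - 1/2 * (norm (p - th))\<^sup>2\<bar>
        = 1/2 * (\<bar>norm (tf - th) - norm (p - th)\<bar> * \<bar>norm (tf - th) + norm (p - th)\<bar>)"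
    proof -
      have "1/2 * a\<^sup>2 - 1/2 * b\<^sup>2 = 1/2 * ((a - b) * (a + b))" for a b :: real
        by (simp add: power2_eq_square algebra_simps)
      then show ?thesis by (simp only: abs_mult)
    qed
    also have "\<dots> \<le> 1/2 * ((2 * R * \<tau>) * (4 * R))" using a b R0 \<tau> by (intro mult_left_mono mult_mono) auto
    finally show ?thesis by (simp add: power2_eq_square algebra_simps)
  qed

  have cv4: "\<bar>(\<Sum>i\<in>I. gf i tf \<bullet> \<Delta> i) - (\<Sum>i\<in>I. g i \<bullet> \<Delta> i)\<bar> \<le> 2 * R * sqrt D * \<tau>"
  proof -
    have "\<bar>(gf i tf - g i) \<bullet> \<Delta> i\<bar> \<le> 2 * R * (w i * norm (\<Delta> i))" if "i \<in> I" for i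
    proof -
      have "\<bar>(gf i tf - g i) \<bullet> \<Delta> i\<bar> \<le> norm (gf i tf - g i) * norm (\<Delta> i)" by (rule Cauchy_Schwarz_ineq2)
      also have "\<dots> \<le> 2 * R * w i * norm (\<Delta> i)" using gfg[OF that R(4)] by (intro mult_right_mono) auto
      finally show ?thesis by (simp add: mult_ac)
    qed
    then have "\<bar>\<Sum>i\<in>I. (gf i tf - g i) \<bullet> \<Delta> i\<bar> \<le> (\<Sum>i\<in>I. 2 * R * (w i * norm (\<Delta> i)))"
      by (intro order_trans[OF sum_abs] sum_mono)
    also have "\<dots> \<le> 2 * R * (\<tau> * sqrt D)" using wD R0 by (simp add: mult_left_mono flip: sum_distrib_left)
    finally show ?thesis by (simp add: inner_diff_left sum_subtractf mult_ac)
  qed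

  \<comment> \<open>Replaces each displacement by \<open>M\<close> times the gradient. The errors
    are summed by Cauchy-Schwarz over the sample: gradients and displacements have bounded square
    sums, the Lipschitz constants one of size \<open>\<tau>^2\<close>.\<close>
  have cv5: "\<bar>(\<Sum>i\<in>I. g i \<bullet> \<Delta> i) - (\<Sum>i\<in>I. g i \<bullet> (M *v g i))\<bar> \<le> (2 * R * sqrt K + sqrt K * sqrt D) * \<tau>"
  proof -
    have "\<bar>g i \<bullet> (\<Delta> i - M *v g i)\<bar> \<le> 2 * R * (norm (g i) * w i) + \<tau> * (norm (g i) * norm (\<Delta> i))"
      if i: "i \<in> I" for i
    proof -
      have "\<Delta> i - M *v g i = M *v ((gf i (ti i) - g i) - (e (ti i) - e tf))"
        by (simp add: \<Delta>M[OF i] flip: matrix_vector_mult_diff_distrib) (simp add: algebra_simps)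
      then have "norm (\<Delta> i - M *v g i) \<le> norm ((gf i (ti i) - g i) - (e (ti i) - e tf))" using M by simp
      also have "\<dots> \<le> 2 * R * w i + \<tau> * norm (\<Delta> i)"
        using norm_triangle_ineq4[of "gf i (ti i) - g i" "e (ti i) - e tf"] gfg[OF i R(5)[OF i]] elip'[OF i]
        by linarith
      finally have "norm (g i) * norm (\<Delta> i - M *v g i) \<le> norm (g i) * (2 * R * w i + \<tau> * norm (\<Delta> i))"
        by (intro mult_left_mono) auto
      then show ?thesis using Cauchy_Schwarz_ineq2[of "g i" "\<Delta> i - M *v g i"] by (simp add: algebra_simps)
    qed
    then have "\<bar>\<Sum>i\<in>I. g i \<bullet> (\<Delta> i - M *v g i)\<bar> \<le>
        (\<Sum>i\<in>I. 2 * R * (norm (g i) * w i) + \<tau> * (norm (g i) * norm (\<Delta> i)))"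
      by (intro order_trans[OF sum_abs] sum_mono)
    also have "\<dots> \<le> 2 * R * (sqrt K * \<tau>) + \<tau> * (sqrt K * sqrt D)"
      using gD gw R0 \<tau> by (simp add: sum.distrib add_mono mult_left_mono flip: sum_distrib_left)
    finally show ?thesis by (simp add: inner_diff_right sum_subtractf algebra_simps)
  qed

  have cv6: "\<bar>(\<Sum>i\<in>I. g i \<bullet> (M *v g i)) - trace (M ** S)\<bar> \<le> (real CARD('k))\<^sup>2 * \<tau>"
    using M S unfolding g_def by (rule sum_quadratic_form_trace)

  have tr: "trace ((M - mat 1) ** S) = trace (M ** S) - trace S"
  proof -
    have "trace ((M - mat 1) ** S) = trace (M ** S) - trace (mat 1 ** S)"
      by (simp add: trace_mult left_diff_distrib sum_subtractf del: matrix_mul_lid)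
    then show ?thesis by simp
  qed
  have "cv_const CARD('k) R K * \<tau> = D * \<tau> + 4 * R\<^sup>2 * \<tau> + 4 * R\<^sup>2 * \<tau> + 2 * R * sqrt D * \<tau> +
      (2 * R * sqrt K + sqrt K * sqrt D) * \<tau> + (real CARD('k))\<^sup>2 * \<tau>"
    by (simp add: cv_const_def Let_def D_def algebra_simps)
  then show ?thesis using cv1 cv2 cv3 cv4 cv5 cv6 unfolding tr by argo
qed

section \<open>A priori bounds for penalized minimizers and the passage to proximal points\<close>

lemma minimizer_bounded:
  fixes G :: "'a::euclidean_space"
  assumes low: "F t \<ge> F 0 + G \<bullet> t + c / 2 * (norm t)\<^sup>2" and "F t \<le> F 0" and c: "c > 0" and G: "norm G \<le> B"
  shows "norm t \<le> 2 / c * B"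
proof (cases "t = 0")
  case True
  have "B \<ge> 0" using G norm_ge_zero[of G] by linarith
  then show ?thesis using True c by simp
next
  case False
  have "c / 2 * (norm t)\<^sup>2 \<le> norm G * norm t"
    using low assms(2) Cauchy_Schwarz_ineq2[of G t] by (auto simp: abs_le_iff)
  then have "c / 2 * norm t \<le> norm G" using False by (simp add: power2_eq_square)
  then show ?thesis using c G by (simp add: field_simps)
qed

definition penalized :: "(real^'k \<Rightarrow> real) \<Rightarrow> ennreal \<Rightarrow> (real^'k \<Rightarrow> real) \<Rightarrow> real^'k" where
  "penalized pen lam F = (if lam = \<infinity> then 0 else arg_min (\<lambda>t. F t + enn2real lam * pen t) (\<lambda>_. True))"

text \<open>Comparison with zero, where the penalty vanishes, gives \<open>F t \<le> F 0\<close>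
  whatever \<open>lam\<close> is, hence a bound uniform in \<open>lam\<close>. Stationarity says
  that \<open>t\<close> is the proximal point of its own gradient step.\<close>

lemma penalized_is_prox:
  fixes F :: "real^'k \<Rightarrow> real" and lam :: ennreal
  assumes pen: "penalty pen" and c: "c > 0"
    and d: "\<And>x. (F has_derivative (\<lambda>v. gF x \<bullet> v)) (at x)"
    and low: "\<And>x. F x \<ge> F 0 + gF 0 \<bullet> x + c / 2 * (norm x)\<^sup>2"
    and B: "norm (gF 0) \<le> B"
  defines "t \<equiv> penalized pen lam F"
  shows "norm t \<le> 2 / c * B" "prox pen lam (t - gF t) = t"
proof -
  have "norm t \<le> 2 / c * B \<and> prox pen lam (t - gF t) = t"
  proof (cases "lam = \<infinity>")
    case True
    have "B \<ge> 0" using B norm_ge_zero[of "gF 0"] by linarith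
    then show ?thesis using True c by (simp add: t_def penalized_def)
  next
    case False
    let ?H = "\<lambda>t. F t + enn2real lam * pen t"
    have p: "convex_on UNIV pen" "continuous_on UNIV pen" "\<And>x. pen x \<ge> 0" "pen 0 = 0"
      using pen by (auto simp: penalty_def)
    have "continuous_on UNIV F"
      using d by (meson continuous_at_imp_continuous_on has_derivative_continuous)
    then have "continuous_on UNIV ?H" by (intro continuous_intros p)
    moreover have "?H x \<ge> F 0 + gF 0 \<bullet> x + c / 2 * (norm x)\<^sup>2" for x
      using low[of x] p(3)[of x] by (simp add: add_increasing2)
    ultimately have "\<exists>t. \<forall>u. ?H t \<le> ?H u" using c by (intro coercive_attains_minimum) auto
    from arg_min_le[OF this] have min: "?H t \<le> ?H u" for u
      using False by (simp add: t_def penalized_def)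
    have "0 \<le> enn2real lam * pen t" using p(3)[of t] by simp
    then have "F t \<le> F 0" using min[of 0] p(4) by simp
    then have "norm t \<le> 2 / c * B" using low c B by (intro minimizer_bounded) auto
    moreover have "is_prox (\<lambda>t. enn2real lam * pen t) (t - gF t) t"
      using p(1) d min by (intro is_prox_if_minimizer[where F = F] convex_on_cmul) auto
    ultimately show ?thesis using prox_eqI[OF pen False] by blast
  qed
  then show "norm t \<le> 2 / c * B" "prox pen lam (t - gF t) = t" by auto
qed

text \<open>The norm bound that puts all estimators into one ball.\<close>

definition estimator_radius :: "real \<Rightarrow> real \<Rightarrow> real" where
  "estimator_radius c R0 = R0 + 2 / c * (3 * R0 + 1)"

text \<open>Supplies the geometric hypotheses of \<open>cv_expansion\<close>: quadratic lower bounds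
  put all minimizers into one ball, and there the arguments of the proximal map stay within \<rho>
  of \<open>th\<close> because \<open>\<tau> * (1 + 4 * R) < \<rho>\<close>.\<close>

lemma cv_close_to_sure:
  fixes f :: "'i \<Rightarrow> real^'k \<Rightarrow> real" and gf :: "'i \<Rightarrow> real^'k \<Rightarrow> real^'k" and S :: "real^'k^'k"
  assumes fin: "finite I" and pen: "penalty pen"
    and c: "c > 0" and \<tau>: "0 \<le> \<tau>" "\<tau> \<le> 1/2" "\<tau> * (1 + 4 * R) < \<rho>"
    and R: "R = estimator_radius c R0"
    and d: "\<And>i x. i \<in> I \<Longrightarrow> (f i has_derivative (\<lambda>v. gf i x \<bullet> v)) (at x)"
    and w: "\<And>i x y. i \<in> I \<Longrightarrow> norm x \<le> R \<Longrightarrow> norm y \<le> R \<Longrightarrow> norm (gf i x - gf i y) \<le> w i * norm (x - y)"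
    and w2: "\<And>i. i \<in> I \<Longrightarrow> w i \<ge> 0" "(\<Sum>i\<in>I. (w i)\<^sup>2) \<le> \<tau>\<^sup>2"
    and K: "(\<Sum>i\<in>I. (norm (gf i t0))\<^sup>2) \<le> K" and g: "\<And>i. i \<in> I \<Longrightarrow> norm (gf i t0) \<le> \<tau>"
    and S: "\<And>a b. \<bar>(\<Sum>i\<in>I. gf i t0 $ a * gf i t0 $ b) - S $ a $ b\<bar> \<le> \<tau>"
    and lip: "\<And>x y. norm x \<le> R \<Longrightarrow> norm y \<le> R \<Longrightarrow>
       norm (((\<Sum>i\<in>I. gf i x) - x) - ((\<Sum>i\<in>I. gf i y) - y)) \<le> \<tau> * norm (x - y)"
    and crit: "(\<Sum>i\<in>I. gf i th) = 0"
    and R0: "norm t0 \<le> R0" "norm th \<le> R0"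
    and low: "\<And>x. (\<Sum>i\<in>I. f i x) \<ge> (\<Sum>i\<in>I. f i 0) + (\<Sum>i\<in>I. gf i 0) \<bullet> x + c / 2 * (norm x)\<^sup>2"
    and lowi: "\<And>i x. i \<in> I \<Longrightarrow> (\<Sum>j\<in>I - {i}. f j x) \<ge>
       (\<Sum>j\<in>I - {i}. f j 0) + (\<Sum>j\<in>I - {i}. gf j 0) \<bullet> x + c / 2 * (norm x)\<^sup>2"
    and aff: "prox_affine_near pen lam \<rho> th M"
  shows "\<bar>(\<Sum>i\<in>I. f i (penalized pen lam (\<lambda>t. \<Sum>j\<in>I - {i}. f j t)))
      - ((\<Sum>i\<in>I. f i th) + trace S / 2) - SURE pen lam th S\<bar> \<le> cv_const CARD('k) R K * \<tau>"
proof -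
  define e where "e x = (\<Sum>i\<in>I. gf i x) - (x - th)" for x
  define tf where "tf = penalized pen lam (\<lambda>t. \<Sum>i\<in>I. f i t)"
  define ti where "ti i = penalized pen lam (\<lambda>t. \<Sum>j\<in>I - {i}. f j t)" for i
  define p where "p = prox pen lam th"
  have R0': "R0 \<ge> 0" using R0(1) norm_ge_zero order_trans by blast
  have RR0: "R0 \<le> R" "2 / c * (3 * R0 + 1) \<le> R" using R c R0' by (auto simp: estimator_radius_def)
  have Rp: "R \<ge> 0" using RR0 R0' by simp
  have \<rho>: "\<rho> > 0" using \<tau> Rp by (smt (verit) mult_nonneg_nonneg)
  have elip: "norm (e x - e y) \<le> \<tau> * norm (x - y)" if "norm x \<le> R" "norm y \<le> R" for x y
    using lip[OF that] by (simp add: e_def algebra_simps)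
  have eth: "e th = 0" by (simp add: e_def crit)
  have thR: "norm th \<le> R" "norm t0 \<le> R" using R0 RR0 by auto
  have e0: "norm (e x) \<le> \<tau> * (norm x + R0)" if "norm x \<le> R" for x
  proof -
    have "norm (e x) \<le> \<tau> * norm (x - th)" using elip[OF that thR(1)] eth by simp
    also have "\<dots> \<le> \<tau> * (norm x + R0)"
      using \<tau> R0 norm_triangle_ineq4[of x th] by (intro mult_left_mono) auto
    finally show ?thesis .
  qed
  have wi: "w i \<le> \<tau>" if "i \<in> I" for i
  proof -
    have "(w i)\<^sup>2 \<le> (\<Sum>i\<in>I. (w i)\<^sup>2)" using that fin by (intro member_le_sum) auto
    then have "(w i)\<^sup>2 \<le> \<tau>\<^sup>2" using w2 by linarith
    then show ?thesis using \<tau> by (simp add: power2_le_iff_abs_le)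
  qed
  have gfi: "norm (gf i x) \<le> \<tau> * (1 + norm x + R0)" if "i \<in> I" "norm x \<le> R" for i x
  proof -
    have "norm (gf i x - gf i t0) \<le> w i * norm (x - t0)" using w that thR by simp
    also have "\<dots> \<le> \<tau> * (norm x + R0)"
      using wi[OF that(1)] w2(1)[OF that(1)] \<tau> R0 norm_triangle_ineq4[of x t0] by (intro mult_mono) auto
    finally have "norm (gf i x - gf i t0) \<le> \<tau> * (norm x + R0)" .
    then show ?thesis
      using g[OF that(1)] norm_triangle_sub[of "gf i x" "gf i t0"] by (simp add: algebra_simps)
  qed
  have \<tau>1: "\<tau> * R0 \<le> R0" using \<tau> R0' by (simp add: mult_left_le_one_le)
  have g0: "norm (\<Sum>i\<in>I. gf i 0) \<le> 2 * R0"
  proof -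
    have "(\<Sum>i\<in>I. gf i 0) = e 0 - th" by (simp add: e_def)
    then have "norm (\<Sum>i\<in>I. gf i 0) \<le> norm (e 0) + norm th" by (simp add: norm_triangle_ineq4)
    also have "\<dots> \<le> 2 * R0" using e0[of 0] Rp R0 \<tau>1 by simp
    finally show ?thesis .
  qed
  \<comment> \<open>Origin of the constant in \<open>estimator_radius\<close>: \<open>2 * R0\<close>
    from the full sample and at most \<open>1 + R0\<close> from the removed loss.\<close>
  have gi0: "norm (\<Sum>j\<in>I - {i}. gf j 0) \<le> 3 * R0 + 1" if i: "i \<in> I" for i
  proof -
    have "(\<Sum>j\<in>I - {i}. gf j 0) = (\<Sum>i\<in>I. gf i 0) - gf i 0"
      using fin i by (simp add: sum_diff1)
    then have "norm (\<Sum>j\<in>I - {i}. gf j 0) \<le> norm (\<Sum>i\<in>I. gf i 0) + norm (gf i 0)"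
      by (simp add: norm_triangle_ineq4)
    also have "\<dots> \<le> 2 * R0 + \<tau> * (1 + R0)" using gfi[OF i, of 0] Rp g0 by simp
    also have "\<dots> \<le> 3 * R0 + 1" using \<tau> \<tau>1 by (simp add: distrib_left)
    finally show ?thesis .
  qed
  have dsum: "((\<lambda>x. \<Sum>j\<in>J. f j x) has_derivative (\<lambda>v. (\<Sum>j\<in>J. gf j x) \<bullet> v)) (at x)" if "J \<subseteq> I" for J x
    unfolding inner_sum_left using d that by (intro has_derivative_sum) auto
  have TL: "norm tf \<le> R" "prox pen lam (tf - (\<Sum>i\<in>I. gf i tf)) = tf"
  proof -
    have g0': "norm (\<Sum>i\<in>I. gf i 0) \<le> 3 * R0 + 1" using g0 R0' by simp
    show "norm tf \<le> R"
      using penalized_is_prox(1)[OF pen c dsum[OF order_refl] low g0', of lam] RR0 unfolding tf_def by linarith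
    show "prox pen lam (tf - (\<Sum>i\<in>I. gf i tf)) = tf"
      using penalized_is_prox(2)[OF pen c dsum[OF order_refl] low g0', of lam] unfolding tf_def .
  qed
  have TI: "norm (ti i) \<le> R" "prox pen lam (ti i - (\<Sum>j\<in>I - {i}. gf j (ti i))) = ti i" if i: "i \<in> I" for i
  proof -
    show "norm (ti i) \<le> R"
      using penalized_is_prox(1)[OF pen c dsum[OF Diff_subset] lowi[OF i] gi0[OF i], of lam] RR0 unfolding ti_def by linarith
    show "prox pen lam (ti i - (\<Sum>j\<in>I - {i}. gf j (ti i))) = ti i"
      using penalized_is_prox(2)[OF pen c dsum[OF Diff_subset] lowi[OF i] gi0[OF i], of lam] unfolding ti_def .
  qed
  have aff': "prox pen lam (th + v) = p + M *v v" if "norm v < \<rho>" for v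
    using aff that unfolding prox_affine_near_def p_def by (metis add_diff_cancel_left')
  \<comment> \<open>The left side adds the bounds \<open>eb\<close> and \<open>gb\<close> below, for
    \<open>e\<close> and for one single gradient.\<close>
  have big: "\<tau> * (R + R0) + \<tau> * (1 + R + R0) < \<rho>"
  proof -
    have "\<tau> * (R + R0) + \<tau> * (1 + R + R0) = \<tau> * (1 + 2 * R + 2 * R0)" by (simp add: algebra_simps)
    also have "\<dots> \<le> \<tau> * (1 + 4 * R)" using \<tau> RR0 by (intro mult_left_mono) auto
    finally show ?thesis using \<tau> by simp
  qed
  have eb: "norm (e x) \<le> \<tau> * (R + R0)" if "norm x \<le> R" for x
  proof -
    have "\<tau> * (norm x + R0) \<le> \<tau> * (R + R0)" using \<tau> that by (intro mult_left_mono) auto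
    then show ?thesis using e0[OF that] by linarith
  qed
  have gb: "norm (gf i x) \<le> \<tau> * (1 + R + R0)" if "i \<in> I" "norm x \<le> R" for i x
  proof -
    have "\<tau> * (1 + norm x + R0) \<le> \<tau> * (1 + R + R0)" using \<tau> that by (intro mult_left_mono) auto
    then show ?thesis using gfi[OF that] by linarith
  qed
  have tfeq: "tf - p = M *v (- e tf)"
  proof -
    have "tf - (\<Sum>i\<in>I. gf i tf) = th + - e tf" by (simp add: e_def)
    moreover have "norm (- e tf) < \<rho>"
      using eb[OF TL(1)] big \<tau> Rp R0' by (smt (verit) mult_nonneg_nonneg norm_minus_cancel)
    ultimately have "tf = p + M *v (- e tf)" using aff'[of "- e tf"] TL(2) by simp
    then show ?thesis by (metis add_diff_cancel_left')
  qed
  have tieq: "ti i - p = M *v (gf i (ti i) - e (ti i))" if i: "i \<in> I" for i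
  proof -
    have "(\<Sum>j\<in>I - {i}. gf j (ti i)) = (\<Sum>j\<in>I. gf j (ti i)) - gf i (ti i)"
      using fin i by (simp add: sum_diff1)
    then have "ti i - (\<Sum>j\<in>I - {i}. gf j (ti i)) = th + (gf i (ti i) - e (ti i))" by (simp add: e_def)
    moreover have "norm (gf i (ti i) - e (ti i)) < \<rho>"
      using eb[OF TI(1)[OF i]] gb[OF i TI(1)[OF i]] big norm_triangle_ineq4[of "gf i (ti i)" "e (ti i)"] by linarith
    ultimately have "ti i = p + M *v (gf i (ti i) - e (ti i))"
      using aff'[of "gf i (ti i) - e (ti i)"] TI(2)[OF i] by simp
    then show ?thesis by (metis add_diff_cancel_left')
  qed
  have pR: "norm p \<le> R"
    using prox_nonexpansive[OF pen, of lam th 0] thR by (simp add: p_def prox_zero[OF pen])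
  have "\<bar>(\<Sum>i\<in>I. f i (ti i)) - ((\<Sum>i\<in>I. f i th) + trace S / 2)
      - (1/2) * (trace S + (norm (p - th))\<^sup>2 + 2 * trace ((M - mat 1) ** S))\<bar>
      \<le> cv_const CARD('k) R K * \<tau>"
    by (rule cv_expansion[OF fin d w w2 K S e_def elip eth thR(2,1) pR TL(1) TI(1)
          prox_affine_near_norm[OF pen aff \<rho>] tfeq tieq \<tau>(1,2)])
  then show ?thesis
    by (simp add: ti_def SURE_def prox_affine_near_deriv[OF aff \<rho>] p_def prox_def)
qed

subsection \<open>Events of high probability\<close>

text \<open>The probability \<epsilon> of failure stays explicit because stochastic boundedness
  comes with constants that depend on it; events free of such constants are expressed by
  \<open>hp\<close>.\<close>

definition whp :: "(nat \<Rightarrow> 'w measure) \<Rightarrow> real \<Rightarrow> (nat \<Rightarrow> 'w \<Rightarrow> bool) \<Rightarrow> bool" where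
  "whp P \<epsilon> Q \<longleftrightarrow> (\<forall>\<^sub>F n in sequentially. \<exists>E\<in>sets (P n).
     measure (P n) E \<ge> 1 - \<epsilon> \<and> (\<forall>\<omega>\<in>E. Q n \<omega>))"

definition hp :: "(nat \<Rightarrow> 'w measure) \<Rightarrow> (nat \<Rightarrow> 'w \<Rightarrow> bool) \<Rightarrow> bool" where
  "hp P Q \<longleftrightarrow> (\<forall>\<epsilon>>0. whp P \<epsilon> Q)"

lemma hp_whp: "hp P Q \<Longrightarrow> \<epsilon> > 0 \<Longrightarrow> whp P \<epsilon> Q"
  by (simp add: hp_def)

lemma whp_mono:
  assumes "whp P \<epsilon> Q" "\<epsilon> \<le> \<epsilon>'"
    and "\<forall>\<^sub>F n in sequentially. \<forall>\<omega>\<in>space (P n). Q n \<omega> \<longrightarrow> Q' n \<omega>"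
  shows "whp P \<epsilon>' Q'"
  using assms(1,3) unfolding whp_def
proof eventually_elim
  case (elim n)
  then obtain E where E: "E \<in> sets (P n)" "measure (P n) E \<ge> 1 - \<epsilon>" "\<forall>\<omega>\<in>E. Q n \<omega>" by blast
  then have "\<forall>\<omega>\<in>E. Q' n \<omega>" using elim(2) sets.sets_into_space[OF E(1)] by blast
  then show ?case using E assms(2) by (intro bexI[of _ E]) auto
qed

lemma hp_mono:
  assumes "hp P Q" "\<forall>\<^sub>F n in sequentially. \<forall>\<omega>\<in>space (P n). Q n \<omega> \<longrightarrow> Q' n \<omega>"
  shows "hp P Q'"
  using assms unfolding hp_def by (auto intro: whp_mono[OF _ order_refl])

section \<open>Combining events along a sequence of probability spaces\<close>

locale prob_sequence =
  fixes P :: "nat \<Rightarrow> 'w measure"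
  assumes prob: "n \<ge> 1 \<Longrightarrow> prob_space (P n)"
begin

lemma ev_prob: "\<forall>\<^sub>F n in sequentially. prob_space (P n)"
  using prob by (auto intro: eventually_sequentiallyI)

lemma whp_conj:
  assumes "whp P a Q" "whp P b Q'"
  shows "whp P (a + b) (\<lambda>n \<omega>. Q n \<omega> \<and> Q' n \<omega>)"
  using assms ev_prob unfolding whp_def
proof eventually_elim
  case (elim n)
  interpret prob_space "P n" by (rule elim)
  obtain E F where E: "E \<in> sets (P n)" "prob E \<ge> 1 - a" "\<forall>\<omega>\<in>E. Q n \<omega>"
    and F: "F \<in> sets (P n)" "prob F \<ge> 1 - b" "\<forall>\<omega>\<in>F. Q' n \<omega>" using elim by blast
  have "prob (E \<inter> F) = prob E + prob F - prob (E \<union> F)"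
    using E F measure_Un3[of E "P n" F] by (simp add: fmeasurable_def emeasure_eq_measure)
  also have "\<dots> \<ge> (1 - a) + (1 - b) - 1" using E F prob_le_1[of "E \<union> F"] by linarith
  finally show ?case using E F by (intro bexI[of _ "E \<inter> F"]) auto
qed

text \<open>An event whose probability tends to one costs arbitrarily little, so it fits into any
  strict slack between \<open>a\<close> and \<open>b\<close>.\<close>

lemma whp_hp_conj:
  assumes "whp P a Q" "hp P Q'" "a < b"
  shows "whp P b (\<lambda>n \<omega>. Q n \<omega> \<and> Q' n \<omega>)"
  using whp_conj[OF assms(1) hp_whp[OF assms(2), of "b - a"]] assms(3) by simp

lemma hp_conj:
  assumes "hp P Q" "hp P Q'"
  shows "hp P (\<lambda>n \<omega>. Q n \<omega> \<and> Q' n \<omega>)"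
  unfolding hp_def
proof (intro allI impI)
  fix \<epsilon> :: real assume "\<epsilon> > 0"
  then show "whp P \<epsilon> (\<lambda>n \<omega>. Q n \<omega> \<and> Q' n \<omega>)"
    using whp_hp_conj[OF hp_whp[OF assms(1), of "\<epsilon> / 2"] assms(2), of \<epsilon>] by simp
qed

lemma hp_True: "hp P (\<lambda>_ _. True)"
  unfolding hp_def whp_def
proof (intro allI impI)
  fix \<epsilon> :: real assume \<epsilon>: "\<epsilon> > 0"
  show "\<forall>\<^sub>F n in sequentially. \<exists>E\<in>sets (P n). 1 - \<epsilon> \<le> measure (P n) E \<and> (\<forall>\<omega>\<in>E. True)"
  proof (rule eventually_mono[OF ev_prob])
    fix n assume "prob_space (P n)"
    then show "\<exists>E\<in>sets (P n). 1 - \<epsilon> \<le> measure (P n) E \<and> (\<forall>\<omega>\<in>E. True)"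
      using \<epsilon> by (intro bexI[of _ "space (P n)"]) (auto simp: prob_space.prob_space)
  qed
qed

lemma hp_always:
  assumes "\<forall>\<^sub>F n in sequentially. \<forall>\<omega>\<in>space (P n). Q n \<omega>"
  shows "hp P Q"
  using hp_mono[OF hp_True] assms by (simp add: eventually_mono)

lemma hp_ball_finite:
  assumes "finite J" "\<And>j. j \<in> J \<Longrightarrow> hp P (Q j)"
  shows "hp P (\<lambda>n \<omega>. \<forall>j\<in>J. Q j n \<omega>)"
  using assms
proof (induction J)
  case empty then show ?case by (intro hp_always) simp
next
  case (insert j J)
  have "hp P (\<lambda>n \<omega>. Q j n \<omega> \<and> (\<forall>j\<in>J. Q j n \<omega>))" using insert by (intro hp_conj) auto
  then show ?case by (rule hp_mono) simp
qed

lemma whp_ball_finite: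
  assumes "finite J" "J \<noteq> {}" "\<And>j. j \<in> J \<Longrightarrow> whp P a (Q j)"
  shows "whp P (real (card J) * a) (\<lambda>n \<omega>. \<forall>j\<in>J. Q j n \<omega>)"
  using assms
proof (induction J rule: finite_ne_induct)
  case (singleton j) then show ?case by simp
next
  case (insert j J)
  have "whp P (a + real (card J) * a) (\<lambda>n \<omega>. Q j n \<omega> \<and> (\<forall>j\<in>J. Q j n \<omega>))"
    using insert by (intro whp_conj) auto
  then show ?case by (rule whp_mono) (use insert in \<open>auto simp: distrib_right\<close>)
qed

lemma whp_compl:
  assumes "\<forall>\<^sub>F n in sequentially. \<exists>A\<in>sets (P n). measure (P n) A \<le> \<epsilon> \<and> (\<forall>\<omega>\<in>space (P n) - A. Q n \<omega>)"
  shows "whp P \<epsilon> Q"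
  using assms ev_prob unfolding whp_def
proof eventually_elim
  case (elim n)
  interpret prob_space "P n" by (rule elim)
  obtain A where "A \<in> sets (P n)" "prob A \<le> \<epsilon>" "\<forall>\<omega>\<in>space (P n) - A. Q n \<omega>" using elim by blast
  then show ?case by (intro bexI[of _ "space (P n) - A"]) (auto simp: prob_compl)
qed

lemma hp_compl:
  assumes A: "\<And>n. n \<ge> 1 \<Longrightarrow> A n \<in> sets (P n)" and b: "b \<longlonglongrightarrow> 0"
    and le: "\<forall>\<^sub>F n in sequentially. measure (P n) (A n) \<le> b n"
    and Q: "\<forall>\<^sub>F n in sequentially. \<forall>\<omega>\<in>space (P n) - A n. Q n \<omega>"
  shows "hp P Q"
  unfolding hp_def
proof (intro allI impI whp_compl)
  fix \<epsilon> :: real assume "\<epsilon> > 0"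
  with b have "\<forall>\<^sub>F n in sequentially. b n < \<epsilon>" by (auto dest: order_tendstoD)
  then show "\<forall>\<^sub>F n in sequentially. \<exists>A\<in>sets (P n). measure (P n) A \<le> \<epsilon> \<and> (\<forall>\<omega>\<in>space (P n) - A. Q n \<omega>)"
    using le Q eventually_ge_at_top[of 1]
  proof eventually_elim
    case (elim n)
    then show ?case using A by (intro bexI[of _ "A n"]) auto
  qed
qed

lemma hp_AE:
  assumes "\<And>n. n \<ge> 1 \<Longrightarrow> AE \<omega> in P n. Q n \<omega>"
  shows "hp P Q"
proof -
  have "\<exists>N. N \<in> sets (P n) \<and> measure (P n) N = 0 \<and> (\<forall>\<omega>\<in>space (P n) - N. Q n \<omega>)" if n: "n \<ge> 1" for n
  proof -
    obtain N where "{\<omega> \<in> space (P n). \<not> Q n \<omega>} \<subseteq> N" "emeasure (P n) N = 0" "N \<in> sets (P n)"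
      using assms[OF n] by (rule AE_E)
    then show ?thesis by (intro exI[of _ N]) (auto simp: measure_def)
  qed
  then obtain N where N: "\<And>n. n \<ge> 1 \<Longrightarrow> N n \<in> sets (P n) \<and> measure (P n) (N n) = 0 \<and> (\<forall>\<omega>\<in>space (P n) - N n. Q n \<omega>)"
    by metis
  show ?thesis
    by (rule hp_compl[of N "\<lambda>_. 0"]) (use N in \<open>auto intro!: eventually_sequentiallyI[of 1]\<close>)
qed

lemma hp_of_with_prob_to_1:
  assumes "with_prob_to_1 P Q"
  shows "hp P Q"
proof -
  obtain E where E: "\<And>n. E n \<in> sets (P n)" "\<And>n \<omega>. \<omega> \<in> E n \<Longrightarrow> Q n \<omega>"
    and lim: "(\<lambda>n. measure (P n) (E n)) \<longlonglongrightarrow> 1"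
    using assms unfolding with_prob_to_1_def by blast
  show ?thesis unfolding hp_def whp_def
  proof (intro allI impI)
    fix \<epsilon> :: real assume "\<epsilon> > 0"
    then have "\<forall>\<^sub>F n in sequentially. 1 - \<epsilon> < measure (P n) (E n)"
      by (intro order_tendstoD(1)[OF lim]) simp
    then show "\<forall>\<^sub>F n in sequentially. \<exists>E\<in>sets (P n). 1 - \<epsilon> \<le> measure (P n) E \<and> (\<forall>\<omega>\<in>E. Q n \<omega>)"
      by eventually_elim (use E in \<open>auto intro!: bexI[of _ "E _"]\<close>)
  qed
qed

text \<open>The events are chosen to be nearly optimal for each \<open>n\<close> separately.\<close>

lemma with_prob_to_1_of_hp:
  assumes "hp P Q"
  shows "with_prob_to_1 P Q"
proof -
  define inner where "inner n = {p. \<exists>E\<in>sets (P n). (\<forall>\<omega>\<in>E. Q n \<omega>) \<and> p = measure (P n) E}" for n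
  have ne: "0 \<in> inner n" for n unfolding inner_def by (auto intro!: bexI[of _ "{}"])
  have bdd: "bdd_above (inner n)" if "n \<ge> 1" for n
    unfolding inner_def
    by (intro bdd_aboveI[of _ 1]) (auto simp: prob_space.prob_le_1[OF prob[OF that]])
  have "\<exists>E. E \<in> sets (P n) \<and> (\<forall>\<omega>\<in>E. Q n \<omega>) \<and> (n \<ge> 1 \<longrightarrow> Sup (inner n) - 1 / real n < measure (P n) E)" for n
  proof (cases "n \<ge> 1")
    case True
    then have "Sup (inner n) - 1 / real n < Sup (inner n)" by simp
    then obtain p where p: "p \<in> inner n" "Sup (inner n) - 1 / real n < p"
      using less_cSup_iff[OF _ bdd[OF True]] ne by blast
    then show ?thesis unfolding inner_def by blast
  next
    \<comment> \<open>The measure \<open>P 0\<close> is arbitrary; the empty event serves there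
      without affecting the limit.\<close>
    case False
    then show ?thesis by (intro exI[of _ "{}"]) auto
  qed
  then obtain E where E: "\<And>n. E n \<in> sets (P n)" "\<And>n \<omega>. \<omega> \<in> E n \<Longrightarrow> Q n \<omega>"
      "\<And>n. n \<ge> 1 \<Longrightarrow> Sup (inner n) - 1 / real n < measure (P n) (E n)"
    by metis
  have "(\<lambda>n. measure (P n) (E n)) \<longlonglongrightarrow> 1"
  proof (rule order_tendstoI)
    fix a :: real assume a: "a < 1"
    \<comment> \<open>Half of the gap pays for the probability missed by \<open>F\<close>, the other
      half for the distance of \<open>E n\<close> from the supremum.\<close>
    define \<epsilon> where "\<epsilon> = (1 - a) / 2"
    have \<epsilon>: "\<epsilon> > 0" using a by (simp add: \<epsilon>_def)
    have "\<forall>\<^sub>F n in sequentially. 1 / real n < \<epsilon>"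
      using lim_1_over_n \<epsilon> by (auto dest: order_tendstoD)
    moreover have "\<forall>\<^sub>F n in sequentially. \<exists>E\<in>sets (P n). measure (P n) E \<ge> 1 - \<epsilon> \<and> (\<forall>\<omega>\<in>E. Q n \<omega>)"
      using assms \<epsilon> unfolding hp_def whp_def by blast
    ultimately show "\<forall>\<^sub>F n in sequentially. a < measure (P n) (E n)"
      using eventually_ge_at_top[of 1]
    proof eventually_elim
      case (elim n)
      then obtain F where F: "F \<in> sets (P n)" "measure (P n) F \<ge> 1 - \<epsilon>" "\<forall>\<omega>\<in>F. Q n \<omega>" by blast
      then have "measure (P n) F \<le> Sup (inner n)"
        using bdd elim by (intro cSup_upper) (auto simp: inner_def)
      moreover have "1 - \<epsilon> - \<epsilon> = a" by (simp add: \<epsilon>_def)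
      ultimately show ?case using F E(3)[of n] elim by linarith
    qed
  next
    fix a :: real assume "1 < a"
    then show "\<forall>\<^sub>F n in sequentially. measure (P n) (E n) < a"
      using ev_prob by (auto elim!: eventually_mono intro: le_less_trans[OF prob_space.prob_le_1])
  qed
  then show ?thesis unfolding with_prob_to_1_def using E by blast
qed

end

subsection \<open>Triangular arrays\<close>

lemma (in prob_space) markov_ennreal:
  assumes f: "f \<in> borel_measurable M" and K: "(\<integral>\<^sup>+x. f x \<partial>M) \<le> ennreal K"
    and a: "a > 0" and K0: "K \<ge> 0"
  shows "prob {x\<in>space M. ennreal a < f x} \<le> K / a"
proof -
  have m: "{x\<in>space M. ennreal a < f x} \<in> events" using f by measurable
  have "ennreal a * emeasure M {x\<in>space M. ennreal a < f x}
      = (\<integral>\<^sup>+x. ennreal a * indicator {x\<in>space M. ennreal a < f x} x \<partial>M)"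
    using m by (simp add: nn_integral_cmult_indicator)
  also have "\<dots> \<le> (\<integral>\<^sup>+x. f x \<partial>M)"
    by (intro nn_integral_mono) (auto simp: indicator_def)
  also note K
  finally have "ennreal a * ennreal (prob {x\<in>space M. ennreal a < f x}) \<le> ennreal K"
    by (simp add: emeasure_eq_measure)
  then have "a * prob {x\<in>space M. ennreal a < f x} \<le> K"
    using a K0 by (simp flip: ennreal_mult add: ennreal_le_iff)
  then show ?thesis using a by (simp add: field_simps)
qed

section \<open>Independent samples: transfer of moments and laws for averages\<close>

locale iid =
  fixes P :: "nat \<Rightarrow> 'w measure" and \<mu> :: "nat \<Rightarrow> 'z measure" and Z :: "nat \<Rightarrow> nat \<Rightarrow> 'w \<Rightarrow> 'z"
  assumes iid: "iid_array P \<mu> Z"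
begin

lemmas iidD = iid[unfolded iid_array_def, THEN spec, THEN mp]

sublocale prob_sequence P
  by (rule prob_sequence.intro) (rule iidD[THEN conjunct1])

lemma indep: "n \<ge> 1 \<Longrightarrow> prob_space.indep_vars (P n) (\<lambda>_. \<mu> n) (Z n) {1..n}"
  by (rule iidD[THEN conjunct2, THEN conjunct1])

lemma distr_Z: "n \<ge> 1 \<Longrightarrow> i \<in> {1..n} \<Longrightarrow> distr (P n) (\<mu> n) (Z n i) = \<mu> n"
  by (rule iidD[THEN conjunct2, THEN conjunct2, THEN bspec])

lemma Z_meas: "n \<ge> 1 \<Longrightarrow> i \<in> {1..n} \<Longrightarrow> Z n i \<in> measurable (P n) (\<mu> n)"
  using prob_space.indep_vars_def[OF prob, THEN iffD1, OF _ indep, THEN conjunct1] by blast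

lemma prob_mu: assumes "n \<ge> 1" shows "prob_space (\<mu> n)"
  using prob_space.prob_space_distr[OF prob Z_meas[of n 1]] distr_Z[of n 1] assms by simp

lemma AE_Z:
  assumes "n \<ge> 1" "AE z in \<mu> n. Q z"
  shows "AE \<omega> in P n. \<forall>i\<in>{1..n}. Q (Z n i \<omega>)"
proof (rule AE_finite_allI)
  fix i assume i: "i \<in> {1..n}"
  have "AE z in distr (P n) (\<mu> n) (Z n i). Q z"
    unfolding distr_Z[OF assms(1) i] by (rule assms(2))
  then show "AE \<omega> in P n. Q (Z n i \<omega>)" by (rule AE_distrD[OF Z_meas[OF assms(1) i]])
qed simp

lemma nn_integral_Z:
  assumes "n \<ge> 1" "i \<in> {1..n}" "f \<in> borel_measurable (\<mu> n)"
  shows "(\<integral>\<^sup>+\<omega>. f (Z n i \<omega>) \<partial>P n) = (\<integral>\<^sup>+z. f z \<partial>\<mu> n)"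
  using nn_integral_distr[OF Z_meas[OF assms(1,2)], of f] assms by (simp add: distr_Z)

lemma integral_Z:
  fixes f :: "'z \<Rightarrow> real"
  assumes "n \<ge> 1" "i \<in> {1..n}" "f \<in> borel_measurable (\<mu> n)"
  shows "(\<integral>\<omega>. f (Z n i \<omega>) \<partial>P n) = (\<integral>z. f z \<partial>\<mu> n)"
  using integral_distr[OF Z_meas[OF assms(1,2)] assms(3)] assms by (simp add: distr_Z)

lemma integrable_Z:
  fixes f :: "'z \<Rightarrow> real"
  assumes "n \<ge> 1" "i \<in> {1..n}" "f \<in> borel_measurable (\<mu> n)"
  shows "integrable (P n) (\<lambda>\<omega>. f (Z n i \<omega>)) \<longleftrightarrow> integrable (\<mu> n) f"
  using integrable_distr_eq[OF Z_meas[OF assms(1,2)] assms(3)] assms by (simp add: distr_Z)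

lemma measurable_Z:
  assumes "n \<ge> 1" "i \<in> {1..n}" "f \<in> measurable (\<mu> n) N"
  shows "(\<lambda>\<omega>. f (Z n i \<omega>)) \<in> measurable (P n) N"
  using measurable_compose[OF Z_meas[OF assms(1,2)] assms(3)] .

lemma measure_Z:
  assumes "n \<ge> 1" "i \<in> {1..n}" "A \<in> sets (\<mu> n)"
  shows "measure (P n) (Z n i -` A \<inter> space (P n)) = measure (\<mu> n) A"
  using measure_distr[OF Z_meas[OF assms(1,2)] assms(3)] assms by (simp add: distr_Z)

lemma indep_f:
  assumes "n \<ge> 1" "f \<in> borel_measurable (\<mu> n)"
  shows "prob_space.indep_vars (P n) (\<lambda>_. borel) (\<lambda>i \<omega>. f (Z n i \<omega>)) {1..n}"
  using prob_space.indep_vars_compose2[OF prob[OF assms(1)] indep[OF assms(1)], of "\<lambda>_. f" "\<lambda>_. borel"] assms(2)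
  by simp

lemma avg_markov:
  assumes n: "n \<ge> 1" and f: "f \<in> borel_measurable (\<mu> n)" and K: "(\<integral>\<^sup>+z. f z \<partial>\<mu> n) \<le> ennreal K"
    and a: "a > 0" and K0: "K \<ge> 0"
  shows "{\<omega>\<in>space (P n). ennreal (real n * a) < (\<Sum>i=1..n. f (Z n i \<omega>))} \<in> sets (P n)"
    and "measure (P n) {\<omega>\<in>space (P n). ennreal (real n * a) < (\<Sum>i=1..n. f (Z n i \<omega>))} \<le> K / a"
proof -
  interpret prob_space "P n" using n by (rule prob)
  let ?S = "\<lambda>\<omega>. \<Sum>i=1..n. f (Z n i \<omega>)"
  have S: "?S \<in> borel_measurable (P n)"
    using measurable_Z[OF n _ f] by (intro borel_measurable_sum) auto
  then show m: "{\<omega>\<in>space (P n). ennreal (real n * a) < ?S \<omega>} \<in> sets (P n)" by measurable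
  have "(\<integral>\<^sup>+\<omega>. ?S \<omega> \<partial>P n) = (\<Sum>i=1..n. \<integral>\<^sup>+\<omega>. f (Z n i \<omega>) \<partial>P n)"
    using measurable_Z[OF n _ f] by (intro nn_integral_sum) auto
  also have "\<dots> = (\<Sum>i=1..n. \<integral>\<^sup>+z. f z \<partial>\<mu> n)" using nn_integral_Z[OF n _ f] by (intro sum.cong) auto
  also have "\<dots> \<le> (\<Sum>i=1..n. ennreal K)" by (intro sum_mono K)
  also have "\<dots> = ennreal (real n * K)" using K0 by (simp add: ennreal_mult ennreal_of_nat_eq_real_of_nat)
  finally have "prob {\<omega>\<in>space (P n). ennreal (real n * a) < ?S \<omega>} \<le> real n * K / (real n * a)"
    using a n K0 by (intro markov_ennreal[OF S]) auto
  then show "prob {\<omega>\<in>space (P n). ennreal (real n * a) < ?S \<omega>} \<le> K / a" using n by simp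
qed

lemma avg_bounded:
  assumes f: "\<And>n. n \<ge> 1 \<Longrightarrow> f n \<in> borel_measurable (\<mu> n)"
    and K: "\<And>n. n \<ge> 1 \<Longrightarrow> (\<integral>\<^sup>+z. f n z \<partial>\<mu> n) \<le> ennreal K" and \<epsilon>: "\<epsilon> > 0"
  obtains a where "a > 0" "whp P \<epsilon> (\<lambda>n \<omega>. (\<Sum>i=1..n. f n (Z n i \<omega>)) \<le> ennreal (real n * a))"
proof
  define K' where "K' = max K 1"
  have K': "(\<integral>\<^sup>+z. f n z \<partial>\<mu> n) \<le> ennreal K'" if "n \<ge> 1" for n
    using K[OF that] by (rule order_trans) (auto simp: K'_def intro: ennreal_leI)
  let ?a = "K' / \<epsilon>"
  show a: "?a > 0" using \<epsilon> by (simp add: K'_def)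
  show "whp P \<epsilon> (\<lambda>n \<omega>. (\<Sum>i=1..n. f n (Z n i \<omega>)) \<le> ennreal (real n * ?a))"
  proof (intro whp_compl eventually_sequentiallyI[of 1])
    fix n :: nat assume n: "1 \<le> n"
    let ?A = "{\<omega>\<in>space (P n). ennreal (real n * ?a) < (\<Sum>i=1..n. f n (Z n i \<omega>))}"
    have "?A \<in> sets (P n)" "measure (P n) ?A \<le> K' / ?a"
      using avg_markov[OF n f[OF n] K'[OF n] a] by (auto simp: K'_def)
    moreover have "K' / ?a = \<epsilon>" using a \<epsilon> by (simp add: K'_def)
    ultimately show "\<exists>A\<in>sets (P n). measure (P n) A \<le> \<epsilon> \<and> (\<forall>\<omega>\<in>space (P n) - A. (\<Sum>i=1..n. f n (Z n i \<omega>)) \<le> ennreal (real n * ?a))"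
      by (intro bexI[of _ ?A]) auto
  qed
qed

lemma avg_bounded_real:
  assumes f: "\<And>n. n \<ge> 1 \<Longrightarrow> f n \<in> borel_measurable (\<mu> n)"
    and K: "\<And>n. n \<ge> 1 \<Longrightarrow> (\<integral>\<^sup>+z. ennreal (f n z) \<partial>\<mu> n) \<le> ennreal K" and f0: "\<And>n z. 0 \<le> f n z" and \<epsilon>: "\<epsilon> > 0"
  obtains a where "a > 0" "whp P \<epsilon> (\<lambda>n \<omega>. (\<Sum>i=1..n. f n (Z n i \<omega>)) \<le> real n * a)"
proof -
  obtain a where a: "a > 0" "whp P \<epsilon> (\<lambda>n \<omega>. (\<Sum>i=1..n. ennreal (f n (Z n i \<omega>))) \<le> ennreal (real n * a))"
    using avg_bounded[of "\<lambda>n z. ennreal (f n z)", OF _ K \<epsilon>] f by auto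
  from a(2) have "whp P \<epsilon> (\<lambda>n \<omega>. (\<Sum>i=1..n. f n (Z n i \<omega>)) \<le> real n * a)"
    by (rule whp_mono) (use a(1) f0 in \<open>auto simp: sum_ennreal ennreal_le_iff intro!: always_eventually\<close>)
  then show ?thesis using that a by blast
qed

text \<open>Stated for a single \<open>n\<close>, since the truncated law below applies it with a
  truncation level chosen for each \<open>n\<close>. Cross terms of the variance vanish by
  independence.\<close>

lemma avg_chebyshev:
  assumes n: "n \<ge> 1" and f: "f \<in> borel_measurable (\<mu> n)" and int: "integrable (\<mu> n) (\<lambda>z. (f z)\<^sup>2)"
    and a: "a > 0"
  defines "A \<equiv> {\<omega>\<in>space (P n). a \<le> \<bar>(\<Sum>i=1..n. f (Z n i \<omega>)) / n - (\<integral>z. f z \<partial>\<mu> n)\<bar>}"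
  shows "A \<in> sets (P n)" "measure (P n) A \<le> (\<integral>z. (f z)\<^sup>2 \<partial>\<mu> n) / (n * a\<^sup>2)"
proof -
  interpret prob_space "P n" using n by (rule prob)
  interpret m: prob_space "\<mu> n" using n by (rule prob_mu)
  define S where "S = (\<lambda>\<omega>. (\<Sum>i=1..n. f (Z n i \<omega>)) / n)"
  define m where "m = (\<integral>z. f z \<partial>\<mu> n)"
  define Y where "Y i \<omega> = f (Z n i \<omega>) - m" for i \<omega>
  have intf: "integrable (\<mu> n) f" by (rule m.square_integrable_imp_integrable[OF f int])
  have intY2: "integrable (\<mu> n) (\<lambda>z. (f z - m)\<^sup>2)"
    using int intf by (simp add: power2_diff)
  have [measurable]: "(\<lambda>\<omega>. f (Z n i \<omega>)) \<in> borel_measurable (P n)" if "i \<in> {1..n}" for i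
    using measurable_Z[OF n that f] .
  have S[measurable]: "S \<in> borel_measurable (P n)" unfolding S_def by measurable
  have "A = {\<omega>\<in>space (P n). a \<le> \<bar>S \<omega> - m\<bar>}" by (simp add: A_def S_def m_def)
  then show "A \<in> sets (P n)" by simp
  have Yint: "integrable (P n) (Y i)" and Ymean: "expectation (Y i) = 0" if i: "i \<in> {1..n}" for i
  proof -
    have "integrable (P n) (\<lambda>\<omega>. f (Z n i \<omega>))" using integrable_Z[OF n i f] intf by simp
    then show "integrable (P n) (Y i)" "expectation (Y i) = 0"
      unfolding Y_def by (auto simp: integral_Z[OF n i f] prob_space m_def)
  qed
  have indY: "indep_vars (\<lambda>_. borel) Y {1..n}"
    using indep_f[OF n, of "\<lambda>z. f z - m"] f by (simp add: Y_def[abs_def])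
  have YY: "integrable (P n) (\<lambda>\<omega>. Y i \<omega> * Y j \<omega>)"
     and EYY: "expectation (\<lambda>\<omega>. Y i \<omega> * Y j \<omega>) = (if i = j then (\<integral>z. (f z - m)\<^sup>2 \<partial>\<mu> n) else 0)"
    if ij: "i \<in> {1..n}" "j \<in> {1..n}" for i j
  proof -
    have "integrable (P n) (\<lambda>\<omega>. Y i \<omega> * Y j \<omega>) \<and>
        expectation (\<lambda>\<omega>. Y i \<omega> * Y j \<omega>) = (if i = j then (\<integral>z. (f z - m)\<^sup>2 \<partial>\<mu> n) else 0)"
    proof (cases "i = j")
      case True
      have "integrable (P n) (\<lambda>\<omega>. (f (Z n i \<omega>) - m)\<^sup>2)"
        using integrable_Z[OF n ij(1), of "\<lambda>z. (f z - m)\<^sup>2"] intY2 f by simp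
      moreover have "expectation (\<lambda>\<omega>. (f (Z n i \<omega>) - m)\<^sup>2) = (\<integral>z. (f z - m)\<^sup>2 \<partial>\<mu> n)"
        using integral_Z[OF n ij(1), of "\<lambda>z. (f z - m)\<^sup>2"] f by simp
      ultimately show ?thesis using True by (simp add: Y_def power2_eq_square)
    next
      case False
      have ind: "indep_vars (\<lambda>_. borel) Y {i, j}" using ij by (intro indep_vars_subset[OF indY]) auto
      have "integrable (P n) (\<lambda>\<omega>. \<Prod>k\<in>{i, j}. Y k \<omega>)"
        by (rule indep_vars_integrable[OF _ ind]) (use Yint ij in auto)
      moreover have "expectation (\<lambda>\<omega>. \<Prod>k\<in>{i, j}. Y k \<omega>) = (\<Prod>k\<in>{i, j}. expectation (Y k))"
        by (rule indep_vars_lebesgue_integral[OF _ ind]) (use Yint ij in auto)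
      ultimately show ?thesis using False Ymean ij by simp
    qed
    then show "integrable (P n) (\<lambda>\<omega>. Y i \<omega> * Y j \<omega>)"
      "expectation (\<lambda>\<omega>. Y i \<omega> * Y j \<omega>) = (if i = j then (\<integral>z. (f z - m)\<^sup>2 \<partial>\<mu> n) else 0)" by auto
  qed
  have Sm: "(S \<omega> - m)\<^sup>2 = (\<Sum>i=1..n. \<Sum>j=1..n. Y i \<omega> * Y j \<omega>) / (real n)\<^sup>2" for \<omega>
  proof -
    have "S \<omega> - m = (\<Sum>i=1..n. Y i \<omega>) / n"
      using n by (simp add: S_def Y_def sum_subtractf diff_divide_distrib)
    then show ?thesis by (simp add: power_divide power2_eq_square sum_product)
  qed
  have int2: "integrable (P n) (\<lambda>\<omega>. (S \<omega> - m)\<^sup>2)" unfolding Sm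
    by (intro integrable_divide Bochner_Integration.integrable_sum YY)
  have "expectation (\<lambda>\<omega>. (S \<omega> - m)\<^sup>2) = (\<Sum>i=1..n. \<Sum>j=1..n. expectation (\<lambda>\<omega>. Y i \<omega> * Y j \<omega>)) / (real n)\<^sup>2"
  proof -
    have "expectation (\<lambda>\<omega>. \<Sum>i=1..n. \<Sum>j=1..n. Y i \<omega> * Y j \<omega>) = (\<Sum>i=1..n. expectation (\<lambda>\<omega>. \<Sum>j=1..n. Y i \<omega> * Y j \<omega>))"
      by (intro Bochner_Integration.integral_sum Bochner_Integration.integrable_sum YY)
    also have "\<dots> = (\<Sum>i=1..n. \<Sum>j=1..n. expectation (\<lambda>\<omega>. Y i \<omega> * Y j \<omega>))"
      by (intro sum.cong refl Bochner_Integration.integral_sum YY)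
    finally show ?thesis unfolding Sm by simp
  qed
  also have "\<dots> = (\<integral>z. (f z - m)\<^sup>2 \<partial>\<mu> n) / n"
    using n by (simp add: EYY power2_eq_square)
  also have "\<dots> \<le> (\<integral>z. (f z)\<^sup>2 \<partial>\<mu> n) / n"
  proof -
    have "(\<integral>z. (f z - m)\<^sup>2 \<partial>\<mu> n) = (\<integral>z. (f z)\<^sup>2 \<partial>\<mu> n) - m\<^sup>2"
      using m.variance_eq[OF intf int] by (simp add: m_def)
    then show ?thesis using n by (intro divide_right_mono) auto
  qed
  finally have var: "expectation (\<lambda>\<omega>. (S \<omega> - m)\<^sup>2) \<le> (\<integral>z. (f z)\<^sup>2 \<partial>\<mu> n) / n" .
  have "A = {\<omega>\<in>space (P n). a\<^sup>2 \<le> (S \<omega> - m)\<^sup>2}"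
  proof -
    have "a \<le> \<bar>S \<omega> - m\<bar> \<longleftrightarrow> a\<^sup>2 \<le> (S \<omega> - m)\<^sup>2" for \<omega>
      using abs_le_square_iff[of a "S \<omega> - m"] a by simp
    then show ?thesis unfolding \<open>A = {\<omega>\<in>space (P n). a \<le> \<bar>S \<omega> - m\<bar>}\<close> by simp
  qed
  then have "prob A \<le> expectation (\<lambda>\<omega>. (S \<omega> - m)\<^sup>2) / a\<^sup>2"
    using integral_Markov_inequality_measure[OF int2, of "{}" "a\<^sup>2"] a by simp
  also have "\<dots> \<le> (\<integral>z. (f z)\<^sup>2 \<partial>\<mu> n) / n / a\<^sup>2" using var by (intro divide_right_mono) auto
  finally show "measure (P n) A \<le> (\<integral>z. (f z)\<^sup>2 \<partial>\<mu> n) / (n * a\<^sup>2)" by simp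
qed

lemma weak_law:
  assumes f: "\<And>n. n \<ge> 1 \<Longrightarrow> f n \<in> borel_measurable (\<mu> n)"
    and int: "\<And>n. n \<ge> 1 \<Longrightarrow> integrable (\<mu> n) (\<lambda>z. (f n z)\<^sup>2)"
    and K: "\<And>n. n \<ge> 1 \<Longrightarrow> (\<integral>z. (f n z)\<^sup>2 \<partial>\<mu> n) \<le> K" and a: "a > 0"
  shows "hp P (\<lambda>n \<omega>. \<bar>(\<Sum>i=1..n. f n (Z n i \<omega>)) / n - (\<integral>z. f n z \<partial>\<mu> n)\<bar> < a)"
proof (rule hp_compl)
  let ?A = "\<lambda>n. {\<omega>\<in>space (P n). a \<le> \<bar>(\<Sum>i=1..n. f n (Z n i \<omega>)) / n - (\<integral>z. f n z \<partial>\<mu> n)\<bar>}"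
  show "?A n \<in> sets (P n)" if "n \<ge> 1" for n using avg_chebyshev(1)[OF that f[OF that] int[OF that] a] .
  show "(\<lambda>n. (K / a\<^sup>2) * (1 / real n)) \<longlonglongrightarrow> 0"
    using tendsto_mult_right_zero[OF lim_1_over_n] by blast
  show "\<forall>\<^sub>F n in sequentially. measure (P n) (?A n) \<le> K / a\<^sup>2 * (1 / real n)"
  proof (rule eventually_sequentiallyI[of 1])
    fix n :: nat assume n: "1 \<le> n"
    have "measure (P n) (?A n) \<le> (\<integral>z. (f n z)\<^sup>2 \<partial>\<mu> n) / (n * a\<^sup>2)"
      using avg_chebyshev(2)[OF n f[OF n] int[OF n] a] .
    also have "\<dots> \<le> K / (n * a\<^sup>2)" using K[OF n] a n by (intro divide_right_mono) auto
    finally show "measure (P n) (?A n) \<le> K / a\<^sup>2 * (1 / real n)" by (simp add: mult.commute)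
  qed
qed (auto intro!: always_eventually)

end

subsection \<open>A weak law under truncation\<close>

text \<open>Since \<open>(1 - p) * (1 + p) \<le> 1\<close>, Bernoulli's inequality gives
  \<open>(1 - p)^n * (1 + n * p) \<le> 1\<close>, so a lower bound on the first factor bounds
  \<open>n * p\<close>.\<close>

lemma one_minus_power_bound:
  fixes p :: real
  assumes "0 \<le> p" "p \<le> 1" "1 - \<eta> \<le> (1 - p) ^ n" "\<eta> \<le> 1/2"
  shows "real n * p \<le> 2 * \<eta>"
proof -
  have "(1 - p) ^ n * (1 + p) ^ n = (1 - p\<^sup>2) ^ n"
    by (simp add: power_mult_distrib[symmetric] power2_eq_square algebra_simps)
  also have "\<dots> \<le> 1" using assms by (intro power_le_one) (auto simp: abs_square_le_1)
  finally have "(1 - p) ^ n * (1 + p) ^ n \<le> 1" .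
  moreover have "1 + real n * p \<le> (1 + p) ^ n" using Bernoulli_inequality[of p n] assms by simp
  moreover have "0 \<le> (1 - p) ^ n" using assms by simp
  ultimately have "(1 - p) ^ n * (1 + real n * p) \<le> 1"
    by (meson mult_left_mono order_trans)
  moreover have "(1 - \<eta>) * (1 + real n * p) \<le> (1 - p) ^ n * (1 + real n * p)"
    using assms by (intro mult_right_mono) auto
  ultimately have "(1 - \<eta>) * (1 + real n * p) \<le> 1" by linarith
  moreover have "1/2 * (real n * p) \<le> (1 - \<eta>) * (real n * p)"
    using assms by (intro mult_right_mono) auto
  ultimately show ?thesis by (simp add: algebra_simps)
qed

context iid
begin

lemma prob_none_in:
  assumes n: "n \<ge> 1" and A: "A \<in> sets (\<mu> n)"
  shows "{\<omega>\<in>space (P n). \<forall>i\<in>{1..n}. Z n i \<omega> \<notin> A} \<in> sets (P n)"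
    and "measure (P n) {\<omega>\<in>space (P n). \<forall>i\<in>{1..n}. Z n i \<omega> \<notin> A} = (1 - measure (\<mu> n) A) ^ n"
proof -
  interpret prob_space "P n" using n by (rule prob)
  interpret m: prob_space "\<mu> n" using n by (rule prob_mu)
  let ?B = "space (\<mu> n) - A"
  have eq: "{\<omega>\<in>space (P n). \<forall>i\<in>{1..n}. Z n i \<omega> \<notin> A} = (\<Inter>i\<in>{1..n}. Z n i -` ?B \<inter> space (P n))"
    using n measurable_space[OF Z_meas[OF n]] by fastforce
  have B: "?B \<in> sets (\<mu> n)" using A by auto
  show "{\<omega>\<in>space (P n). \<forall>i\<in>{1..n}. Z n i \<omega> \<notin> A} \<in> sets (P n)"
    unfolding eq using n by (intro sets.finite_INT measurable_sets[OF Z_meas[OF n]] B) auto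
  have "prob (\<Inter>i\<in>{1..n}. Z n i -` ?B \<inter> space (P n)) = (\<Prod>i\<in>{1..n}. prob (Z n i -` ?B \<inter> space (P n)))"
    by (rule indep_varsD[OF indep[OF n]]) (use n B in auto)
  also have "\<dots> = (\<Prod>i\<in>{1..n}. 1 - measure (\<mu> n) A)"
    using measure_Z[OF n _ B] m.prob_compl[OF A] by (intro prod.cong) auto
  finally show "prob {\<omega>\<in>space (P n). \<forall>i\<in>{1..n}. Z n i \<omega> \<notin> A} = (1 - measure (\<mu> n) A) ^ n"
    unfolding eq by simp
qed

text \<open>Second moments of order \<open>n\<close> are harmless as long as the observed mean square stays bounded:
  values above \<open>sqrt (K n)\<close> then have probability \<open>o(1/n)\<close>, so that by Cauchy-Schwarz they do not
  contribute to the mean.\<close>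

lemma truncated_weak_law:
  assumes f: "\<And>n. n \<ge> 1 \<Longrightarrow> f n \<in> borel_measurable (\<mu> n)"
    and int: "\<And>n. n \<ge> 1 \<Longrightarrow> integrable (\<mu> n) (\<lambda>z. (f n z)\<^sup>2)"
    and K: "\<And>n. n \<ge> 1 \<Longrightarrow> (\<integral>z. (f n z)\<^sup>2 \<partial>\<mu> n) \<le> real n * K"
    and bnd: "\<And>\<epsilon>. \<epsilon> > 0 \<Longrightarrow> \<exists>K'. whp P \<epsilon> (\<lambda>n \<omega>. (\<Sum>i=1..n. (f n (Z n i \<omega>))\<^sup>2) / n \<le> K')"
    and a: "a > 0"
  shows "hp P (\<lambda>n \<omega>. \<bar>(\<Sum>i=1..n. f n (Z n i \<omega>)) / n - (\<integral>z. f n z \<partial>\<mu> n)\<bar> < a)"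
  unfolding hp_def
proof (intro allI impI)
  fix \<epsilon> :: real assume \<epsilon>: "\<epsilon> > 0"
  define L where "L = max K 1"
  have L: "L > 0" "\<And>n. n \<ge> 1 \<Longrightarrow> (\<integral>z. (f n z)\<^sup>2 \<partial>\<mu> n) \<le> real n * L"
    using K by (auto simp: L_def intro: order_trans[OF K] mult_left_mono)
  \<comment> \<open>The weight in the inequality
    \<open>\<bar>f\<bar> \<le> t * f^2 / (2 * n) + n / (2 * t)\<close>, used above the truncation
    level. With this choice the first term contributes at most \<open>a / 6\<close>, and with \<eta>
    below the second at most \<open>a / 12\<close>.\<close>
  define t where "t = a / (3 * L)"
  have t: "t > 0" "t * L = a / 3" using a L by (auto simp: t_def)
  define \<eta> where "\<eta> = min (\<epsilon> / 2) (min (1/2) (a * t / 12))"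
  have \<eta>: "\<eta> > 0" "\<eta> \<le> \<epsilon> / 2" "\<eta> \<le> 1/2" "\<eta> \<le> a * t / 12" using \<epsilon> a t by (auto simp: \<eta>_def)
  obtain K0 where K0: "whp P \<eta> (\<lambda>n \<omega>. (\<Sum>i=1..n. (f n (Z n i \<omega>))\<^sup>2) / n \<le> K0)"
    using bnd[OF \<eta>(1)] by blast
  define K' where "K' = max K0 1"
  have K': "K' > 0" by (simp add: K'_def)
  have ev1: "\<forall>\<^sub>F n in sequentially. \<exists>E\<in>sets (P n). measure (P n) E \<ge> 1 - \<eta> \<and>
      (\<forall>\<omega>\<in>E. (\<Sum>i=1..n. (f n (Z n i \<omega>))\<^sup>2) / n \<le> K')"
    using K0 unfolding whp_def by (rule eventually_mono) (force simp: K'_def)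
  have ev2: "\<forall>\<^sub>F n in sequentially. (72 * K' / a\<^sup>2) * (1 / real n) < \<epsilon> / 2"
    using \<epsilon> by (intro order_tendstoD(2)[OF tendsto_mult_right_zero[OF lim_1_over_n]]) simp
  show "whp P \<epsilon> (\<lambda>n \<omega>. \<bar>(\<Sum>i=1..n. f n (Z n i \<omega>)) / n - (\<integral>z. f n z \<partial>\<mu> n)\<bar> < a)"
    unfolding whp_def using ev1 ev2 eventually_ge_at_top[of 1]
  proof eventually_elim
    case (elim n)
    then have n: "n \<ge> 1" by simp
    interpret prob_space "P n" using n by (rule prob)
    interpret m: prob_space "\<mu> n" using n by (rule prob_mu)
    note [measurable] = f[OF n]
    obtain E where E: "E \<in> sets (P n)" "prob E \<ge> 1 - \<eta>"
      and EK: "\<And>\<omega>. \<omega> \<in> E \<Longrightarrow> (\<Sum>i=1..n. (f n (Z n i \<omega>))\<^sup>2) / n \<le> K'"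
      using elim by blast
    have Esp: "E \<subseteq> space (P n)" using sets.sets_into_space[OF E(1)] .
    \<comment> \<open>On \<open>E\<close> the sum of the squares is at most \<open>K' * n\<close>,
      so no observed value exceeds this level and truncation changes nothing there.\<close>
    define b where "b = sqrt (K' * n)"
    have b: "b\<^sup>2 = K' * n" "b \<ge> 0" using K' by (auto simp: b_def)
    define A where "A = {z\<in>space (\<mu> n). b < \<bar>f n z\<bar>}"
    have A: "A \<in> sets (\<mu> n)" unfolding A_def by measurable
    define p where "p = measure (\<mu> n) A"
    have small: "\<bar>f n (Z n i \<omega>)\<bar> \<le> b" if "\<omega> \<in> E" "i \<in> {1..n}" for \<omega> i
    proof -
      have "(f n (Z n i \<omega>))\<^sup>2 \<le> (\<Sum>i=1..n. (f n (Z n i \<omega>))\<^sup>2)" using that by (intro member_le_sum) auto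
      also have "\<dots> \<le> b\<^sup>2" using EK[OF that(1)] n by (simp add: b field_simps)
      finally show ?thesis using b(2) by (simp add: abs_le_square_iff[symmetric])
    qed
    \<comment> \<open>With probability at least \<open>1 - \<eta>\<close> no observation exceeds
      \<open>b\<close>; by independence this probability is at most \<open>(1 - p)^n\<close>, which
      forces \<open>p\<close> below a small multiple of \<open>1 / n\<close>.\<close>
    have np: "real n * p \<le> 2 * \<eta>"
    proof (rule one_minus_power_bound)
      have "E \<subseteq> {\<omega>\<in>space (P n). \<forall>i\<in>{1..n}. Z n i \<omega> \<notin> A}"
        using Esp small by (force simp: A_def)
      then have "prob E \<le> (1 - p) ^ n"
        using finite_measure_mono[OF _ prob_none_in(1)[OF n A]] prob_none_in(2)[OF n A] by (simp add: p_def)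
      then show "1 - \<eta> \<le> (1 - p) ^ n" using E by simp
    qed (use \<eta> in \<open>auto simp: p_def\<close>)
    define Y where "Y z = (if \<bar>f n z\<bar> \<le> b then f n z else 0)" for z
    have [measurable]: "Y \<in> borel_measurable (\<mu> n)" unfolding Y_def by measurable
    have intf: "integrable (\<mu> n) (f n)" by (rule m.square_integrable_imp_integrable[OF f[OF n] int[OF n]])
    have Yb: "\<bar>Y z\<bar> \<le> b" for z using b by (simp add: Y_def)
    have Y2b: "(Y z)\<^sup>2 \<le> b\<^sup>2" for z using Yb[of z] by (metis abs_ge_zero power2_abs power_mono)
    have intY: "integrable (\<mu> n) Y" by (rule m.integrable_const_bound[of _ b]) (use Yb in auto)
    have intY2: "integrable (\<mu> n) (\<lambda>z. (Y z)\<^sup>2)"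
      by (rule m.integrable_const_bound[of _ "b\<^sup>2"]) (use Y2b in auto)
    have Y4b: "((Y z)\<^sup>2)\<^sup>2 \<le> b\<^sup>2 * (Y z)\<^sup>2" for z
      unfolding power2_eq_square[of "(Y z)\<^sup>2"] using Y2b[of z] by (intro mult_right_mono) auto
    have intY4: "integrable (\<mu> n) (\<lambda>z. ((Y z)\<^sup>2)\<^sup>2)"
    proof (rule m.integrable_const_bound[of _ "b\<^sup>2 * b\<^sup>2"])
      have "((Y z)\<^sup>2)\<^sup>2 \<le> b\<^sup>2 * b\<^sup>2" for z
        using Y4b[of z] mult_left_mono[OF Y2b[of z], of "b\<^sup>2"] by simp
      then show "AE z in \<mu> n. norm (((Y z)\<^sup>2)\<^sup>2) \<le> b\<^sup>2 * b\<^sup>2" by simp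
    qed measurable
    define q where "q = (\<integral>z. (Y z)\<^sup>2 \<partial>\<mu> n)"
    \<comment> \<open>If \<open>q\<close> exceeded \<open>8 * K'\<close>, Chebyshev, with a fourth
      moment of at most \<open>b^2 * q\<close>, would keep the average square within
      \<open>q / 2\<close> of \<open>q\<close> with probability above one half. But on
      \<open>E\<close>, of probability at least one half, that average is at most
      \<open>K' < q / 2\<close>.\<close>
    have q: "q \<le> 8 * K'"
    proof (rule ccontr)
      assume "\<not> q \<le> 8 * K'"
      then have qb: "q > 8 * K'" and q0: "q > 0" using K' by auto
      let ?B = "{\<omega>\<in>space (P n). q / 2 \<le> \<bar>(\<Sum>i=1..n. (Y (Z n i \<omega>))\<^sup>2) / n - (\<integral>z. (Y z)\<^sup>2 \<partial>\<mu> n)\<bar>}"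
      have B: "?B \<in> sets (P n)" "prob ?B \<le> (\<integral>z. ((Y z)\<^sup>2)\<^sup>2 \<partial>\<mu> n) / (n * (q/2)\<^sup>2)"
        by (rule avg_chebyshev[OF n _ intY4]; use q0 in simp)+
      have "(\<integral>z. ((Y z)\<^sup>2)\<^sup>2 \<partial>\<mu> n) \<le> (\<integral>z. b\<^sup>2 * (Y z)\<^sup>2 \<partial>\<mu> n)"
        using Y4b intY4 intY2 by (intro integral_mono) auto
      also have "\<dots> = K' * n * q" by (simp add: b q_def)
      finally have "(\<integral>z. ((Y z)\<^sup>2)\<^sup>2 \<partial>\<mu> n) / (n * (q/2)\<^sup>2) \<le> K' * n * q / (n * (q/2)\<^sup>2)"
        by (intro divide_right_mono) auto
      with B(2) have "prob ?B \<le> K' * n * q / (n * (q/2)\<^sup>2)" by (rule order_trans)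
      also have "\<dots> = 4 * K' / q" using n q0 by (simp add: power2_eq_square)
      also have "\<dots> < 1/2" using qb q0 by (simp add: field_simps)
      finally have lt: "prob ?B < 1/2" .
      have "E \<subseteq> ?B"
      proof
        fix \<omega> assume \<omega>: "\<omega> \<in> E"
        have "(\<Sum>i=1..n. (Y (Z n i \<omega>))\<^sup>2) = (\<Sum>i=1..n. (f n (Z n i \<omega>))\<^sup>2)"
          using small[OF \<omega>] by (intro sum.cong) (auto simp: Y_def)
        then have "(\<Sum>i=1..n. (Y (Z n i \<omega>))\<^sup>2) / n \<le> K'" using EK[OF \<omega>] by simp
        then have "q / 2 \<le> \<bar>(\<Sum>i=1..n. (Y (Z n i \<omega>))\<^sup>2) / n - q\<bar>" using qb K' by linarith
        then show "\<omega> \<in> ?B" using \<omega> Esp unfolding q_def mem_Collect_eq by blast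
      qed
      then have "prob E \<le> prob ?B" by (rule finite_measure_mono[OF _ B(1)])
      then show False using E lt \<eta> by simp
    qed
    let ?C = "{\<omega>\<in>space (P n). a / 3 \<le> \<bar>(\<Sum>i=1..n. Y (Z n i \<omega>)) / n - (\<integral>z. Y z \<partial>\<mu> n)\<bar>}"
    have C: "?C \<in> sets (P n)" "prob ?C \<le> q / (n * (a / 3)\<^sup>2)"
      unfolding q_def by (rule avg_chebyshev[OF n _ intY2]; use a in simp)+
    have "q / (n * (a / 3)\<^sup>2) \<le> 8 * K' / (n * (a / 3)\<^sup>2)" using q by (intro divide_right_mono) auto
    also have "\<dots> = (72 * K' / a\<^sup>2) * (1 / real n)" by (simp add: power_divide)
    finally have C2: "prob ?C \<le> \<epsilon> / 2" using C(2) elim by linarith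
    \<comment> \<open>Values above \<open>b\<close> combine a probability that is a small multiple
      of \<open>1 / n\<close> with a second moment of order \<open>n\<close>; the weighted
      inequality balances the two.\<close>
    have EfY: "\<bar>(\<integral>z. f n z \<partial>\<mu> n) - (\<integral>z. Y z \<partial>\<mu> n)\<bar> \<le> a / 4"
    proof -
      have le: "\<bar>f n z - Y z\<bar> \<le> t / n * (f n z)\<^sup>2 / 2 + n / t * indicator A z / 2" if z: "z \<in> space (\<mu> n)" for z
      proof (cases "z \<in> A")
        case True
        define x where "x = \<bar>f n z\<bar>"
        have "0 \<le> (t / n) * (x - n / t)\<^sup>2" using t by simp
        also have "\<dots> = t / n * x\<^sup>2 - 2 * x + n / t"
          using t n by (simp add: power2_eq_square field_simps)
        finally have "0 \<le> t / n * x\<^sup>2 - 2 * x + n / t" .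
        moreover have "x \<le> u / 2 + v / 2" if "0 \<le> u - 2 * x + v" for u v using that by linarith
        ultimately have "x \<le> t / n * x\<^sup>2 / 2 + n / t / 2" by blast
        moreover have "\<bar>f n z - Y z\<bar> = x" "(indicator A z :: real) = 1" "x\<^sup>2 = (f n z)\<^sup>2"
          using True by (auto simp: A_def Y_def x_def)
        ultimately show ?thesis by simp
      next
        case False
        then show ?thesis using z t by (auto simp: A_def Y_def)
      qed
      have iA: "integrable (\<mu> n) (\<lambda>z. indicator A z :: real)" using A by (simp add: m.emeasure_eq_measure)
      have "\<bar>(\<integral>z. f n z \<partial>\<mu> n) - (\<integral>z. Y z \<partial>\<mu> n)\<bar> = \<bar>\<integral>z. f n z - Y z \<partial>\<mu> n\<bar>"
        using intf intY by simp
      also have "\<dots> \<le> (\<integral>z. \<bar>f n z - Y z\<bar> \<partial>\<mu> n)" by (rule integral_abs_bound)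
      also have "\<dots> \<le> (\<integral>z. t / n * (f n z)\<^sup>2 / 2 + n / t * indicator A z / 2 \<partial>\<mu> n)"
      proof (rule integral_mono)
        show "integrable (\<mu> n) (\<lambda>z. t / n * (f n z)\<^sup>2 / 2 + n / t * indicator A z / 2)"
          using int[OF n] iA by (intro Bochner_Integration.integrable_add integrable_divide integrable_mult_right)
      qed (use le intf intY in auto)
      also have "\<dots> = t / n * (\<integral>z. (f n z)\<^sup>2 \<partial>\<mu> n) / 2 + n / t * p / 2"
        using int[OF n] iA A by (simp add: p_def)
      also have "\<dots> \<le> t * L / 2 + \<eta> / t"
      proof (rule add_mono)
        have "t / n * (\<integral>z. (f n z)\<^sup>2 \<partial>\<mu> n) \<le> t / n * (n * L)" using L n t by (intro mult_left_mono) auto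
        then show "t / n * (\<integral>z. (f n z)\<^sup>2 \<partial>\<mu> n) / 2 \<le> t * L / 2" using n by simp
        show "n / t * p / 2 \<le> \<eta> / t" using np t by (simp add: field_simps)
      qed
      also have "\<dots> \<le> a / 6 + a / 12" using t \<eta> by (intro add_mono) (auto simp: field_simps)
      finally show ?thesis by simp
    qed
    have "prob E - prob ?C \<le> prob (E - ?C)"
      using finite_measure_Diff'[OF E(1) C(1)] finite_measure_mono[OF Int_lower2 C(1), of E] by linarith
    then have "1 - \<epsilon> \<le> prob (E - ?C)" using E C2 \<eta> by linarith
    moreover have "\<bar>(\<Sum>i=1..n. f n (Z n i \<omega>)) / n - (\<integral>z. f n z \<partial>\<mu> n)\<bar> < a" if \<omega>: "\<omega> \<in> E - ?C" for \<omega>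
    proof -
      have "(\<Sum>i=1..n. Y (Z n i \<omega>)) = (\<Sum>i=1..n. f n (Z n i \<omega>))"
        using small \<omega> by (intro sum.cong) (auto simp: Y_def)
      moreover have "\<bar>(\<Sum>i=1..n. Y (Z n i \<omega>)) / n - (\<integral>z. Y z \<partial>\<mu> n)\<bar> < a / 3" using \<omega> Esp by auto
      ultimately have "\<bar>(\<Sum>i=1..n. f n (Z n i \<omega>)) / n - (\<integral>z. Y z \<partial>\<mu> n)\<bar> < a / 3" by simp
      then show ?thesis using EfY a by linarith
    qed
    ultimately show ?case using E C by (intro bexI[of _ "E - ?C"]) auto
  qed
qed

subsection \<open>Central limit theorem and anti-concentration\<close>

text \<open>Both the law and the summand change with \<open>n\<close>; the fourth moment bound makes
  the third-order error of the characteristic function uniform. The index is shifted because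
  \<open>P 0\<close> need not be a probability space.\<close>

lemma clt_array:
  fixes f :: "nat \<Rightarrow> 'z \<Rightarrow> real" and s M :: real
  assumes f: "\<And>n. n \<ge> 1 \<Longrightarrow> f n \<in> borel_measurable (\<mu> n)"
    and mean: "\<And>n. n \<ge> 1 \<Longrightarrow> (\<integral>z. f n z \<partial>\<mu> n) = 0"
    and int: "\<And>n. n \<ge> 1 \<Longrightarrow> integrable (\<mu> n) (\<lambda>z. (f n z)\<^sup>2)"
    and var: "\<And>n. n \<ge> 1 \<Longrightarrow> (\<integral>z. (f n z)\<^sup>2 \<partial>\<mu> n) = s" and s: "s > 0"
    and int4: "\<And>n. n \<ge> 1 \<Longrightarrow> integrable (\<mu> n) (\<lambda>z. f n z ^ 4)"
    and M: "\<And>n. n \<ge> 1 \<Longrightarrow> (\<integral>z. f n z ^ 4 \<partial>\<mu> n) \<le> M"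
  shows "weak_conv_m (\<lambda>n. distr (P (Suc n)) borel (\<lambda>\<omega>. (\<Sum>i=1..Suc n. f (Suc n) (Z (Suc n) i \<omega>)) / sqrt (Suc n * s)))
    std_normal_distribution"
proof (rule levy_continuity)
  let ?S = "\<lambda>n \<omega>. (\<Sum>i=1..n. f n (Z n i \<omega>)) / sqrt (n * s)"
  have Sm: "?S n \<in> borel_measurable (P n)" if "n \<ge> 1" for n
    using measurable_Z[OF that _ f[OF that]] by (intro borel_measurable_divide borel_measurable_sum) auto
  show "real_distribution (distr (P (Suc n)) borel (?S (Suc n)))" for n
  proof -
    interpret prob_space "P (Suc n)" by (rule prob) simp
    show ?thesis using Sm[of "Suc n"] by simp
  qed
  show "real_distribution std_normal_distribution" by (rule real_dist_normal_dist)
  fix t :: real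
  \<comment> \<open>One factor of the characteristic function has error at most
    \<open>t^2 / 6 * \<bar>t\<bar> * E \<bar>X\<bar>^3\<close>, where
    \<open>X = f / sqrt (n * s)\<close> and \<open>E \<bar>f\<bar>^3 \<le> 1 + M\<close>;
    multiplying by the \<open>n\<close> factors leaves \<open>1 / sqrt n\<close>.\<close>
  define C where "C = \<bar>t\<bar> ^ 3 / 6 * ((1 + M) / (s * sqrt s))"
  have main: "cmod (char (distr (P n) borel (?S n)) t - complex_of_real ((1 + (- (t\<^sup>2) / 2) / n) ^ n)) \<le> C * (1 / sqrt n)"
    if n: "n \<ge> 1" "real n \<ge> t\<^sup>2 / 4" for n
  proof -
    interpret prob_space "P n" using n(1) by (rule prob)
    interpret m: prob_space "\<mu> n" using n(1) by (rule prob_mu)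
    note [measurable] = f[OF n(1)]
    have intf: "integrable (\<mu> n) (f n)" by (rule m.square_integrable_imp_integrable[OF f[OF n(1)] int[OF n(1)]])
    define X where "X i \<omega> = f n (Z n i \<omega>) / sqrt (n * s)" for i \<omega>
    define c where "c = complex_of_real (1 + (- (t\<^sup>2) / 2) / n)"
    have Xm: "X i \<in> borel_measurable (P n)" if "i \<in> {1..n}" for i
      unfolding X_def using measurable_Z[OF n(1) that f[OF n(1)]] by measurable
    have "char (distr (P n) borel (?S n)) t = char (distr (P n) borel (\<lambda>\<omega>. \<Sum>i=1..n. X i \<omega>)) t"
      by (simp add: X_def sum_divide_distrib)
    also have "\<dots> = (\<Prod>i=1..n. char (distr (P n) borel (X i)) t)"
      using indep_f[OF n(1), of "\<lambda>z. f n z / sqrt (n * s)"] by (intro char_distr_sum) (simp add: X_def[abs_def])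
    finally have prod: "char (distr (P n) borel (?S n)) t = (\<Prod>i=1..n. char (distr (P n) borel (X i)) t)" .
    have ch: "char (distr (P n) borel (X i)) t = char (distr (\<mu> n) borel (\<lambda>z. f n z / sqrt (n * s))) t"
      if i: "i \<in> {1..n}" for i
    proof -
      have "distr (P n) borel (X i) = distr (distr (P n) (\<mu> n) (Z n i)) borel (\<lambda>z. f n z / sqrt (n * s))"
        using Z_meas[OF n(1) i] by (subst distr_distr) (auto simp: X_def[abs_def] comp_def)
      then show ?thesis unfolding distr_Z[OF n(1) i] by simp
    qed
    define \<psi> where "\<psi> = char (distr (\<mu> n) borel (\<lambda>z. f n z / sqrt (n * s))) t"
    have chn: "char (distr (P n) borel (?S n)) t = \<psi> ^ n"
      using prod ch by (simp add: \<psi>_def)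
    have X2: "(\<lambda>z. (f n z / sqrt (n * s))\<^sup>2) = (\<lambda>z. (f n z)\<^sup>2 / (n * s))"
      using s by (simp add: power_divide)
    have meanX: "m.expectation (\<lambda>z. f n z / sqrt (n * s)) = 0" using mean[OF n(1)] by simp
    have approx: "cmod (\<psi> - (1 - t\<^sup>2 * (1 / n) / 2)) \<le>
        t\<^sup>2 / 6 * m.expectation (\<lambda>z. min (6 * (f n z / sqrt (n * s))\<^sup>2) (\<bar>t\<bar> * \<bar>f n z / sqrt (n * s)\<bar> ^ 3))"
      unfolding \<psi>_def
    proof (rule m.char_approx3'[OF _ _ _ meanX _ refl])
      show "integrable (\<mu> n) (\<lambda>z. f n z / sqrt (n * s))" using intf by simp
      show "integrable (\<mu> n) (\<lambda>z. (f n z / sqrt (n * s))\<^sup>2)" unfolding X2 using int[OF n(1)] by simp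
      show "m.variance (\<lambda>z. f n z / sqrt (n * s)) = 1 / n"
        unfolding meanX using X2 var[OF n(1)] s by simp
    qed measurable
    have "m.expectation (\<lambda>z. min (6 * (f n z / sqrt (n * s))\<^sup>2) (\<bar>t\<bar> * \<bar>f n z / sqrt (n * s)\<bar> ^ 3))
        \<le> m.expectation (\<lambda>z. \<bar>t\<bar> / (sqrt (n * s)) ^ 3 * (1 + f n z ^ 4))"
    proof (rule integral_mono)
      have q: "integrable (\<mu> n) (\<lambda>z. \<bar>t\<bar> / (sqrt (n * s)) ^ 3 * (1 + f n z ^ 4))" using int4[OF n(1)] by simp
      show "integrable (\<mu> n) (\<lambda>z. \<bar>t\<bar> / (sqrt (n * s)) ^ 3 * (1 + f n z ^ 4))" by (rule q)
      have le: "min (6 * (f n z / sqrt (n * s))\<^sup>2) (\<bar>t\<bar> * \<bar>f n z / sqrt (n * s)\<bar> ^ 3)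
          \<le> \<bar>t\<bar> / (sqrt (n * s)) ^ 3 * (1 + f n z ^ 4)" for z
      proof -
        have "\<bar>f n z\<bar> ^ 3 \<le> 1 + f n z ^ 4"
        proof (cases "\<bar>f n z\<bar> \<le> 1")
          case True
          then have "\<bar>f n z\<bar> ^ 3 \<le> 1" by (intro power_le_one) auto
          then show ?thesis by (smt (verit) zero_le_even_power' numeral_Bit0 mult_2 even_numeral zero_le_power_eq_numeral)
        next
          case False
          then have "\<bar>f n z\<bar> ^ 3 \<le> \<bar>f n z\<bar> ^ 4" by (intro power_increasing) auto
          then show ?thesis by simp
        qed
        then have "\<bar>t\<bar> / (sqrt (n * s)) ^ 3 * \<bar>f n z\<bar> ^ 3 \<le> \<bar>t\<bar> / (sqrt (n * s)) ^ 3 * (1 + f n z ^ 4)"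
          using s by (intro mult_left_mono) auto
        moreover have "\<bar>t\<bar> * \<bar>f n z / sqrt (n * s)\<bar> ^ 3 = \<bar>t\<bar> / (sqrt (n * s)) ^ 3 * \<bar>f n z\<bar> ^ 3"
          using s by (simp add: abs_divide power_divide)
        ultimately show ?thesis by linarith
      qed
      show "integrable (\<mu> n) (\<lambda>z. min (6 * (f n z / sqrt (n * s))\<^sup>2) (\<bar>t\<bar> * \<bar>f n z / sqrt (n * s)\<bar> ^ 3))"
      proof (rule Bochner_Integration.integrable_bound[OF q])
        show "AE z in \<mu> n. norm (min (6 * (f n z / sqrt (n * s))\<^sup>2) (\<bar>t\<bar> * \<bar>f n z / sqrt (n * s)\<bar> ^ 3))
           \<le> norm (\<bar>t\<bar> / (sqrt (n * s)) ^ 3 * (1 + f n z ^ 4))"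
        proof (intro AE_I2)
          fix z
          have "0 \<le> min (6 * (f n z / sqrt (n * s))\<^sup>2) (\<bar>t\<bar> * \<bar>f n z / sqrt (n * s)\<bar> ^ 3)" by simp
          then show "norm (min (6 * (f n z / sqrt (n * s))\<^sup>2) (\<bar>t\<bar> * \<bar>f n z / sqrt (n * s)\<bar> ^ 3))
           \<le> norm (\<bar>t\<bar> / (sqrt (n * s)) ^ 3 * (1 + f n z ^ 4))" using le[of z] unfolding real_norm_def by linarith
        qed
      qed measurable
      show "min (6 * (f n z / sqrt (n * s))\<^sup>2) (\<bar>t\<bar> * \<bar>f n z / sqrt (n * s)\<bar> ^ 3)
          \<le> \<bar>t\<bar> / (sqrt (n * s)) ^ 3 * (1 + f n z ^ 4)" for z by (rule le)
    qed
    also have "\<dots> = \<bar>t\<bar> / (sqrt (n * s)) ^ 3 * (1 + (\<integral>z. f n z ^ 4 \<partial>\<mu> n))"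
      using int4[OF n(1)] by (simp add: m.prob_space)
    also have "\<dots> \<le> \<bar>t\<bar> / (sqrt (n * s)) ^ 3 * (1 + M)"
      using M[OF n(1)] s by (intro mult_left_mono) auto
    finally have "cmod (\<psi> - (1 - t\<^sup>2 * (1 / n) / 2)) \<le> t\<^sup>2 / 6 * (\<bar>t\<bar> / (sqrt (n * s)) ^ 3 * (1 + M))"
      by (intro order_trans[OF approx] mult_left_mono) auto
    moreover have "1 - t\<^sup>2 * (1 / n) / 2 = 1 + (- (t\<^sup>2) / 2) / n" by simp
    ultimately have 1: "cmod (\<psi> - c) \<le> t\<^sup>2 / 6 * (\<bar>t\<bar> / (sqrt (n * s)) ^ 3 * (1 + M))"
      unfolding c_def by (metis of_real_1 of_real_diff of_real_divide of_real_mult of_real_numeral of_real_of_nat_eq of_real_power)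
    have \<psi>1: "cmod \<psi> \<le> 1"
      unfolding \<psi>_def by (intro real_distribution.cmod_char_le_1 m.real_distribution_distr) measurable
    \<comment> \<open>The condition \<open>n \<ge> t^2 / 4\<close> keeps
      \<open>1 - t^2 / (2 * n)\<close> above \<open>-1\<close>, as the comparison of powers
      requires.\<close>
    have c1: "cmod c \<le> 1"
      unfolding c_def norm_of_real using n by (intro abs_leI) (auto simp: field_simps)
    have "cmod (\<psi> ^ n - c ^ n) \<le> n * cmod (\<psi> - c)" by (rule norm_power_diff[OF \<psi>1 c1])
    also have "\<dots> \<le> n * (t\<^sup>2 / 6 * (\<bar>t\<bar> / (sqrt (n * s)) ^ 3 * (1 + M)))" using 1 by (intro mult_left_mono) auto
    also have "\<dots> = C * (1 / sqrt n)"
    proof -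
      have "(sqrt (n * s)) ^ 3 = n * s * (sqrt n * sqrt s)"
        using s by (simp add: power3_eq_cube flip: real_sqrt_mult)
      moreover have "t\<^sup>2 * \<bar>t\<bar> = \<bar>t\<bar> ^ 3" by (simp add: power3_eq_cube power2_eq_square)
      ultimately show ?thesis using n s by (simp add: C_def field_simps)
    qed
    finally show ?thesis unfolding chn c_def of_real_power .
  qed
  have lim1: "(\<lambda>n. C * (1 / sqrt (real n))) \<longlonglongrightarrow> 0"
  proof -
    have "(\<lambda>n. 1 / sqrt (real n)) \<longlonglongrightarrow> 0"
      by (intro tendsto_divide_0[OF tendsto_const] filterlim_at_top_imp_at_infinity
          filterlim_compose[OF sqrt_at_top] filterlim_real_sequentially)
    then show ?thesis using tendsto_mult_right_zero by blast
  qed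
  have ev: "\<forall>\<^sub>F n in sequentially. cmod (char (distr (P n) borel (?S n)) t - complex_of_real ((1 + (- (t\<^sup>2) / 2) / n) ^ n)) \<le> C * (1 / sqrt n)"
  proof -
    have "\<forall>\<^sub>F n in sequentially. real n \<ge> t\<^sup>2 / 4"
      using filterlim_real_sequentially unfolding filterlim_at_top by blast
    then show ?thesis using eventually_ge_at_top[of 1] by eventually_elim (rule main)
  qed
  have "(\<lambda>n. complex_of_real ((1 + (- (t\<^sup>2) / 2) / n) ^ n)) \<longlonglongrightarrow> complex_of_real (exp (- (t\<^sup>2) / 2))"
    by (rule isCont_tendsto_compose[OF _ tendsto_exp_limit_sequentially]) auto
  then have "(\<lambda>n. char (distr (P n) borel (?S n)) t) \<longlonglongrightarrow> complex_of_real (exp (- (t\<^sup>2) / 2))"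
    by (rule Lim_transform) (rule Lim_null_comparison[OF ev lim1])
  then have "(\<lambda>n. char (distr (P n) borel (?S n)) t) \<longlonglongrightarrow> char std_normal_distribution t"
    by (simp add: char_std_normal_distribution)
  then show "(\<lambda>n. char (distr (P (Suc n)) borel (?S (Suc n))) t) \<longlonglongrightarrow> char std_normal_distribution t"
    by (rule LIMSEQ_Suc)
qed

text \<open>The normal limit has no atoms, so a short enough interval around the rescaled centre has
  limiting probability below \<epsilon>; convergence of the distribution functions at its two ends
  transfers this to large \<open>n\<close>.\<close>

lemma anti_concentration:
  fixes f :: "nat \<Rightarrow> 'z \<Rightarrow> real" and s M c :: real
  assumes f: "\<And>n. n \<ge> 1 \<Longrightarrow> f n \<in> borel_measurable (\<mu> n)"
    and mean: "\<And>n. n \<ge> 1 \<Longrightarrow> (\<integral>z. f n z \<partial>\<mu> n) = 0"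
    and int: "\<And>n. n \<ge> 1 \<Longrightarrow> integrable (\<mu> n) (\<lambda>z. (f n z)\<^sup>2)"
    and var: "\<And>n. n \<ge> 1 \<Longrightarrow> (\<integral>z. (f n z)\<^sup>2 \<partial>\<mu> n) = s" and s: "s > 0"
    and int4: "\<And>n. n \<ge> 1 \<Longrightarrow> integrable (\<mu> n) (\<lambda>z. f n z ^ 4)"
    and M: "\<And>n. n \<ge> 1 \<Longrightarrow> (\<integral>z. f n z ^ 4 \<partial>\<mu> n) \<le> M"
    and \<epsilon>: "\<epsilon> > 0"
  obtains \<rho> where "\<rho> > 0" "whp P \<epsilon> (\<lambda>n \<omega>. \<rho> \<le> \<bar>(\<Sum>i=1..n. f n (Z n i \<omega>)) / sqrt n - c\<bar>)"
proof -
  define F where "F = cdf std_normal_distribution"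
  interpret N: real_distribution std_normal_distribution by (rule real_dist_normal_dist)
  have cont: "isCont F x" for x
  proof -
    have "{x} \<in> null_sets lborel" by (intro finite_imp_null_set_lborel) simp
    then have "{x} \<in> null_sets std_normal_distribution"
      using absolutely_continuousI_density[of "std_normal_density" lborel]
      by (auto simp: absolutely_continuous_def)
    then have "measure std_normal_distribution {x} = 0" by (simp add: measure_def null_setsD1)
    then show ?thesis unfolding F_def N.isCont_cdf .
  qed
  define c' where "c' = c / sqrt s"
  obtain d where d: "d > 0" "\<And>x. dist x c' < d \<Longrightarrow> dist (F x) (F c') < \<epsilon> / 4"
    using cont[of c'] \<epsilon> unfolding isCont_def Lim_at continuous_at_eps_delta
    by (metis dist_eq_0_iff divide_pos_pos dist_commute zero_less_numeral dist_self zero_less_dist_iff)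
  define r where "r = d / 2"
  have r: "r > 0" using d by (simp add: r_def)
  have Fr: "F (c' + r) - F (c' - r) < \<epsilon>"
    using d(2)[of "c' + r"] d(2)[of "c' - r"] d(1) \<epsilon> by (auto simp: r_def dist_real_def abs_if split: if_splits)
  let ?S = "\<lambda>n \<omega>. (\<Sum>i=1..n. f n (Z n i \<omega>)) / sqrt (n * s)"
  let ?D = "\<lambda>n. distr (P n) borel (?S n)"
  have Sm[measurable]: "?S n \<in> borel_measurable (P n)" if "n \<ge> 1" for n
    using measurable_Z[OF that _ f[OF that]] by (intro borel_measurable_divide borel_measurable_sum) auto
  have lim: "(\<lambda>n. cdf (?D (Suc n)) x) \<longlonglongrightarrow> F x" for x
    using clt_array[OF f mean int var s int4 M] cont[of x]
    unfolding weak_conv_m_def weak_conv_def F_def by blast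
  have "(\<lambda>n. cdf (?D (Suc n)) (c' + r) - cdf (?D (Suc n)) (c' - r)) \<longlonglongrightarrow> F (c' + r) - F (c' - r)"
    by (intro tendsto_diff lim)
  then have "\<forall>\<^sub>F n in sequentially. cdf (?D (Suc n)) (c' + r) - cdf (?D (Suc n)) (c' - r) < \<epsilon>"
    using Fr by (rule order_tendstoD)
  then have ev: "\<forall>\<^sub>F n in sequentially. cdf (?D n) (c' + r) - cdf (?D n) (c' - r) < \<epsilon>"
    using eventually_sequentially_Suc[of "\<lambda>n. cdf (?D n) (c' + r) - cdf (?D n) (c' - r) < \<epsilon>"] by simp
  show ?thesis
  proof
    show "r * sqrt s > 0" using r s by simp
    show "whp P \<epsilon> (\<lambda>n \<omega>. r * sqrt s \<le> \<bar>(\<Sum>i=1..n. f n (Z n i \<omega>)) / sqrt n - c\<bar>)"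
    proof (rule whp_compl)
      show "\<forall>\<^sub>F n in sequentially. \<exists>A\<in>sets (P n). measure (P n) A \<le> \<epsilon> \<and>
          (\<forall>\<omega>\<in>space (P n) - A. r * sqrt s \<le> \<bar>(\<Sum>i=1..n. f n (Z n i \<omega>)) / sqrt n - c\<bar>)"
        using ev eventually_ge_at_top[of 1]
      proof eventually_elim
        case (elim n)
        interpret prob_space "P n" using elim by (intro prob) simp
        interpret D: real_distribution "?D n" using Sm elim by (intro real_distribution_distr) simp
        let ?A = "?S n -` {c' - r<..c' + r} \<inter> space (P n)"
        have A: "?A \<in> sets (P n)" using Sm[of n] elim by (intro measurable_sets) auto
        have "measure (P n) ?A = measure (?D n) {c' - r<..c' + r}"
          using Sm[of n] elim by (intro measure_distr[symmetric]) auto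
        also have "\<dots> = cdf (?D n) (c' + r) - cdf (?D n) (c' - r)"
          using r by (subst D.cdf_diff_eq) auto
        finally have "measure (P n) ?A \<le> \<epsilon>" using elim by simp
        moreover have "r * sqrt s \<le> \<bar>(\<Sum>i=1..n. f n (Z n i \<omega>)) / sqrt n - c\<bar>" if "\<omega> \<in> space (P n) - ?A" for \<omega>
        proof -
          have "r \<le> \<bar>?S n \<omega> - c'\<bar>" using that by auto
          then have "r * sqrt s \<le> \<bar>?S n \<omega> - c'\<bar> * sqrt s" using s by (intro mult_right_mono) auto
          also have "\<dots> = \<bar>(?S n \<omega> - c') * sqrt s\<bar>" using s by (simp add: abs_mult)
          also have "(?S n \<omega> - c') * sqrt s = (\<Sum>i=1..n. f n (Z n i \<omega>)) / sqrt n - c"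
            using s by (simp add: c'_def real_sqrt_mult left_diff_distrib)
          finally show ?thesis .
        qed
        ultimately show ?case using A by (intro bexI[of _ ?A] conjI ballI)
      qed
    qed
  qed
qed

end

subsection \<open>Higher derivatives\<close>

lemma frechet_has_derivative:
  assumes "f differentiable (at x)"
  shows "(f has_derivative blinfun_apply (frechet f x)) (at x)"
proof -
  have "(f has_derivative frechet_derivative f (at x)) (at x)"
    using assms by (simp add: frechet_derivative_works)
  then show ?thesis unfolding frechet_def
    by (simp add: bounded_linear_Blinfun_apply has_derivative_bounded_linear)
qed

lemma frechet_unique:
  assumes "(f has_derivative blinfun_apply D) (at x)"
  shows "frechet f x = D"
proof -
  have "frechet_derivative f (at x) = blinfun_apply D"
    using frechet_derivative_at[OF assms] by simp
  then show ?thesis by (simp add: frechet_def blinfun_apply_inverse)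
qed

lemma frechet_sum:
  assumes "\<And>i. i \<in> I \<Longrightarrow> f i differentiable (at x)"
  shows "frechet (\<lambda>x. \<Sum>i\<in>I. f i x) x = (\<Sum>i\<in>I. frechet (f i) x)"
proof (rule frechet_unique)
  have "((\<lambda>x. \<Sum>i\<in>I. f i x) has_derivative (\<lambda>v. \<Sum>i\<in>I. blinfun_apply (frechet (f i) x) v)) (at x)"
    using assms by (intro has_derivative_sum frechet_has_derivative)
  then show "((\<lambda>x. \<Sum>i\<in>I. f i x) has_derivative blinfun_apply (\<Sum>i\<in>I. frechet (f i) x)) (at x)"
    by (rule has_derivative_eq_rhs) (simp add: fun_eq_iff blinfun.sum_left)
qed

lemma blinfun_axis_expand:
  fixes D :: "(real^'k) \<Rightarrow>\<^sub>L 'b::real_normed_vector"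
  shows "blinfun_apply D v = (\<Sum>i\<in>UNIV. (v $ i) *\<^sub>R blinfun_apply D (axis i 1))"
proof -
  have "v = (\<Sum>i\<in>UNIV. (v $ i) *\<^sub>R axis i 1)"
    by (simp add: vec_eq_iff axis_def if_distrib cong: if_cong)
  then have "blinfun_apply D v = blinfun_apply D (\<Sum>i\<in>UNIV. (v $ i) *\<^sub>R axis i 1)" by simp
  then show ?thesis by (simp add: blinfun.sum_right blinfun.scaleR_right)
qed

lemma grad_inner: "grad f x \<bullet> v = blinfun_apply (frechet f x) v"
  by (simp add: blinfun_axis_expand[of _ v] grad_def inner_vec_def mult.commute)

lemma grad_has_derivative:
  assumes "f differentiable (at x)"
  shows "(f has_derivative (\<lambda>v. grad f x \<bullet> v)) (at x)"
  using frechet_has_derivative[OF assms] by (simp add: grad_inner)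

lemma grad_eqI:
  assumes "(f has_derivative (\<lambda>v. g \<bullet> v)) (at x)"
  shows "grad f x = g"
proof -
  have "f differentiable (at x)" using assms by (auto simp: differentiable_def)
  from fun_cong[OF has_derivative_unique[OF grad_has_derivative[OF this] assms]]
  have "grad f x \<bullet> v = g \<bullet> v" for v .
  then have "(grad f x - g) \<bullet> (grad f x - g) = 0" by (simp only: inner_diff_left)
  then show ?thesis by simp
qed

lemma norm_grad_diff_le: "norm (grad f x - grad g y) \<le> norm (frechet f x - frechet g y)"
proof (cases "grad f x = grad g y")
  case False
  define d where "d = grad f x - grad g y"
  have "norm d * norm d = blinfun_apply (frechet f x - frechet g y) d"
    by (simp add: d_def blinfun.diff_left inner_diff_left flip: grad_inner power2_eq_square)
      (simp add: power2_norm_eq_inner inner_diff_left)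
  also have "\<dots> \<le> norm (blinfun_apply (frechet f x - frechet g y) d)" by simp
  also have "\<dots> \<le> norm (frechet f x - frechet g y) * norm d" by (rule norm_blinfun)
  finally show ?thesis using False by (simp add: d_def)
qed simp

lemma hess_quadratic_form: "u \<bullet> (hess f x *v v) = blinfun_apply (blinfun_apply (frechet (frechet f) x) u) v"
proof -
  have "blinfun_apply (blinfun_apply (frechet (frechet f) x) u) v
      = (\<Sum>i\<in>UNIV. \<Sum>j\<in>UNIV. u $ i * (hess f x $ i $ j * v $ j))"
    unfolding blinfun_axis_expand[of _ u] blinfun.sum_left blinfun.scaleR_left
    by (subst blinfun_axis_expand[of _ v]) (simp add: hess_def sum_distrib_left mult_ac)
  then show ?thesis by (simp add: inner_vec_def matrix_vector_mult_def sum_distrib_left)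
qed

lemma line_derivative:
  assumes "F differentiable (at (x + s *\<^sub>R u))"
  shows "((\<lambda>s. F (x + s *\<^sub>R u)) has_vector_derivative blinfun_apply (frechet F (x + s *\<^sub>R u)) u) (at s)"
proof -
  have "((\<lambda>s::real. x + s *\<^sub>R u) has_derivative (\<lambda>s. s *\<^sub>R u)) (at s)"
    by (auto intro!: derivative_eq_intros)
  from has_derivative_compose[OF this frechet_has_derivative[OF assms]]
  show ?thesis by (simp add: has_vector_derivative_def blinfun.scaleR_right)
qed

lemma line_derivative_real:
  fixes F :: "'a::real_normed_vector \<Rightarrow> real"
  assumes "F differentiable (at (x + s *\<^sub>R u))"
  shows "((\<lambda>s. F (x + s *\<^sub>R u)) has_real_derivative blinfun_apply (frechet F (x + s *\<^sub>R u)) u) (at s)"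
  using line_derivative[OF assms] by (simp add: has_real_derivative_iff_has_vector_derivative)

lemma line_derivative_apply:
  fixes F :: "'a::real_normed_vector \<Rightarrow> 'b::real_normed_vector" and T :: "'b \<Rightarrow> real"
  assumes "F differentiable (at (x + s *\<^sub>R u))" "bounded_linear T"
  shows "((\<lambda>s. T (F (x + s *\<^sub>R u))) has_real_derivative T (blinfun_apply (frechet F (x + s *\<^sub>R u)) u)) (at s)"
  using bounded_linear.has_vector_derivative[OF assms(2) line_derivative[OF assms(1)]]
  by (simp add: has_real_derivative_iff_has_vector_derivative)

section \<open>Derivatives up to order four along lines\<close>

abbreviation D2 :: "('a::real_normed_vector \<Rightarrow> real) \<Rightarrow> 'a \<Rightarrow> 'a \<Rightarrow> 'a \<Rightarrow> real" where
  "D2 f x u v \<equiv> blinfun_apply (blinfun_apply (frechet (frechet f) x) u) v"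

abbreviation D3 :: "('a::real_normed_vector \<Rightarrow> real) \<Rightarrow> 'a \<Rightarrow> 'a \<Rightarrow> 'a \<Rightarrow> 'a \<Rightarrow> real" where
  "D3 f x u v w \<equiv> blinfun_apply (blinfun_apply (blinfun_apply (frechet (frechet (frechet f)) x) u) v) w"

abbreviation D4 :: "('a::real_normed_vector \<Rightarrow> real) \<Rightarrow> 'a \<Rightarrow> 'a \<Rightarrow> 'a \<Rightarrow> 'a \<Rightarrow> 'a \<Rightarrow> real" where
  "D4 f x t u v w \<equiv> blinfun_apply (blinfun_apply (blinfun_apply (blinfun_apply
     (frechet (frechet (frechet (frechet f))) x) t) u) v) w"

lemma bounded_linear_eval1: "bounded_linear (\<lambda>D::'a::real_normed_vector \<Rightarrow>\<^sub>L real. blinfun_apply D v)"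
  by (rule blinfun.bounded_linear_left)

lemma bounded_linear_eval2: "bounded_linear (\<lambda>D::'a::real_normed_vector \<Rightarrow>\<^sub>L 'a \<Rightarrow>\<^sub>L real. blinfun_apply (blinfun_apply D u) v)"
  by (rule bounded_linear_compose[OF bounded_linear_eval1 blinfun.bounded_linear_left])

lemma bounded_linear_eval3: "bounded_linear (\<lambda>D::'a::real_normed_vector \<Rightarrow>\<^sub>L 'a \<Rightarrow>\<^sub>L 'a \<Rightarrow>\<^sub>L real.
    blinfun_apply (blinfun_apply (blinfun_apply D u) v) w)"
  by (rule bounded_linear_compose[OF bounded_linear_eval2 blinfun.bounded_linear_left])

lemma line_derivatives:
  assumes "four_times_differentiable f"
  shows "((\<lambda>s. f (x + s *\<^sub>R u)) has_real_derivative blinfun_apply (frechet f (x + s *\<^sub>R u)) u) (at s)"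
    "((\<lambda>s. blinfun_apply (frechet f (x + s *\<^sub>R u)) v) has_real_derivative D2 f (x + s *\<^sub>R u) u v) (at s)"
    "((\<lambda>s. D2 f (x + s *\<^sub>R u) v w) has_real_derivative D3 f (x + s *\<^sub>R u) u v w) (at s)"
    "((\<lambda>s. D3 f (x + s *\<^sub>R u) v w y) has_real_derivative D4 f (x + s *\<^sub>R u) u v w y) (at s)"
  using assms line_derivative_real[of f x s u] line_derivative_apply[of "frechet f" x s u, OF _ bounded_linear_eval1]
    line_derivative_apply[of "frechet (frechet f)" x s u, OF _ bounded_linear_eval2]
    line_derivative_apply[of "frechet (frechet (frechet f))" x s u, OF _ bounded_linear_eval3]
  unfolding four_times_differentiable_def by blast+

lemma abs_D4_le: "\<bar>D4 f x t u v w\<bar> \<le> norm (frechet (frechet (frechet (frechet f))) x) * norm t * norm u * norm v * norm w"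
proof -
  let ?T = "frechet (frechet (frechet (frechet f))) x"
  have "\<bar>D4 f x t u v w\<bar> \<le> norm (blinfun_apply (blinfun_apply (blinfun_apply ?T t) u) v) * norm w"
    using norm_blinfun[of "blinfun_apply (blinfun_apply (blinfun_apply ?T t) u) v" w] by simp
  also have "\<dots> \<le> norm (blinfun_apply (blinfun_apply ?T t) u) * norm v * norm w"
    by (intro mult_right_mono norm_blinfun) auto
  also have "\<dots> \<le> norm (blinfun_apply ?T t) * norm u * norm v * norm w"
    by (intro mult_right_mono norm_blinfun) auto
  also have "\<dots> \<le> norm ?T * norm t * norm u * norm v * norm w"
    by (intro mult_right_mono norm_blinfun) auto
  finally show ?thesis .
qed

lemma abs_D2_le: "\<bar>D2 f x u v\<bar> \<le> norm (frechet (frechet f) x) * norm u * norm v"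
proof -
  have "\<bar>D2 f x u v\<bar> \<le> norm (blinfun_apply (frechet (frechet f) x) u) * norm v"
    using norm_blinfun[of "blinfun_apply (frechet (frechet f) x) u" v] by simp
  also have "\<dots> \<le> norm (frechet (frechet f) x) * norm u * norm v"
    by (intro mult_right_mono norm_blinfun) auto
  finally show ?thesis .
qed

text \<open>Odd orders cancel between \<open>h\<close> and \<open>- h\<close>, so function values
  determine the second derivative up to fourth order. The 12 comes from two remainders with factor
  \<open>1 / 24\<close>.\<close>

lemma even_taylor4:
  assumes f: "four_times_differentiable f"
    and b: "\<And>x. norm (frechet (frechet (frechet (frechet f))) x) \<le> b"
  shows "\<bar>f (x + h) + f (x - h) - 2 * f x - D2 f x h h\<bar> \<le> b * norm h ^ 4 / 12"
proof -
  define df where "df = (\<lambda>m::nat. \<lambda>s::real. if m = 0 then f (x + s *\<^sub>R h) else if m = 1 then blinfun_apply (frechet f (x + s *\<^sub>R h)) h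
     else if m = 2 then D2 f (x + s *\<^sub>R h) h h else if m = 3 then D3 f (x + s *\<^sub>R h) h h h else D4 f (x + s *\<^sub>R h) h h h h)"
  have df0: "df 0 = (\<lambda>s. f (x + s *\<^sub>R h))" by (simp add: df_def)
  have der: "\<forall>m t. m < 4 \<and> \<bar>t\<bar> \<le> \<bar>s\<bar> \<longrightarrow> DERIV (df m) t :> df (Suc m) t" for s :: real
  proof (intro allI impI)
    fix m :: nat and t :: real assume "m < 4 \<and> \<bar>t\<bar> \<le> \<bar>s\<bar>"
    then have "m \<in> {0, 1, 2, 3}" by auto
    then show "DERIV (df m) t :> df (Suc m) t"
      using line_derivatives[OF f, where x = x and u = h and s = t] by (auto simp: df_def)
  qed
  have expand: "(\<Sum>m<4. df m 0 / fact m * s ^ m) = f x + blinfun_apply (frechet f x) h * s + D2 f x h h / 2 * s\<^sup>2 + D3 f x h h h / 6 * s ^ 3" for s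
    by (simp add: df_def eval_nat_numeral fact_numeral)
  obtain t1 where t1: "f (x + 1 *\<^sub>R h) = (\<Sum>m<4. df m 0 / fact m * 1 ^ m) + df 4 t1 / fact 4 * 1 ^ 4"
    using Maclaurin_bi_le[of df "\<lambda>s. f (x + s *\<^sub>R h)" 4 1, OF df0 der] by blast
  obtain t2 where t2: "f (x + (-1) *\<^sub>R h) = (\<Sum>m<4. df m 0 / fact m * (-1) ^ m) + df 4 t2 / fact 4 * (-1) ^ 4"
    using Maclaurin_bi_le[of df "\<lambda>s. f (x + s *\<^sub>R h)" 4 "-1", OF df0 der] by blast
  have d4: "\<bar>df 4 t\<bar> \<le> b * norm h ^ 4" for t
  proof -
    have "\<bar>df 4 t\<bar> \<le> norm (frechet (frechet (frechet (frechet f))) (x + t *\<^sub>R h)) * norm h * norm h * norm h * norm h"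
      using abs_D4_le by (simp add: df_def)
    also have "\<dots> \<le> b * norm h * norm h * norm h * norm h" using b by (intro mult_right_mono) auto
    finally show ?thesis by (simp add: eval_nat_numeral mult_ac)
  qed
  have "f (x + h) + f (x - h) - 2 * f x - D2 f x h h = (df 4 t1 + df 4 t2) / 24"
    using t1 t2 unfolding expand by (simp add: fact_numeral)
  moreover have "\<bar>X\<bar> \<le> B / 12" if "X = (u + v) / 24" "\<bar>u\<bar> \<le> B" "\<bar>v\<bar> \<le> B" for X u v B :: real
  proof (rule abs_leI)
    show "X \<le> B / 12" "- X \<le> B / 12" using that by (auto simp: abs_le_iff)
  qed
  ultimately show ?thesis using d4 by blast
qed

text \<open>A parabola that stays above a nonnegative function has a nonpositive discriminant.\<close>

lemma nonneg_small_second_derivative: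
  fixes \<phi> :: "real \<Rightarrow> real"
  assumes d1: "\<And>s. (\<phi> has_real_derivative \<phi>' s) (at s)" and d2: "\<And>s. (\<phi>' has_real_derivative \<phi>'' s) (at s)"
    and nn: "\<And>s. \<phi> s \<ge> 0" and b: "\<And>s. \<bar>\<phi>'' s\<bar> \<le> \<delta>"
  shows "\<bar>\<phi> s - \<phi> 0\<bar> \<le> \<bar>s\<bar> * sqrt (2 * \<delta> * \<phi> 0) + \<delta> * s\<^sup>2 / 2"
proof -
  have taylor: "\<bar>\<phi> s - \<phi> 0 - s * \<phi>' 0\<bar> \<le> \<delta> * s\<^sup>2 / 2" for s
  proof -
    define df where "df = (\<lambda>m::nat. if m = 0 then \<phi> else if m = 1 then \<phi>' else \<phi>'')"
    have "\<forall>m t. m < 2 \<and> \<bar>t\<bar> \<le> \<bar>s\<bar> \<longrightarrow> DERIV (df m) t :> df (Suc m) t"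
      using d1 d2 by (auto simp: df_def less_2_cases_iff)
    then obtain t where "\<phi> s = (\<Sum>m<2. df m 0 / fact m * s ^ m) + df 2 t / fact 2 * s ^ 2"
      using Maclaurin_bi_le[of df \<phi> 2 s] by (auto simp: df_def)
    then have "\<phi> s - \<phi> 0 - s * \<phi>' 0 = \<phi>'' t * s\<^sup>2 / 2" by (simp add: df_def eval_nat_numeral)
    moreover have "\<bar>\<phi>'' t * s\<^sup>2\<bar> \<le> \<delta> * s\<^sup>2" using b[of t] by (simp add: abs_mult mult_right_mono)
    ultimately show ?thesis by (simp only: abs_divide)
  qed
  have \<delta>: "\<delta> \<ge> 0" using b[of 0] by linarith
  have q: "0 \<le> \<phi> 0 + s * \<phi>' 0 + \<delta> * s\<^sup>2 / 2" for s
    using taylor[of s] nn[of s] by linarith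
  \<comment> \<open>Evaluates the parabola at its vertex; for \<open>\<delta> = 0\<close> it is a
    line that stays nonnegative, so its slope vanishes.\<close>
  have disc: "(\<phi>' 0)\<^sup>2 \<le> 2 * \<delta> * \<phi> 0"
  proof (cases "\<delta> = 0")
    case True
    have "\<phi>' 0 = 0"
    proof (rule ccontr)
      assume "\<phi>' 0 \<noteq> 0"
      then show False using q[of "- (\<phi> 0 + 1) / \<phi>' 0"] True by simp
    qed
    then show ?thesis using True by simp
  next
    case False
    then have "\<delta> > 0" using \<delta> by simp
    then show ?thesis using q[of "- \<phi>' 0 / \<delta>"] by (simp add: field_simps power2_eq_square)
  qed
  then have "\<bar>\<phi>' 0\<bar> \<le> sqrt (2 * \<delta> * \<phi> 0)" by (simp add: real_le_rsqrt)
  then have "\<bar>s * \<phi>' 0\<bar> \<le> \<bar>s\<bar> * sqrt (2 * \<delta> * \<phi> 0)" by (simp add: abs_mult mult_left_mono)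
  then show ?thesis using taylor[of s] by linarith
qed

section \<open>Curvature expressed by second differences\<close>

lemma second_difference_le:
  fixes f :: "'a::real_inner \<Rightarrow> real"
  assumes d: "\<And>x. (f has_derivative (\<lambda>v. g x \<bullet> v)) (at x)"
    and lip: "\<And>x y. norm (g x - g y) \<le> b * norm (x - y)"
  shows "\<bar>f (x + h) + f (x - h) - 2 * f x\<bar> \<le> 2 * b * (norm h)\<^sup>2"
proof -
  let ?R = "norm x + norm h"
  have "\<bar>f (x + h) - f x - g x \<bullet> (x + h - x)\<bar> \<le> b * (norm (x + h - x))\<^sup>2"
    by (rule taylor_first_order[where R = ?R, OF d lip]) (auto intro: norm_triangle_ineq)
  moreover have "\<bar>f (x - h) - f x - g x \<bullet> (x - h - x)\<bar> \<le> b * (norm (x - h - x))\<^sup>2"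
    by (rule taylor_first_order[where R = ?R, OF d lip]) (auto intro: norm_triangle_ineq4)
  ultimately show ?thesis by simp
qed

text \<open>Second differences are sums of function values. They therefore split over the
  observations and are measurable, which is what the leave-one-out argument exploits.\<close>

lemma strongly_convex_second_difference:
  assumes "strongly_convex c f"
  shows "f (x + h) + f (x - h) - 2 * f x \<ge> c * (norm h)\<^sup>2"
proof -
  have d1: "f differentiable (at y)" and d2: "frechet f differentiable (at y)" for y
    using assms eventually_nhds_x_imp_x unfolding strongly_convex_def twice_differentiable_at_def by blast+
  have psd: "D2 f y h h \<ge> c * (norm h)\<^sup>2" for y
  proof -
    have "0 \<le> h \<bullet> ((hess f y - c *\<^sub>R mat 1) *v h)"
      using assms unfolding strongly_convex_def pos_semidef_def by blast
    then have "0 \<le> h \<bullet> (hess f y *v h) - c * (h \<bullet> h)"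
      by (simp add: matrix_vector_mult_diff_rdistrib inner_diff_right scaleR_matrix_vector_assoc[symmetric])
    then show ?thesis by (simp add: hess_quadratic_form power2_norm_eq_inner)
  qed
  define df where "df = (\<lambda>m::nat. \<lambda>s::real. if m = 0 then f (x + s *\<^sub>R h) else if m = 1 then blinfun_apply (frechet f (x + s *\<^sub>R h)) h
     else D2 f (x + s *\<^sub>R h) h h)"
  have df0: "df 0 = (\<lambda>s. f (x + s *\<^sub>R h))" by (simp add: df_def)
  have der: "\<forall>m t. m < 2 \<and> \<bar>t\<bar> \<le> \<bar>s\<bar> \<longrightarrow> DERIV (df m) t :> df (Suc m) t" for s :: real
    using line_derivative_real[OF d1] line_derivative_apply[OF d2 bounded_linear_eval1] by (auto simp: df_def less_2_cases_iff)
  obtain t1 where t1: "f (x + 1 *\<^sub>R h) = (\<Sum>m<2. df m 0 / fact m * 1 ^ m) + df 2 t1 / fact 2 * 1 ^ 2"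
    using Maclaurin_bi_le[of df "\<lambda>s. f (x + s *\<^sub>R h)" 2 1, OF df0 der] by blast
  obtain t2 where t2: "f (x + (-1) *\<^sub>R h) = (\<Sum>m<2. df m 0 / fact m * (-1) ^ m) + df 2 t2 / fact 2 * (-1) ^ 2"
    using Maclaurin_bi_le[of df "\<lambda>s. f (x + s *\<^sub>R h)" 2 "-1", OF df0 der] by blast
  have "f (x + h) + f (x - h) - 2 * f x = (D2 f (x + t1 *\<^sub>R h) h h + D2 f (x + t2 *\<^sub>R h) h h) / 2"
    using t1 t2 by (simp add: df_def eval_nat_numeral)
  then show ?thesis using psd[of "x + t1 *\<^sub>R h"] psd[of "x + t2 *\<^sub>R h"] by simp
qed

text \<open>Symmetry of the Hessian is read off from \<open>pos_semidef\<close>, which contains it,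
  rather than from continuity of second derivatives.\<close>

lemma strongly_convex_symmetric:
  assumes "strongly_convex c f"
  shows "D2 f x u v = D2 f x v u"
proof -
  have "transpose (hess f x - c *\<^sub>R mat 1) = hess f x - c *\<^sub>R mat 1"
    using assms unfolding strongly_convex_def pos_semidef_def by blast
  moreover have "transpose (hess f x - c *\<^sub>R mat 1) = transpose (hess f x) - c *\<^sub>R mat 1"
    by (auto simp: transpose_def vec_eq_iff mat_def)
  ultimately have T: "transpose (hess f x) = hess f x" by simp
  have "u \<bullet> (hess f x *v v) = (transpose (hess f x) *v u) \<bullet> v"
    unfolding transpose_matrix_vector by (rule dot_lmul_matrix[symmetric])
  then have "u \<bullet> (hess f x *v v) = v \<bullet> (hess f x *v u)"
    unfolding T by (simp add: inner_commute)
  then show ?thesis by (simp add: hess_quadratic_form)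
qed

text \<open>Iterated midpoint inequality: after subtraction of the quadratic, the increment from 0
  to \<open>x\<close> is at least \<open>2^m\<close> times the increment over the initial fraction
  \<open>2^(-m)\<close> of the segment, and this tends to the derivative at zero.\<close>

lemma second_difference_lower_bound:
  fixes f :: "'a::real_inner \<Rightarrow> real"
  assumes d: "(f has_derivative (\<lambda>v. g \<bullet> v)) (at 0)"
    and sd: "\<And>x h. f (x + h) + f (x - h) - 2 * f x \<ge> c * (norm h)\<^sup>2"
  shows "f x \<ge> f 0 + g \<bullet> x + c / 2 * (norm x)\<^sup>2"
proof -
  define q where "q y = f y - c / 2 * (norm y)\<^sup>2" for y
  have mid: "q y - q 0 \<ge> 2 * (q ((1/2) *\<^sub>R y) - q 0)" for y
  proof -
    have "(1/2) *\<^sub>R y + (1/2) *\<^sub>R y = y" by (simp flip: scaleR_left_distrib)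
    then show ?thesis
      using sd[of "(1/2) *\<^sub>R y" "(1/2) *\<^sub>R y"] by (simp add: q_def power_divide algebra_simps)
  qed
  have it: "q x - q 0 \<ge> 2 ^ m * (q ((1/2) ^ m *\<^sub>R x) - q 0)" for m
  proof (induction m)
    case (Suc m)
    have "2 ^ m * (q ((1/2) ^ m *\<^sub>R x) - q 0) \<ge> 2 ^ m * (2 * (q ((1/2) *\<^sub>R (1/2) ^ m *\<^sub>R x) - q 0))"
      by (intro mult_left_mono mid) auto
    moreover have "2 ^ Suc m * (q ((1/2) ^ Suc m *\<^sub>R x) - q 0) = 2 ^ m * (2 * (q ((1/2) *\<^sub>R (1/2) ^ m *\<^sub>R x) - q 0))"
      by simp
    ultimately show ?case using Suc by linarith
  qed simp
  have dq: "(q has_derivative (\<lambda>v. g \<bullet> v)) (at 0)"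
    unfolding q_def power2_norm_eq_inner using d by (auto intro!: derivative_eq_intros)
  have "((\<lambda>s::real. q (0 + s *\<^sub>R x)) has_real_derivative g \<bullet> x) (at 0)"
  proof -
    have "((\<lambda>s::real. 0 + s *\<^sub>R x) has_derivative (\<lambda>s. s *\<^sub>R x)) (at 0)"
      by (auto intro!: derivative_eq_intros)
    from has_derivative_compose[OF this, of q "\<lambda>v. g \<bullet> v"] dq
    show ?thesis unfolding has_field_derivative_def
      by simp (auto elim!: has_derivative_eq_rhs simp: fun_eq_iff)
  qed
  then have "((\<lambda>s. (q (s *\<^sub>R x) - q 0) / s) \<longlongrightarrow> g \<bullet> x) (at 0)"
    unfolding has_field_derivative_iff by simp
  moreover have "filterlim (\<lambda>m. (1/2::real) ^ m) (at 0) sequentially"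
    by (intro filterlim_atI LIMSEQ_power_zero) (auto intro!: always_eventually)
  ultimately have "(\<lambda>m. (q ((1/2) ^ m *\<^sub>R x) - q 0) / (1/2) ^ m) \<longlonglongrightarrow> g \<bullet> x"
    by (rule filterlim_compose)
  then have "(\<lambda>m. 2 ^ m * (q ((1/2) ^ m *\<^sub>R x) - q 0)) \<longlonglongrightarrow> g \<bullet> x"
    by (simp add: power_divide mult.commute)
  then have "g \<bullet> x \<le> q x - q 0" by (rule LIMSEQ_le_const2) (use it in auto)
  then show ?thesis by (simp add: q_def)
qed

text \<open>The even part is exactly quadratic along the line, so its derivative is
  \<open>2 * s * q\<close>. Dividing by \<open>s\<close> identifies \<open>q\<close> with
  differentiability of \<open>frechet F\<close> at \<open>x\<close> alone.\<close>

lemma quadratic_even_part: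
  assumes tw: "twice_differentiable_at F x"
    and q: "\<And>s. F (x + s *\<^sub>R h) + F (x - s *\<^sub>R h) = C + s\<^sup>2 * q"
  shows "q = D2 F x h h"
proof -
  have ev: "\<forall>\<^sub>F y in nhds x. F differentiable (at y)" and d2: "frechet F differentiable (at x)"
    using tw by (auto simp: twice_differentiable_at_def)
  have lim: "filterlim (\<lambda>s. x + s *\<^sub>R v) (nhds x) (at (0::real))" for v
    by (auto intro!: tendsto_eq_intros)
  define p where "p s = blinfun_apply (frechet F (x + s *\<^sub>R h)) h" for s
  define m where "m s = blinfun_apply (frechet F (x + s *\<^sub>R (- h))) (- h)" for s
  have dp: "((\<lambda>s. F (x + s *\<^sub>R h)) has_real_derivative p s) (at s)" if "F differentiable (at (x + s *\<^sub>R h))" for s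
    unfolding p_def by (rule line_derivative_real[OF that])
  have dm: "((\<lambda>s. F (x + s *\<^sub>R (- h))) has_real_derivative m s) (at s)" if "F differentiable (at (x + s *\<^sub>R (- h)))" for s
    unfolding m_def by (rule line_derivative_real[OF that])
  have "\<forall>\<^sub>F s in at 0. p s + m s = 2 * s * q"
    using filterlim_iff[THEN iffD1, OF lim, rule_format, OF ev, of h] filterlim_iff[THEN iffD1, OF lim, rule_format, OF ev, of "- h"]
  proof eventually_elim
    case (elim s)
    have "((\<lambda>s. F (x + s *\<^sub>R h) + F (x + s *\<^sub>R (- h))) has_real_derivative p s + m s) (at s)"
      by (intro DERIV_add dp dm elim)
    then have "((\<lambda>s. C + s\<^sup>2 * q) has_real_derivative p s + m s) (at s)" by (simp add: q)
    moreover have "((\<lambda>s. C + s\<^sup>2 * q) has_real_derivative 2 * s * q) (at s)"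
      by (auto intro!: derivative_eq_intros)
    ultimately show ?case by (rule DERIV_unique)
  qed
  then have "\<forall>\<^sub>F s in at 0. (p s - p 0) / s + (m s - m 0) / s = 2 * q"
    using eventually_neq_at_within[of 0]
  proof eventually_elim
    case (elim s)
    have "m 0 = - p 0" by (simp add: p_def m_def blinfun.minus_right)
    then have "(p s - p 0) / s + (m s - m 0) / s = (p s + m s) / s"
      by (simp add: add_divide_distrib diff_divide_distrib)
    then show ?case using elim by simp
  qed
  then have l1: "((\<lambda>s. (p s - p 0) / s + (m s - m 0) / s) \<longlongrightarrow> 2 * q) (at 0)"
    by (rule tendsto_eventually)
  have "(p has_real_derivative D2 F x h h) (at 0)"
    using line_derivative_apply[of "frechet F" x 0 h, OF _ bounded_linear_eval1[of h]] d2 unfolding p_def by simp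
  moreover have "(m has_real_derivative D2 F x h h) (at 0)"
    using line_derivative_apply[of "frechet F" x 0 "- h", OF _ bounded_linear_eval1[of "- h"]] d2 unfolding m_def
    by (simp add: blinfun.minus_right blinfun.minus_left)
  ultimately have "((\<lambda>s. (p s - p 0) / s + (m s - m 0) / s) \<longlongrightarrow> D2 F x h h + D2 F x h h) (at 0)"
    unfolding has_field_derivative_iff by (intro tendsto_add) auto
  from tendsto_unique[OF _ l1 this] show ?thesis by simp
qed

text \<open>Polarization, applied to unit vectors so that the sum of squares turns into a product of
  norms.\<close>

lemma symmetric_form_bound:
  fixes B :: "'a::real_inner \<Rightarrow> 'a \<Rightarrow> real"
  assumes lin: "bilinear B" and sym: "\<And>u v. B u v = B v u" and b: "\<And>v. \<bar>B v v\<bar> \<le> \<tau> * (norm v)\<^sup>2"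
  shows "\<bar>B u v\<bar> \<le> \<tau> * norm u * norm v"
proof -
  have half: "\<bar>B u v\<bar> \<le> \<tau> * ((norm u)\<^sup>2 + (norm v)\<^sup>2) / 2" for u v
  proof -
    have "4 * B u v = B (u + v) (u + v) - B (u - v) (u - v)"
      using sym[of u v] by (simp add: bilinear_ladd[OF lin] bilinear_radd[OF lin] bilinear_lsub[OF lin] bilinear_rsub[OF lin])
    then have "4 * \<bar>B u v\<bar> \<le> \<tau> * (norm (u + v))\<^sup>2 + \<tau> * (norm (u - v))\<^sup>2"
      using b[of "u + v"] b[of "u - v"] by linarith
    also have "\<dots> = 2 * (\<tau> * ((norm u)\<^sup>2 + (norm v)\<^sup>2))"
      by (simp add: power2_norm_eq_inner inner_add_left inner_add_right inner_diff_left inner_diff_right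
          inner_commute algebra_simps)
    finally show ?thesis by simp
  qed
  show ?thesis
  proof (cases "u = 0 \<or> v = 0")
    case True
    then show ?thesis by (auto simp: bilinear_lzero[OF lin] bilinear_rzero[OF lin])
  next
    case False
    define u' v' where "u' = u /\<^sub>R norm u" "v' = v /\<^sub>R norm v"
    have n: "norm u' = 1" "norm v' = 1" using False by (auto simp: u'_v'_def)
    have "B u v = B (norm u *\<^sub>R u') (norm v *\<^sub>R v')" using False by (simp add: u'_v'_def)
    also have "\<dots> = norm u * norm v * B u' v'"
      by (simp add: bilinear_lmul[OF lin] bilinear_rmul[OF lin])
    finally have "\<bar>B u v\<bar> = norm u * norm v * \<bar>B u' v'\<bar>" by (simp add: abs_mult)
    also have "\<dots> \<le> norm u * norm v * \<tau>" using half[of u' v'] n by (intro mult_left_mono) auto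
    finally show ?thesis by (simp add: mult_ac)
  qed
qed

text \<open>The gradient minus the identity is tested against its own increment \<open>w\<close>;
  the resulting function is scalar, so a single intermediate point from the mean value theorem
  suffices.\<close>

lemma gradient_near_identity:
  fixes f :: "real^'k \<Rightarrow> real"
  assumes d1: "\<And>x. f differentiable (at x)" and d2: "\<And>x. frechet f differentiable (at x)"
    and sym: "\<And>x u v. D2 f x u v = D2 f x v u"
    and b: "\<And>x v. norm x \<le> R \<Longrightarrow> \<bar>D2 f x v v - (norm v)\<^sup>2\<bar> \<le> \<tau> * (norm v)\<^sup>2"
    and R: "norm x \<le> R" "norm y \<le> R"
  shows "norm ((grad f x - x) - (grad f y - y)) \<le> \<tau> * norm (x - y)"
proof -
  have bound: "\<bar>D2 f z u v - u \<bullet> v\<bar> \<le> \<tau> * norm u * norm v" if "norm z \<le> R" for z u v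
  proof (rule symmetric_form_bound[where B = "\<lambda>u v. D2 f z u v - u \<bullet> v"])
    show "bilinear (\<lambda>u v. D2 f z u v - u \<bullet> v)"
      unfolding bilinear_def
      by (auto intro!: linearI simp: blinfun.add_right blinfun.add_left blinfun.scaleR_right blinfun.scaleR_left
          inner_add_left inner_add_right algebra_simps)
    show "D2 f z u v - u \<bullet> v = D2 f z v u - v \<bullet> u" for u v using sym by (simp add: inner_commute)
    show "\<bar>D2 f z v v - v \<bullet> v\<bar> \<le> \<tau> * (norm v)\<^sup>2" for v using b[OF that] by (simp add: power2_norm_eq_inner)
  qed
  define w where "w = (grad f x - x) - (grad f y - y)"
  let ?u = "x - y"
  have der: "((\<lambda>s. blinfun_apply (frechet f (y + s *\<^sub>R ?u)) w - (y + s *\<^sub>R ?u) \<bullet> w) has_real_derivative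
      D2 f (y + s *\<^sub>R ?u) ?u w - ?u \<bullet> w) (at s)" for s
    using line_derivative_apply[OF d2 bounded_linear_eval1, where x = y and s = s and u = ?u]
    by (auto intro!: derivative_eq_intros simp: inner_add_left)
  obtain s :: real where s: "0 < s" "s < 1" and eq:
     "(blinfun_apply (frechet f (y + 1 *\<^sub>R ?u)) w - (y + 1 *\<^sub>R ?u) \<bullet> w) - (blinfun_apply (frechet f (y + 0 *\<^sub>R ?u)) w - (y + 0 *\<^sub>R ?u) \<bullet> w)
      = (1 - 0) * (D2 f (y + s *\<^sub>R ?u) ?u w - ?u \<bullet> w)"
    using MVT2[OF zero_less_one, of "\<lambda>s. blinfun_apply (frechet f (y + s *\<^sub>R ?u)) w - (y + s *\<^sub>R ?u) \<bullet> w"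
        "\<lambda>s. D2 f (y + s *\<^sub>R ?u) ?u w - ?u \<bullet> w"] der by blast
  have "norm w * norm w = w \<bullet> w" by (simp flip: power2_norm_eq_inner power2_eq_square)
  also have "\<dots> = D2 f (y + s *\<^sub>R ?u) ?u w - ?u \<bullet> w"
    using eq by (simp add: w_def inner_diff_left flip: grad_inner)
  also have "\<dots> \<le> \<tau> * norm ?u * norm w"
    using bound[OF norm_segment_le[OF R(2,1) s], of ?u w] by (simp add: abs_le_iff)
  finally have *: "norm w * norm w \<le> \<tau> * norm ?u * norm w" .
  show ?thesis
  proof (cases "w = 0")
    \<comment> \<open>Here the right side must still be nonnegative; the sign of \<tau> is deduced
      from the bound on the form.\<close>
    case True
    have "0 \<le> \<tau> * (norm ?u * norm ?u)"
      using bound[OF R(1), of ?u ?u] by (metis abs_ge_zero mult.assoc order_trans)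
    then have "0 \<le> \<tau> * norm ?u"
    proof (cases "?u = 0")
      case False
      then have "0 < norm ?u * norm ?u" by simp
      then have "0 \<le> \<tau>" using \<open>0 \<le> \<tau> * (norm ?u * norm ?u)\<close> by (metis mult.commute mult_less_0_iff not_le)
      then show ?thesis by simp
    qed simp
    then show ?thesis using True unfolding w_def by simp
  next
    case False
    then show ?thesis using * unfolding w_def by simp
  qed
qed

lemma grad_lipschitz_on_ball:
  fixes f :: "real^'k \<Rightarrow> real"
  assumes d2: "\<And>x. frechet f differentiable (at x)"
    and b: "\<And>x. norm x \<le> R \<Longrightarrow> norm (frechet (frechet f) x) \<le> w"
    and R: "norm x \<le> R" "norm y \<le> R"
  shows "norm (grad f x - grad f y) \<le> w * norm (x - y)"
proof -
  have "norm (frechet f x - frechet f y) \<le> w * norm (x - y)"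
  proof (rule differentiable_bound[of "cball 0 R"])
    show "(frechet f has_derivative blinfun_apply (frechet (frechet f) z)) (at z within cball 0 R)" for z
      using frechet_has_derivative[OF d2] by (rule has_derivative_at_withinI)
    show "onorm (blinfun_apply (frechet (frechet f) z)) \<le> w" if "z \<in> cball 0 R" for z
      using b that by (simp add: norm_blinfun.rep_eq)
  qed (use R in auto)
  then show ?thesis using norm_grad_diff_le order_trans by blast
qed

lemma four_times_differentiable_sum:
  assumes fin: "finite I" and f: "\<And>i. i \<in> I \<Longrightarrow> four_times_differentiable (f i)"
  defines "F \<equiv> \<lambda>x. \<Sum>i\<in>I. f i x"
  shows "four_times_differentiable F"
    "frechet F = (\<lambda>x. \<Sum>i\<in>I. frechet (f i) x)"
    "frechet (frechet F) = (\<lambda>x. \<Sum>i\<in>I. frechet (frechet (f i)) x)"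
    "frechet (frechet (frechet (frechet F))) = (\<lambda>x. \<Sum>i\<in>I. frechet (frechet (frechet (frechet (f i)))) x)"
    "grad F x = (\<Sum>i\<in>I. grad (f i) x)"
proof -
  have d: "f i differentiable (at x)" "frechet (f i) differentiable (at x)"
    "frechet (frechet (f i)) differentiable (at x)" "frechet (frechet (frechet (f i))) differentiable (at x)"
    if "i \<in> I" for i x using f[OF that] by (auto simp: four_times_differentiable_def)
  show 1: "frechet F = (\<lambda>x. \<Sum>i\<in>I. frechet (f i) x)"
    unfolding F_def using d by (intro ext frechet_sum)
  show 2: "frechet (frechet F) = (\<lambda>x. \<Sum>i\<in>I. frechet (frechet (f i)) x)"
    unfolding 1 using d by (intro ext frechet_sum)
  have 3: "frechet (frechet (frechet F)) = (\<lambda>x. \<Sum>i\<in>I. frechet (frechet (frechet (f i))) x)"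
    unfolding 2 using d by (intro ext frechet_sum)
  show "frechet (frechet (frechet (frechet F))) = (\<lambda>x. \<Sum>i\<in>I. frechet (frechet (frechet (frechet (f i)))) x)"
    unfolding 3 using d by (intro ext frechet_sum)
  have "F differentiable (at x)" for x unfolding F_def using d fin by (intro differentiable_sum) auto
  moreover have "frechet F differentiable (at x)" for x unfolding 1 using d fin by (intro differentiable_sum) auto
  moreover have "frechet (frechet F) differentiable (at x)" for x
    unfolding 2 using d fin by (intro differentiable_sum) auto
  moreover have "frechet (frechet (frechet F)) differentiable (at x)" for x
    unfolding 3 using d fin by (intro differentiable_sum) auto
  ultimately show "four_times_differentiable F" unfolding four_times_differentiable_def by blast
  show "grad F x = (\<Sum>i\<in>I. grad (f i) x)"
    unfolding grad_def 1 by (simp add: vec_eq_iff blinfun.sum_left)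
qed

subsection \<open>Consequences of the moment conditions\<close>

definition fourth_sup :: "(real^'k \<Rightarrow> 'z \<Rightarrow> real) \<Rightarrow> nat \<Rightarrow> 'z \<Rightarrow> ennreal" where
  "fourth_sup l n z = (SUP \<theta>. ennreal (norm ((real n)\<^sup>2 *\<^sub>R
     frechet (frechet (frechet (frechet (\<lambda>t. local_loss l n t z)))) \<theta>)))"

text \<open>Fixes witnesses for the existential moment conditions, with real numbers in place of the
  suprema; curvature enters as an \<open>hp\<close> event.\<close>

locale cv_setting = iid P \<mu> Z
  for P :: "nat \<Rightarrow> 'w measure" and \<mu> :: "nat \<Rightarrow> 'z measure" and Z :: "nat \<Rightarrow> nat \<Rightarrow> 'w \<Rightarrow> 'z" +
  fixes l :: "real^'k \<Rightarrow> 'z \<Rightarrow> real" and \<theta>0 :: "real^'k" and S :: "real^'k^'k"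
    and B C :: "nat \<Rightarrow> 'z \<Rightarrow> real" and KB KC MG MD c :: real
  assumes l_meas: "\<And>n \<beta>. n \<ge> 1 \<Longrightarrow> l \<beta> \<in> borel_measurable (\<mu> n)"
    and stable: "stable_parameters \<mu> l \<theta>0 S"
    and limit: "normalized_limit_risk P Z l \<theta>0"
    and theta_bounded: "bounded_in_prob P (\<lambda>n \<omega>. theta_hat l n (sample Z n \<omega>))"
    and c: "c > 0"
    and convex: "hp P (\<lambda>n \<omega>. strongly_convex c (total_loss l n (sample Z n \<omega>)))"
    and B_meas: "\<And>n. n \<ge> 1 \<Longrightarrow> B n \<in> borel_measurable (\<mu> n)"
    and B_lip: "\<And>n. n \<ge> 1 \<Longrightarrow> AE z in \<mu> n. \<forall>\<theta> \<theta>'.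
                norm (sqrt (real n) *\<^sub>R grad (\<lambda>t. local_loss l n t z) \<theta>
                      - sqrt (real n) *\<^sub>R grad (\<lambda>t. local_loss l n t z) \<theta>') \<le> B n z * norm (\<theta> - \<theta>')"
    and KB: "KB \<ge> 0" "\<And>n. n \<ge> 1 \<Longrightarrow> (\<integral>\<^sup>+z. ennreal ((B n z)\<^sup>2) \<partial>\<mu> n) \<le> ennreal KB"
    and MG: "\<And>n. n \<ge> 1 \<Longrightarrow>
        (\<integral>\<^sup>+z. ennreal (norm (sqrt (real n) *\<^sub>R grad (\<lambda>t. local_loss l n t z) \<theta>0) ^ 4) \<partial>\<mu> n) \<le> ennreal MG"
    and hess_bounded: "bounded_in_prob P (\<lambda>n \<omega>. (1 / real n) *
        (\<Sum>i=1..n. (norm (real n *\<^sub>R frechet (frechet (\<lambda>t. local_loss l n t (Z n i \<omega>))) \<theta>0))\<^sup>2))"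
    and C_meas: "\<And>n. n \<ge> 1 \<Longrightarrow> C n \<in> borel_measurable (\<mu> n)"
    and C_lip: "\<And>n. n \<ge> 1 \<Longrightarrow> AE z in \<mu> n. \<forall>\<theta> \<theta>'.
                norm (real n *\<^sub>R frechet (frechet (\<lambda>t. local_loss l n t z)) \<theta>
                      - real n *\<^sub>R frechet (frechet (\<lambda>t. local_loss l n t z)) \<theta>') \<le> C n z * norm (\<theta> - \<theta>')"
    and KC: "\<And>n. n \<ge> 1 \<Longrightarrow> (\<integral>\<^sup>+z. ennreal ((C n z)\<^sup>2) \<partial>\<mu> n) \<le> ennreal KC"
    and four: "\<And>n. n \<ge> 1 \<Longrightarrow> AE z in \<mu> n. four_times_differentiable (\<lambda>t. local_loss l n t z)"
    and fourth_meas: "\<And>n. n \<ge> 1 \<Longrightarrow> fourth_sup l n \<in> borel_measurable (\<mu> n)"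
    and MD: "\<And>n. n \<ge> 1 \<Longrightarrow> (\<integral>\<^sup>+z. fourth_sup l n z ^ 4 \<partial>\<mu> n) \<le> ennreal MD"
begin

abbreviation loss :: "nat \<Rightarrow> 'z \<Rightarrow> real^'k \<Rightarrow> real" where
  "loss n z \<equiv> (\<lambda>t. local_loss l n t z)"

abbreviation sample_loss :: "nat \<Rightarrow> 'w \<Rightarrow> real^'k \<Rightarrow> real" where
  "sample_loss n \<omega> \<equiv> (\<lambda>t. \<Sum>i=1..n. loss n (Z n i \<omega>) t)"

abbreviation loo_sample_loss :: "nat \<Rightarrow> nat \<Rightarrow> 'w \<Rightarrow> real^'k \<Rightarrow> real" where
  "loo_sample_loss n i \<omega> \<equiv> (\<lambda>t. \<Sum>j\<in>{1..n} - {i}. loss n (Z n j \<omega>) t)"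

abbreviation near_identity :: "nat \<Rightarrow> 'w \<Rightarrow> real \<Rightarrow> real \<Rightarrow> bool" where
  "near_identity n \<omega> R \<tau> \<equiv>
     \<forall>x v. norm x \<le> R \<longrightarrow> \<bar>D2 (sample_loss n \<omega>) x v v - (norm v)\<^sup>2\<bar> \<le> \<tau> * (norm v)\<^sup>2"

abbreviation total_convex :: "nat \<Rightarrow> 'w \<Rightarrow> bool" where
  "total_convex n \<omega> \<equiv> strongly_convex c (total_loss l n (sample Z n \<omega>))"

definition fourth_bd :: "nat \<Rightarrow> 'z \<Rightarrow> real" where
  "fourth_bd n z = enn2real (fourth_sup l n z)"

definition score :: "nat \<Rightarrow> 'z \<Rightarrow> real^'k" where
  "score n z = grad (\<lambda>\<beta>. l \<beta> z) (\<theta>0 /\<^sub>R sqrt (real n))"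

text \<open>The almost sure regularity of one observation, with the scaling divided out: increments
  of the gradient have order \<open>n^(-1/2)\<close>, those of the Hessian order
  \<open>n^(-1)\<close>, and the fourth derivative order \<open>n^(-2)\<close>.\<close>

definition good :: "nat \<Rightarrow> 'z \<Rightarrow> bool" where
  "good n z \<longleftrightarrow> four_times_differentiable (loss n z) \<and>
     (\<forall>\<theta> \<theta>'. norm (grad (loss n z) \<theta> - grad (loss n z) \<theta>') \<le> \<bar>B n z\<bar> / sqrt n * norm (\<theta> - \<theta>')) \<and>
     (\<forall>\<theta> \<theta>'. norm (frechet (frechet (loss n z)) \<theta> - frechet (frechet (loss n z)) \<theta>') \<le> \<bar>C n z\<bar> / n * norm (\<theta> - \<theta>')) \<and>
     (\<forall>\<theta>. norm (frechet (frechet (frechet (frechet (loss n z)))) \<theta>) \<le> fourth_bd n z / (real n)\<^sup>2)"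

abbreviation all_good :: "nat \<Rightarrow> 'w \<Rightarrow> bool" where
  "all_good n \<omega> \<equiv> \<forall>i\<in>{1..n}. good n (Z n i \<omega>)"

lemma fourth_bd_nonneg: "fourth_bd n z \<ge> 0" by (simp add: fourth_bd_def)

lemma AE_good: assumes n: "n \<ge> 1" shows "AE z in \<mu> n. good n z"
proof -
  \<comment> \<open>A finite fourth moment makes the supremum finite almost surely, so that
    \<open>enn2real\<close> in \<open>fourth_bd\<close> loses nothing.\<close>
  have fin: "AE z in \<mu> n. fourth_sup l n z ^ 4 \<noteq> \<infinity>"
    using fourth_meas[OF n] MD[OF n] by (intro nn_integral_noteq_infinite) (auto simp: top_unique)
  show ?thesis using four[OF n] B_lip[OF n] C_lip[OF n] fin
  proof eventually_elim
    case (elim z)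
    have "norm (grad (loss n z) \<theta> - grad (loss n z) \<theta>') \<le> \<bar>B n z\<bar> / sqrt n * norm (\<theta> - \<theta>')" for \<theta> \<theta>'
    proof -
      have "sqrt n * norm (grad (loss n z) \<theta> - grad (loss n z) \<theta>') =
          norm (sqrt n *\<^sub>R grad (loss n z) \<theta> - sqrt n *\<^sub>R grad (loss n z) \<theta>')"
        by (simp flip: scaleR_diff_right)
      also have "\<dots> \<le> B n z * norm (\<theta> - \<theta>')" using elim by blast
      also have "\<dots> \<le> \<bar>B n z\<bar> * norm (\<theta> - \<theta>')" by (intro mult_right_mono) auto
      finally show ?thesis using n by (simp add: field_simps)
    qed
    moreover have "norm (frechet (frechet (loss n z)) \<theta> - frechet (frechet (loss n z)) \<theta>') \<le> \<bar>C n z\<bar> / n * norm (\<theta> - \<theta>')" for \<theta> \<theta>'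
    proof -
      have "n * norm (frechet (frechet (loss n z)) \<theta> - frechet (frechet (loss n z)) \<theta>') =
          norm (real n *\<^sub>R frechet (frechet (loss n z)) \<theta> - real n *\<^sub>R frechet (frechet (loss n z)) \<theta>')"
        by (simp flip: scaleR_diff_right)
      also have "\<dots> \<le> C n z * norm (\<theta> - \<theta>')" using elim by blast
      also have "\<dots> \<le> \<bar>C n z\<bar> * norm (\<theta> - \<theta>')" by (intro mult_right_mono) auto
      finally show ?thesis using n by (simp add: field_simps)
    qed
    moreover have "norm (frechet (frechet (frechet (frechet (loss n z)))) \<theta>) \<le> fourth_bd n z / (real n)\<^sup>2" for \<theta>
    proof -
      have "fourth_sup l n z \<noteq> \<infinity>" using elim(4) by (auto simp: eval_nat_numeral)
      then have "fourth_sup l n z < top" by (simp add: less_top)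
      then have eq: "ennreal (fourth_bd n z) = fourth_sup l n z" unfolding fourth_bd_def by (rule ennreal_enn2real)
      have "ennreal (norm ((real n)\<^sup>2 *\<^sub>R frechet (frechet (frechet (frechet (loss n z)))) \<theta>)) \<le> ennreal (fourth_bd n z)"
        unfolding eq fourth_sup_def by (rule SUP_upper) simp
      then have "(real n)\<^sup>2 * norm (frechet (frechet (frechet (frechet (loss n z)))) \<theta>) \<le> fourth_bd n z"
        by (simp add: fourth_bd_nonneg)
      then show ?thesis using n by (simp add: field_simps)
    qed
    ultimately show ?case using elim(1) unfolding good_def by blast
  qed
qed

lemma hp_good: "hp P (\<lambda>n \<omega>. all_good n \<omega>)"
  using AE_Z[OF _ AE_good] by (intro hp_AE) auto

lemma good_differentiable:
  assumes "good n z"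
  shows "loss n z differentiable (at x)" "frechet (loss n z) differentiable (at x)"
    "(loss n z has_derivative (\<lambda>v. grad (loss n z) x \<bullet> v)) (at x)" "continuous_on UNIV (loss n z)"
proof -
  show 1: "loss n z differentiable (at x)" "frechet (loss n z) differentiable (at x)" for x
    using assms by (auto simp: good_def four_times_differentiable_def)
  show "(loss n z has_derivative (\<lambda>v. grad (loss n z) x \<bullet> v)) (at x)" by (rule grad_has_derivative[OF 1(1)])
  show "continuous_on UNIV (loss n z)"
    by (intro continuous_at_imp_continuous_on ballI differentiable_imp_continuous_within 1(1))
qed

lemma good_grad:
  assumes n: "n \<ge> 1" and z: "good n z"
  shows "grad (loss n z) \<theta>0 = score n z /\<^sub>R sqrt n"
proof -
  have n0: "sqrt n > 0" using n by simp
  have "((\<lambda>\<beta>::real^'k. sqrt n *\<^sub>R \<beta>) has_derivative (\<lambda>v. sqrt n *\<^sub>R v)) (at (\<theta>0 /\<^sub>R sqrt n))"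
    by (auto intro!: derivative_eq_intros)
  moreover have "(loss n z has_derivative (\<lambda>v. grad (loss n z) \<theta>0 \<bullet> v)) (at (sqrt n *\<^sub>R (\<theta>0 /\<^sub>R sqrt n)))"
    using good_differentiable(3)[OF z, of \<theta>0] n0 by simp
  ultimately have "((\<lambda>\<beta>. loss n z (sqrt n *\<^sub>R \<beta>)) has_derivative (\<lambda>v. grad (loss n z) \<theta>0 \<bullet> (sqrt n *\<^sub>R v))) (at (\<theta>0 /\<^sub>R sqrt n))"
    by (rule has_derivative_compose)
  moreover have "(\<lambda>\<beta>. loss n z (sqrt n *\<^sub>R \<beta>)) = (\<lambda>\<beta>. l \<beta> z)" using n0 by (simp add: local_loss_def)
  ultimately have "((\<lambda>\<beta>. l \<beta> z) has_derivative (\<lambda>v. (sqrt n *\<^sub>R grad (loss n z) \<theta>0) \<bullet> v)) (at (\<theta>0 /\<^sub>R sqrt n))"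
    by simp
  then have "score n z = sqrt n *\<^sub>R grad (loss n z) \<theta>0" unfolding score_def by (rule grad_eqI)
  then show ?thesis using n0 by simp
qed

section \<open>Moments of the score at the true parameter\<close>

lemma loss_meas: "n \<ge> 1 \<Longrightarrow> (\<lambda>z. loss n z t) \<in> borel_measurable (\<mu> n)"
  unfolding local_loss_def using l_meas by blast

lemma stableD:
  assumes n: "n \<ge> 1"
  shows "integrable (\<mu> n) (\<lambda>z. loss n z t)" "(\<integral>z. loss n z \<theta>0 \<partial>\<mu> n) \<le> (\<integral>z. loss n z t \<partial>\<mu> n)"
    "score n \<in> borel_measurable (\<mu> n)" "integrable (\<mu> n) (\<lambda>z. (norm (score n z))\<^sup>2)"
    "cov_matrix (\<mu> n) (score n) = S"
proof -
  have eq: "(\<lambda>z. grad (\<lambda>\<beta>. l \<beta> z) (\<theta>0 /\<^sub>R sqrt (real n))) = score n" by (simp add: score_def fun_eq_iff)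
  note st = stable[unfolded stable_parameters_def Let_def, THEN conjunct2, THEN spec, THEN mp, OF n]
  note * = st[THEN conjunct1] st[THEN conjunct2, THEN conjunct1]
    st[THEN conjunct2, THEN conjunct2, THEN conjunct1]
    st[THEN conjunct2, THEN conjunct2, THEN conjunct2, THEN conjunct1]
    st[THEN conjunct2, THEN conjunct2, THEN conjunct2, THEN conjunct2]
  show "integrable (\<mu> n) (\<lambda>z. loss n z t)" using *(1)[rule_format, of t] by simp
  show "(\<integral>z. loss n z \<theta>0 \<partial>\<mu> n) \<le> (\<integral>z. loss n z t \<partial>\<mu> n)" using *(2) by (simp add: is_arg_min_linorder)
  show "score n \<in> borel_measurable (\<mu> n)" "cov_matrix (\<mu> n) (score n) = S"
    unfolding eq[symmetric] by (rule *(3), rule *(5))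
  show "integrable (\<mu> n) (\<lambda>z. (norm (score n z))\<^sup>2)"
    unfolding score_def by (rule *(4))
qed

lemma score_nth_meas: "n \<ge> 1 \<Longrightarrow> (\<lambda>z. score n z $ i) \<in> borel_measurable (\<mu> n)"
  using borel_measurable_inner[OF stableD(3) borel_measurable_const[of "axis i 1"]] by (simp add: inner_axis)

lemma B2_integrable:
  assumes n: "n \<ge> 1"
  shows "integrable (\<mu> n) (\<lambda>z. (B n z)\<^sup>2)" "(\<integral>z. (B n z)\<^sup>2 \<partial>\<mu> n) \<le> KB" "integrable (\<mu> n) (\<lambda>z. \<bar>B n z\<bar>)"
proof -
  interpret m: prob_space "\<mu> n" using n by (rule prob_mu)
  note [measurable] = B_meas[OF n]
  have "(\<integral>\<^sup>+z. ennreal ((B n z)\<^sup>2) \<partial>\<mu> n) < \<infinity>" using KB(2)[OF n] by (simp add: le_less_trans)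
  then show i: "integrable (\<mu> n) (\<lambda>z. (B n z)\<^sup>2)" by (intro integrableI_nonneg) auto
  have "ennreal (\<integral>z. (B n z)\<^sup>2 \<partial>\<mu> n) \<le> ennreal KB"
    using KB(2)[OF n] nn_integral_eq_integral[OF i] by simp
  then show "(\<integral>z. (B n z)\<^sup>2 \<partial>\<mu> n) \<le> KB" using KB(1) by simp
  show "integrable (\<mu> n) (\<lambda>z. \<bar>B n z\<bar>)"
    using m.square_integrable_imp_integrable[OF B_meas[OF n] i] by simp
qed

lemma score_inner_integrable: assumes n: "n \<ge> 1" shows "integrable (\<mu> n) (\<lambda>z. score n z \<bullet> v)"
    "integrable (\<mu> n) (\<lambda>z. score n z $ a * score n z $ b)"
proof -
  interpret m: prob_space "\<mu> n" using n by (rule prob_mu)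
  note [measurable] = stableD(3)[OF n]
  have "integrable (\<mu> n) (\<lambda>z. (norm v * norm (score n z))\<^sup>2)"
    using stableD(4)[OF n] by (simp add: power_mult_distrib)
  then have i: "integrable (\<mu> n) (\<lambda>z. norm v * norm (score n z))"
    by (rule m.square_integrable_imp_integrable[rotated]) measurable
  show "integrable (\<mu> n) (\<lambda>z. score n z \<bullet> v)"
    by (rule Bochner_Integration.integrable_bound[OF i])
      (auto simp: abs_mult mult.commute intro!: AE_I2 order_trans[OF Cauchy_Schwarz_ineq2])
  have [measurable]: "(\<lambda>z. score n z $ i) \<in> borel_measurable (\<mu> n)" for i
    by (rule score_nth_meas[OF n])
  show "integrable (\<mu> n) (\<lambda>z. score n z $ a * score n z $ b)"
  proof (rule Bochner_Integration.integrable_bound[OF stableD(4)[OF n]])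
    show "AE z in \<mu> n. norm (score n z $ a * score n z $ b) \<le> norm ((norm (score n z))\<^sup>2)"
      by (auto simp: abs_mult power2_eq_square intro!: AE_I2 mult_mono component_le_norm_cart)
  qed measurable
qed

text \<open>Expectation and derivative are not interchanged. Since \<theta>0 minimizes the expected
  loss, integrating the first-order Taylor bound with remainder \<open>B\<close> gives
  \<open>0 \<le> E (score \<bullet> v) + s * b * (norm v)^2\<close> for small positive
  \<open>s\<close>; then \<open>v\<close> and \<open>- v\<close> are both inserted.\<close>

lemma score_mean: assumes n: "n \<ge> 1" shows "(\<integral>z. score n z \<bullet> v \<partial>\<mu> n) = 0"
proof -
  interpret m: prob_space "\<mu> n" using n by (rule prob_mu)
  define b where "b = (\<integral>z. \<bar>B n z\<bar> \<partial>\<mu> n)"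
  have nn: "(\<integral>z. score n z \<bullet> v \<partial>\<mu> n) \<ge> 0" for v
  proof (rule field_le_epsilon)
    fix e :: real assume e: "e > 0"
    define s where "s = e / (b * (norm v)\<^sup>2 + 1)"
    have b0: "b \<ge> 0" by (simp add: b_def)
    then have bv: "b * (norm v)\<^sup>2 \<ge> 0" by simp
    then have s: "s > 0" "s * (b * (norm v)\<^sup>2) \<le> e" using e by (auto simp: s_def field_simps)
    have sq: "sqrt n > 0" using n by simp
    have le: "AE z in \<mu> n. loss n z (\<theta>0 + s *\<^sub>R v) \<le> loss n z \<theta>0 + (s / sqrt n) * (score n z \<bullet> v) + (s\<^sup>2 * (norm v)\<^sup>2 / sqrt n) * \<bar>B n z\<bar>"
      using AE_good[OF n]
    proof eventually_elim
      case (elim z)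
      let ?y = "\<theta>0 + s *\<^sub>R v" and ?R = "norm \<theta>0 + norm (s *\<^sub>R v)"
      have "\<bar>loss n z ?y - loss n z \<theta>0 - grad (loss n z) \<theta>0 \<bullet> (?y - \<theta>0)\<bar> \<le> \<bar>B n z\<bar> / sqrt n * (norm (?y - \<theta>0))\<^sup>2"
      proof (rule taylor_first_order[where R = ?R])
        show "(loss n z has_derivative (\<lambda>v. grad (loss n z) x \<bullet> v)) (at x)" for x
          by (rule good_differentiable(3)[OF elim])
        show "norm (grad (loss n z) x - grad (loss n z) \<theta>0) \<le> \<bar>B n z\<bar> / sqrt n * norm (x - \<theta>0)" for x
          using elim unfolding good_def by blast
        show "norm ?y \<le> ?R" by (rule norm_triangle_ineq)
        show "norm \<theta>0 \<le> ?R" by simp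
      qed
      then have "loss n z ?y \<le> loss n z \<theta>0 + grad (loss n z) \<theta>0 \<bullet> (s *\<^sub>R v) + \<bar>B n z\<bar> / sqrt n * (norm (s *\<^sub>R v))\<^sup>2"
        by (simp add: abs_le_iff)
      also have "grad (loss n z) \<theta>0 \<bullet> (s *\<^sub>R v) = (s / sqrt n) * (score n z \<bullet> v)"
        by (simp add: good_grad[OF n elim] divide_inverse)
      also have "\<bar>B n z\<bar> / sqrt n * (norm (s *\<^sub>R v))\<^sup>2 = (s\<^sup>2 * (norm v)\<^sup>2 / sqrt n) * \<bar>B n z\<bar>"
        by (simp add: power_mult_distrib)
      finally show ?case .
    qed
    have "(\<integral>z. loss n z \<theta>0 \<partial>\<mu> n) \<le> (\<integral>z. loss n z (\<theta>0 + s *\<^sub>R v) \<partial>\<mu> n)" by (rule stableD(2)[OF n])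
    also have "\<dots> \<le> (\<integral>z. loss n z \<theta>0 + (s / sqrt n) * (score n z \<bullet> v) + (s\<^sup>2 * (norm v)\<^sup>2 / sqrt n) * \<bar>B n z\<bar> \<partial>\<mu> n)"
      using le by (intro integral_mono_AE Bochner_Integration.integrable_add integrable_mult_right
          stableD(1)[OF n] score_inner_integrable[OF n] B2_integrable(3)[OF n]) auto
    also have "\<dots> = (\<integral>z. loss n z \<theta>0 \<partial>\<mu> n) + (s / sqrt n) * (\<integral>z. score n z \<bullet> v \<partial>\<mu> n) + (s\<^sup>2 * (norm v)\<^sup>2 / sqrt n) * b"
      using stableD(1)[OF n] score_inner_integrable[OF n] B2_integrable(3)[OF n] by (simp add: b_def)
    finally have "0 \<le> (s / sqrt n) * (\<integral>z. score n z \<bullet> v \<partial>\<mu> n) + (s\<^sup>2 * (norm v)\<^sup>2 / sqrt n) * b" by simp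
    also have "\<dots> = (s / sqrt n) * ((\<integral>z. score n z \<bullet> v \<partial>\<mu> n) + s * (b * (norm v)\<^sup>2))"
      by (simp add: power2_eq_square algebra_simps)
    finally have "0 \<le> (\<integral>z. score n z \<bullet> v \<partial>\<mu> n) + s * (b * (norm v)\<^sup>2)"
      using divide_pos_pos[OF s(1) sq] by (meson mult_pos_neg not_le)
    then show "0 \<le> (\<integral>z. score n z \<bullet> v \<partial>\<mu> n) + e" using s(2) by linarith
  qed
  have "(\<integral>z. score n z \<bullet> (- v) \<partial>\<mu> n) = - (\<integral>z. score n z \<bullet> v \<partial>\<mu> n)" by simp
  then show ?thesis using nn[of v] nn[of "- v"] by linarith
qed

lemma score_cov: assumes n: "n \<ge> 1" shows "(\<integral>z. score n z $ a * score n z $ b \<partial>\<mu> n) = S $ a $ b"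
proof -
  have mean: "(\<integral>z. score n z $ i \<partial>\<mu> n) = 0" for i
    using score_mean[OF n, of "axis i 1"] by (simp add: inner_axis)
  have "S $ a $ b = cov_matrix (\<mu> n) (score n) $ a $ b" by (simp add: stableD(5)[OF n])
  then show ?thesis by (simp add: cov_matrix_def mean)
qed

text \<open>This is the variance in the central limit theorem for \<open>score \<bullet> v\<close>;
  for \<open>v \<noteq> 0\<close> it is positive since \<open>S\<close> is positive
  definite.\<close>

lemma score_inner_square: assumes n: "n \<ge> 1"
  shows "integrable (\<mu> n) (\<lambda>z. (score n z \<bullet> v)\<^sup>2)" "(\<integral>z. (score n z \<bullet> v)\<^sup>2 \<partial>\<mu> n) = v \<bullet> (S *v v)"
proof -
  have eq: "(score n z \<bullet> v)\<^sup>2 = (\<Sum>a\<in>UNIV. \<Sum>b\<in>UNIV. (v $ a * v $ b) * (score n z $ a * score n z $ b))" for z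
    by (simp add: inner_vec_def power2_eq_square sum_product mult_ac)
  show "integrable (\<mu> n) (\<lambda>z. (score n z \<bullet> v)\<^sup>2)"
    unfolding eq by (intro Bochner_Integration.integrable_sum integrable_mult_right score_inner_integrable[OF n])
  have "(\<integral>z. (score n z \<bullet> v)\<^sup>2 \<partial>\<mu> n) = (\<Sum>a\<in>UNIV. \<integral>z. (\<Sum>b\<in>UNIV. (v $ a * v $ b) * (score n z $ a * score n z $ b)) \<partial>\<mu> n)"
    unfolding eq by (intro Bochner_Integration.integral_sum Bochner_Integration.integrable_sum
        integrable_mult_right score_inner_integrable[OF n])
  also have "\<dots> = (\<Sum>a\<in>UNIV. \<Sum>b\<in>UNIV. \<integral>z. (v $ a * v $ b) * (score n z $ a * score n z $ b) \<partial>\<mu> n)"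
    by (intro sum.cong refl Bochner_Integration.integral_sum integrable_mult_right score_inner_integrable[OF n])
  also have "\<dots> = (\<Sum>a\<in>UNIV. \<Sum>b\<in>UNIV. v $ a * (S $ a $ b * v $ b))"
    using score_inner_integrable[OF n] by (simp add: score_cov[OF n] mult_ac)
  also have "\<dots> = v \<bullet> (S *v v)" by (simp add: inner_vec_def matrix_vector_mult_def sum_distrib_left)
  finally show "(\<integral>z. (score n z \<bullet> v)\<^sup>2 \<partial>\<mu> n) = v \<bullet> (S *v v)" .
qed

lemma score4: assumes n: "n \<ge> 1"
  shows "integrable (\<mu> n) (\<lambda>z. norm (score n z) ^ 4)" "(\<integral>z. norm (score n z) ^ 4 \<partial>\<mu> n) \<le> max MG 0"
    "(\<integral>\<^sup>+z. ennreal (norm (score n z) ^ 4) \<partial>\<mu> n) \<le> ennreal MG"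
proof -
  note [measurable] = stableD(3)[OF n]
  have "AE z in \<mu> n. ennreal (norm (score n z) ^ 4) = ennreal (norm (sqrt (real n) *\<^sub>R grad (loss n z) \<theta>0) ^ 4)"
    using AE_good[OF n] by eventually_elim (use n in \<open>simp add: good_grad\<close>)
  then have "(\<integral>\<^sup>+z. ennreal (norm (score n z) ^ 4) \<partial>\<mu> n) =
      (\<integral>\<^sup>+z. ennreal (norm (sqrt (real n) *\<^sub>R grad (loss n z) \<theta>0) ^ 4) \<partial>\<mu> n)" by (rule nn_integral_cong_AE)
  also have "\<dots> \<le> ennreal MG" by (rule MG[OF n])
  finally show le: "(\<integral>\<^sup>+z. ennreal (norm (score n z) ^ 4) \<partial>\<mu> n) \<le> ennreal MG" .
  then have "(\<integral>\<^sup>+z. ennreal (norm (score n z) ^ 4) \<partial>\<mu> n) < \<infinity>" by (simp add: le_less_trans)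
  then show i: "integrable (\<mu> n) (\<lambda>z. norm (score n z) ^ 4)" by (intro integrableI_nonneg) auto
  have "ennreal (\<integral>z. norm (score n z) ^ 4 \<partial>\<mu> n) \<le> ennreal (max MG 0)"
    using le nn_integral_eq_integral[OF i] by (simp add: ennreal_max_0 max.commute)
  then show "(\<integral>z. norm (score n z) ^ 4 \<partial>\<mu> n) \<le> max MG 0" by (subst (asm) ennreal_le_iff) auto
qed

lemma score_inner4: assumes n: "n \<ge> 1"
  shows "integrable (\<mu> n) (\<lambda>z. (score n z \<bullet> v) ^ 4)" "(\<integral>z. (score n z \<bullet> v) ^ 4 \<partial>\<mu> n) \<le> norm v ^ 4 * max MG 0"
proof -
  note [measurable] = stableD(3)[OF n]
  have le: "(score n z \<bullet> v) ^ 4 \<le> norm v ^ 4 * norm (score n z) ^ 4" for z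
  proof -
    have "\<bar>score n z \<bullet> v\<bar> ^ 4 \<le> (norm (score n z) * norm v) ^ 4" by (intro power_mono Cauchy_Schwarz_ineq2) auto
    then show ?thesis by (simp add: power_mult_distrib mult.commute)
  qed
  have i: "integrable (\<mu> n) (\<lambda>z. norm v ^ 4 * norm (score n z) ^ 4)" using score4(1)[OF n] by simp
  show i': "integrable (\<mu> n) (\<lambda>z. (score n z \<bullet> v) ^ 4)"
    by (rule Bochner_Integration.integrable_bound[OF i]) (use le in \<open>auto intro!: AE_I2\<close>)
  have "(\<integral>z. (score n z \<bullet> v) ^ 4 \<partial>\<mu> n) \<le> (\<integral>z. norm v ^ 4 * norm (score n z) ^ 4 \<partial>\<mu> n)"
    using i i' le by (intro integral_mono) auto
  also have "\<dots> \<le> norm v ^ 4 * max MG 0" using score4(2)[OF n] by (simp add: mult_left_mono)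
  finally show "(\<integral>z. (score n z \<bullet> v) ^ 4 \<partial>\<mu> n) \<le> norm v ^ 4 * max MG 0" .
qed

text \<open>Products of score coordinates have second moments bounded by the fourth moment of the
  score, so the plain weak law suffices here.\<close>

lemma outer_product_law:
  assumes "\<tau> > 0"
  shows "hp P (\<lambda>n \<omega>. \<forall>a b. \<bar>(\<Sum>i=1..n. score n (Z n i \<omega>) $ a * score n (Z n i \<omega>) $ b) / n - S $ a $ b\<bar> < \<tau>)"
proof -
  have "hp P (\<lambda>n \<omega>. \<bar>(\<Sum>i=1..n. score n (Z n i \<omega>) $ a * score n (Z n i \<omega>) $ b) / n - (\<integral>z. score n z $ a * score n z $ b \<partial>\<mu> n)\<bar> < \<tau>)" for a b
  proof (rule weak_law[OF _ _ _ assms])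
    fix n :: nat assume n: "n \<ge> 1"
    have [measurable]: "(\<lambda>z. score n z $ i) \<in> borel_measurable (\<mu> n)" for i
      by (rule score_nth_meas[OF n])
    show "(\<lambda>z. score n z $ a * score n z $ b) \<in> borel_measurable (\<mu> n)" by measurable
    have le: "(score n z $ a * score n z $ b)\<^sup>2 \<le> norm (score n z) ^ 4" for z
    proof -
      have "\<bar>score n z $ a * score n z $ b\<bar> \<le> norm (score n z) * norm (score n z)"
        unfolding abs_mult by (intro mult_mono component_le_norm_cart) auto
      then have "\<bar>score n z $ a * score n z $ b\<bar>\<^sup>2 \<le> (norm (score n z) * norm (score n z))\<^sup>2" by (intro power_mono) auto
      then show ?thesis by (simp add: eval_nat_numeral)
    qed
    show i: "integrable (\<mu> n) (\<lambda>z. (score n z $ a * score n z $ b)\<^sup>2)"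
      by (rule Bochner_Integration.integrable_bound[OF score4(1)[OF n]]) (use le in \<open>auto intro!: AE_I2\<close>)
    have "(\<integral>z. (score n z $ a * score n z $ b)\<^sup>2 \<partial>\<mu> n) \<le> (\<integral>z. norm (score n z) ^ 4 \<partial>\<mu> n)"
      using i score4(1)[OF n] le by (intro integral_mono) auto
    then show "(\<integral>z. (score n z $ a * score n z $ b)\<^sup>2 \<partial>\<mu> n) \<le> max MG 0" using score4(2)[OF n] by linarith
  qed
  then have "hp P (\<lambda>n \<omega>. \<forall>ab\<in>UNIV. \<bar>(\<Sum>i=1..n. score n (Z n i \<omega>) $ fst ab * score n (Z n i \<omega>) $ snd ab) / n
     - (\<integral>z. score n z $ fst ab * score n z $ snd ab \<partial>\<mu> n)\<bar> < \<tau>)"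
    by (intro hp_ball_finite) auto
  then show ?thesis
    by (rule hp_mono) (auto intro!: eventually_sequentiallyI[of 1] simp: score_cov)
qed

subsection \<open>Convergence of the Hessian\<close>

text \<open>A limit of difference quotients is measurable, while measurability of the Hessian itself is
  not among the assumptions.\<close>

definition hess_form :: "nat \<Rightarrow> real^'k \<Rightarrow> 'z \<Rightarrow> real" where
  "hess_form n h z = lim (\<lambda>m. real (Suc m) ^ 2 * (n * (loss n z (\<theta>0 + h /\<^sub>R real (Suc m)) + loss n z (\<theta>0 - h /\<^sub>R real (Suc m)) - 2 * loss n z \<theta>0)))"

lemma hess_form_meas: assumes n: "n \<ge> 1" shows "hess_form n h \<in> borel_measurable (\<mu> n)"
proof -
  note [measurable] = loss_meas[OF n]
  show ?thesis unfolding hess_form_def by measurable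
qed

lemma good_even_taylor:
  assumes "good n z"
  shows "\<bar>loss n z (x + h) + loss n z (x - h) - 2 * loss n z x - D2 (loss n z) x h h\<bar> \<le> fourth_bd n z / (real n)\<^sup>2 * norm h ^ 4 / 12"
  using assms unfolding good_def by (intro even_taylor4) auto

text \<open>The fourth-order remainder of the even Taylor expansion, divided by the square of the
  step, still vanishes with the step.\<close>

lemma good_hess_form:
  assumes n: "n \<ge> 1" and z: "good n z"
  shows "hess_form n h z = n * D2 (loss n z) \<theta>0 h h"
proof -
  let ?r = "\<lambda>m. loss n z (\<theta>0 + h /\<^sub>R real (Suc m)) + loss n z (\<theta>0 - h /\<^sub>R real (Suc m)) - 2 * loss n z \<theta>0"
  define K where "K = fourth_bd n z / n * norm h ^ 4 / 12"
  have K: "K \<ge> 0" by (simp add: K_def fourth_bd_nonneg)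
  have bd: "\<bar>real (Suc m) ^ 2 * (n * ?r m) - n * D2 (loss n z) \<theta>0 h h\<bar> \<le> K * (1 / real (Suc m))" for m
  proof -
    define s where "s = real (Suc m)"
    have s: "s \<ge> 1" by (simp add: s_def)
    have "D2 (loss n z) \<theta>0 (h /\<^sub>R s) (h /\<^sub>R s) = D2 (loss n z) \<theta>0 h h / s\<^sup>2"
      by (simp add: blinfun.scaleR_right blinfun.scaleR_left power2_eq_square divide_inverse)
    then have "s\<^sup>2 * (n * ?r m) - n * D2 (loss n z) \<theta>0 h h = (s\<^sup>2 * n) * (?r m - D2 (loss n z) \<theta>0 (h /\<^sub>R s) (h /\<^sub>R s))"
      using s by (simp add: algebra_simps)
    also have "\<bar>\<dots>\<bar> = (s\<^sup>2 * n) * \<bar>?r m - D2 (loss n z) \<theta>0 (h /\<^sub>R s) (h /\<^sub>R s)\<bar>" by (simp add: abs_mult)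
    also have "\<dots> \<le> (s\<^sup>2 * n) * (fourth_bd n z / (real n)\<^sup>2 * norm (h /\<^sub>R s) ^ 4 / 12)"
      using good_even_taylor[OF z, of \<theta>0 "h /\<^sub>R s"] by (intro mult_left_mono) (auto simp: s_def)
    also have "\<dots> = K / s\<^sup>2"
      using n s by (simp add: K_def eval_nat_numeral power_mult_distrib field_simps)
    also have "\<dots> \<le> K / s" using s K by (intro divide_left_mono) (auto simp: power2_eq_square)
    finally show ?thesis by (simp add: s_def)
  qed
  have z: "(\<lambda>m. K * (1 / real (Suc m))) \<longlonglongrightarrow> 0"
    by (rule tendsto_mult_right_zero[OF LIMSEQ_Suc[OF lim_1_over_n]])
  have "(\<lambda>m. real (Suc m) ^ 2 * (n * ?r m) - n * D2 (loss n z) \<theta>0 h h) \<longlonglongrightarrow> 0"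
    by (rule Lim_null_comparison[OF _ z], rule always_eventually, unfold real_norm_def, intro allI bd)
  then have "(\<lambda>m. real (Suc m) ^ 2 * (n * ?r m)) \<longlonglongrightarrow> n * D2 (loss n z) \<theta>0 h h"
    by (simp add: LIM_zero_iff)
  then show ?thesis unfolding hess_form_def by (rule limI)
qed

lemma good_second_difference:
  assumes "good n z"
  shows "\<bar>loss n z (x + h) + loss n z (x - h) - 2 * loss n z x\<bar> \<le> 2 * (\<bar>B n z\<bar> / sqrt n) * (norm h)\<^sup>2"
  using assms good_differentiable(3)[OF assms]
  by (intro second_difference_le[where g = "grad (loss n z)"]) (auto simp: good_def)

text \<open>The Lipschitz constant of the gradient, of order \<open>n^(-1/2)\<close>, controls
  second differences and hence the Hessian. Rescaling by \<open>n\<close> leaves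
  \<open>sqrt n\<close>, the source of second moments of order \<open>n\<close>.\<close>

lemma good_hess_form_bound:
  assumes n: "n \<ge> 1" and z: "good n z"
  shows "\<bar>hess_form n h z\<bar> \<le> 2 * sqrt n * \<bar>B n z\<bar> * (norm h)\<^sup>2"
proof -
  have form: "\<bar>D2 (loss n z) \<theta>0 h h\<bar> \<le> 2 * (\<bar>B n z\<bar> / sqrt n) * (norm h)\<^sup>2"
  proof (rule field_le_epsilon)
    fix e :: real assume e: "e > 0"
    define K where "K = fourth_bd n z / (real n)\<^sup>2 * norm h ^ 4 / 12"
    have K: "K \<ge> 0" by (simp add: K_def fourth_bd_nonneg)
    \<comment> \<open>Short enough that the remainder \<open>K * s ^ 4\<close> is at most
      \<open>e * s^2\<close>.\<close>
    define s where "s = min 1 (e / (K + 1))"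
    have s: "s > 0" "s \<le> 1" "s * K \<le> e"
    proof -
      show "s > 0" "s \<le> 1" using e K by (auto simp: s_def)
      have "s * K \<le> e / (K + 1) * K" using K by (intro mult_right_mono) (auto simp: s_def)
      also have "\<dots> \<le> e" using e K by (simp add: field_simps)
      finally show "s * K \<le> e" .
    qed
    let ?r = "loss n z (\<theta>0 + s *\<^sub>R h) + loss n z (\<theta>0 - s *\<^sub>R h) - 2 * loss n z \<theta>0"
    have a: "\<bar>?r - s\<^sup>2 * D2 (loss n z) \<theta>0 h h\<bar> \<le> K * s ^ 4"
      using good_even_taylor[OF z, of \<theta>0 "s *\<^sub>R h"] s
      by (simp add: blinfun.scaleR_right blinfun.scaleR_left power2_eq_square K_def power_mult_distrib mult_ac)
    have b: "\<bar>?r\<bar> \<le> s\<^sup>2 * (2 * (\<bar>B n z\<bar> / sqrt n) * (norm h)\<^sup>2)"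
      using good_second_difference[OF z, of \<theta>0 "s *\<^sub>R h"] by (simp add: power_mult_distrib mult_ac)
    have "s\<^sup>2 * \<bar>D2 (loss n z) \<theta>0 h h\<bar> = \<bar>s\<^sup>2 * D2 (loss n z) \<theta>0 h h\<bar>" by (simp add: abs_mult)
    also have "\<dots> \<le> s\<^sup>2 * (2 * (\<bar>B n z\<bar> / sqrt n) * (norm h)\<^sup>2) + K * s ^ 4" using a b by linarith
    also have "K * s ^ 4 = s\<^sup>2 * (s * (s * K))" by (simp add: eval_nat_numeral)
    also have "s * (s * K) \<le> 1 * (s * K)" using s K by (intro mult_right_mono) auto
    also have "1 * (s * K) \<le> e" using s by simp
    finally have "s\<^sup>2 * \<bar>D2 (loss n z) \<theta>0 h h\<bar> \<le> s\<^sup>2 * (2 * (\<bar>B n z\<bar> / sqrt n) * (norm h)\<^sup>2 + e)"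
      by (simp add: distrib_left mult_left_mono)
    then show "\<bar>D2 (loss n z) \<theta>0 h h\<bar> \<le> 2 * (\<bar>B n z\<bar> / sqrt n) * (norm h)\<^sup>2 + e" using s by simp
  qed
  have "\<bar>hess_form n h z\<bar> = n * \<bar>D2 (loss n z) \<theta>0 h h\<bar>" by (simp add: good_hess_form[OF n z] abs_mult)
  also have "\<dots> \<le> n * (2 * (\<bar>B n z\<bar> / sqrt n) * (norm h)\<^sup>2)" using form by (intro mult_left_mono) auto
  also have "\<dots> = 2 * (n / sqrt n) * \<bar>B n z\<bar> * (norm h)\<^sup>2" by simp
  also have "n / sqrt n = sqrt n" by (simp add: real_div_sqrt)
  finally show ?thesis .
qed

lemma hess_form_square: assumes n: "n \<ge> 1"
  shows "integrable (\<mu> n) (\<lambda>z. (hess_form n h z)\<^sup>2)" "(\<integral>z. (hess_form n h z)\<^sup>2 \<partial>\<mu> n) \<le> real n * (4 * norm h ^ 4 * KB)"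
    "integrable (\<mu> n) (hess_form n h)"
proof -
  interpret m: prob_space "\<mu> n" using n by (rule prob_mu)
  note [measurable] = hess_form_meas[OF n]
  have le: "AE z in \<mu> n. (hess_form n h z)\<^sup>2 \<le> (4 * n * norm h ^ 4) * (B n z)\<^sup>2"
    using AE_good[OF n]
  proof eventually_elim
    case (elim z)
    have "\<bar>hess_form n h z\<bar>\<^sup>2 \<le> (2 * sqrt n * \<bar>B n z\<bar> * (norm h)\<^sup>2)\<^sup>2"
      using good_hess_form_bound[OF n elim] by (intro power_mono) auto
    also have "(2 * sqrt n * \<bar>B n z\<bar> * (norm h)\<^sup>2)\<^sup>2 = (4 * n * norm h ^ 4) * (B n z)\<^sup>2"
      by (simp add: power_mult_distrib)
    finally show ?case by simp
  qed
  have i: "integrable (\<mu> n) (\<lambda>z. (4 * n * norm h ^ 4) * (B n z)\<^sup>2)" using B2_integrable(1)[OF n] by simp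
  show i': "integrable (\<mu> n) (\<lambda>z. (hess_form n h z)\<^sup>2)"
    by (rule Bochner_Integration.integrable_bound[OF i]) (use le in auto)
  have "(\<integral>z. (hess_form n h z)\<^sup>2 \<partial>\<mu> n) \<le> (\<integral>z. (4 * n * norm h ^ 4) * (B n z)\<^sup>2 \<partial>\<mu> n)"
    using i i' le by (intro integral_mono_AE) auto
  also have "\<dots> = (4 * n * norm h ^ 4) * (\<integral>z. (B n z)\<^sup>2 \<partial>\<mu> n)" by simp
  also have "\<dots> \<le> (4 * n * norm h ^ 4) * KB" using B2_integrable(2)[OF n] by (intro mult_left_mono) auto
  finally show "(\<integral>z. (hess_form n h z)\<^sup>2 \<partial>\<mu> n) \<le> real n * (4 * norm h ^ 4 * KB)" by (simp add: mult_ac)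
  show "integrable (\<mu> n) (hess_form n h)" by (rule m.square_integrable_imp_integrable[OF _ i']) measurable
qed

text \<open>The second moment is only of order \<open>n\<close>; the bound on the observed mean
  square that the truncated law asks for is the stochastic bound
  \<open>hess_bounded\<close>.\<close>

lemma hess_form_law:
  assumes "a > 0"
  shows "hp P (\<lambda>n \<omega>. \<bar>(\<Sum>i=1..n. hess_form n h (Z n i \<omega>)) / n - (\<integral>z. hess_form n h z \<partial>\<mu> n)\<bar> < a)"
proof (rule truncated_weak_law[OF _ _ _ _ assms])
  show "(\<integral>z. (hess_form n h z)\<^sup>2 \<partial>\<mu> n) \<le> real n * (4 * norm h ^ 4 * KB)" if "n \<ge> 1" for n
    using hess_form_square(2)[OF that] .
  fix \<epsilon> :: real assume \<epsilon>: "\<epsilon> > 0"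
  obtain K where K: "whp P (\<epsilon> / 2) (\<lambda>n \<omega>. norm ((1 / real n) *
        (\<Sum>i=1..n. (norm (real n *\<^sub>R frechet (frechet (loss n (Z n i \<omega>))) \<theta>0))\<^sup>2)) \<le> K)"
    using hess_bounded \<epsilon> unfolding bounded_in_prob_def whp_def by (meson half_gt_zero)
  have "whp P \<epsilon> (\<lambda>n \<omega>. norm ((1 / real n) *
        (\<Sum>i=1..n. (norm (real n *\<^sub>R frechet (frechet (loss n (Z n i \<omega>))) \<theta>0))\<^sup>2)) \<le> K \<and> all_good n \<omega>)"
    using \<epsilon> by (intro whp_hp_conj[OF K hp_good]) simp
  then have "whp P \<epsilon> (\<lambda>n \<omega>. (\<Sum>i=1..n. (hess_form n h (Z n i \<omega>))\<^sup>2) / n \<le> norm h ^ 4 * K)"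
  proof (rule whp_mono)
    show "\<forall>\<^sub>F n in sequentially. \<forall>\<omega>\<in>space (P n). norm ((1 / real n) *
        (\<Sum>i=1..n. (norm (real n *\<^sub>R frechet (frechet (loss n (Z n i \<omega>))) \<theta>0))\<^sup>2)) \<le> K \<and> all_good n \<omega> \<longrightarrow>
        (\<Sum>i=1..n. (hess_form n h (Z n i \<omega>))\<^sup>2) / n \<le> norm h ^ 4 * K"
    proof (intro eventually_sequentiallyI[of 1] ballI impI)
      fix n \<omega> assume n: "1 \<le> n"
        and *: "norm ((1 / real n) * (\<Sum>i=1..n. (norm (real n *\<^sub>R frechet (frechet (loss n (Z n i \<omega>))) \<theta>0))\<^sup>2)) \<le> K \<and> all_good n \<omega>"
      let ?X = "\<lambda>i. norm (real n *\<^sub>R frechet (frechet (loss n (Z n i \<omega>))) \<theta>0)"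
      have "(hess_form n h (Z n i \<omega>))\<^sup>2 \<le> norm h ^ 4 * (?X i)\<^sup>2" if "i \<in> {1..n}" for i
      proof -
        have "\<bar>hess_form n h (Z n i \<omega>)\<bar> = n * \<bar>D2 (loss n (Z n i \<omega>)) \<theta>0 h h\<bar>"
          using * that by (simp add: good_hess_form[OF n] abs_mult)
        also have "\<dots> \<le> n * (norm (frechet (frechet (loss n (Z n i \<omega>))) \<theta>0) * norm h * norm h)"
          by (intro mult_left_mono abs_D2_le) auto
        finally have "\<bar>hess_form n h (Z n i \<omega>)\<bar> \<le> (norm h)\<^sup>2 * ?X i" by (simp add: power2_eq_square mult_ac)
        then have "\<bar>hess_form n h (Z n i \<omega>)\<bar>\<^sup>2 \<le> ((norm h)\<^sup>2 * ?X i)\<^sup>2" by (intro power_mono) auto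
        then show ?thesis by (simp add: power_mult_distrib)
      qed
      then have "(\<Sum>i=1..n. (hess_form n h (Z n i \<omega>))\<^sup>2) \<le> (\<Sum>i=1..n. norm h ^ 4 * (?X i)\<^sup>2)" by (rule sum_mono)
      then have "(\<Sum>i=1..n. (hess_form n h (Z n i \<omega>))\<^sup>2) / n \<le> norm h ^ 4 * ((1 / real n) * (\<Sum>i=1..n. (?X i)\<^sup>2))"
        by (simp add: divide_right_mono flip: sum_distrib_left)
      also have "(1 / real n) * (\<Sum>i=1..n. (?X i)\<^sup>2) \<le> K"
        using * unfolding real_norm_def by linarith
      finally show "(\<Sum>i=1..n. (hess_form n h (Z n i \<omega>))\<^sup>2) / n \<le> norm h ^ 4 * K" by (simp add: mult_left_mono)
    qed
  qed simp
  then show "\<exists>K'. whp P \<epsilon> (\<lambda>n \<omega>. (\<Sum>i=1..n. (hess_form n h (Z n i \<omega>))\<^sup>2) / n \<le> K')" by blast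
qed (use hess_form_meas hess_form_square in auto)

lemma total_loss_sample: "total_loss l n (sample Z n \<omega>) = (\<lambda>\<theta>. \<Sum>i=1..n. loss n (Z n i \<omega>) \<theta>)"
  by (simp add: total_loss_def sample_def fun_eq_iff)

lemma excess_risk_eq:
  assumes n: "n \<ge> 1"
  shows "excess_risk P Z l \<theta>0 n \<theta> = n * ((\<integral>z. loss n z \<theta> \<partial>\<mu> n) - (\<integral>z. loss n z \<theta>0 \<partial>\<mu> n))"
proof -
  have i: "integrable (P n) (\<lambda>\<omega>. loss n (Z n i \<omega>) t)" if "i \<in> {1..n}" for i t
    using integrable_Z[OF n that loss_meas[OF n]] stableD(1)[OF n] by blast
  have s: "(\<integral>\<omega>. (\<Sum>i=1..n. loss n (Z n i \<omega>) t) \<partial>P n) = n * (\<integral>z. loss n z t \<partial>\<mu> n)" for t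
  proof -
    have "(\<integral>\<omega>. (\<Sum>i=1..n. loss n (Z n i \<omega>) t) \<partial>P n) = (\<Sum>i=1..n. \<integral>\<omega>. loss n (Z n i \<omega>) t \<partial>P n)"
      by (rule Bochner_Integration.integral_sum) (rule i)
    also have "\<dots> = (\<Sum>i=1..n. \<integral>z. loss n z t \<partial>\<mu> n)"
      by (intro sum.cong refl integral_Z[OF n _ loss_meas[OF n]])
    finally show ?thesis by simp
  qed
  have "excess_risk P Z l \<theta>0 n \<theta> = (\<integral>\<omega>. (\<Sum>i=1..n. loss n (Z n i \<omega>) \<theta>) \<partial>P n) - (\<integral>\<omega>. (\<Sum>i=1..n. loss n (Z n i \<omega>) \<theta>0) \<partial>P n)"
    unfolding excess_risk_def total_loss_sample
    by (intro Bochner_Integration.integral_diff Bochner_Integration.integrable_sum i)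
  then show ?thesis unfolding s by (simp add: right_diff_distrib)
qed

lemma fourth_bd_meas: "n \<ge> 1 \<Longrightarrow> fourth_bd n \<in> borel_measurable (\<mu> n)"
  unfolding fourth_bd_def using fourth_meas by measurable

lemma fourth_bd_integral:
  assumes n: "n \<ge> 1"
  shows "(\<integral>\<^sup>+z. ennreal (fourth_bd n z) \<partial>\<mu> n) \<le> ennreal (1 + max MD 0)" "integrable (\<mu> n) (fourth_bd n)" "(\<integral>z. fourth_bd n z \<partial>\<mu> n) \<le> 1 + max MD 0"
proof -
  interpret m: prob_space "\<mu> n" using n by (rule prob_mu)
  have le: "ennreal (fourth_bd n z) \<le> 1 + fourth_sup l n z ^ 4" for z
  proof (cases "fourth_sup l n z")
    case (real r)
    have "r \<le> 1 + r ^ 4"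
    proof (cases "r \<le> 1")
      case True then show ?thesis by (simp add: add_increasing2)
    next
      case False
      then have "r ^ 1 \<le> r ^ 4" by (intro power_increasing) auto
      then show ?thesis by simp
    qed
    then have "ennreal r \<le> ennreal (1 + r ^ 4)" by (rule ennreal_leI)
    then show ?thesis using real by (simp add: fourth_bd_def ennreal_power)
  next
    case top then show ?thesis by (simp add: fourth_bd_def)
  qed
  have "(\<integral>\<^sup>+z. ennreal (fourth_bd n z) \<partial>\<mu> n) \<le> (\<integral>\<^sup>+z. 1 + fourth_sup l n z ^ 4 \<partial>\<mu> n)"
    by (intro nn_integral_mono le)
  also have "\<dots> = 1 + (\<integral>\<^sup>+z. fourth_sup l n z ^ 4 \<partial>\<mu> n)"
    using fourth_meas[OF n] by (subst nn_integral_add) (auto simp: m.emeasure_space_1)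
  also have "\<dots> \<le> 1 + ennreal (max MD 0)"
    using MD[OF n] by (intro add_left_mono) (simp add: ennreal_max_0 max.commute)
  finally show b: "(\<integral>\<^sup>+z. ennreal (fourth_bd n z) \<partial>\<mu> n) \<le> ennreal (1 + max MD 0)" by simp
  show i: "integrable (\<mu> n) (fourth_bd n)"
    using fourth_bd_meas[OF n] b fourth_bd_nonneg by (intro integrableI_nonneg) (auto simp: le_less_trans)
  have "ennreal (\<integral>z. fourth_bd n z \<partial>\<mu> n) \<le> ennreal (1 + max MD 0)"
    using b nn_integral_eq_integral[OF i] fourth_bd_nonneg by simp
  then show "(\<integral>z. fourth_bd n z \<partial>\<mu> n) \<le> 1 + max MD 0" by (subst (asm) ennreal_le_iff) auto
qed

text \<open>The excess risk vanishes at \<theta>0, so these two values form a full second difference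
  of \<open>n\<close> times the expected loss; the remainder of order \<open>n^(-2)\<close> per
  observation leaves \<open>1 / n\<close>.\<close>

lemma hess_form_mean_excess_risk:
  assumes n: "n \<ge> 1"
  shows "\<bar>excess_risk P Z l \<theta>0 n (\<theta>0 + h) + excess_risk P Z l \<theta>0 n (\<theta>0 - h) - (\<integral>z. hess_form n h z \<partial>\<mu> n)\<bar>
    \<le> (norm h ^ 4 * (1 + max MD 0) / 12) * (1 / real n)"
proof -
  let ?r = "\<lambda>z. n * (loss n z (\<theta>0 + h) + loss n z (\<theta>0 - h) - 2 * loss n z \<theta>0)"
  note i = stableD(1)[OF n]
  have ir: "integrable (\<mu> n) ?r" by (intro integrable_mult_right Bochner_Integration.integrable_diff Bochner_Integration.integrable_add i)
  have "excess_risk P Z l \<theta>0 n (\<theta>0 + h) + excess_risk P Z l \<theta>0 n (\<theta>0 - h) = (\<integral>z. ?r z \<partial>\<mu> n)"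
    using i by (simp add: excess_risk_eq[OF n] algebra_simps)
  then have "\<bar>excess_risk P Z l \<theta>0 n (\<theta>0 + h) + excess_risk P Z l \<theta>0 n (\<theta>0 - h) - (\<integral>z. hess_form n h z \<partial>\<mu> n)\<bar> = \<bar>\<integral>z. ?r z - hess_form n h z \<partial>\<mu> n\<bar>"
    using Bochner_Integration.integral_diff[OF ir hess_form_square(3)[OF n]] by simp
  also have "\<dots> \<le> (\<integral>z. \<bar>?r z - hess_form n h z\<bar> \<partial>\<mu> n)" by (rule integral_abs_bound)
  also have "\<dots> \<le> (\<integral>z. (norm h ^ 4 / (12 * n)) * fourth_bd n z \<partial>\<mu> n)"
  proof (rule integral_mono_AE)
    show "AE z in \<mu> n. \<bar>?r z - hess_form n h z\<bar> \<le> (norm h ^ 4 / (12 * n)) * fourth_bd n z"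
      using AE_good[OF n]
    proof eventually_elim
      case (elim z)
      have "\<bar>?r z - hess_form n h z\<bar> = n * \<bar>loss n z (\<theta>0 + h) + loss n z (\<theta>0 - h) - 2 * loss n z \<theta>0 - D2 (loss n z) \<theta>0 h h\<bar>"
        by (simp add: good_hess_form[OF n elim] abs_mult flip: right_diff_distrib)
      also have "\<dots> \<le> n * (fourth_bd n z / (real n)\<^sup>2 * norm h ^ 4 / 12)"
        by (intro mult_left_mono good_even_taylor[OF elim]) auto
      also have "\<dots> = (norm h ^ 4 / (12 * n)) * fourth_bd n z" using n by (simp add: power2_eq_square mult_ac)
      finally show ?case .
    qed
  qed (use ir hess_form_square(3)[OF n] fourth_bd_integral(2)[OF n] in auto)
  also have "\<dots> = (norm h ^ 4 / (12 * n)) * (\<integral>z. fourth_bd n z \<partial>\<mu> n)" by simp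
  also have "\<dots> \<le> (norm h ^ 4 / (12 * n)) * (1 + max MD 0)"
    using fourth_bd_integral(3)[OF n] by (intro mult_left_mono) auto
  finally show ?thesis by (simp add: mult_ac)
qed

text \<open>For each \<open>n\<close> the mean Hessian form scales with \<open>s^2\<close>, and for
  every fixed \<open>h\<close>, however large, it differs from the even part of the excess risk by
  order \<open>1 / n\<close>. The even part of the limiting risk is therefore exactly quadratic on
  every line through \<theta>0, and its second derivative at \<theta>0, the identity, determines
  it.\<close>

lemma hess_form_mean_limit: "(\<lambda>n. \<integral>z. hess_form n h z \<partial>\<mu> n) \<longlonglongrightarrow> (norm h)\<^sup>2"
proof -
  define L where "L = limit_risk P Z l \<theta>0"
  have exc: "(\<lambda>n. excess_risk P Z l \<theta>0 n t) \<longlonglongrightarrow> L t" for t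
    using limit unfolding normalized_limit_risk_def L_def limit_risk_def by (simp add: convergent_LIMSEQ_iff)
  have lim: "(\<lambda>n. \<integral>z. hess_form n h z \<partial>\<mu> n) \<longlonglongrightarrow> L (\<theta>0 + h) + L (\<theta>0 - h)" for h
  proof (rule Lim_transform[OF tendsto_add[OF exc exc]])
    have z: "(\<lambda>n. (norm h ^ 4 * (1 + max MD 0) / 12) * (1 / real n)) \<longlonglongrightarrow> 0"
      by (rule tendsto_mult_right_zero[OF lim_1_over_n])
    show "(\<lambda>n. (\<integral>z. hess_form n h z \<partial>\<mu> n) - (excess_risk P Z l \<theta>0 n (\<theta>0 + h) + excess_risk P Z l \<theta>0 n (\<theta>0 - h))) \<longlonglongrightarrow> 0"
    proof (rule Lim_null_comparison[OF _ z], rule eventually_sequentiallyI[of 1])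
      fix n :: nat assume "1 \<le> n"
      from hess_form_mean_excess_risk[OF this, of h]
      show "norm ((\<integral>z. hess_form n h z \<partial>\<mu> n) - (excess_risk P Z l \<theta>0 n (\<theta>0 + h) + excess_risk P Z l \<theta>0 n (\<theta>0 - h)))
         \<le> (norm h ^ 4 * (1 + max MD 0) / 12) * (1 / real n)"
        unfolding real_norm_def by (subst abs_minus_commute)
    qed
  qed
  have scale: "L (\<theta>0 + s *\<^sub>R h) + L (\<theta>0 - s *\<^sub>R h) = 0 + s\<^sup>2 * (L (\<theta>0 + h) + L (\<theta>0 - h))" for s
  proof -
    have "(\<integral>z. hess_form n (s *\<^sub>R h) z \<partial>\<mu> n) = s\<^sup>2 * (\<integral>z. hess_form n h z \<partial>\<mu> n)" if n: "n \<ge> 1" for n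
    proof -
      have "AE z in \<mu> n. hess_form n (s *\<^sub>R h) z = s\<^sup>2 * hess_form n h z"
        using AE_good[OF n]
      proof eventually_elim
        case (elim z)
        then show ?case
          by (simp add: good_hess_form[OF n] blinfun.scaleR_right blinfun.scaleR_left power2_eq_square)
      qed
      then have "(\<integral>z. hess_form n (s *\<^sub>R h) z \<partial>\<mu> n) = (\<integral>z. s\<^sup>2 * hess_form n h z \<partial>\<mu> n)"
        using hess_form_meas[OF n] by (intro integral_cong_AE) auto
      then show ?thesis by simp
    qed
    then have "\<forall>\<^sub>F n in sequentially. s\<^sup>2 * (\<integral>z. hess_form n h z \<partial>\<mu> n) = (\<integral>z. hess_form n (s *\<^sub>R h) z \<partial>\<mu> n)"
      by (intro eventually_sequentiallyI[of 1]) simp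
    from Lim_transform_eventually[OF tendsto_mult_left[OF lim[of h]] this]
    have "(\<lambda>n. \<integral>z. hess_form n (s *\<^sub>R h) z \<partial>\<mu> n) \<longlonglongrightarrow> s\<^sup>2 * (L (\<theta>0 + h) + L (\<theta>0 - h))" .
    from LIMSEQ_unique[OF lim this] show ?thesis by simp
  qed
  have "L (\<theta>0 + h) + L (\<theta>0 - h) = D2 L \<theta>0 h h"
    using limit scale unfolding normalized_limit_risk_def L_def[symmetric] by (intro quadratic_even_part) auto
  also have "\<dots> = h \<bullet> (hess L \<theta>0 *v h)" by (simp add: hess_quadratic_form)
  also have "\<dots> = (norm h)\<^sup>2"
    using limit unfolding normalized_limit_risk_def L_def[symmetric] by (simp add: power2_norm_eq_inner)
  finally show ?thesis using lim[of h] by simp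
qed

lemma hess_law:
  assumes a: "a > 0"
  shows "hp P (\<lambda>n \<omega>. \<bar>(\<Sum>i=1..n. hess_form n h (Z n i \<omega>)) / n - (norm h)\<^sup>2\<bar> < a)"
proof (rule hp_mono[OF hess_form_law[of "a / 2"]])
  have "\<forall>\<^sub>F n in sequentially. dist (\<integral>z. hess_form n h z \<partial>\<mu> n) ((norm h)\<^sup>2) < a / 2"
    using hess_form_mean_limit a by (intro tendstoD) auto
  then show "\<forall>\<^sub>F n in sequentially. \<forall>\<omega>\<in>space (P n). \<bar>(\<Sum>i=1..n. hess_form n h (Z n i \<omega>)) / n - (\<integral>z. hess_form n h z \<partial>\<mu> n)\<bar> < a / 2 \<longrightarrow>
      \<bar>(\<Sum>i=1..n. hess_form n h (Z n i \<omega>)) / n - (norm h)\<^sup>2\<bar> < a"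
  proof eventually_elim
    case (elim n)
    then have "\<bar>(\<integral>z. hess_form n h z \<partial>\<mu> n) - (norm h)\<^sup>2\<bar> < a / 2" by (simp add: dist_real_def)
    show ?case
    proof (intro ballI impI)
      fix \<omega> assume "\<bar>(\<Sum>i=1..n. hess_form n h (Z n i \<omega>)) / n - (\<integral>z. hess_form n h z \<partial>\<mu> n)\<bar> < a / 2"
      with \<open>\<bar>(\<integral>z. hess_form n h z \<partial>\<mu> n) - (norm h)\<^sup>2\<bar> < a / 2\<close>
      show "\<bar>(\<Sum>i=1..n. hess_form n h (Z n i \<omega>)) / n - (norm h)\<^sup>2\<bar> < a" by linarith
    qed
  qed
qed (use a in simp)

end

subsection \<open>Strong convexity of the leave-one-out losses\<close>

definition second_diff :: "('a::real_normed_vector \<Rightarrow> real) \<Rightarrow> 'a \<Rightarrow> 'a \<Rightarrow> real" where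
  "second_diff F x h = F (x + h) + F (x - h) - 2 * F x"

lemma second_diff_sum: "second_diff (\<lambda>x. \<Sum>i\<in>I. f i x) x h = (\<Sum>i\<in>I. second_diff (f i) x h)"
  by (simp add: second_diff_def sum.distrib sum_subtractf sum_distrib_left)

text \<open>A violation is an open condition on the pair of point and direction, so it would occur
  within a dense set; a countable one makes failure of convexity an event.\<close>

lemma second_diff_bound_dense:
  fixes F :: "real^'k \<Rightarrow> real"
  assumes cont: "continuous_on UNIV F" and D: "\<And>X. open X \<Longrightarrow> X \<noteq> {} \<Longrightarrow> \<exists>d\<in>D. d \<in> X"
    and le: "\<And>d. d \<in> D \<Longrightarrow> a * (norm (snd d))\<^sup>2 \<le> second_diff F (fst d) (snd d)"
  shows "a * (norm h)\<^sup>2 \<le> second_diff F x h"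
proof (rule ccontr)
  assume neg: "\<not> ?thesis"
  let ?X = "{d::(real^'k) \<times> (real^'k). second_diff F (fst d) (snd d) < a * (norm (snd d))\<^sup>2}"
  have "open ?X" unfolding second_diff_def
    by (intro open_Collect_less continuous_intros continuous_on_compose2[OF cont]) auto
  moreover have "(x, h) \<in> ?X" using neg by simp
  ultimately obtain d where "d \<in> D" "d \<in> ?X" using D by blast
  then show False using le by fastforce
qed

context cv_setting
begin

text \<open>Removing an observation with a small Hessian is harmless. The remaining observations have
  probability \<open>O(1/n)\<close> each, and by independence such an observation is unlikely to coincide with
  a leave-one-out sample that is not strongly convex.\<close>

lemma loo_convex:
  "hp P (\<lambda>n \<omega>. \<forall>i\<in>{1..n}. \<forall>x h. c / 2 * (norm h)\<^sup>2 \<le> second_diff (loo_sample_loss n i \<omega>) x h)"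
  unfolding hp_def
proof (intro allI impI)
  fix \<delta> :: real assume \<delta>: "\<delta> > 0"
  \<comment> \<open>Removing a loss with \<open>\<bar>B\<bar> \<le> \<eta> * sqrt n\<close> lowers
    the curvature by at most \<open>2 * \<eta> = c / 4\<close>, which leaves more than
    \<open>c / 2\<close>.\<close>
  define \<eta> where "\<eta> = c / 8"
  have \<eta>: "\<eta> > 0" using c by (simp add: \<eta>_def)
  define K where "K = KB / \<eta>\<^sup>2"
  have K: "K \<ge> 0" using KB(1) by (simp add: K_def)
  define \<epsilon> where "\<epsilon> = \<delta> / (1 + 2 * K)"
  have "\<epsilon> * (1 + 2 * K) = \<delta>" using K by (simp add: \<epsilon>_def)
  then have \<epsilon>: "\<epsilon> + 2 * K * \<epsilon> = \<delta>" "\<epsilon> > 0"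
    using \<delta> K by (simp add: algebra_simps, simp add: \<epsilon>_def)
  obtain D :: "((real^'k) \<times> (real^'k)) set" where D: "countable D" "\<And>X. open X \<Longrightarrow> X \<noteq> {} \<Longrightarrow> \<exists>d\<in>D. d \<in> X"
    using countable_dense_setE by blast
  have "whp P \<epsilon> (\<lambda>n \<omega>. total_convex n \<omega> \<and> all_good n \<omega>)"
    using \<epsilon> by (intro whp_hp_conj[OF hp_whp[OF convex, of "\<epsilon> / 2"] hp_good]) auto
  then have evE: "\<forall>\<^sub>F n in sequentially. \<exists>E\<in>sets (P n). measure (P n) E \<ge> 1 - \<epsilon> \<and>
      (\<forall>\<omega>\<in>E. total_convex n \<omega> \<and> all_good n \<omega>)"
    unfolding whp_def .
  have evn: "\<forall>\<^sub>F n in sequentially. real n \<ge> 2 * K"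
    using filterlim_real_sequentially unfolding filterlim_at_top by blast
  show "whp P \<delta> (\<lambda>n \<omega>. \<forall>i\<in>{1..n}. \<forall>x h. c / 2 * (norm h)\<^sup>2 \<le> second_diff (loo_sample_loss n i \<omega>) x h)"
  proof (rule whp_compl)
    show "\<forall>\<^sub>F n in sequentially. \<exists>A\<in>sets (P n). measure (P n) A \<le> \<delta> \<and>
      (\<forall>\<omega>\<in>space (P n) - A. \<forall>i\<in>{1..n}. \<forall>x h. c / 2 * (norm h)\<^sup>2 \<le> second_diff (loo_sample_loss n i \<omega>) x h)"
      using evE evn eventually_ge_at_top[of 1]
    proof eventually_elim
      case (elim n)
      then have n: "n \<ge> 1" by simp
      interpret prob_space "P n" using n by (rule prob)
      interpret m: prob_space "\<mu> n" using n by (rule prob_mu)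
      obtain E where E: "E \<in> events" "prob E \<ge> 1 - \<epsilon>"
        and Econv: "\<And>\<omega>. \<omega> \<in> E \<Longrightarrow> total_convex n \<omega>"
        and Egood: "\<And>\<omega> i. \<omega> \<in> E \<Longrightarrow> i \<in> {1..n} \<Longrightarrow> good n (Z n i \<omega>)" using elim by blast
      \<comment> \<open>The observations whose removal may matter; Markov's inequality bounds their
        probability by \<open>K / n\<close>.\<close>
      define SA where "SA = {z\<in>space (\<mu> n). \<eta> * sqrt n < \<bar>B n z\<bar>}"
      have SA: "SA \<in> sets (\<mu> n)" unfolding SA_def using B_meas[OF n] by measurable
      define p where "p = measure (\<mu> n) SA"
      have p: "p \<le> K / n" "p \<ge> 0"
      proof -
        have "\<eta> * sqrt n < \<bar>B n z\<bar> \<longleftrightarrow> \<eta>\<^sup>2 * n < (B n z)\<^sup>2" for z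
        proof -
          have "\<bar>B n z\<bar> \<le> \<eta> * sqrt n \<longleftrightarrow> (B n z)\<^sup>2 \<le> (\<eta> * sqrt n)\<^sup>2"
            using abs_le_square_iff[of "B n z" "\<eta> * sqrt n"] \<eta> by simp
          then have "\<eta> * sqrt n < \<bar>B n z\<bar> \<longleftrightarrow> (\<eta> * sqrt n)\<^sup>2 < (B n z)\<^sup>2" by (simp only: not_le[symmetric])
          then show ?thesis by (simp add: power_mult_distrib)
        qed
        then have "SA = {z\<in>space (\<mu> n). ennreal (\<eta>\<^sup>2 * n) < ennreal ((B n z)\<^sup>2)}"
          unfolding SA_def by (simp add: ennreal_less_iff)
        moreover have "m.prob {z\<in>space (\<mu> n). ennreal (\<eta>\<^sup>2 * n) < ennreal ((B n z)\<^sup>2)} \<le> KB / (\<eta>\<^sup>2 * n)"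
          using B_meas[OF n] KB n \<eta> by (intro m.markov_ennreal) auto
        ultimately show "p \<le> K / n" by (simp add: p_def K_def)
      qed (simp add: p_def)
      have p2: "p \<le> 1/2"
      proof -
        have "K / n \<le> 1/2" using elim n by (simp add: field_simps)
        then show ?thesis using p(1) by linarith
      qed
      define spec where "spec i = {\<omega>\<in>space (P n). Z n i \<omega> \<in> SA}" for i
      \<comment> \<open>The countable set \<open>D\<close> makes this an event, and it involves only
        the observations other than \<open>i\<close>.\<close>
      define bad where "bad i = {\<omega>\<in>space (P n). \<exists>d\<in>D. (\<Sum>j\<in>{1..n} - {i}. second_diff (loss n (Z n j \<omega>)) (fst d) (snd d)) < c / 2 * (norm (snd d))\<^sup>2}" for i
      have ind: "bad i \<in> events" "spec i \<in> events" "prob (spec i) = p" "prob (spec i \<inter> bad i) = p * prob (bad i)"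
        if i: "i \<in> {1..n}" for i
      proof -
        let ?J = "{1..n} - {i}"
        let ?MA = "PiM {i} (\<lambda>_. \<mu> n)" and ?MB = "PiM ?J (\<lambda>_. \<mu> n)"
        define XA where "XA = {w\<in>space ?MA. w i \<in> SA}"
        define XB where "XB = {w\<in>space ?MB. \<exists>d\<in>D. (\<Sum>j\<in>?J. second_diff (loss n (w j)) (fst d) (snd d)) < c / 2 * (norm (snd d))\<^sup>2}"
        have XA: "XA \<in> sets ?MA"
          unfolding XA_def using measurable_sets[OF measurable_component_singleton[of i "{i}" "\<lambda>_. \<mu> n"] SA]
          by (simp add: vimage_def Int_def conj_commute)
        have XB: "XB \<in> sets ?MB"
        proof -
          have [measurable]: "(\<lambda>w. loss n (w j) t) \<in> borel_measurable ?MB" if "j \<in> ?J" for j t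
            by (rule measurable_compose[OF measurable_component_singleton[OF that] loss_meas[OF n]])
          have "(\<lambda>w. \<Sum>j\<in>?J. second_diff (loss n (w j)) x h) \<in> borel_measurable ?MB" for x h
            unfolding second_diff_def by (intro borel_measurable_sum) measurable
          then have "{w\<in>space ?MB. (\<Sum>j\<in>?J. second_diff (loss n (w j)) (fst d) (snd d)) < c / 2 * (norm (snd d))\<^sup>2} \<in> sets ?MB" for d
            by (rule borel_measurable_less) simp
          then have "(\<Union>d\<in>D. {w\<in>space ?MB. (\<Sum>j\<in>?J. second_diff (loss n (w j)) (fst d) (snd d)) < c / 2 * (norm (snd d))\<^sup>2}) \<in> sets ?MB"
            by (intro sets.countable_UN'[OF D(1)] image_subsetI)
          moreover have "XB = (\<Union>d\<in>D. {w\<in>space ?MB. (\<Sum>j\<in>?J. second_diff (loss n (w j)) (fst d) (snd d)) < c / 2 * (norm (snd d))\<^sup>2})"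
            unfolding XB_def by blast
          ultimately show ?thesis by simp
        qed
        let ?A = "\<lambda>\<omega>. restrict (\<lambda>i. Z n i \<omega>) {i}" and ?B = "\<lambda>\<omega>. restrict (\<lambda>i. Z n i \<omega>) ?J"
        \<comment> \<open>The event \<open>spec i\<close> depends on observation \<open>i\<close>
          and \<open>bad i\<close> on all others, hence their independence.\<close>
        have iv: "indep_var ?MA ?A ?MB ?B"
          using i by (intro indep_var_restrict[OF indep[OF n]]) auto
        have rv: "random_variable ?MA ?A" "random_variable ?MB ?B"
          using indep_var_rv1[OF iv] indep_var_rv2[OF iv] by auto
        have A: "?A -` XA \<inter> space (P n) = spec i"
          using measurable_space[OF rv(1)] by (auto simp: XA_def spec_def)
        have B: "?B -` XB \<inter> space (P n) = bad i"
        proof -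
          have eqB: "(\<Sum>j\<in>?J. second_diff (loss n (?B \<omega> j)) x h) = (\<Sum>j\<in>?J. second_diff (loss n (Z n j \<omega>)) x h)" for \<omega> x h
            by (intro sum.cong) auto
          show ?thesis
          proof (rule set_eqI)
            fix \<omega>
            show "\<omega> \<in> ?B -` XB \<inter> space (P n) \<longleftrightarrow> \<omega> \<in> bad i"
              unfolding vimage_eq Int_iff XB_def bad_def mem_Collect_eq eqB
              using measurable_space[OF rv(2), of \<omega>] by blast
          qed
        qed
        show bs: "bad i \<in> events" "spec i \<in> events"
          unfolding A[symmetric] B[symmetric] by (rule measurable_sets[OF rv(2) XB], rule measurable_sets[OF rv(1) XA])
        have "spec i = Z n i -` SA \<inter> space (P n)" by (auto simp: spec_def)
        then show ps: "prob (spec i) = p" using measure_Z[OF n i SA] by (simp add: p_def)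
        have "(\<lambda>\<omega>. (?A \<omega>, ?B \<omega>)) -` (XA \<times> XB) \<inter> space (P n) = spec i \<inter> bad i"
          unfolding A[symmetric] B[symmetric] by blast
        then show "prob (spec i \<inter> bad i) = p * prob (bad i)"
          using indep_varD[OF iv XA XB] unfolding A B ps by simp
      qed
      have direct: "c / 2 * (norm h)\<^sup>2 \<le> second_diff (loo_sample_loss n i \<omega>) x h"
        if \<omega>: "\<omega> \<in> E" "\<omega> \<in> space (P n)" "\<omega> \<notin> spec i" and i: "i \<in> {1..n}" for \<omega> i x h
      proof -
        have "c * (norm h)\<^sup>2 \<le> second_diff (\<lambda>t. \<Sum>j=1..n. loss n (Z n j \<omega>) t) x h"
          using strongly_convex_second_difference[OF Econv[OF \<omega>(1)]] by (simp add: second_diff_def total_loss_sample)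
        also have "\<dots> = second_diff (loss n (Z n i \<omega>)) x h + second_diff (loo_sample_loss n i \<omega>) x h"
          unfolding second_diff_sum by (rule sum.remove) (use i in auto)
        also have "second_diff (loss n (Z n i \<omega>)) x h \<le> 2 * \<eta> * (norm h)\<^sup>2"
        proof -
          have "Z n i \<omega> \<in> space (\<mu> n)" using measurable_space[OF Z_meas[OF n i] \<omega>(2)] .
          then have "\<bar>B n (Z n i \<omega>)\<bar> \<le> \<eta> * sqrt n" using \<omega> by (auto simp: spec_def SA_def)
          then have "\<bar>B n (Z n i \<omega>)\<bar> / sqrt n \<le> \<eta>" using n by (simp add: field_simps)
          then have "2 * (\<bar>B n (Z n i \<omega>)\<bar> / sqrt n) * (norm h)\<^sup>2 \<le> 2 * \<eta> * (norm h)\<^sup>2"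
            by (intro mult_right_mono mult_left_mono) auto
          moreover have "second_diff (loss n (Z n i \<omega>)) x h \<le> 2 * (\<bar>B n (Z n i \<omega>)\<bar> / sqrt n) * (norm h)\<^sup>2"
            using good_second_difference[OF Egood[OF \<omega>(1) i], of x h] unfolding second_diff_def by linarith
          ultimately show ?thesis by linarith
        qed
        finally have "c * (norm h)\<^sup>2 - 2 * \<eta> * (norm h)\<^sup>2 \<le> second_diff (loo_sample_loss n i \<omega>) x h" by simp
        moreover have "c / 2 * (norm h)\<^sup>2 \<le> (c - 2 * \<eta>) * (norm h)\<^sup>2"
          using c by (intro mult_right_mono) (auto simp: \<eta>_def)
        ultimately show ?thesis by (simp add: left_diff_distrib)
      qed
      \<comment> \<open>If the removed loss is harmless, failure of convexity can only happen
        outside \<open>E\<close>. Independence and \<open>p \<le> 1/2\<close> then lift the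
        restriction to the complement of \<open>spec i\<close> at the price of a factor 2.\<close>
      have pbad: "prob (bad i) \<le> 2 * \<epsilon>" if i: "i \<in> {1..n}" for i
      proof -
        note b = ind[OF i]
        have "bad i - spec i \<subseteq> space (P n) - E"
        proof
          fix \<omega> assume \<omega>: "\<omega> \<in> bad i - spec i"
          then have sp: "\<omega> \<in> space (P n)" by (simp add: bad_def)
          obtain d where "(\<Sum>j\<in>{1..n} - {i}. second_diff (loss n (Z n j \<omega>)) (fst d) (snd d)) < c / 2 * (norm (snd d))\<^sup>2"
            using \<omega> by (auto simp: bad_def)
          then have "\<omega> \<notin> E" using direct[of \<omega> i "snd d" "fst d"] \<omega> sp i by (auto simp: second_diff_sum)
          then show "\<omega> \<in> space (P n) - E" using sp by simp
        qed
        then have "prob (bad i - spec i) \<le> prob (space (P n) - E)"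
          using E b by (intro finite_measure_mono) auto
        also have "\<dots> \<le> \<epsilon>" using E by (simp add: prob_compl)
        also have "prob (bad i - spec i) = prob (bad i) - prob (spec i \<inter> bad i)"
          using finite_measure_Diff'[OF b(1,2)] by (simp add: Int_commute)
        finally have "prob (bad i) - p * prob (bad i) \<le> \<epsilon>" by (simp add: b)
        moreover have "p * prob (bad i) \<le> 1/2 * prob (bad i)" using p2 by (intro mult_right_mono) auto
        ultimately show ?thesis by simp
      qed
      \<comment> \<open>A union bound over all \<open>bad i\<close> would lose a factor
        \<open>n\<close>, whereas each \<open>spec i \<inter> bad i\<close> has probability at most
        \<open>2 * K * \<epsilon> / n\<close>.\<close>
      define A where "A = (space (P n) - E) \<union> (\<Union>i\<in>{1..n}. spec i \<inter> bad i)"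
      have Um: "(\<Union>i\<in>{1..n}. spec i \<inter> bad i) \<in> events" using ind by (intro sets.finite_UN) auto
      have Am: "A \<in> events" unfolding A_def using E Um by auto
      have "prob (\<Union>i\<in>{1..n}. spec i \<inter> bad i) \<le> (\<Sum>i\<in>{1..n}. prob (spec i \<inter> bad i))"
        using ind by (intro finite_measure_subadditive_finite) auto
      also have "\<dots> \<le> (\<Sum>i\<in>{1..n}. K / n * (2 * \<epsilon>))"
      proof (rule sum_mono)
        fix i assume i: "i \<in> {1..n}"
        have "p * prob (bad i) \<le> K / n * (2 * \<epsilon>)" using pbad[OF i] p K by (intro mult_mono) auto
        then show "prob (spec i \<inter> bad i) \<le> K / n * (2 * \<epsilon>)" by (simp only: ind(4)[OF i])
      qed
      also have "\<dots> = 2 * K * \<epsilon>" using n by simp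
      finally have "prob A \<le> \<epsilon> + 2 * K * \<epsilon>"
        unfolding A_def using measure_Un_le[OF _ Um, of "space (P n) - E"] E by (simp add: prob_compl)
      then have "prob A \<le> \<delta>" using \<epsilon> by simp
      moreover have "c / 2 * (norm h)\<^sup>2 \<le> second_diff (loo_sample_loss n i \<omega>) x h"
        if \<omega>: "\<omega> \<in> space (P n) - A" and i: "i \<in> {1..n}" for \<omega> i x h
      proof (cases "\<omega> \<in> spec i")
        case False
        then show ?thesis using \<omega> i by (intro direct) (auto simp: A_def)
      next
        case True
        then have nb: "\<omega> \<notin> bad i" and \<omega>E: "\<omega> \<in> E" using \<omega> i by (auto simp: A_def)
        show ?thesis
        proof (rule second_diff_bound_dense[OF _ D(2)])
          show "continuous_on UNIV (loo_sample_loss n i \<omega>)"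
            using good_differentiable(4)[OF Egood[OF \<omega>E]] by (intro continuous_on_sum) auto
          show "c / 2 * (norm (snd d))\<^sup>2 \<le> second_diff (loo_sample_loss n i \<omega>) (fst d) (snd d)" if "d \<in> D" for d
            using nb that \<omega> unfolding bad_def second_diff_sum by (force simp: not_less)
        qed
      qed
      ultimately show ?case using Am by blast
    qed
  qed
qed

subsection \<open>The total loss is locally quadratic\<close>

lemma total_derivatives:
  assumes "all_good n \<omega>"
  defines "L \<equiv> \<lambda>t. \<Sum>i=1..n. loss n (Z n i \<omega>) t"
  shows "four_times_differentiable L" "D2 L x u v = (\<Sum>i=1..n. D2 (loss n (Z n i \<omega>)) x u v)"
    "norm (frechet (frechet (frechet (frechet L))) x) \<le> (\<Sum>i=1..n. fourth_bd n (Z n i \<omega>)) / (real n)\<^sup>2"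
    "grad L x = (\<Sum>i=1..n. grad (loss n (Z n i \<omega>)) x)"
    "(L has_derivative (\<lambda>v. (\<Sum>i=1..n. grad (loss n (Z n i \<omega>)) x) \<bullet> v)) (at x)"
proof -
  have f: "four_times_differentiable (loss n (Z n i \<omega>))" if "i \<in> {1..n}" for i
    using assms that by (auto simp: good_def)
  note s = four_times_differentiable_sum[of "{1..n}" "\<lambda>i. loss n (Z n i \<omega>)", OF _ f]
  show L4: "four_times_differentiable L" unfolding L_def by (rule s(1)) auto
  show "D2 L x u v = (\<Sum>i=1..n. D2 (loss n (Z n i \<omega>)) x u v)"
    unfolding L_def by (subst s(3)) (auto simp: blinfun.sum_left)
  have "norm (frechet (frechet (frechet (frechet L))) x) \<le> (\<Sum>i=1..n. norm (frechet (frechet (frechet (frechet (loss n (Z n i \<omega>))))) x))"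
    unfolding L_def by (subst s(4)) (auto intro: norm_sum)
  also have "\<dots> \<le> (\<Sum>i=1..n. fourth_bd n (Z n i \<omega>) / (real n)\<^sup>2)"
    using assms by (intro sum_mono) (auto simp: good_def)
  finally show "norm (frechet (frechet (frechet (frechet L))) x) \<le> (\<Sum>i=1..n. fourth_bd n (Z n i \<omega>)) / (real n)\<^sup>2"
    by (simp add: sum_divide_distrib)
  show g: "grad L x = (\<Sum>i=1..n. grad (loss n (Z n i \<omega>)) x)" unfolding L_def by (rule s(5)) auto
  show "(L has_derivative (\<lambda>v. (\<Sum>i=1..n. grad (loss n (Z n i \<omega>)) x) \<bullet> v)) (at x)"
    using L4 grad_has_derivative[of L x] unfolding g by (auto simp: four_times_differentiable_def)
qed

text \<open>Polarization leaves each entry with an error of half of three deviations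
  \<open>a\<close>, and a quadratic form has \<open>CARD('k) ^ 2\<close> entries.\<close>

definition hess_tol :: "real \<Rightarrow> real" where
  "hess_tol a = (real CARD('k))\<^sup>2 * (3 / 2 * a)"

text \<open>At \<theta>0 the Hessian is tested on basis vectors and their pairwise sums, which
  controls every entry. It is carried to \<open>x\<close> along the line from \<theta>0, where the
  form in direction \<open>v\<close> is nonnegative and has a second derivative of order
  \<open>1 / n\<close>.\<close>

lemma hess_near_identity:
  assumes n: "n \<ge> 1" and good: "all_good n \<omega>"
    and conv: "total_convex n \<omega>"
    and q1: "\<And>i. \<bar>(\<Sum>m=1..n. hess_form n (axis i 1) (Z n m \<omega>)) / n - (norm (axis i 1 :: real^'k))\<^sup>2\<bar> < a"
    and q2: "\<And>i j. \<bar>(\<Sum>m=1..n. hess_form n (axis i 1 + axis j 1) (Z n m \<omega>)) / n - (norm (axis i 1 + axis j 1 :: real^'k))\<^sup>2\<bar> < a"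
    and fourth_bd: "(\<Sum>m=1..n. fourth_bd n (Z n m \<omega>)) \<le> n * K" and R: "norm \<theta>0 \<le> R" "norm x \<le> R"
  shows "\<bar>D2 (sample_loss n \<omega>) x v v - (norm v)\<^sup>2\<bar>
    \<le> (hess_tol a + 2 * R * sqrt (2 * (K / n) * (1 + hess_tol a)) + 2 * R\<^sup>2 * (K / n)) * (norm v)\<^sup>2"
proof -
  define L where "L = (sample_loss n \<omega>)"
  note tot = total_derivatives[OF good, folded L_def]
  have cL: "strongly_convex c L" using conv by (simp add: total_loss_sample L_def)
  have a0: "a > 0" using q1[of undefined] by (meson abs_ge_zero le_less_trans)
  have D2q: "D2 L \<theta>0 h h = (\<Sum>m=1..n. hess_form n h (Z n m \<omega>)) / n" for h
  proof -
    have "(\<Sum>m=1..n. hess_form n h (Z n m \<omega>)) = (\<Sum>m=1..n. n * D2 (loss n (Z n m \<omega>)) \<theta>0 h h)"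
      using good by (intro sum.cong) (auto simp: good_hess_form[OF n])
    then show ?thesis using n by (simp add: tot(2) flip: sum_distrib_left)
  qed
  define H where "H = hess L \<theta>0 - mat 1"
  have Hij: "\<bar>H $ i $ j\<bar> \<le> 3 / 2 * a" for i j
  proof -
    let ?e = "\<lambda>i. axis i (1::real) :: real^'k"
    have "H $ i $ j = D2 L \<theta>0 (?e i) (?e j) - ?e i \<bullet> ?e j"
      by (simp add: H_def hess_def mat_def inner_axis_axis)
    moreover have "D2 L \<theta>0 (?e i + ?e j) (?e i + ?e j) = D2 L \<theta>0 (?e i) (?e i) + D2 L \<theta>0 (?e j) (?e j) + 2 * D2 L \<theta>0 (?e i) (?e j)"
      using strongly_convex_symmetric[OF cL, of \<theta>0 "?e i" "?e j"] by (simp add: blinfun.add_left blinfun.add_right)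
    moreover have "(norm (?e i + ?e j))\<^sup>2 = (norm (?e i))\<^sup>2 + (norm (?e j))\<^sup>2 + 2 * (?e i \<bullet> ?e j)"
      by (simp only: power2_norm_eq_inner inner_add_left inner_add_right inner_commute)
    ultimately show ?thesis using q1[of i] q1[of j] q2[of i j] unfolding D2q[symmetric] by linarith
  qed
  have base: "\<bar>D2 L \<theta>0 v v - (norm v)\<^sup>2\<bar> \<le> hess_tol a * (norm v)\<^sup>2"
  proof -
    have "D2 L \<theta>0 v v - (norm v)\<^sup>2 = v \<bullet> (H *v v)"
      by (simp add: H_def matrix_vector_mult_diff_rdistrib inner_diff_right hess_quadratic_form power2_norm_eq_inner)
    also have "\<dots> = (\<Sum>i\<in>UNIV. \<Sum>j\<in>UNIV. v $ i * (H $ i $ j * v $ j))"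
      by (simp add: inner_vec_def matrix_vector_mult_def sum_distrib_left)
    also have "\<bar>\<dots>\<bar> \<le> (\<Sum>i\<in>(UNIV::'k set). \<Sum>j\<in>(UNIV::'k set). norm v * (3 / 2 * a * norm v))"
    proof (intro order_trans[OF sum_abs] sum_mono)
      fix i j
      show "\<bar>v $ i * (H $ i $ j * v $ j)\<bar> \<le> norm v * (3 / 2 * a * norm v)"
        unfolding abs_mult using Hij a0 by (intro mult_mono component_le_norm_cart) auto
    qed
    also have "\<dots> = hess_tol a * (norm v)\<^sup>2" by (simp add: hess_tol_def power2_eq_square)
    finally show ?thesis .
  qed
  define u where "u = x - \<theta>0"
  have u: "norm u \<le> 2 * R" using R norm_triangle_ineq4[of x \<theta>0] by (simp add: u_def)
  have R0: "R \<ge> 0" using R(1) norm_ge_zero order_trans by blast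
  have K0: "K \<ge> 0"
  proof -
    have "0 \<le> (\<Sum>m=1..n. fourth_bd n (Z n m \<omega>))" by (intro sum_nonneg fourth_bd_nonneg)
    then have "0 \<le> n * K" using fourth_bd by linarith
    then show ?thesis using n by (simp add: zero_le_mult_iff)
  qed
  have h0: "hess_tol a \<ge> 0" using a0 by (simp add: hess_tol_def)
  define \<phi> where "\<phi> s = D2 L (\<theta>0 + s *\<^sub>R u) v v" for s :: real
  define \<delta> where "\<delta> = K / n * ((norm u)\<^sup>2 * (norm v)\<^sup>2)"
  have "\<bar>\<phi> 1 - \<phi> 0\<bar> \<le> \<bar>1\<bar> * sqrt (2 * \<delta> * \<phi> 0) + \<delta> * 1\<^sup>2 / 2"
  proof (rule nonneg_small_second_derivative)
    show "(\<phi> has_real_derivative D3 L (\<theta>0 + s *\<^sub>R u) u v v) (at s)" for s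
      unfolding \<phi>_def by (rule line_derivatives(3)[OF tot(1)])
    show "((\<lambda>s. D3 L (\<theta>0 + s *\<^sub>R u) u v v) has_real_derivative D4 L (\<theta>0 + s *\<^sub>R u) u u v v) (at s)" for s
      by (rule line_derivatives(4)[OF tot(1)])
    \<comment> \<open>Needed for all real \<open>s\<close>, also where the line leaves the ball;
      strong convexity holds globally.\<close>
    show "0 \<le> \<phi> s" for s
    proof -
      have "0 \<le> v \<bullet> ((hess L (\<theta>0 + s *\<^sub>R u) - c *\<^sub>R mat 1) *v v)"
        using cL unfolding strongly_convex_def pos_semidef_def by blast
      then have "c * (v \<bullet> v) \<le> \<phi> s"
        by (simp add: \<phi>_def matrix_vector_mult_diff_rdistrib inner_diff_right hess_quadratic_form scaleR_matrix_vector_assoc[symmetric])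
      moreover have "0 \<le> c * (v \<bullet> v)" using c by simp
      ultimately show ?thesis by linarith
    qed
    show "\<bar>D4 L (\<theta>0 + s *\<^sub>R u) u u v v\<bar> \<le> \<delta>" for s
    proof -
      have "norm (frechet (frechet (frechet (frechet L))) (\<theta>0 + s *\<^sub>R u)) \<le> n * K / (real n)\<^sup>2"
        using tot(3) fourth_bd by (meson divide_right_mono order_trans zero_le_power2)
      also have "\<dots> = K / n" using n by (simp add: power2_eq_square)
      finally have "norm (frechet (frechet (frechet (frechet L))) (\<theta>0 + s *\<^sub>R u)) * norm u * norm u * norm v * norm v
         \<le> K / n * norm u * norm u * norm v * norm v" by (intro mult_right_mono) auto
      then show ?thesis using abs_D4_le[of L "\<theta>0 + s *\<^sub>R u" u u v v] by (simp add: \<delta>_def power2_eq_square mult_ac)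
    qed
  qed
  also have "\<dots> \<le> (2 * R * sqrt (2 * (K / n) * (1 + hess_tol a)) + 2 * R\<^sup>2 * (K / n)) * (norm v)\<^sup>2"
  proof -
    have \<phi>0: "\<phi> 0 \<le> (1 + hess_tol a) * (norm v)\<^sup>2" using base by (simp add: \<phi>_def algebra_simps abs_le_iff)
    have u2: "(norm u)\<^sup>2 \<le> (2 * R)\<^sup>2" using u by (intro power_mono) auto
    have \<delta>: "\<delta> \<le> K / n * ((2 * R)\<^sup>2 * (norm v)\<^sup>2)" "\<delta> \<ge> 0"
    proof -
      have "(norm u)\<^sup>2 * (norm v)\<^sup>2 \<le> (2 * R)\<^sup>2 * (norm v)\<^sup>2" using u2 by (rule mult_right_mono) simp
      then show "\<delta> \<le> K / n * ((2 * R)\<^sup>2 * (norm v)\<^sup>2)"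
        unfolding \<delta>_def using K0 by (intro mult_left_mono) auto
      show "\<delta> \<ge> 0" unfolding \<delta>_def using K0 by simp
    qed
    have "2 * \<delta> * \<phi> 0 \<le> 2 * \<delta> * ((1 + hess_tol a) * (norm v)\<^sup>2)" using \<phi>0 \<delta> by (intro mult_left_mono) auto
    also have "\<dots> \<le> 2 * (K / n * ((2 * R)\<^sup>2 * (norm v)\<^sup>2)) * ((1 + hess_tol a) * (norm v)\<^sup>2)"
      using \<delta> h0 by (intro mult_right_mono) auto
    also have "\<dots> = (2 * (K / n) * (1 + hess_tol a)) * (2 * R * (norm v)\<^sup>2)\<^sup>2"
      by (simp add: power_mult_distrib power2_eq_square mult_ac)
    finally have "sqrt (2 * \<delta> * \<phi> 0) \<le> sqrt ((2 * (K / n) * (1 + hess_tol a)) * (2 * R * (norm v)\<^sup>2)\<^sup>2)"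
      by (rule real_sqrt_le_mono)
    also have "\<dots> = sqrt (2 * (K / n) * (1 + hess_tol a)) * (2 * R * (norm v)\<^sup>2)"
      using R0 by (simp only: real_sqrt_mult real_sqrt_abs) simp
    finally have "sqrt (2 * \<delta> * \<phi> 0) \<le> 2 * R * sqrt (2 * (K / n) * (1 + hess_tol a)) * (norm v)\<^sup>2"
      by (simp add: mult_ac)
    moreover have "\<delta> * 1\<^sup>2 / 2 \<le> 2 * R\<^sup>2 * (K / n) * (norm v)\<^sup>2" using \<delta> by (simp add: power_mult_distrib mult_ac)
    ultimately show ?thesis by (simp add: distrib_right)
  qed
  finally have "\<bar>D2 L x v v - D2 L \<theta>0 v v\<bar> \<le> (2 * R * sqrt (2 * (K / n) * (1 + hess_tol a)) + 2 * R\<^sup>2 * (K / n)) * (norm v)\<^sup>2"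
    by (simp add: \<phi>_def u_def)
  with base have "\<bar>D2 L x v v - (norm v)\<^sup>2\<bar> \<le> hess_tol a * (norm v)\<^sup>2 + (2 * R * sqrt (2 * (K / n) * (1 + hess_tol a)) + 2 * R\<^sup>2 * (K / n)) * (norm v)\<^sup>2"
    by linarith
  then show ?thesis by (simp add: L_def distrib_right add.assoc)
qed

lemma hess_uniform:
  assumes \<tau>: "\<tau> > 0" and R: "norm \<theta>0 \<le> R"
  shows "hp P (\<lambda>n \<omega>. near_identity n \<omega> R \<tau>)"
  unfolding hp_def
proof (intro allI impI)
  fix \<epsilon> :: real assume \<epsilon>: "\<epsilon> > 0"
  \<comment> \<open>Makes \<open>hess_tol a = \<tau> / 2\<close>; the other half is left for the
    change between \<theta>0 and \<open>x\<close>, which tends to zero.\<close>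
  define a where "a = \<tau> / (3 * (real CARD('k))\<^sup>2)"
  have k: "real CARD('k) > 0" by simp
  have a: "a > 0" "hess_tol a = \<tau> / 2" using \<tau> k by (auto simp: a_def hess_tol_def)
  obtain K where K: "K > 0" "whp P (\<epsilon> / 2) (\<lambda>n \<omega>. (\<Sum>i=1..n. fourth_bd n (Z n i \<omega>)) \<le> real n * K)"
    using avg_bounded_real[of fourth_bd "1 + max MD 0" "\<epsilon> / 2"] fourth_bd_meas fourth_bd_integral(1) fourth_bd_nonneg \<epsilon> by auto
  have H1: "hp P (\<lambda>n \<omega>. \<forall>i\<in>UNIV. \<bar>(\<Sum>m=1..n. hess_form n (axis i 1) (Z n m \<omega>)) / n - (norm (axis i 1 :: real^'k))\<^sup>2\<bar> < a)"
    by (intro hp_ball_finite hess_law a) auto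
  have H2: "hp P (\<lambda>n \<omega>. \<forall>i\<in>UNIV. \<forall>j\<in>UNIV. \<bar>(\<Sum>m=1..n. hess_form n (axis i 1 + axis j 1) (Z n m \<omega>)) / n - (norm (axis i 1 + axis j 1 :: real^'k))\<^sup>2\<bar> < a)"
    by (intro hp_ball_finite hess_law a) auto
  have lim: "(\<lambda>n. 2 * R * sqrt (2 * (K * (1 / real n)) * (1 + hess_tol a)) + 2 * R\<^sup>2 * (K * (1 / real n))) \<longlonglongrightarrow>
      2 * R * sqrt (2 * (K * 0) * (1 + hess_tol a)) + 2 * R\<^sup>2 * (K * 0)"
    by (intro tendsto_intros lim_1_over_n)
  have ev: "\<forall>\<^sub>F n in sequentially. 2 * R * sqrt (2 * (K * (1 / real n)) * (1 + hess_tol a)) + 2 * R\<^sup>2 * (K * (1 / real n)) < \<tau> / 2"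
    by (rule order_tendstoD(2)[OF lim]) (use \<tau> in simp)
  show "whp P \<epsilon> (\<lambda>n \<omega>. near_identity n \<omega> R \<tau>)"
  proof (rule whp_mono[OF whp_hp_conj[OF K(2) hp_conj[OF hp_conj[OF H1 H2] hp_conj[OF hp_good convex]]]])
    show "\<epsilon> / 2 < \<epsilon>" using \<epsilon> by simp
    show "\<forall>\<^sub>F n in sequentially. \<forall>\<omega>\<in>space (P n). (\<Sum>i=1..n. fourth_bd n (Z n i \<omega>)) \<le> real n * K \<and>
       ((\<forall>i\<in>UNIV. \<bar>(\<Sum>m=1..n. hess_form n (axis i 1) (Z n m \<omega>)) / n - (norm (axis i 1 :: real^'k))\<^sup>2\<bar> < a) \<and>
        (\<forall>i\<in>UNIV. \<forall>j\<in>UNIV. \<bar>(\<Sum>m=1..n. hess_form n (axis i 1 + axis j 1) (Z n m \<omega>)) / n - (norm (axis i 1 + axis j 1 :: real^'k))\<^sup>2\<bar> < a)) \<and>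
       all_good n \<omega> \<and> total_convex n \<omega> \<longrightarrow>
       near_identity n \<omega> R \<tau>"
      using ev eventually_ge_at_top[of 1]
    proof eventually_elim
      case (elim n)
      show ?case
      proof (intro ballI impI allI, elim conjE)
        fix \<omega> and x v :: "real^'k"
        assume x: "norm x \<le> R" and hyps: "(\<Sum>i=1..n. fourth_bd n (Z n i \<omega>)) \<le> real n * K"
          "\<forall>i\<in>UNIV. \<bar>(\<Sum>m=1..n. hess_form n (axis i 1) (Z n m \<omega>)) / n - (norm (axis i 1 :: real^'k))\<^sup>2\<bar> < a"
          "\<forall>i\<in>UNIV. \<forall>j\<in>UNIV. \<bar>(\<Sum>m=1..n. hess_form n (axis i 1 + axis j 1) (Z n m \<omega>)) / n - (norm (axis i 1 + axis j 1 :: real^'k))\<^sup>2\<bar> < a"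
          "all_good n \<omega>" "total_convex n \<omega>"
        have "\<bar>D2 (sample_loss n \<omega>) x v v - (norm v)\<^sup>2\<bar>
            \<le> (hess_tol a + 2 * R * sqrt (2 * (K / n) * (1 + hess_tol a)) + 2 * R\<^sup>2 * (K / n)) * (norm v)\<^sup>2"
          using elim(2) hyps R x by (intro hess_near_identity) auto
        also have "\<dots> \<le> \<tau> * (norm v)\<^sup>2"
          using elim(1) a(2) by (intro mult_right_mono) auto
        finally show "\<bar>D2 (sample_loss n \<omega>) x v v - (norm v)\<^sup>2\<bar> \<le> \<tau> * (norm v)\<^sup>2" .
      qed
    qed
  qed simp
qed

end

subsection \<open>The estimator\<close>

context cv_setting
begin

abbreviation est :: "nat \<Rightarrow> 'w \<Rightarrow> real^'k" where
  "est n \<omega> \<equiv> theta_hat l n (sample Z n \<omega>)"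

lemma total_lower_bound:
  assumes good: "all_good n \<omega>"
    and conv: "total_convex n \<omega>"
  shows "(\<Sum>i=1..n. loss n (Z n i \<omega>) x) \<ge> (\<Sum>i=1..n. loss n (Z n i \<omega>) 0) +
    (\<Sum>i=1..n. grad (loss n (Z n i \<omega>)) 0) \<bullet> x + c / 2 * (norm x)\<^sup>2"
  using strongly_convex_second_difference[OF conv]
  by (intro second_difference_lower_bound[where f = "\<lambda>x. \<Sum>i=1..n. loss n (Z n i \<omega>) x"] total_derivatives(5)[OF good])
    (simp add: total_loss_sample)

text \<open>As \<open>arg_min\<close> is arbitrary when there is no minimum, existence comes first;
  it follows from quadratic growth.\<close>

lemma theta_hat_critical:
  assumes good: "all_good n \<omega>"
    and conv: "total_convex n \<omega>"
  shows "(\<Sum>i=1..n. grad (loss n (Z n i \<omega>)) (est n \<omega>)) = 0"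
proof -
  let ?L = "\<lambda>x. \<Sum>i=1..n. loss n (Z n i \<omega>) x" and ?g = "\<Sum>i=1..n. grad (loss n (Z n i \<omega>)) (est n \<omega>)"
  have "continuous_on UNIV ?L" using good good_differentiable(4) by (intro continuous_on_sum) auto
  then have "\<exists>t. \<forall>u. ?L t \<le> ?L u"
    by (rule coercive_attains_minimum[OF _ c total_lower_bound[OF good conv]])
  then have "?L (arg_min ?L (\<lambda>_. True)) \<le> ?L u" for u by (rule arg_min_le)
  then have min: "\<forall>u\<in>UNIV. ?L (est n \<omega>) \<le> ?L u" by (simp add: theta_hat_def total_loss_sample)
  have "(\<lambda>v. ?g \<bullet> v) = (\<lambda>v. 0)"
    by (rule differential_zero_maxmin[OF _ open_UNIV total_derivatives(5)[OF good]]) (use min in auto)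
  from fun_cong[OF this, of ?g] show ?thesis by simp
qed

lemma whp_theta_bounded:
  assumes "\<epsilon> > 0"
  obtains K where "whp P \<epsilon> (\<lambda>n \<omega>. norm (est n \<omega>) \<le> K)"
  using theta_bounded assms unfolding bounded_in_prob_def whp_def by blast

lemma total_gradient_near_identity:
  assumes good: "all_good n \<omega>"
    and conv: "total_convex n \<omega>"
    and hess: "near_identity n \<omega> R \<tau>"
    and R: "norm x \<le> R" "norm y \<le> R"
  shows "norm (((\<Sum>i=1..n. grad (loss n (Z n i \<omega>)) x) - x) - ((\<Sum>i=1..n. grad (loss n (Z n i \<omega>)) y) - y)) \<le> \<tau> * norm (x - y)"
proof -
  let ?L = "\<lambda>t. \<Sum>i=1..n. loss n (Z n i \<omega>) t"
  have "norm ((grad ?L x - x) - (grad ?L y - y)) \<le> \<tau> * norm (x - y)"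
  proof (rule gradient_near_identity[OF _ _ _ _ R])
    show "?L differentiable (at x)" "frechet ?L differentiable (at x)" for x
      using total_derivatives(1)[OF good] by (auto simp: four_times_differentiable_def)
    show "D2 ?L x u v = D2 ?L x v u" for x u v
      using strongly_convex_symmetric[OF conv] by (simp add: total_loss_sample)
  qed (use hess in blast)
  then show ?thesis by (simp only: total_derivatives(4)[OF good])
qed

text \<open>With a gradient map close to the identity, the estimator is \<theta>0 minus the
  normalized sum of the scores up to a small error, and the nondegenerate normal limit of that sum
  does not concentrate on a hyperplane.\<close>

lemma theta_hat_off_hyperplane:
  assumes v: "v \<noteq> 0" and \<epsilon>: "\<epsilon> > 0"
  obtains \<rho> where "\<rho> > 0" "whp P \<epsilon> (\<lambda>n \<omega>. \<rho> \<le> \<bar>v \<bullet> est n \<omega> - b\<bar>)"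
proof -
  have \<epsilon>3: "\<epsilon> / 3 > 0" using \<epsilon> by simp
  obtain K where K: "whp P (\<epsilon> / 3) (\<lambda>n \<omega>. norm (est n \<omega>) \<le> K)" using whp_theta_bounded[OF \<epsilon>3] .
  define R where "R = max K (norm \<theta>0)"
  have R: "R \<ge> 0" "norm \<theta>0 \<le> R" "K \<le> R" by (auto simp: R_def le_max_iff_disj)
  have s: "v \<bullet> (S *v v) > 0" using stable v unfolding stable_parameters_def pos_def_def by blast
  have meas: "(\<lambda>z. score n z \<bullet> v) \<in> borel_measurable (\<mu> n)" if "n \<ge> 1" for n
    by (rule borel_measurable_inner[OF stableD(3)[OF that] borel_measurable_const])
  obtain r where r: "r > 0" "whp P (\<epsilon> / 3) (\<lambda>n \<omega>. r \<le> \<bar>(\<Sum>i=1..n. score n (Z n i \<omega>) \<bullet> v) / sqrt n - (v \<bullet> \<theta>0 - b)\<bar>)"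
    by (rule anti_concentration[where f = "\<lambda>n z. score n z \<bullet> v", OF meas score_mean score_inner_square s score_inner4 \<epsilon>3])
  \<comment> \<open>Small enough that the linearization error moves
    \<open>v \<bullet> est n \<omega>\<close> by at most \<open>r / 2\<close>; the summand 1 keeps
    the denominator positive.\<close>
  define \<tau> where "\<tau> = r / (2 * (norm v * (2 * R) + 1))"
  have d: "norm v * (2 * R) + 1 > 0" using R by (simp add: add_nonneg_pos)
  have \<tau>: "\<tau> > 0" using r d by (simp add: \<tau>_def)
  have "\<tau> * (norm v * (2 * R) + 1) = r / 2" using d by (simp add: \<tau>_def field_simps)
  then have \<tau>r: "norm v * (\<tau> * (2 * R)) \<le> r / 2" using \<tau> by (simp add: algebra_simps)
  show ?thesis
  proof
    show "r / 2 > 0" using r by simp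
    show "whp P \<epsilon> (\<lambda>n \<omega>. r / 2 \<le> \<bar>v \<bullet> est n \<omega> - b\<bar>)"
    proof (rule whp_mono[OF whp_hp_conj[OF whp_conj[OF K r(2)] hp_conj[OF hess_uniform[OF \<tau> R(2)] hp_conj[OF hp_good convex]], of \<epsilon>]])
      show "\<epsilon> / 3 + \<epsilon> / 3 < \<epsilon>" using \<epsilon> by simp
      show "\<forall>\<^sub>F n in sequentially. \<forall>\<omega>\<in>space (P n).
        (norm (est n \<omega>) \<le> K \<and> r \<le> \<bar>(\<Sum>i=1..n. score n (Z n i \<omega>) \<bullet> v) / sqrt n - (v \<bullet> \<theta>0 - b)\<bar>) \<and>
        near_identity n \<omega> R \<tau> \<and>
        all_good n \<omega> \<and> total_convex n \<omega> \<longrightarrow>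
        r / 2 \<le> \<bar>v \<bullet> est n \<omega> - b\<bar>"
      proof (intro eventually_sequentiallyI[of 1] ballI impI, elim conjE)
        fix n \<omega>
        assume n: "1 \<le> n" and tK: "norm (est n \<omega>) \<le> K" and far: "r \<le> \<bar>(\<Sum>i=1..n. score n (Z n i \<omega>) \<bullet> v) / sqrt n - (v \<bullet> \<theta>0 - b)\<bar>"
          and hess: "near_identity n \<omega> R \<tau>"
          and good: "all_good n \<omega>" and conv: "total_convex n \<omega>"
        have tR: "norm (est n \<omega>) \<le> R" using tK R by simp
        define g where "g = (\<Sum>i=1..n. grad (loss n (Z n i \<omega>)) \<theta>0)"
        \<comment> \<open>Increment, from \<theta>0 to the estimator, of the gradient map minus the
          identity; the gradient vanishes at the estimator.\<close>
        define w where "w = (0 - est n \<omega>) - (g - \<theta>0)"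
        have "norm w \<le> \<tau> * norm (est n \<omega> - \<theta>0)"
          using total_gradient_near_identity[OF good conv hess tR R(2)]
          unfolding theta_hat_critical[OF good conv] w_def g_def .
        also have "\<dots> \<le> \<tau> * (2 * R)"
          using \<tau> tR R norm_triangle_ineq4[of "est n \<omega>" \<theta>0] by (intro mult_left_mono) auto
        finally have "norm v * norm w \<le> norm v * (\<tau> * (2 * R))" by (intro mult_left_mono) auto
        then have vw: "\<bar>v \<bullet> w\<bar> \<le> r / 2" using Cauchy_Schwarz_ineq2[of v w] \<tau>r by linarith
        have "g = (\<Sum>i=1..n. score n (Z n i \<omega>) /\<^sub>R sqrt n)"
          unfolding g_def using good by (intro sum.cong) (auto simp: good_grad[OF n])
        then have "v \<bullet> g = (\<Sum>i=1..n. score n (Z n i \<omega>) \<bullet> v) / sqrt n"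
          by (simp add: inner_sum_right inner_commute divide_inverse sum_distrib_left mult.commute)
        moreover have "v \<bullet> est n \<omega> = v \<bullet> \<theta>0 - v \<bullet> g - v \<bullet> w" by (simp add: w_def inner_diff_right)
        ultimately show "r / 2 \<le> \<bar>v \<bullet> est n \<omega> - b\<bar>" using far vw by linarith
      qed
    qed simp
  qed
qed

subsection \<open>Cross-validation and SURE\<close>

lemma CV_eq:
  "CV l pen n (sample Z n \<omega>) lam = (\<Sum>i=1..n. loss n (Z n i \<omega>)
     (penalized pen lam (loo_sample_loss n i \<omega>)))"
proof -
  have "loo_loss l n (sample Z n \<omega>) i = (loo_sample_loss n i \<omega>)" for i
    by (simp add: loo_loss_def sample_def fun_eq_iff)
  then have "theta_loo l pen n (sample Z n \<omega>) lam i = penalized pen lam (loo_sample_loss n i \<omega>)" for i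
    by (simp add: theta_loo_def penalized_def)
  then show ?thesis by (simp add: CV_def sample_def)
qed

text \<open>Sample size enters through \<open>w\<tau>\<close> and \<open>g\<tau>\<close>: the
  squared Lipschitz constants of the gradients sum to order \<open>1 / n\<close>, and the largest
  single gradient has order \<open>n^(-1/4)\<close>. Curvature \<open>c / 2\<close> is what the
  leave-one-out losses retain.\<close>

lemma cv_sure_bound:
  assumes n: "n \<ge> 1" and pen: "penalty pen"
    and good: "all_good n \<omega>"
    and conv: "total_convex n \<omega>"
    and loo: "\<forall>i\<in>{1..n}. \<forall>x h. c / 2 * (norm h)\<^sup>2 \<le> second_diff (loo_sample_loss n i \<omega>) x h"
    and R: "R = estimator_radius (c / 2) R0" and R0: "norm \<theta>0 \<le> R0" "norm (est n \<omega>) \<le> R0"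
    and \<tau>: "0 \<le> \<tau>" "\<tau> \<le> 1/2" "\<tau> * (1 + 4 * R) < \<rho>"
    and hess: "near_identity n \<omega> R \<tau>"
    and K2: "(\<Sum>i=1..n. (norm (real n *\<^sub>R frechet (frechet (loss n (Z n i \<omega>))) \<theta>0))\<^sup>2) \<le> n * K2"
    and K3: "(\<Sum>i=1..n. (C n (Z n i \<omega>))\<^sup>2) \<le> n * K3"
    and w\<tau>: "2 * K2 + 8 * R\<^sup>2 * K3 \<le> n * \<tau>\<^sup>2"
    and K4: "(\<Sum>i=1..n. norm (score n (Z n i \<omega>)) ^ 4) \<le> n * K4" and g\<tau>: "K4 \<le> n * \<tau> ^ 4"
    and outer: "\<forall>a b. \<bar>(\<Sum>i=1..n. score n (Z n i \<omega>) $ a * score n (Z n i \<omega>) $ b) / n - S $ a $ b\<bar> < \<tau>"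
    and aff: "prox_affine_near pen lam \<rho> (est n \<omega>) M"
  shows "\<bar>CV l pen n (sample Z n \<omega>) lam - (total_loss l n (sample Z n \<omega>) (est n \<omega>) + trace S / 2)
     - SURE pen lam (est n \<omega>) S\<bar> \<le> cv_const CARD('k) R (1 + K4) * \<tau>"
proof -
  define f where "f i = loss n (Z n i \<omega>)" for i
  define gf where "gf i = grad (f i)" for i
  have n0: "real n > 0" using n by simp
  have goodi: "good n (Z n i \<omega>)" if "i \<in> {1..n}" for i using good that by blast
  have c2: "c / 2 > 0" using c by simp
  have Rb: "norm \<theta>0 \<le> R" "R \<ge> 0"
  proof -
    have "R0 \<ge> 0" using R0(1) norm_ge_zero order_trans by blast
    then have "R0 \<le> R" using c by (simp add: R estimator_radius_def)
    then show "norm \<theta>0 \<le> R" "R \<ge> 0" using R0 \<open>R0 \<ge> 0\<close> by auto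
  qed
  have gf0: "gf i \<theta>0 = score n (Z n i \<omega>) /\<^sub>R sqrt n" if "i \<in> {1..n}" for i
    using good_grad[OF n goodi[OF that]] by (simp add: gf_def f_def)
  define X where "X i = norm (real n *\<^sub>R frechet (frechet (f i)) \<theta>0)" for i
  \<comment> \<open>Bounds the Hessian on the ball by its value at \<theta>0 plus its variation over
    a distance of at most \<open>2 * R\<close>.\<close>
  define w where "w i = (X i + 2 * R * \<bar>C n (Z n i \<omega>)\<bar>) / n" for i
  have d: "(f i has_derivative (\<lambda>v. gf i x \<bullet> v)) (at x)" if "i \<in> {1..n}" for i x
    unfolding f_def gf_def by (rule good_differentiable(3)[OF goodi[OF that]])
  have "\<bar>(\<Sum>i\<in>{1..n}. f i (penalized pen lam (\<lambda>t. \<Sum>j\<in>{1..n} - {i}. f j t)))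
      - ((\<Sum>i\<in>{1..n}. f i (est n \<omega>)) + trace S / 2) - SURE pen lam (est n \<omega>) S\<bar> \<le> cv_const CARD('k) R (1 + K4) * \<tau>"
  proof (rule cv_close_to_sure[where ?t0.0 = \<theta>0 and ?R0.0 = R0 and gf = gf and w = w, OF _ pen c2 \<tau> R d _ _ _ _ _ _ _ _ R0 _ _ aff])
    show "norm (gf i x - gf i y) \<le> w i * norm (x - y)" if i: "i \<in> {1..n}" and xy: "norm x \<le> R" "norm y \<le> R" for i x y
      unfolding gf_def
    proof (rule grad_lipschitz_on_ball[OF _ _ xy])
      show "frechet (f i) differentiable (at x)" for x
        unfolding f_def by (rule good_differentiable(2)[OF goodi[OF i]])
      fix x :: "real^'k" assume x: "norm x \<le> R"
      let ?F = "frechet (frechet (f i))"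
      have "norm (?F x - ?F \<theta>0) \<le> \<bar>C n (Z n i \<omega>)\<bar> / n * norm (x - \<theta>0)"
        using goodi[OF i] unfolding good_def f_def by blast
      also have "\<dots> \<le> \<bar>C n (Z n i \<omega>)\<bar> / n * (2 * R)"
        using x Rb norm_triangle_ineq4[of x \<theta>0] by (intro mult_left_mono) auto
      finally have "norm (?F x) \<le> norm (?F \<theta>0) + \<bar>C n (Z n i \<omega>)\<bar> / n * (2 * R)"
        using norm_triangle_sub[of "?F x" "?F \<theta>0"] by linarith
      also have "norm (?F \<theta>0) = X i / n" using n0 by (simp add: X_def)
      finally show "norm (?F x) \<le> w i" by (simp add: w_def add_divide_distrib mult_ac)
    qed
    show "w i \<ge> 0" for i using Rb by (simp add: w_def X_def)
    show "(\<Sum>i\<in>{1..n}. (w i)\<^sup>2) \<le> \<tau>\<^sup>2"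
    proof -
      have "(w i)\<^sup>2 \<le> (2 * (X i)\<^sup>2 + 8 * R\<^sup>2 * (C n (Z n i \<omega>))\<^sup>2) / (real n)\<^sup>2" for i
      proof -
        have "(X i + 2 * R * \<bar>C n (Z n i \<omega>)\<bar>)\<^sup>2 \<le> 2 * (X i)\<^sup>2 + 2 * (2 * R * \<bar>C n (Z n i \<omega>)\<bar>)\<^sup>2"
          using sum_squares_bound[of "X i" "2 * R * \<bar>C n (Z n i \<omega>)\<bar>"] by (simp add: power2_sum)
        then have "(X i + 2 * R * \<bar>C n (Z n i \<omega>)\<bar>)\<^sup>2 \<le> 2 * (X i)\<^sup>2 + 8 * R\<^sup>2 * (C n (Z n i \<omega>))\<^sup>2"
          by (simp add: power_mult_distrib)
        then show ?thesis unfolding w_def power_divide by (intro divide_right_mono) auto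
      qed
      then have "(\<Sum>i\<in>{1..n}. (w i)\<^sup>2) \<le> (\<Sum>i\<in>{1..n}. (2 * (X i)\<^sup>2 + 8 * R\<^sup>2 * (C n (Z n i \<omega>))\<^sup>2) / (real n)\<^sup>2)"
        by (rule sum_mono)
      also have "\<dots> = (2 * (\<Sum>i\<in>{1..n}. (X i)\<^sup>2) + 8 * R\<^sup>2 * (\<Sum>i\<in>{1..n}. (C n (Z n i \<omega>))\<^sup>2)) / (real n)\<^sup>2"
        by (simp add: sum.distrib sum_distrib_left flip: sum_divide_distrib)
      also have "\<dots> \<le> (2 * (n * K2) + 8 * R\<^sup>2 * (n * K3)) / (real n)\<^sup>2"
        using K2 K3 by (intro divide_right_mono add_mono mult_left_mono) (auto simp: X_def f_def)
      also have "\<dots> = (2 * K2 + 8 * R\<^sup>2 * K3) / n" using n0 by (simp add: power2_eq_square field_simps)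
      also have "\<dots> \<le> \<tau>\<^sup>2" using w\<tau> n0 by (simp add: divide_le_eq mult.commute)
      finally show ?thesis .
    qed
    show "(\<Sum>i\<in>{1..n}. (norm (gf i \<theta>0))\<^sup>2) \<le> 1 + K4"
    proof -
      have "(norm (gf i \<theta>0))\<^sup>2 \<le> (1 + norm (score n (Z n i \<omega>)) ^ 4) / n" if i: "i \<in> {1..n}" for i
      proof -
        have "(norm (gf i \<theta>0))\<^sup>2 = (norm (score n (Z n i \<omega>)))\<^sup>2 / n"
          using n0 by (simp add: gf0[OF i] power_mult_distrib divide_inverse power_inverse)
        moreover have "x\<^sup>2 \<le> 1 + x ^ 4" for x :: real
        proof -
          have "2 * x\<^sup>2 * 1 \<le> (x\<^sup>2)\<^sup>2 + 1\<^sup>2" by (rule sum_squares_bound)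
          then have "2 * x\<^sup>2 \<le> x ^ 4 + 1" by simp
          moreover have "0 \<le> x\<^sup>2" by simp
          ultimately show ?thesis by linarith
        qed
        ultimately show ?thesis by (simp add: divide_right_mono)
      qed
      then have "(\<Sum>i\<in>{1..n}. (norm (gf i \<theta>0))\<^sup>2) \<le> (\<Sum>i\<in>{1..n}. (1 + norm (score n (Z n i \<omega>)) ^ 4) / n)"
        by (rule sum_mono)
      also have "\<dots> = (n + (\<Sum>i\<in>{1..n}. norm (score n (Z n i \<omega>)) ^ 4)) / n"
        by (simp add: sum.distrib flip: sum_divide_distrib)
      also have "\<dots> \<le> (n + n * K4) / n" using K4 by (intro divide_right_mono) auto
      also have "\<dots> = 1 + K4" using n0 by (simp add: add_divide_distrib)
      finally show ?thesis .
    qed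
    \<comment> \<open>The largest fourth power is bounded by the sum of all of them, which is of
      order \<open>n\<close>.\<close>
    show "norm (gf i \<theta>0) \<le> \<tau>" if i: "i \<in> {1..n}" for i
    proof -
      have "norm (score n (Z n i \<omega>)) ^ 4 \<le> (\<Sum>i=1..n. norm (score n (Z n i \<omega>)) ^ 4)" using i by (intro member_le_sum) auto
      also have "\<dots> \<le> n * (n * \<tau> ^ 4)" using K4 g\<tau> n0 by (meson mult_left_mono of_nat_0_le_iff order_trans)
      finally have "norm (score n (Z n i \<omega>)) ^ 4 \<le> (sqrt n * \<tau>) ^ 4"
        by (simp add: power_mult_distrib eval_nat_numeral mult_ac)
      then have "norm (score n (Z n i \<omega>)) \<le> sqrt n * \<tau>" using \<tau> by (rule_tac power_le_imp_le_base[of _ 3]) auto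
      then show ?thesis using n0 by (simp add: gf0[OF i] field_simps)
    qed
    show "\<bar>(\<Sum>i\<in>{1..n}. gf i \<theta>0 $ a * gf i \<theta>0 $ b) - S $ a $ b\<bar> \<le> \<tau>" for a b
    proof -
      have "(\<Sum>i\<in>{1..n}. gf i \<theta>0 $ a * gf i \<theta>0 $ b) = (\<Sum>i=1..n. score n (Z n i \<omega>) $ a * score n (Z n i \<omega>) $ b / n)"
      proof (rule sum.cong[OF refl])
        fix i assume i: "i \<in> {1..n}"
        have "inverse (sqrt n) * inverse (sqrt n) = 1 / n"
          by (simp add: inverse_eq_divide)
        then show "gf i \<theta>0 $ a * gf i \<theta>0 $ b = score n (Z n i \<omega>) $ a * score n (Z n i \<omega>) $ b / n"
          by (simp add: gf0[OF i] field_simps)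
      qed
      then show ?thesis using outer by (simp add: less_imp_le flip: sum_divide_distrib)
    qed
    show "norm (((\<Sum>i\<in>{1..n}. gf i x) - x) - ((\<Sum>i\<in>{1..n}. gf i y) - y)) \<le> \<tau> * norm (x - y)"
      if "norm x \<le> R" "norm y \<le> R" for x y
      unfolding gf_def f_def by (rule total_gradient_near_identity[OF good conv hess that])
    show "(\<Sum>i\<in>{1..n}. gf i (est n \<omega>)) = 0" unfolding gf_def f_def by (rule theta_hat_critical[OF good conv])
    show "(\<Sum>i\<in>{1..n}. f i 0) + (\<Sum>i\<in>{1..n}. gf i 0) \<bullet> x + c / 2 / 2 * (norm x)\<^sup>2 \<le> (\<Sum>i\<in>{1..n}. f i x)" for x
    proof -
      have "c / 2 / 2 * (norm x)\<^sup>2 \<le> c / 2 * (norm x)\<^sup>2" using c by (intro mult_right_mono) auto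
      then show ?thesis using total_lower_bound[OF good conv, of x] unfolding gf_def f_def by linarith
    qed
    show "(\<Sum>j\<in>{1..n} - {i}. f j 0) + (\<Sum>j\<in>{1..n} - {i}. gf j 0) \<bullet> x + c / 2 / 2 * (norm x)\<^sup>2 \<le> (\<Sum>j\<in>{1..n} - {i}. f j x)"
      if i: "i \<in> {1..n}" for i x
    proof (rule second_difference_lower_bound[where f = "\<lambda>x. \<Sum>j\<in>{1..n} - {i}. f j x"])
      show "((\<lambda>x. \<Sum>j\<in>{1..n} - {i}. f j x) has_derivative (\<bullet>) (\<Sum>j\<in>{1..n} - {i}. gf j 0)) (at 0)"
        using d by (auto simp: inner_sum_left[abs_def] intro!: has_derivative_sum)
      show "c / 2 * (norm h)\<^sup>2 \<le> (\<Sum>j\<in>{1..n} - {i}. f j (x + h)) + (\<Sum>j\<in>{1..n} - {i}. f j (x - h)) - 2 * (\<Sum>j\<in>{1..n} - {i}. f j x)" for x h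
        using loo i unfolding second_diff_def f_def by blast
    qed
  qed auto
  then show ?thesis unfolding CV_eq total_loss_sample f_def .
qed

text \<open>The order of choices is confidence level, then the bounds \<open>K1\<close> to
  \<open>K4\<close> and \<rho>, then \<tau>, then \<open>n\<close>. It works because
  \<open>cv_const\<close> is independent of \<tau>.\<close>

lemma cv_approximates_sure:
  assumes pen: "penalty pen"
    and aff: "\<And>\<epsilon>. \<epsilon> > 0 \<Longrightarrow> \<exists>\<rho>>0. whp P \<epsilon> (\<lambda>n \<omega>. \<forall>lam\<in>\<Lambda>. \<exists>M. prox_affine_near pen lam \<rho> (est n \<omega>) M)"
  shows "tendsto_0_in_prob P (\<lambda>n \<omega>. SUP lam\<in>\<Lambda>. ennreal \<bar>CV l pen n (sample Z n \<omega>) lam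
     - (total_loss l n (sample Z n \<omega>) (est n \<omega>) + trace S / 2) - SURE pen lam (est n \<omega>) S\<bar>)"
  unfolding tendsto_0_in_prob_def
proof (intro allI impI, rule with_prob_to_1_of_hp, unfold hp_def, intro allI impI)
  fix e \<delta> :: real assume e: "e > 0" and \<delta>: "\<delta> > 0"
  \<comment> \<open>Five events cost \<eta> each; the strict slack up to \<delta> absorbs the events
    whose probability tends to one.\<close>
  define \<eta> where "\<eta> = \<delta> / 8"
  have \<eta>: "\<eta> > 0" using \<delta> by (simp add: \<eta>_def)
  obtain K1 where A1: "whp P \<eta> (\<lambda>n \<omega>. norm (est n \<omega>) \<le> K1)" using whp_theta_bounded[OF \<eta>] .
  obtain K2 where A2: "whp P \<eta> (\<lambda>n \<omega>. norm ((1 / real n) *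
        (\<Sum>i=1..n. (norm (real n *\<^sub>R frechet (frechet (loss n (Z n i \<omega>))) \<theta>0))\<^sup>2)) \<le> K2)"
    using hess_bounded \<eta> unfolding bounded_in_prob_def whp_def by blast
  obtain K3 where A3: "whp P \<eta> (\<lambda>n \<omega>. (\<Sum>i=1..n. (C n (Z n i \<omega>))\<^sup>2) \<le> real n * K3)"
    using avg_bounded_real[where f = "\<lambda>n z. (C n z)\<^sup>2", OF borel_measurable_power[OF C_meas] KC zero_le_power2 \<eta>]
    by blast
  have score4m: "(\<lambda>z. norm (score n z) ^ 4) \<in> borel_measurable (\<mu> n)" if "n \<ge> 1" for n
    using stableD(3)[OF that] by measurable
  obtain K4 where A4: "whp P \<eta> (\<lambda>n \<omega>. (\<Sum>i=1..n. norm (score n (Z n i \<omega>)) ^ 4) \<le> real n * K4)"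
    using avg_bounded_real[of "\<lambda>n z. norm (score n z) ^ 4" MG \<eta>, OF score4m score4(3)] \<eta> by auto
  obtain \<rho> where \<rho>: "\<rho> > 0" and A5: "whp P \<eta> (\<lambda>n \<omega>. \<forall>lam\<in>\<Lambda>. \<exists>M. prox_affine_near pen lam \<rho> (est n \<omega>) M)"
    using aff[OF \<eta>] by blast
  define R0 where "R0 = max K1 (norm \<theta>0)"
  define R where "R = estimator_radius (c / 2) R0"
  have R0: "R0 \<ge> 0" "norm \<theta>0 \<le> R0" "K1 \<le> R0" by (auto simp: R0_def le_max_iff_disj)
  have R: "R \<ge> 0" "norm \<theta>0 \<le> R"
  proof -
    have "R0 \<le> R" using R0 c by (simp add: R_def estimator_radius_def)
    then show "R \<ge> 0" "norm \<theta>0 \<le> R" using R0 by auto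
  qed
  define Kc where "Kc = cv_const CARD('k) R (1 + K4)"
  \<comment> \<open>The three bounds serve the absorption step of the expansion, the radius on which
    the proximal map is affine, and the target accuracy.\<close>
  define \<tau> where "\<tau> = min (1/2) (min (\<rho> / (2 * (1 + 4 * R))) (e / (\<bar>Kc\<bar> + 1)))"
  have \<tau>: "\<tau> > 0" "\<tau> \<le> 1/2" "\<tau> \<le> \<rho> / (2 * (1 + 4 * R))" "\<tau> \<le> e / (\<bar>Kc\<bar> + 1)"
  proof -
    show "\<tau> > 0" using e \<rho> R by (simp add: \<tau>_def)
    show "\<tau> \<le> 1/2" "\<tau> \<le> \<rho> / (2 * (1 + 4 * R))" "\<tau> \<le> e / (\<bar>Kc\<bar> + 1)"
      unfolding \<tau>_def by linarith+
  qed
  have \<tau>\<rho>: "\<tau> * (1 + 4 * R) < \<rho>"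
  proof -
    have "\<tau> * (1 + 4 * R) \<le> \<rho> / (2 * (1 + 4 * R)) * (1 + 4 * R)" using \<tau> R by (intro mult_right_mono) auto
    also have "\<dots> = \<rho> / 2" using R by (simp add: field_simps)
    finally show ?thesis using \<rho> by simp
  qed
  have \<tau>e: "Kc * \<tau> \<le> e"
  proof -
    have "Kc * \<tau> \<le> (\<bar>Kc\<bar> + 1) * \<tau>" using \<tau> by (intro mult_right_mono) auto
    also have "\<dots> \<le> (\<bar>Kc\<bar> + 1) * (e / (\<bar>Kc\<bar> + 1))" using \<tau> by (intro mult_left_mono) auto
    also have "\<dots> = e" by simp
    finally show ?thesis .
  qed
  have big: "\<forall>\<^sub>F n in sequentially. K \<le> real n * x" if "x > 0" for K x :: real
  proof -
    have "\<forall>\<^sub>F n in sequentially. K / x \<le> real n" using filterlim_real_sequentially unfolding filterlim_at_top by blast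
    then show ?thesis by eventually_elim (use that in \<open>simp add: field_simps\<close>)
  qed
  note ev = big[OF zero_less_power[OF \<tau>(1), of 2], of "2 * K2 + 8 * R\<^sup>2 * K3"] big[OF zero_less_power[OF \<tau>(1), of 4], of K4]
  note whps = whp_conj[OF whp_conj[OF whp_conj[OF A1 A2] whp_conj[OF A3 A4]] A5]
  note hps = hp_conj[OF hp_conj[OF hp_good convex] hp_conj[OF loo_convex hp_conj[OF outer_product_law[OF \<tau>(1)] hess_uniform[OF \<tau>(1) R(2)]]]]
  show "whp P \<delta> (\<lambda>n \<omega>. (SUP lam\<in>\<Lambda>. ennreal \<bar>CV l pen n (sample Z n \<omega>) lam
     - (total_loss l n (sample Z n \<omega>) (est n \<omega>) + trace S / 2) - SURE pen lam (est n \<omega>) S\<bar>) \<le> ennreal e)"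
  proof (rule whp_mono[OF whp_hp_conj[OF whps hps, of \<delta>] order_refl])
    show "\<eta> + \<eta> + (\<eta> + \<eta>) + \<eta> < \<delta>" using \<delta> by (simp add: \<eta>_def)
  next
    show "\<forall>\<^sub>F n in sequentially. \<forall>\<omega>\<in>space (P n).
     ((((norm (est n \<omega>) \<le> K1 \<and>
          norm ((1 / real n) * (\<Sum>i=1..n. (norm (real n *\<^sub>R frechet (frechet (loss n (Z n i \<omega>))) \<theta>0))\<^sup>2)) \<le> K2) \<and>
         (\<Sum>i=1..n. (C n (Z n i \<omega>))\<^sup>2) \<le> real n * K3 \<and> (\<Sum>i=1..n. norm (score n (Z n i \<omega>)) ^ 4) \<le> real n * K4) \<and>
        (\<forall>lam\<in>\<Lambda>. \<exists>M. prox_affine_near pen lam \<rho> (est n \<omega>) M)) \<and>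
       (all_good n \<omega> \<and> total_convex n \<omega>) \<and>
       (\<forall>i\<in>{1..n}. \<forall>x h. c / 2 * (norm h)\<^sup>2 \<le> second_diff (loo_sample_loss n i \<omega>) x h) \<and>
       (\<forall>a b. \<bar>(\<Sum>i=1..n. score n (Z n i \<omega>) $ a * score n (Z n i \<omega>) $ b) / n - S $ a $ b\<bar> < \<tau>) \<and>
       near_identity n \<omega> R \<tau>) \<longrightarrow>
      (SUP lam\<in>\<Lambda>. ennreal \<bar>CV l pen n (sample Z n \<omega>) lam
     - (total_loss l n (sample Z n \<omega>) (est n \<omega>) + trace S / 2) - SURE pen lam (est n \<omega>) S\<bar>) \<le> ennreal e"
      using ev eventually_ge_at_top[of 1]
    proof eventually_elim
      case (elim n)
      show ?case
      proof (intro ballI impI SUP_least ennreal_leI, elim conjE)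
        fix \<omega> lam
        assume lam: "lam \<in> \<Lambda>" and h1: "norm (est n \<omega>) \<le> K1"
          and h2: "norm ((1 / real n) * (\<Sum>i=1..n. (norm (real n *\<^sub>R frechet (frechet (loss n (Z n i \<omega>))) \<theta>0))\<^sup>2)) \<le> K2"
          and h3: "(\<Sum>i=1..n. (C n (Z n i \<omega>))\<^sup>2) \<le> real n * K3"
          and h4: "(\<Sum>i=1..n. norm (score n (Z n i \<omega>)) ^ 4) \<le> real n * K4"
          and h5: "\<forall>lam\<in>\<Lambda>. \<exists>M. prox_affine_near pen lam \<rho> (est n \<omega>) M"
          and h6: "all_good n \<omega>" "total_convex n \<omega>"
            "\<forall>i\<in>{1..n}. \<forall>x h. c / 2 * (norm h)\<^sup>2 \<le> second_diff (loo_sample_loss n i \<omega>) x h"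
          and h7: "\<forall>a b. \<bar>(\<Sum>i=1..n. score n (Z n i \<omega>) $ a * score n (Z n i \<omega>) $ b) / n - S $ a $ b\<bar> < \<tau>"
          and h8: "near_identity n \<omega> R \<tau>"
        obtain M where M: "prox_affine_near pen lam \<rho> (est n \<omega>) M" using h5 lam by blast
        have h2': "(\<Sum>i=1..n. (norm (real n *\<^sub>R frechet (frechet (loss n (Z n i \<omega>))) \<theta>0))\<^sup>2) \<le> n * K2"
        proof -
          have "(1 / real n) * (\<Sum>i=1..n. (norm (real n *\<^sub>R frechet (frechet (loss n (Z n i \<omega>))) \<theta>0))\<^sup>2) \<le> K2"
            using h2 unfolding real_norm_def by linarith
          then show ?thesis using elim(3) by (simp add: field_simps)
        qed
        have "norm (est n \<omega>) \<le> R0" using h1 R0 by simp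
        from cv_sure_bound[OF elim(3) pen h6 R_def R0(2) this less_imp_le[OF \<tau>(1)] \<tau>(2) \<tau>\<rho> h8 h2' h3 elim(1) h4 elim(2) h7 M]
        show "\<bar>CV l pen n (sample Z n \<omega>) lam - (total_loss l n (sample Z n \<omega>) (est n \<omega>) + trace S / 2) - SURE pen lam (est n \<omega>) S\<bar> \<le> e"
          using \<tau>e unfolding Kc_def by linarith
      qed
    qed
  qed
qed

text \<open>Each hyperplane receives an equal share of the error probability, and the smallest of
  the finitely many distances serves for all of them.\<close>

lemma lasso_whp_affine:
  assumes lasso: "lasso_penalty pen \<Lambda>" and \<epsilon>: "\<epsilon> > 0"
  shows "\<exists>\<rho>>0. whp P \<epsilon> (\<lambda>n \<omega>. \<forall>lam\<in>\<Lambda>. \<exists>M. prox_affine_near pen lam \<rho> (est n \<omega>) M)"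
proof -
  show ?thesis
  proof (rule lasso_prox_affine_off_hyperplanes[OF lasso])
    fix H :: "((real^'k) \<times> real) set" and K
    assume H: "finite H" "\<And>v b. (v, b) \<in> H \<Longrightarrow> v \<noteq> 0" and K: "K > 0"
      and aff: "\<And>\<rho> x lam. \<rho> > 0 \<Longrightarrow> (\<And>v b. (v, b) \<in> H \<Longrightarrow> \<rho> \<le> \<bar>v \<bullet> x - b\<bar>) \<Longrightarrow> lam \<in> \<Lambda> \<Longrightarrow>
         \<exists>M. prox_affine_near pen lam (\<rho> / K) x M"
    show ?thesis
    proof (cases "H = {}")
      case True
      have "hp P (\<lambda>n \<omega>. \<forall>lam\<in>\<Lambda>. \<exists>M. prox_affine_near pen lam (1 / K) (est n \<omega>) M)"
        using aff[of 1] True by (intro hp_always always_eventually) auto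
      then show ?thesis using K \<epsilon> by (intro exI[of _ "1 / K"]) (auto simp: hp_def)
    next
      case False
      define a where "a = \<epsilon> / real (card H)"
      have cH: "real (card H) > 0" using H False by (simp add: card_gt_0_iff)
      have a: "a > 0" using \<epsilon> cH by (simp add: a_def)
      have "\<exists>r>0. whp P a (\<lambda>n \<omega>. r \<le> \<bar>fst vb \<bullet> est n \<omega> - snd vb\<bar>)" if "vb \<in> H" for vb
      proof -
        have "fst vb \<noteq> 0" using H(2)[of "fst vb" "snd vb"] that by simp
        from theta_hat_off_hyperplane[OF this a] show ?thesis by blast
      qed
      then have "\<forall>vb\<in>H. \<exists>r. r > 0 \<and> whp P a (\<lambda>n \<omega>. r \<le> \<bar>fst vb \<bullet> est n \<omega> - snd vb\<bar>)" by blast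
      from bchoice[OF this] obtain r where
        r: "\<And>vb. vb \<in> H \<Longrightarrow> r vb > 0 \<and> whp P a (\<lambda>n \<omega>. r vb \<le> \<bar>fst vb \<bullet> est n \<omega> - snd vb\<bar>)" by blast
      define \<rho> where "\<rho> = Min (r ` H)"
      have \<rho>: "\<rho> > 0" "\<And>vb. vb \<in> H \<Longrightarrow> \<rho> \<le> r vb" using r H False by (auto simp: \<rho>_def)
      have "whp P (real (card H) * a) (\<lambda>n \<omega>. \<forall>vb\<in>H. r vb \<le> \<bar>fst vb \<bullet> est n \<omega> - snd vb\<bar>)"
        using r by (intro whp_ball_finite H False) auto
      then have "whp P \<epsilon> (\<lambda>n \<omega>. \<forall>lam\<in>\<Lambda>. \<exists>M. prox_affine_near pen lam (\<rho> / K) (est n \<omega>) M)"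
      proof (rule whp_mono)
        show "real (card H) * a \<le> \<epsilon>" using cH by (simp add: a_def)
        show "\<forall>\<^sub>F n in sequentially. \<forall>\<omega>\<in>space (P n). (\<forall>vb\<in>H. r vb \<le> \<bar>fst vb \<bullet> est n \<omega> - snd vb\<bar>) \<longrightarrow>
            (\<forall>lam\<in>\<Lambda>. \<exists>M. prox_affine_near pen lam (\<rho> / K) (est n \<omega>) M)"
        proof (intro always_eventually allI ballI impI)
          fix n \<omega> lam assume far: "\<forall>vb\<in>H. r vb \<le> \<bar>fst vb \<bullet> est n \<omega> - snd vb\<bar>" and lam: "lam \<in> \<Lambda>"
          show "\<exists>M. prox_affine_near pen lam (\<rho> / K) (est n \<omega>) M"
          proof (rule aff[OF \<rho>(1) _ lam])
            fix v b assume "(v, b) \<in> H"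
            then show "\<rho> \<le> \<bar>v \<bullet> est n \<omega> - b\<bar>" using far \<rho>(2) by force
          qed
        qed
      qed
      then show ?thesis using \<rho> K by (intro exI[of _ "\<rho> / K"]) auto
    qed
  qed
qed

text \<open>The map is globally affine for every \<open>lam\<close>, so radius 1 holds on the whole
  space and an infinite \<Lambda> costs no probability.\<close>

lemma ridge_whp_affine:
  assumes ridge: "ridge_penalty pen \<Lambda>" and \<epsilon>: "\<epsilon> > 0"
  shows "\<exists>\<rho>>0. whp P \<epsilon> (\<lambda>n \<omega>. \<forall>lam\<in>\<Lambda>. \<exists>M. prox_affine_near pen lam \<rho> (est n \<omega>) M)"
proof -
  have "hp P (\<lambda>n \<omega>. \<forall>lam\<in>\<Lambda>. \<exists>M. prox_affine_near pen lam 1 (est n \<omega>) M)"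
    using ridge_prox_affine(2)[OF ridge] by (intro hp_always always_eventually) blast
  then show ?thesis using \<epsilon> by (intro exI[of _ 1]) (auto simp: hp_def)
qed

end

lemma SUP_nat_bound:
  fixes f :: "nat \<Rightarrow> ennreal"
  assumes "(SUP n\<in>{1..}. f n) < \<infinity>" "n \<ge> 1"
  shows "f n \<le> ennreal (enn2real (SUP n\<in>{1..}. f n))"
  using assms by (simp add: SUP_upper)

theorem lemma4:
  fixes P :: "nat \<Rightarrow> 'w measure"
    and \<mu> :: "nat \<Rightarrow> 'z measure"
    and Z :: "nat \<Rightarrow> nat \<Rightarrow> 'w \<Rightarrow> 'z"
    and l :: "real^'k \<Rightarrow> 'z \<Rightarrow> real"
    and \<theta>0 :: "real^'k"
    and \<Sigma> :: "real^'k^'k"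
    and \<pi> :: "real^'k \<Rightarrow> real"
    and \<Lambda> :: "ennreal set"
  assumes "iid_array P \<mu> Z"
    and "\<And>n \<beta>. n \<ge> 1 \<Longrightarrow> l \<beta> \<in> borel_measurable (\<mu> n)"
    and "stable_parameters \<mu> l \<theta>0 \<Sigma>"
    and "normalized_limit_risk P Z l \<theta>0"
    and "ridge_penalty \<pi> \<Lambda> \<or> lasso_penalty \<pi> \<Lambda>"
    and "locally_regular_loss \<mu> l"
    and "bounded_in_prob P (\<lambda>n \<omega>. theta_hat l n (sample Z n \<omega>))"
    and "curvature P Z l"
    and "gradient_moments \<mu> l \<theta>0"
    and "hessian_moments P \<mu> Z l \<theta>0"
    and "fourth_derivative_moments \<mu> l"
  shows "\<exists>c :: nat \<Rightarrow> (nat \<Rightarrow> 'z) \<Rightarrow> real.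
           tendsto_0_in_prob P (\<lambda>n \<omega>.
             SUP lam\<in>\<Lambda>. ennreal \<bar>CV l \<pi> n (sample Z n \<omega>) lam - c n (sample Z n \<omega>)
                                 - SURE \<pi> lam (theta_hat l n (sample Z n \<omega>)) \<Sigma>\<bar>)"
proof -
  interpret iid P \<mu> Z by (rule iid.intro) (rule assms(1))
  obtain c \<nu> where c: "c > 0" and curv: "with_prob_to_1 P (\<lambda>n \<omega>.
        let f = total_loss l n (sample Z n \<omega>) in strongly_convex c f \<and> smooth \<nu> (frechet (frechet f)))"
    using assms(8) unfolding curvature_def by blast
  have conv: "hp P (\<lambda>n \<omega>. strongly_convex c (total_loss l n (sample Z n \<omega>)))"
    by (rule hp_mono[OF hp_of_with_prob_to_1[OF curv]]) (simp add: Let_def)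
  obtain B where B: "\<And>n. n \<ge> 1 \<Longrightarrow> B n \<in> borel_measurable (\<mu> n)"
      "\<And>n. n \<ge> 1 \<Longrightarrow> AE z in \<mu> n. \<forall>\<theta> \<theta>'.
                norm (sqrt (real n) *\<^sub>R grad (\<lambda>t. local_loss l n t z) \<theta>
                      - sqrt (real n) *\<^sub>R grad (\<lambda>t. local_loss l n t z) \<theta>') \<le> B n z * norm (\<theta> - \<theta>')"
      "(SUP n\<in>{1..}. \<integral>\<^sup>+z. ennreal ((B n z)\<^sup>2) \<partial>\<mu> n) < \<infinity>"
    using assms(9) unfolding gradient_moments_def by blast
  obtain MG where MG: "\<And>n. n \<ge> 1 \<Longrightarrow>
        (\<integral>\<^sup>+z. ennreal (norm (sqrt (real n) *\<^sub>R grad (\<lambda>t. local_loss l n t z) \<theta>0) ^ 4) \<partial>\<mu> n) \<le> ennreal MG"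
    using assms(9) unfolding gradient_moments_def by blast
  obtain C where C: "\<And>n. n \<ge> 1 \<Longrightarrow> C n \<in> borel_measurable (\<mu> n)"
      "\<And>n. n \<ge> 1 \<Longrightarrow> AE z in \<mu> n. \<forall>\<theta> \<theta>'.
                norm (real n *\<^sub>R frechet (frechet (\<lambda>t. local_loss l n t z)) \<theta>
                      - real n *\<^sub>R frechet (frechet (\<lambda>t. local_loss l n t z)) \<theta>') \<le> C n z * norm (\<theta> - \<theta>')"
      "(SUP n\<in>{1..}. \<integral>\<^sup>+z. ennreal ((C n z)\<^sup>2) \<partial>\<mu> n) < \<infinity>"
    using assms(10) unfolding hessian_moments_def by blast
  obtain MD where MD: "\<And>n. n \<ge> 1 \<Longrightarrow> fourth_sup l n \<in> borel_measurable (\<mu> n)"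
      "\<And>n. n \<ge> 1 \<Longrightarrow> (\<integral>\<^sup>+z. fourth_sup l n z ^ 4 \<partial>\<mu> n) \<le> ennreal MD"
    using assms(11) unfolding fourth_derivative_moments_def Let_def fourth_sup_def[symmetric] by blast
  interpret cv_setting P \<mu> Z l \<theta>0 \<Sigma> B C "enn2real (SUP n\<in>{1..}. \<integral>\<^sup>+z. ennreal ((B n z)\<^sup>2) \<partial>\<mu> n)"
    "enn2real (SUP n\<in>{1..}. \<integral>\<^sup>+z. ennreal ((C n z)\<^sup>2) \<partial>\<mu> n)" MG MD c
  proof (intro cv_setting.intro iid.intro assms(1) cv_setting_axioms.intro assms(2,3,4,7) c conv B(1,2) C(1,2) MG MD)
    show "(\<integral>\<^sup>+z. ennreal ((B n z)\<^sup>2) \<partial>\<mu> n) \<le> ennreal (enn2real (SUP n\<in>{1..}. \<integral>\<^sup>+z. ennreal ((B n z)\<^sup>2) \<partial>\<mu> n))" if "n \<ge> 1" for n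
      by (rule SUP_nat_bound[OF B(3) that])
    show "(\<integral>\<^sup>+z. ennreal ((C n z)\<^sup>2) \<partial>\<mu> n) \<le> ennreal (enn2real (SUP n\<in>{1..}. \<integral>\<^sup>+z. ennreal ((C n z)\<^sup>2) \<partial>\<mu> n))" if "n \<ge> 1" for n
      by (rule SUP_nat_bound[OF C(3) that])
    show "AE z in \<mu> n. four_times_differentiable (\<lambda>t. local_loss l n t z)" if "n \<ge> 1" for n
      using assms(11) that unfolding fourth_derivative_moments_def by blast
    show "bounded_in_prob P (\<lambda>n \<omega>. (1 / real n) *
        (\<Sum>i=1..n. (norm (real n *\<^sub>R frechet (frechet (\<lambda>t. local_loss l n t (Z n i \<omega>))) \<theta>0))\<^sup>2))"
      using assms(10) unfolding hessian_moments_def by blast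
  qed (assumption | rule enn2real_nonneg)+
  have pen: "penalty \<pi>"
    using assms(5) ridge_prox_affine(1) lasso_is_penalty unfolding lasso_penalty_def by blast
  have aff: "\<exists>\<rho>>0. whp P \<epsilon> (\<lambda>n \<omega>. \<forall>lam\<in>\<Lambda>. \<exists>M. prox_affine_near \<pi> lam \<rho> (theta_hat l n (sample Z n \<omega>)) M)" if "\<epsilon> > 0" for \<epsilon>
    using assms(5) ridge_whp_affine[OF _ that] lasso_whp_affine[OF _ that] by blast
  show ?thesis
    \<comment> \<open>The constant depends on the data through the minimal total loss, and not on
      \<open>lam\<close>.\<close>
    by (rule exI[of _ "\<lambda>n zs. total_loss l n zs (theta_hat l n zs) + trace \<Sigma> / 2"])
      (rule cv_approximates_sure[OF pen aff])
qed

end
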